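(* Assume $a_{ij}$ satisfies the ($K$-Lip) property for some $K>0$, and let $u_0$ be a locally uniform limit, as $\epsilon_k\to0$, of minimizers $u_{\epsilon_k}\in H^1_\varphi(\Omega)$ of $\mathscr{F}_{\epsilon_k}(u)=\int_\Omega\{\tfrac12\langle a_{ij}\nabla u,\nabla u\rangle+B_{\epsilon_k}(u)\}dX$; set $\Omega_0=\{u_0>0\}\cap\Omega$. Then $\Omega_0$ has locally finite perimeter in $\Omega$ (its free boundary $\partial\Omega_0\cap\Omega$ has locally finite $\mathcal{H}^{n-1}$ measure), and, if $\partial\Omega_0\cap\Omega\neq\emptyset$, $\dim_{\mathcal H}(\partial\Omega_0\cap\Omega)=n-1$.
   Context: $\Omega\subset\mathbb{R}^n$ is a bounded Lipschitz domain, $a_{ij}$ a measurable symmetric matrix field with $\lambda\,\mathrm{Id}\le a_{ij}\le\Lambda\,\mathrm{Id}$ a.e., $\varphi\ge0$ in $L^2(\partial\Omega)$, $H^1_\varphi(\Omega)=\{u\in H^1(\Omega):\mathrm{Trace}(u)=\varphi\}$. $\beta\in L^\infty(\mathbb{R})$ is nonnegative, supported in $[0,1]$, $\int\beta>0$; $\beta_\epsilon(t)=\epsilon^{-1}\beta(t/\epsilon)$, $B_\epsilon(\xi)=\int_0^\xi\beta_\epsilon(t)dt$. ($K$-Lip) property: $a_{ij}$ satisfies ($K$-Lip) if for every $0<d<1$, every ball $B_d$ of radius $d$ and every $h\in H^1(B_d)$ solving $\mathrm{div}(a_{ij}\nabla h)=0$ in $B_d$ distributionally, $\|\nabla h\|_{L^\infty(B_{d/2})}\le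 \frac{K}{d}\|h\|_{L^\infty(B_d)}$. *)

theory Defs
  imports "HOL-Analysis.Analysis" "HOL-Probability.Essential_Supremum"
begin

fun dirderiv :: "'a::euclidean_space list \<Rightarrow> ('a \<Rightarrow> real) \<Rightarrow> ('a \<Rightarrow> real)" where
  "dirderiv [] f = f"
| "dirderiv (v # vs) f = (\<lambda>x. frechet_derivative (dirderiv vs f) (at x) v)"

definition smooth_fun :: "('a::euclidean_space \<Rightarrow> real) \<Rightarrow> bool" where
  "smooth_fun f \<longleftrightarrow> (\<forall>vs x. dirderiv vs f differentiable (at x))"

definition test_fun :: "'a::euclidean_space set \<Rightarrow> ('a \<Rightarrow> real) \<Rightarrow> bool" where
  "test_fun U \<psi> \<longleftrightarrow> smooth_fun \<psi> \<and>
     (\<exists>C. compact C \<and> C \<subseteq> U \<and> (\<forall>x. x \<notin> C \<longrightarrow> \<psi> x = 0))"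

definition pderiv :: "('a::euclidean_space \<Rightarrow> real) \<Rightarrow> 'a \<Rightarrow> 'a \<Rightarrow> real" where
  "pderiv f b x = frechet_derivative f (at x) b"

definition cgrad :: "('a::euclidean_space \<Rightarrow> real) \<Rightarrow> 'a \<Rightarrow> 'a" where
  "cgrad f x = (\<Sum>b\<in>Basis. pderiv f b x *\<^sub>R b)"

definition L2_on :: "'a::euclidean_space set \<Rightarrow> ('a \<Rightarrow> real) \<Rightarrow> bool" where
  "L2_on U f \<longleftrightarrow> f \<in> borel_measurable (lebesgue_on U) \<and> integrable (lebesgue_on U) (\<lambda>x. (f x)\<^sup>2)"

definition is_weak_grad :: "'a::euclidean_space set \<Rightarrow> ('a \<Rightarrow> real) \<Rightarrow> ('a \<Rightarrow> 'a) \<Rightarrow> bool" where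
  "is_weak_grad U f G \<longleftrightarrow>
     (\<forall>b\<in>Basis. L2_on U (\<lambda>x. G x \<bullet> b)) \<and>
     (\<forall>\<psi>. test_fun U \<psi> \<longrightarrow> (\<forall>b\<in>Basis.
        integral\<^sup>L (lebesgue_on U) (\<lambda>x. f x * pderiv \<psi> b x)
        = - integral\<^sup>L (lebesgue_on U) (\<lambda>x. (G x \<bullet> b) * \<psi> x)))"

definition H1 :: "'a::euclidean_space set \<Rightarrow> ('a \<Rightarrow> real) \<Rightarrow> bool" where
  "H1 U f \<longleftrightarrow> L2_on U f \<and> (\<exists>G. is_weak_grad U f G)"

text \<open>Unnormalised s-dimensional Hausdorff measure (the normalising constant is irrelevant
  for the statement: finiteness, nullity and dimension do not depend on it).\<close>
definition diam_pow :: "real \<Rightarrow> 'a::euclidean_space set \<Rightarrow> real" where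
  "diam_pow s C = (if C = {} then 0 else if s = 0 then 1 else diameter C powr s)"

definition hausdorff_delta :: "real \<Rightarrow> real \<Rightarrow> 'a::euclidean_space set \<Rightarrow> ennreal" where
  "hausdorff_delta s \<delta> A = Inf {(\<Sum>i. ennreal (diam_pow s (C i))) | C :: nat \<Rightarrow> 'a set.
       A \<subseteq> (\<Union>i. C i) \<and> (\<forall>i. bounded (C i) \<and> diameter (C i) \<le> \<delta>)}"

definition hausdorff_measure :: "real \<Rightarrow> 'a::euclidean_space set \<Rightarrow> ennreal" where
  "hausdorff_measure s A = (SUP \<delta>\<in>{0<..}. hausdorff_delta s \<delta> A)"

definition hausdorff_dim :: "'a::euclidean_space set \<Rightarrow> real" where
  "hausdorff_dim A = Inf {s. 0 \<le> s \<and> hausdorff_measure s A = 0}"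

definition lipschitz_domain :: "'a::euclidean_space set \<Rightarrow> bool" where
  "lipschitz_domain \<Omega> \<longleftrightarrow> open \<Omega> \<and> connected \<Omega> \<and> bounded \<Omega> \<and> \<Omega> \<noteq> {} \<and>
    (\<forall>p\<in>frontier \<Omega>. \<exists>e r h L g.
        norm e = 1 \<and> r > 0 \<and> h > 0 \<and> L \<ge> 0 \<and>
        (\<forall>x t. g (x + t *\<^sub>R e) = g x) \<and>
        (\<forall>x y. \<bar>g x - g y\<bar> \<le> L * norm (x - y)) \<and>
        (\<forall>x. norm ((x - p) - ((x - p) \<bullet> e) *\<^sub>R e) < r \<and> \<bar>(x - p) \<bullet> e\<bar> < h \<longrightarrow>
             (x \<in> \<Omega> \<longleftrightarrow> x \<bullet> e < g x)))"

definition bdry_measure :: "'a::euclidean_space set \<Rightarrow> 'a measure" where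
  "bdry_measure \<Omega> = measure_of (frontier \<Omega>) (sets (restrict_space borel (frontier \<Omega>)))
      (hausdorff_measure (real DIM('a) - 1))"

definition L2_bdry :: "'a::euclidean_space set \<Rightarrow> ('a \<Rightarrow> real) \<Rightarrow> bool" where
  "L2_bdry \<Omega> \<phi> \<longleftrightarrow> \<phi> \<in> borel_measurable (bdry_measure \<Omega>) \<and>
     (\<integral>\<^sup>+x. ennreal ((\<phi> x)\<^sup>2) \<partial>bdry_measure \<Omega>) < \<infinity>"

text \<open>Trace(u) = phi: the trace operator is the continuous extension of the restriction map
  from smooth functions (dense in H^1 of a Lipschitz domain).\<close>
definition has_trace :: "'a::euclidean_space set \<Rightarrow> ('a \<Rightarrow> real) \<Rightarrow> ('a \<Rightarrow> real) \<Rightarrow> bool" where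
  "has_trace \<Omega> u \<phi> \<longleftrightarrow> (\<exists>v G. (\<forall>k. smooth_fun (v k)) \<and> is_weak_grad \<Omega> u G \<and>
     (\<lambda>k. \<integral>\<^sup>+x. ennreal ((v k x - u x)\<^sup>2 + (norm (cgrad (v k) x - G x))\<^sup>2) \<partial>lebesgue_on \<Omega>)
        \<longlonglongrightarrow> 0 \<and>
     (\<lambda>k. \<integral>\<^sup>+x. ennreal ((v k x - \<phi> x)\<^sup>2) \<partial>bdry_measure \<Omega>) \<longlonglongrightarrow> 0)"

definition H1_phi :: "'a::euclidean_space set \<Rightarrow> ('a \<Rightarrow> real) \<Rightarrow> ('a \<Rightarrow> real) \<Rightarrow> bool" where
  "H1_phi \<Omega> \<phi> u \<longleftrightarrow> H1 \<Omega> u \<and> has_trace \<Omega> u \<phi>"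

definition quad :: "('a::euclidean_space \<Rightarrow> 'a \<Rightarrow> 'a \<Rightarrow> real) \<Rightarrow> 'a \<Rightarrow> 'a \<Rightarrow> 'a \<Rightarrow> real" where
  "quad a x \<xi> \<zeta> = (\<Sum>i\<in>Basis. \<Sum>j\<in>Basis. a x i j * (\<xi> \<bullet> j) * (\<zeta> \<bullet> i))"

definition elliptic_field ::
  "'a::euclidean_space set \<Rightarrow> ('a \<Rightarrow> 'a \<Rightarrow> 'a \<Rightarrow> real) \<Rightarrow> real \<Rightarrow> real \<Rightarrow> bool" where
  "elliptic_field \<Omega> a lam Lam \<longleftrightarrow> 0 < lam \<and> lam \<le> Lam \<and>
     (\<forall>i\<in>Basis. \<forall>j\<in>Basis. (\<lambda>x. a x i j) \<in> borel_measurable (lebesgue_on \<Omega>)) \<and>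
     (AE x in lebesgue_on \<Omega>. (\<forall>i\<in>Basis. \<forall>j\<in>Basis. a x i j = a x j i) \<and>
        (\<forall>\<xi>. lam * (norm \<xi>)\<^sup>2 \<le> quad a x \<xi> \<xi> \<and> quad a x \<xi> \<xi> \<le> Lam * (norm \<xi>)\<^sup>2))"

definition K_Lip :: "'a::euclidean_space set \<Rightarrow> ('a \<Rightarrow> 'a \<Rightarrow> 'a \<Rightarrow> real) \<Rightarrow> real \<Rightarrow> bool" where
  "K_Lip \<Omega> a K \<longleftrightarrow> (\<forall>d x0 h G. 0 < d \<and> d < 1 \<and> ball x0 d \<subseteq> \<Omega> \<and>
      H1 (ball x0 d) h \<and> is_weak_grad (ball x0 d) h G \<and>
      (\<forall>\<psi>. test_fun (ball x0 d) \<psi> \<longrightarrow>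
          integral\<^sup>L (lebesgue_on (ball x0 d)) (\<lambda>x. quad a x (G x) (cgrad \<psi> x)) = 0)
      \<longrightarrow> esssup (lebesgue_on (ball x0 (d/2))) (\<lambda>x. ereal (norm (G x)))
          \<le> ereal (K / d) * esssup (lebesgue_on (ball x0 d)) (\<lambda>x. ereal \<bar>h x\<bar>))"

definition beta_eps :: "(real \<Rightarrow> real) \<Rightarrow> real \<Rightarrow> real \<Rightarrow> real" where
  "beta_eps \<beta> \<epsilon> t = \<beta> (t / \<epsilon>) / \<epsilon>"

definition B_eps :: "(real \<Rightarrow> real) \<Rightarrow> real \<Rightarrow> real \<Rightarrow> real" where
  "B_eps \<beta> \<epsilon> \<xi> = interval_lebesgue_integral lborel (ereal 0) (ereal \<xi>) (beta_eps \<beta> \<epsilon>)"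

definition admissible_beta :: "(real \<Rightarrow> real) \<Rightarrow> bool" where
  "admissible_beta \<beta> \<longleftrightarrow> \<beta> \<in> borel_measurable lborel \<and> (\<exists>M. AE t in lborel. \<bar>\<beta> t\<bar> \<le> M) \<and>
     (\<forall>t. 0 \<le> \<beta> t) \<and> (\<forall>t. t \<notin> {0..1} \<longrightarrow> \<beta> t = 0) \<and> integral\<^sup>L lborel \<beta> > 0"

text \<open>F_eps(u), computed with a weak gradient G of u.\<close>
definition energy :: "'a::euclidean_space set \<Rightarrow> ('a \<Rightarrow> 'a \<Rightarrow> 'a \<Rightarrow> real) \<Rightarrow> (real \<Rightarrow> real)
    \<Rightarrow> real \<Rightarrow> ('a \<Rightarrow> real) \<Rightarrow> ('a \<Rightarrow> 'a) \<Rightarrow> real" where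
  "energy \<Omega> a \<beta> \<epsilon> u G = integral\<^sup>L (lebesgue_on \<Omega>)
      (\<lambda>x. (1/2) * quad a x (G x) (G x) + B_eps \<beta> \<epsilon> (u x))"

definition is_minimizer :: "'a::euclidean_space set \<Rightarrow> ('a \<Rightarrow> 'a \<Rightarrow> 'a \<Rightarrow> real) \<Rightarrow> (real \<Rightarrow> real)
    \<Rightarrow> ('a \<Rightarrow> real) \<Rightarrow> real \<Rightarrow> ('a \<Rightarrow> real) \<Rightarrow> bool" where
  "is_minimizer \<Omega> a \<beta> \<phi> \<epsilon> u \<longleftrightarrow> H1_phi \<Omega> \<phi> u \<and>
     (\<exists>G. is_weak_grad \<Omega> u G \<and>
        (\<forall>v Gv. H1_phi \<Omega> \<phi> v \<longrightarrow> is_weak_grad \<Omega> v Gv \<longrightarrow>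
            energy \<Omega> a \<beta> \<epsilon> u G \<le> energy \<Omega> a \<beta> \<epsilon> v Gv))"

definition divergence :: "('a::euclidean_space \<Rightarrow> 'a) \<Rightarrow> 'a \<Rightarrow> real" where
  "divergence F x = (\<Sum>b\<in>Basis. pderiv (\<lambda>y. F y \<bullet> b) b x)"

definition perimeter :: "'a::euclidean_space set \<Rightarrow> 'a set \<Rightarrow> ereal" where
  "perimeter E V = (SUP F \<in> {F. (\<forall>b\<in>Basis. test_fun V (\<lambda>x. F x \<bullet> b)) \<and> (\<forall>x. norm (F x) \<le> 1)}.
      ereal (set_lebesgue_integral lebesgue E (divergence F)))"

definition locally_finite_perimeter :: "'a::euclidean_space set \<Rightarrow> 'a set \<Rightarrow> bool" where
  "locally_finite_perimeter E \<Omega> \<longleftrightarrow>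
     (\<forall>V. open V \<and> compact (closure V) \<and> closure V \<subseteq> \<Omega> \<longrightarrow> perimeter E V < \<infinity>)"

end

theory Submission
  imports Defs
begin

text \<open>Every Sobolev function that occurs is a limit in \<open>L2\<close>, with its gradient, of smooth functions,
so positive parts, products and integration by parts reduce to the smooth case. By the (K-Lip) property
harmonic replacements are locally Lipschitz; comparison then gives local bounds, a mean value inequality
and a Harnack inequality.

Comparing a minimizer with its replacements at dyadic scales yields linear growth
\<open>u x \<le> C (u c + r)\<close>, uniformly in \<open>\<epsilon>\<close>. Testing minimality with \<open>- min u (\<delta> \<eta>)\<close> bounds the Dirichlet
energy in \<open>{u < \<delta>}\<close> and the volume of \<open>{\<epsilon> \<le> u < \<delta>}\<close> by \<open>C \<delta>\<close>; with the mean value inequality this gives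
nondegeneracy. The two bounds make the gradients of ramps of \<open>u\<close> between \<open>\<delta>/2\<close> and \<open>\<delta>\<close> bounded in \<open>L1\<close>, hence
finite perimeter. A ball of radius \<open>r\<close> about a free boundary point contains volume \<open>\<ge> c r ^ n\<close> of
\<open>{0 < u0 \<le> C r}\<close>, whose volume is \<open>\<le> C r\<close>, so at most \<open>C r ^ (1 - n)\<close> such balls are disjoint.

Conversely the zero set has positive measure near a free boundary point (otherwise the penalty saturates,
\<open>u0\<close> coincides with its replacement, and Harnack makes it vanish), and all segments that join it to a ball
where \<open>u0 > 0\<close> cross the free boundary, which is therefore not null.\<close>

text \<open>The coefficients are merely measurable and \<open>\<beta>\<close> merely bounded, so no
  differentiability of the penalty and no regularity theory is at hand. Two choices shape the proof.
  First, apart from the sign of minimizers, minimality is tested in three directions only: downward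
  perturbations (giving a subsolution), the harmonic replacement in a ball (whose energy gain is
  paid by the unsaturated penalty \<open>gap\<close>), and
  \<open>- min u (\<delta> * \<eta>)\<close>. Secondly, (K-Lip) is a gradient bound by a supremum;
  maximizing a power of the distance to the sphere times \<open>abs h\<close> turns it into bounds
  by the L2 norm and, with the level-set argument, by the value at the centre. Sobolev functions are
  pairs (function, gradient) in a strong closure: the definition of the trace supplies smooth
  approximants, so minimizers and all competitors are such pairs from the start. The sign of a
  minimizer is settled only up to an alternative: it is nonnegative, or it is nonpositive
  everywhere. If the second case occurs infinitely often, the limit has an empty positivity set. All
  constants of the growth and nondegeneracy estimates are fixed before \<open>\<epsilon>\<close> and
  \<open>u\<close> are introduced, so they survive the limit.\<close>

abbreviation "Leb \<equiv> lebesgue_on"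

section \<open>Smooth functions\<close>

text \<open>Carrying the whole sequence of derivatives as a witness makes differentiation and
  antidifferentiation a shift of the index.\<close>

definition smooth1 :: "(real \<Rightarrow> real) \<Rightarrow> bool" where
 "smooth1 F \<longleftrightarrow> (\<exists>D::nat \<Rightarrow> real \<Rightarrow> real. D 0 = F \<and>
   (\<forall>n t. (D n has_real_derivative D (Suc n) t) (at t)))"

lemma smooth1_deriv:
 assumes "smooth1 F"
 obtains F' where "smooth1 F'" "\<And>t. (F has_real_derivative F' t) (at t)"
proof -
 from assms obtain D where D: "D 0 = F" "\<And>n t. (D n has_real_derivative D (Suc n) t) (at t)"
  unfolding smooth1_def by auto
 have "smooth1 (D 1)" unfolding smooth1_def
  by (rule exI[of _ "\<lambda>n. D (Suc n)"]) (use D in auto)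
 moreover have "(F has_real_derivative D 1 t) (at t)" for t using D(2)[of 0 t] D(1) by simp
 ultimately show thesis using that by blast
qed

lemma smooth1_antideriv:
 assumes "smooth1 F'" "\<And>t. (F has_real_derivative F' t) (at t)"
 shows "smooth1 F"
proof -
 from assms(1) obtain D where D: "D 0 = F'" "\<And>n t. (D n has_real_derivative D (Suc n) t) (at t)"
  unfolding smooth1_def by auto
 show ?thesis unfolding smooth1_def
  by (rule exI[of _ "\<lambda>n. case n of 0 \<Rightarrow> F | Suc m \<Rightarrow> D m"])
    (use D assms(2) in \<open>auto split: nat.split\<close>)
qed

lemma smooth1_continuous: "smooth1 F \<Longrightarrow> continuous_on S F"
 by (meson smooth1_deriv DERIV_isCont continuous_at_imp_continuous_on)

text \<open>The class \<open>S\<close> is an invariant: \<open>dirderiv vs f\<close> stays in it by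
  induction on \<open>vs\<close>, whatever the iterated derivatives look like.\<close>

lemma smooth_fun_coinduct:
 assumes "f \<in> S"
  and S: "\<And>f x. f \<in> S \<Longrightarrow> f differentiable (at x)"
  and S': "\<And>f v. f \<in> S \<Longrightarrow> (\<lambda>x. frechet_derivative f (at x) v) \<in> S"
 shows "smooth_fun (f :: 'a::euclidean_space \<Rightarrow> real)"
proof -
 have "dirderiv vs f \<in> S" for vs
  by (induction vs) (use assms in auto)
 thus ?thesis unfolding smooth_fun_def using S by blast
qed

text \<open>The recursion of \<open>dirderiv\<close> peels off the outermost derivative; smoothness
  of a derivative of \<open>f\<close> needs the innermost one.\<close>

lemma dirderiv_append: "dirderiv (vs @ [v]) f = dirderiv vs (\<lambda>x. frechet_derivative f (at x) v)"
 by (induction vs) auto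

lemma smooth_fun_frechet:
 "smooth_fun f \<Longrightarrow> smooth_fun (\<lambda>x. frechet_derivative f (at x) v)"
 unfolding smooth_fun_def using dirderiv_append by metis

lemma smooth_fun_differentiable: "smooth_fun f \<Longrightarrow> f differentiable (at x)"
 unfolding smooth_fun_def by (metis dirderiv.simps(1))

lemma smooth_fun_continuous: "smooth_fun f \<Longrightarrow> continuous_on S f"
 by (meson smooth_fun_differentiable differentiable_imp_continuous_within continuous_at_imp_continuous_on)

lemma smooth_fun_const: "smooth_fun (\<lambda>x::'a::euclidean_space. c)"
proof (rule smooth_fun_coinduct[where S="{f. \<exists>c. f = (\<lambda>x. c)}"])
 fix f :: "'a \<Rightarrow> real" and v assume "f \<in> {f. \<exists>c. f = (\<lambda>x. c)}"
 hence "(\<lambda>x. frechet_derivative f (at x) v) = (\<lambda>x. 0)" by (auto simp: frechet_derivative_const)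
 thus "(\<lambda>x. frechet_derivative f (at x) v) \<in> {f. \<exists>c. f = (\<lambda>x. c)}" by blast
qed auto

lemma smooth_fun_bounded_linear:
 assumes f: "bounded_linear (f :: 'a::euclidean_space \<Rightarrow> real)"
 shows "smooth_fun f"
proof -
 have *: "frechet_derivative f (at x) = f" for x
  using bounded_linear_imp_has_derivative[OF f] frechet_derivative_at by metis
 let ?S = "{f} \<union> {f. \<exists>c. f = (\<lambda>x::'a. c)}"
 show ?thesis
 proof (rule smooth_fun_coinduct[where S="?S"])
  fix g :: "'a \<Rightarrow> real" and v assume "g \<in> ?S"
  thus "(\<lambda>x. frechet_derivative g (at x) v) \<in> ?S"
   using * by (auto simp: frechet_derivative_const)
 qed (use f in \<open>auto intro: bounded_linear_imp_differentiable\<close>)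
qed

text \<open>The derivative of a product is a sum of products, and that of a composition is a product
  with a composition, so none of these operations is closed under differentiation by itself. Closing
  under all of them at once gives an invariant class for \<open>smooth_fun_coinduct\<close>.\<close>

inductive_set smooth_alg :: "('a::euclidean_space \<Rightarrow> real) set" where
 base: "smooth_fun f \<Longrightarrow> f \<in> smooth_alg"
| comp: "smooth1 F \<Longrightarrow> f \<in> smooth_alg \<Longrightarrow> (\<lambda>x. F (f x)) \<in> smooth_alg"
| add: "f \<in> smooth_alg \<Longrightarrow> g \<in> smooth_alg \<Longrightarrow> (\<lambda>x. f x + g x) \<in> smooth_alg"
| mult: "f \<in> smooth_alg \<Longrightarrow> g \<in> smooth_alg \<Longrightarrow> (\<lambda>x. f x * g x) \<in> smooth_alg"

lemma smooth_alg_deriv: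
 "f \<in> smooth_alg \<Longrightarrow> \<exists>D. \<forall>x. (f has_derivative D x) (at x) \<and> (\<forall>v. (\<lambda>x. D x v) \<in> smooth_alg)"
proof (induction rule: smooth_alg.induct)
 case (base f)
 thus ?case
  by (intro exI[of _ "\<lambda>x. frechet_derivative f (at x)"])
   (auto simp: smooth_fun_differentiable frechet_derivative_works[symmetric] smooth_fun_frechet
    intro: smooth_alg.base)
next
 case (comp F f)
 then obtain D where D: "\<And>x. (f has_derivative D x) (at x)" "\<And>v. (\<lambda>x. D x v) \<in> smooth_alg" by auto
 obtain F' where F': "smooth1 F'" "\<And>t. (F has_real_derivative F' t) (at t)"
  using comp smooth1_deriv by blast
 have "((\<lambda>x. F (f x)) has_derivative (\<lambda>v. F' (f x) * D x v)) (at x)" for x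
  using has_derivative_compose[OF D(1) F'(2)[of "f x", unfolded has_field_derivative_def]] by simp
 moreover have "(\<lambda>x. F' (f x) * D x v) \<in> smooth_alg" for v
  by (rule smooth_alg.mult[OF smooth_alg.comp[OF F'(1) comp(2)] D(2)])
 ultimately show ?case by (intro exI[of _ "\<lambda>x v. F' (f x) * D x v"]) auto
next
 case (add f g)
 then obtain D D' where D: "\<And>x. (f has_derivative D x) (at x)" "\<And>v. (\<lambda>x. D x v) \<in> smooth_alg"
  "\<And>x. (g has_derivative D' x) (at x)" "\<And>v. (\<lambda>x. D' x v) \<in> smooth_alg" by auto
 thus ?case
  by (intro exI[of _ "\<lambda>x v. D x v + D' x v"]) (auto intro!: has_derivative_add smooth_alg.add)
next
 case (mult f g)
 then obtain D D' where D: "\<And>x. (f has_derivative D x) (at x)" "\<And>v. (\<lambda>x. D x v) \<in> smooth_alg"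
  "\<And>x. (g has_derivative D' x) (at x)" "\<And>v. (\<lambda>x. D' x v) \<in> smooth_alg" by auto
 have "((\<lambda>x. f x * g x) has_derivative (\<lambda>v. f x * D' x v + D x v * g x)) (at x)" for x
  by (rule has_derivative_mult[OF D(1) D(3)])
 thus ?case
  by (intro exI[of _ "\<lambda>x v. f x * D' x v + D x v * g x"])
    (auto intro!: smooth_alg.add smooth_alg.mult D mult)
qed

lemma smooth_alg_smooth: "f \<in> smooth_alg \<Longrightarrow> smooth_fun f"
proof (rule smooth_fun_coinduct[where S=smooth_alg])
 fix f :: "'a \<Rightarrow> real" and x v assume "f \<in> smooth_alg"
 then obtain D where D: "\<And>x. (f has_derivative D x) (at x)" "\<And>v. (\<lambda>x. D x v) \<in> smooth_alg"
  using smooth_alg_deriv by blast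
 show "f differentiable at x" using D(1) differentiableI by blast
 have "frechet_derivative f (at x) = D x" for x using D(1) frechet_derivative_at by metis
 thus "(\<lambda>x. frechet_derivative f (at x) v) \<in> smooth_alg" using D(2) by simp
qed

lemma smooth_fun_add: "smooth_fun f \<Longrightarrow> smooth_fun g \<Longrightarrow> smooth_fun (\<lambda>x. f x + g x)"
 by (rule smooth_alg_smooth[OF smooth_alg.add[OF smooth_alg.base smooth_alg.base]])
lemma smooth_fun_mult: "smooth_fun f \<Longrightarrow> smooth_fun g \<Longrightarrow> smooth_fun (\<lambda>x. f x * g x)"
 by (rule smooth_alg_smooth[OF smooth_alg.mult[OF smooth_alg.base smooth_alg.base]])
lemma smooth_fun_comp: "smooth1 F \<Longrightarrow> smooth_fun f \<Longrightarrow> smooth_fun (\<lambda>x. F (f x))"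
 by (rule smooth_alg_smooth[OF smooth_alg.comp[OF _ smooth_alg.base]])
lemma smooth_fun_cmult: "smooth_fun f \<Longrightarrow> smooth_fun (\<lambda>x. c * f x)"
 by (intro smooth_fun_mult smooth_fun_const)
lemma smooth_fun_diff: "smooth_fun f \<Longrightarrow> smooth_fun g \<Longrightarrow> smooth_fun (\<lambda>x. f x - g x)"
 using smooth_fun_add[OF _ smooth_fun_cmult[where c="-1"], of f g] by simp
lemma smooth_fun_sum: "(\<And>i. i \<in> I \<Longrightarrow> smooth_fun (f i)) \<Longrightarrow> smooth_fun (\<lambda>x. \<Sum>i\<in>I. f i x)"
 by (induction I rule: infinite_finite_induct) (auto intro: smooth_fun_const smooth_fun_add)
lemma smooth_fun_prod: "(\<And>i. i \<in> I \<Longrightarrow> smooth_fun (f i)) \<Longrightarrow> smooth_fun (\<lambda>x. \<Prod>i\<in>I. f i x)"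
 by (induction I rule: infinite_finite_induct) (auto intro: smooth_fun_const smooth_fun_mult)

lemma smooth_real: "smooth_fun (f::real \<Rightarrow> real) \<Longrightarrow> smooth1 f"
proof -
 assume f: "smooth_fun f"
 have "((dirderiv (replicate n 1) f) has_real_derivative dirderiv (replicate (Suc n) 1) f t) (at t)" for n t
 proof -
  let ?g = "dirderiv (replicate n 1) f" let ?D = "frechet_derivative ?g (at t)"
  have "?g differentiable at t" using f unfolding smooth_fun_def by blast
  hence D: "(?g has_derivative ?D) (at t)" using frechet_derivative_works by blast
  have "?D v = ?D 1 * v" for v
   using linear_cmul[OF has_derivative_linear[OF D], of v 1] by (simp add: mult.commute)
  hence "?D = (*) (?D 1)" by blast
  with D have "(?g has_derivative (*) (?D 1)) (at t)" by simp
  thus ?thesis unfolding has_field_derivative_def by simp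
 qed
 thus "smooth1 f" unfolding smooth1_def
  by (intro exI[of _ "\<lambda>n. dirderiv (replicate n 1) f"]) auto
qed

text \<open>On the real line both notions of smoothness agree, so the closure properties are
  inherited from \<open>smooth_fun\<close>.\<close>

lemma smooth1_mult: "smooth1 F \<Longrightarrow> smooth1 G \<Longrightarrow> smooth1 (\<lambda>t. F t * G t)"
 and smooth1_add: "smooth1 F \<Longrightarrow> smooth1 G \<Longrightarrow> smooth1 (\<lambda>t. F t + G t)"
 and smooth1_comp: "smooth1 F \<Longrightarrow> smooth1 G \<Longrightarrow> smooth1 (\<lambda>t. F (G t))"
proof -
 have *: "smooth_fun F" if "smooth1 F" for F :: "real \<Rightarrow> real"
  using smooth_fun_comp[OF that smooth_fun_bounded_linear[OF bounded_linear_ident]] by simp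
 show "smooth1 F \<Longrightarrow> smooth1 G \<Longrightarrow> smooth1 (\<lambda>t. F t * G t)"
  "smooth1 F \<Longrightarrow> smooth1 G \<Longrightarrow> smooth1 (\<lambda>t. F t + G t)"
  "smooth1 F \<Longrightarrow> smooth1 G \<Longrightarrow> smooth1 (\<lambda>t. F (G t))"
  using smooth_fun_mult[OF * *, THEN smooth_real] smooth_fun_add[OF * *, THEN smooth_real]
   smooth_fun_comp[OF _ *, THEN smooth_real] by blast+
qed

lemma smooth1_affine: "smooth1 (\<lambda>t. c * t + d)"
 by (intro smooth_real smooth_fun_add smooth_fun_const smooth_fun_cmult
   smooth_fun_bounded_linear[OF bounded_linear_ident])

subsection \<open>Smooth steps and cutoffs\<close>

definition flat_exp :: "real \<Rightarrow> real" where
 "flat_exp t = (if t \<le> 0 then 0 else exp (- (1 / t)))"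

text \<open>For \<open>t > 0\<close> the n-th derivative of \<open>exp (- (1 / t))\<close> is
  \<open>p (1 / t) * exp (- (1 / t))\<close> with \<open>p = flat_poly n\<close>; differentiating
  once more gives the recursion, since \<open>1 / t\<close> has derivative
  \<open>- (1 / t) ^ 2\<close>.\<close>

fun flat_poly :: "nat \<Rightarrow> real poly" where
 "flat_poly 0 = 1"
| "flat_poly (Suc n) = monom 1 2 * (flat_poly n - Polynomial.pderiv (flat_poly n))"

lemma poly_exp_decay: "((\<lambda>t. poly p (1 / t) * exp (- (1 / t))) \<longlongrightarrow> 0) (at_right (0::real))"
proof -
 have "((\<lambda>x. poly p x * exp (- x)) \<longlongrightarrow> 0) (at_top :: real filter)"
 proof -
  have "((\<lambda>x. \<Sum>i\<le>degree p. coeff p i * (x ^ i / exp x)) \<longlongrightarrow> (\<Sum>i\<le>degree p. coeff p i * 0)) (at_top :: real filter)"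
   by (intro tendsto_sum tendsto_mult tendsto_const tendsto_power_div_exp_0)
  thus ?thesis
   by (simp add: poly_altdef sum_distrib_right exp_minus divide_inverse mult.assoc)
 qed
 thus ?thesis
  using filterlim_compose[OF _ filterlim_inverse_at_top_right] by (auto simp: inverse_eq_divide)
qed

lemma flat_exp_smooth: "smooth1 flat_exp"
proof -
 define D where "D n t = (if t \<le> 0 then 0 else poly (flat_poly n) (1 / t) * exp (- (1 / t)))" for n and t :: real
 have pos: "((\<lambda>t. poly q (1 / t) * exp (- (1 / t))) has_real_derivative
   poly (monom 1 2 * (q - Polynomial.pderiv q)) (1 / t) * exp (- (1 / t))) (at t)" if "t > 0" for q t
  using that
  by (auto intro!: derivative_eq_intros DERIV_chain2[OF poly_DERIV]
    simp: poly_monom power2_eq_square algebra_simps)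
 have "(D n has_real_derivative D (Suc n) t) (at t)" for n t
 proof -
  consider "t > 0" | "t < 0" | "t = 0" by linarith
  thus ?thesis
  proof cases
   case 1
   show ?thesis
    by (rule has_field_derivative_transform_within_open[where S="{0<..}"])
      (use pos[OF 1, of "flat_poly n"] 1 in \<open>auto simp: D_def\<close>)
  next
   case 2
   show ?thesis
    by (rule has_field_derivative_transform_within_open[where S="{..<0}" and f="\<lambda>_. 0"])
      (use 2 in \<open>auto simp: D_def\<close>)
  next
   case 3
   have "((\<lambda>s. D n s / s) \<longlongrightarrow> 0) (at_right 0)"
   proof (rule Lim_transform_eventually[OF poly_exp_decay[of "monom 1 1 * flat_poly n"]])
    show "\<forall>\<^sub>F s in at_right 0. poly (monom 1 1 * flat_poly n) (1 / s) * exp (- (1 / s)) = D n s / s"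
     by (auto simp: eventually_at_filter D_def poly_monom)
   qed
   moreover have "((\<lambda>s. D n s / s) \<longlongrightarrow> 0) (at_left 0)"
    by (rule Lim_transform_eventually[OF tendsto_const]) (auto simp: eventually_at_filter D_def)
   ultimately have "((\<lambda>s. D n s / s) \<longlongrightarrow> 0) (at 0)" by (simp add: filterlim_split_at)
   thus ?thesis using 3 by (simp add: has_field_derivative_iff D_def)
  qed
 qed
 moreover have "D 0 = flat_exp" by (auto simp: D_def flat_exp_def)
 ultimately show ?thesis unfolding smooth1_def by blast
qed

lemma antiderivative_exists:
 assumes "continuous_on UNIV (f::real \<Rightarrow> real)"
 obtains F where "\<And>t. (F has_real_derivative f t) (at t)"
proof -
 have "\<exists>F. \<forall>x::real. (F has_vector_derivative f x) (at x)"
  using einterval_antiderivative[of "-\<infinity>" "\<infinity>" f] assms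
  by (auto simp: continuous_on_eq_continuous_at)
 thus thesis using that by (auto simp: has_real_derivative_iff_has_vector_derivative)
qed

text \<open>The antiderivative of a bump supported in \<open>{0..1}\<close>, shifted and normalised
  by its total increase.\<close>

lemma smooth_step_exists:
 "\<exists>s. smooth1 s \<and> (\<forall>t. 0 \<le> s t \<and> s t \<le> 1) \<and> (\<forall>t\<le>0. s t = 0) \<and> (\<forall>t\<ge>1. s t = 1)"
proof -
 define b where "b t = flat_exp t * flat_exp ((-1) * t + 1)" for t
 have b: "smooth1 b" unfolding b_def
  by (intro smooth1_mult flat_exp_smooth smooth1_comp[OF flat_exp_smooth smooth1_affine])
 have b0: "b t \<ge> 0" for t by (simp add: b_def flat_exp_def)
 have b1: "b t = 0" if "t \<le> 0 \<or> t \<ge> 1" for t using that by (auto simp: b_def flat_exp_def)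
 have b2: "b t > 0" if "0 < t" "t < 1" for t using that by (auto simp: b_def flat_exp_def)
 obtain F where F: "\<And>t. (F has_real_derivative b t) (at t)"
  using antiderivative_exists smooth1_continuous[OF b] by blast
 have Fs: "smooth1 F" using smooth1_antideriv b F by blast
 have mono: "F x \<le> F y" if "x \<le> y" for x y
  using DERIV_nonneg_imp_nondecreasing[OF that] F b0 by metis
 have lt: "F 0 < F 1"
 proof -
  obtain z where "0 < z" "z < 1" "F 1 - F 0 = (1 - 0) * b z" using MVT2[of 0 1 F b] F by auto
  thus ?thesis using b2[of z] by auto
 qed
 have l: "F t = F 0" if t: "t \<le> 0" for t
 proof (cases "t = 0")
  case False
  then obtain z where "t < z" "z < 0" "F 0 - F t = (0 - t) * b z" using MVT2[of t 0 F b] F t by auto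
  thus ?thesis using b1[of z] by auto
 qed auto
 have r: "F t = F 1" if t: "t \<ge> 1" for t
 proof (cases "t = 1")
  case False
  then obtain z where "1 < z" "z < t" "F t - F 1 = (t - 1) * b z" using MVT2[of 1 t F b] F t by auto
  thus ?thesis using b1[of z] by auto
 qed auto
 have rng: "F 0 \<le> F t \<and> F t \<le> F 1" for t using mono l r by (metis linear)
 define s where "s t = (1 / (F 1 - F 0)) * F t + (- F 0 / (F 1 - F 0))" for t
 have seq: "s t = (F t - F 0) / (F 1 - F 0)" for t by (simp add: s_def diff_divide_distrib)
 have "smooth1 s" unfolding s_def using smooth1_comp[OF smooth1_affine Fs] .
 moreover have "0 \<le> s t \<and> s t \<le> 1" for t using rng[of t] lt unfolding seq by simp
 moreover have "t \<le> 0 \<Longrightarrow> s t = 0" for t using l[of t] unfolding seq by simp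
 moreover have "t \<ge> 1 \<Longrightarrow> s t = 1" for t using r[of t] lt unfolding seq by simp
 ultimately show ?thesis by blast
qed

definition sstep :: "real \<Rightarrow> real" where
 "sstep = (SOME s. smooth1 s \<and> (\<forall>t. 0 \<le> s t \<and> s t \<le> 1) \<and> (\<forall>t\<le>0. s t = 0) \<and> (\<forall>t\<ge>1. s t = 1))"

lemma sstep: "smooth1 sstep" "0 \<le> sstep t" "sstep t \<le> 1" "t \<le> 0 \<Longrightarrow> sstep t = 0" "t \<ge> 1 \<Longrightarrow> sstep t = 1"
proof -
 from someI_ex[OF smooth_step_exists, folded sstep_def]
 show "smooth1 sstep" "0 \<le> sstep t" "sstep t \<le> 1" "t \<le> 0 \<Longrightarrow> sstep t = 0" "t \<ge> 1 \<Longrightarrow> sstep t = 1"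
  by auto
qed

definition ppos1 :: "real \<Rightarrow> real" where
 "ppos1 = (SOME F. (\<forall>t. (F has_real_derivative sstep t) (at t)) \<and> F 0 = 0)"

lemma ppos1: "(ppos1 has_real_derivative sstep t) (at t)" "ppos1 0 = 0"
proof -
 obtain F where F: "\<And>t. (F has_real_derivative sstep t) (at t)"
  using antiderivative_exists[OF smooth1_continuous[OF sstep(1)]] by blast
 have "\<exists>F. (\<forall>t. (F has_real_derivative sstep t) (at t)) \<and> F 0 = 0"
  by (rule exI[of _ "\<lambda>t. F t - F 0"]) (auto intro!: derivative_eq_intros F)
 hence "(\<forall>t. (ppos1 has_real_derivative sstep t) (at t)) \<and> ppos1 0 = 0"
  unfolding ppos1_def by (rule someI_ex)
 thus "(ppos1 has_real_derivative sstep t) (at t)" "ppos1 0 = 0" by auto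
qed

text \<open>A smooth substitute for the positive part at scale \<open>d\<close>: for
  \<open>d > 0\<close> it is 1-Lipschitz, nonnegative and within \<open>d\<close> of
  \<open>max t 0\<close>. That it vanishes exactly on \<open>t \<le> 0\<close>, not just
  approximately, is what preserves compact supports under truncation.\<close>

definition ppos :: "real \<Rightarrow> real \<Rightarrow> real" where "ppos d t = d * ppos1 (t / d)"

context
 fixes d :: real
 assumes d: "d > 0"
begin

lemma ppos_deriv: "(ppos d has_real_derivative sstep (t / d)) (at t)"
 unfolding ppos_def using d by (auto intro!: derivative_eq_intros DERIV_chain2[OF ppos1(1)])

lemma ppos_smooth: "smooth1 (ppos d)"
 using smooth1_antideriv[OF smooth1_comp[OF sstep(1) smooth1_affine[of "1/d" 0]]] ppos_deriv
 by simp

lemma ppos_mvt: "t < s \<Longrightarrow> \<exists>z. t < z \<and> z < s \<and> ppos d s - ppos d t = (s - t) * sstep (z / d)"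
 using MVT2[of t s "ppos d" "\<lambda>z. sstep (z / d)"] ppos_deriv by auto

lemma ppos_lipschitz: "\<bar>ppos d s - ppos d t\<bar> \<le> \<bar>s - t\<bar>"
proof -
 have *: "\<bar>ppos d s - ppos d t\<bar> \<le> \<bar>s - t\<bar>" if ts: "t < s" for s t
 proof -
  obtain z where "ppos d s - ppos d t = (s - t) * sstep (z / d)"
   using ppos_mvt[OF ts] by blast
  thus ?thesis using sstep(2,3)[of "z/d"] ts by (simp add: mult_left_le abs_mult)
 qed
 show ?thesis using *[of s t] *[of t s] by (cases s t rule: linorder_cases) (auto simp: abs_minus_commute)
qed

lemma ppos_zero: "ppos d 0 = 0"
 by (simp add: ppos_def ppos1)

lemma ppos_nonpos: assumes t: "t \<le> 0" shows "ppos d t = 0"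
proof (cases "t = 0")
 case False
 then obtain z where z: "t < z" "z < 0" "ppos d 0 - ppos d t = (0 - t) * sstep (z / d)"
  using ppos_mvt[of t 0] t by auto
 have "sstep (z / d) = 0" using z d by (intro sstep) (simp add: divide_le_0_iff)
 thus ?thesis using z ppos_zero by simp
qed (simp add: ppos_zero)

lemma ppos_nonneg: "0 \<le> ppos d t"
proof (cases "t \<le> 0")
 case False
 then obtain z where "ppos d t - ppos d 0 = (t - 0) * sstep (z / d)"
  using ppos_mvt[of 0 t] by auto
 thus ?thesis using False sstep(2)[of "z/d"] ppos_zero by simp
qed (simp add: ppos_nonpos)

lemma ppos_le: "ppos d t \<le> max t 0"
 using ppos_lipschitz[of t 0] ppos_zero ppos_nonpos[of t] by (auto simp: max_def)

lemma ppos_ge: "max t 0 - d \<le> ppos d t"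
proof (cases "t \<le> d")
 case True thus ?thesis using ppos_nonneg[of t] d by auto
next
 case False
 then obtain z where z: "d < z" "z < t" "ppos d t - ppos d d = (t - d) * sstep (z / d)"
  using ppos_mvt[of d t] by auto
 hence "sstep (z / d) = 1" using d by (intro sstep) auto
 thus ?thesis using z ppos_nonneg[of d] d False by (auto simp: max_def)
qed

end

section \<open>Classical gradients, test functions and cutoffs\<close>

lemma frechet_eq_cgrad:
 assumes "f differentiable (at x)"
 shows "frechet_derivative f (at x) v = cgrad f x \<bullet> v"
proof -
 have D: "(f has_derivative frechet_derivative f (at x)) (at x)"
  using assms frechet_derivative_works by blast
 interpret linear "frechet_derivative f (at x)" using has_derivative_linear[OF D] .
 have "frechet_derivative f (at x) v = frechet_derivative f (at x) (\<Sum>b\<in>Basis. (v \<bullet> b) *\<^sub>R b)"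
  by (simp add: euclidean_representation)
 also have "\<dots> = (\<Sum>b\<in>Basis. (v \<bullet> b) * frechet_derivative f (at x) b)" by (simp add: sum scale)
 also have "\<dots> = cgrad f x \<bullet> v"
  by (simp add: cgrad_def pderiv_def inner_sum_left inner_sum_right inner_commute mult.commute)
 finally show ?thesis .
qed

lemma has_derivative_cgrad:
 "f differentiable (at x) \<Longrightarrow> (f has_derivative (\<lambda>v. cgrad f x \<bullet> v)) (at x)"
 using frechet_derivative_works[of f "at x"] frechet_eq_cgrad[of f x] by (metis ext)

lemma smooth_has_derivative:
 "smooth_fun f \<Longrightarrow> (f has_derivative (\<lambda>v. cgrad f x \<bullet> v)) (at x)"
 by (intro has_derivative_cgrad smooth_fun_differentiable)

lemma cgrad_unique:
 assumes "(f has_derivative (\<lambda>v. g \<bullet> v)) (at x)" shows "cgrad f x = g"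
proof -
 have "frechet_derivative f (at x) = (\<lambda>v. g \<bullet> v)" using frechet_derivative_at[OF assms] by simp
 thus ?thesis unfolding cgrad_def pderiv_def by (simp add: euclidean_representation)
qed

lemma cgrad_inner_Basis: "b \<in> Basis \<Longrightarrow> cgrad f x \<bullet> b = pderiv f b x"
 by (simp add: cgrad_def inner_sum_left inner_Basis if_distrib cong: if_cong)

lemma cgrad_const: "cgrad (\<lambda>x. c) x = 0"
 by (rule cgrad_unique) simp

lemma cgrad_add: "smooth_fun f \<Longrightarrow> smooth_fun g \<Longrightarrow> cgrad (\<lambda>x. f x + g x) x = cgrad f x + cgrad g x"
 by (rule cgrad_unique) (auto intro!: derivative_eq_intros smooth_has_derivative simp: inner_add_left)
lemma cgrad_diff: "smooth_fun f \<Longrightarrow> smooth_fun g \<Longrightarrow> cgrad (\<lambda>x. f x - g x) x = cgrad f x - cgrad g x"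
 by (rule cgrad_unique) (auto intro!: derivative_eq_intros smooth_has_derivative simp: inner_diff_left)
lemma cgrad_mult: "smooth_fun f \<Longrightarrow> smooth_fun g \<Longrightarrow> cgrad (\<lambda>x. f x * g x) x = f x *\<^sub>R cgrad g x + g x *\<^sub>R cgrad f x"
 by (rule cgrad_unique) (auto intro!: derivative_eq_intros smooth_has_derivative simp: inner_add_left algebra_simps)
lemma cgrad_cmult: "smooth_fun f \<Longrightarrow> cgrad (\<lambda>x. c * f x) x = c *\<^sub>R cgrad f x"
 by (rule cgrad_unique) (auto intro!: derivative_eq_intros smooth_has_derivative)
lemma cgrad_comp:
 assumes "smooth_fun f" "(F has_real_derivative F') (at (f x))"
 shows "cgrad (\<lambda>x. F (f x)) x = F' *\<^sub>R cgrad f x"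
 using has_derivative_compose[OF smooth_has_derivative[OF assms(1), of x] assms(2)[unfolded has_field_derivative_def]]
 by (intro cgrad_unique) simp

lemma smooth_fun_cgrad_inner: "smooth_fun f \<Longrightarrow> smooth_fun (\<lambda>x. cgrad f x \<bullet> v)"
 using smooth_fun_frechet[of f v] by (simp add: frechet_eq_cgrad smooth_fun_differentiable)

lemma smooth_fun_pderiv: "smooth_fun f \<Longrightarrow> smooth_fun (pderiv f b)"
 unfolding pderiv_def by (rule smooth_fun_frechet)

lemma smooth_cgrad_continuous:
 assumes "smooth_fun f" shows "continuous_on S (cgrad f)"
 unfolding cgrad_def
 by (intro continuous_intros smooth_fun_continuous smooth_fun_pderiv assms)

lemma test_fun_smooth: "test_fun U \<psi> \<Longrightarrow> smooth_fun \<psi>" unfolding test_fun_def by blast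

lemma test_fun_support:
 assumes "test_fun U \<psi>"
 obtains C where "compact C" "C \<subseteq> U" "\<And>x. x \<notin> C \<Longrightarrow> \<psi> x = 0" "\<And>x. x \<notin> C \<Longrightarrow> cgrad \<psi> x = 0"
proof -
 obtain C where C: "compact C" "C \<subseteq> U" "\<And>x. x \<notin> C \<Longrightarrow> \<psi> x = 0"
  using assms unfolding test_fun_def by blast
 have "cgrad \<psi> x = 0" if "x \<notin> C" for x
 proof -
  have "(\<psi> has_derivative (\<lambda>v. 0 \<bullet> v)) (at x)"
   by (rule has_derivative_transform_within_open[of "\<lambda>_. 0" _ _ UNIV "- C"])
     (use C that in \<open>auto simp: compact_imp_closed open_Compl\<close>)
  thus ?thesis by (rule cgrad_unique)
 qed
 thus thesis using that C by blast
qed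

lemma test_fun_outside: assumes "test_fun U \<psi>" "x \<notin> U" shows "\<psi> x = 0" "cgrad \<psi> x = 0"
 using test_fun_support[OF assms(1)] assms(2) by (metis subsetD)+

lemma test_fun_mono: "test_fun U \<psi> \<Longrightarrow> U \<subseteq> V \<Longrightarrow> test_fun V \<psi>"
 unfolding test_fun_def by blast

lemma test_fun_zero: "test_fun U (\<lambda>x. 0)"
 unfolding test_fun_def by (auto intro: smooth_fun_const exI[of _ "{}"])

lemma test_fun_add: "test_fun U f \<Longrightarrow> test_fun U g \<Longrightarrow> test_fun U (\<lambda>x. f x + g x)"
 unfolding test_fun_def
proof safe
 fix C D assume "smooth_fun f" "smooth_fun g" "compact C" "C \<subseteq> U" "\<forall>x. x \<notin> C \<longrightarrow> f x = 0"
  "compact D" "D \<subseteq> U" "\<forall>x. x \<notin> D \<longrightarrow> g x = 0"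
 thus "\<exists>C. compact C \<and> C \<subseteq> U \<and> (\<forall>x. x \<notin> C \<longrightarrow> f x + g x = 0)"
  by (intro exI[of _ "C \<union> D"]) auto
qed (rule smooth_fun_add)

lemma test_fun_mult: "test_fun U f \<Longrightarrow> smooth_fun g \<Longrightarrow> test_fun U (\<lambda>x. g x * f x)"
 unfolding test_fun_def by (auto intro: smooth_fun_mult)

lemma test_fun_cmult: "test_fun U f \<Longrightarrow> test_fun U (\<lambda>x. c * f x)"
 by (intro test_fun_mult smooth_fun_const)

lemma test_fun_diff: "test_fun U f \<Longrightarrow> test_fun U g \<Longrightarrow> test_fun U (\<lambda>x. f x - g x)"
 using test_fun_add[OF _ test_fun_cmult[where c="-1"], of U f g] by simp

lemma smooth_bounded_on:
 assumes "smooth_fun f" "bounded U"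
 obtains B where "B > 0" "\<And>x. x \<in> U \<Longrightarrow> \<bar>f x\<bar> \<le> B" "\<And>x. x \<in> U \<Longrightarrow> norm (cgrad f x) \<le> B"
proof -
 have c: "compact (closure U)" using assms by simp
 have "bounded (f ` closure U)" "bounded (cgrad f ` closure U)"
  using c assms by (auto intro!: compact_imp_bounded compact_continuous_image smooth_fun_continuous smooth_cgrad_continuous)
 then obtain B1 B2 where "\<And>x. x \<in> closure U \<Longrightarrow> norm (f x) \<le> B1" "\<And>x. x \<in> closure U \<Longrightarrow> norm (cgrad f x) \<le> B2"
  unfolding bounded_iff by auto
 thus thesis
  by (intro that[of "max 1 (max B1 B2)"]) (use closure_subset in \<open>force+\<close>)
qed

lemma test_fun_bounded:
 assumes "test_fun U f"
 obtains B where "B > 0" "\<And>x. \<bar>f x\<bar> \<le> B" "\<And>x. norm (cgrad f x) \<le> B"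
proof -
 obtain C where C: "compact C" "\<And>x. x \<notin> C \<Longrightarrow> f x = 0" "\<And>x. x \<notin> C \<Longrightarrow> cgrad f x = 0"
  using test_fun_support[OF assms] by metis
 obtain B where "B > 0" "\<And>x. x \<in> C \<Longrightarrow> \<bar>f x\<bar> \<le> B" "\<And>x. x \<in> C \<Longrightarrow> norm (cgrad f x) \<le> B"
  using smooth_bounded_on[OF test_fun_smooth[OF assms] compact_imp_bounded[OF C(1)]] by metis
 thus thesis using that[of B] C by (metis abs_zero less_eq_real_def norm_zero)
qed

text \<open>The squared distance keeps the function smooth at \<open>z\<close>. The argument of
  \<open>sstep\<close> is at least 1 up to distance \<open>\<rho>\<close> and nonpositive beyond
  \<open>sqrt 2 * \<rho>\<close>; the rational bound \<open>3/2 * \<rho>\<close> is used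
  instead.\<close>

definition bump :: "'a::euclidean_space \<Rightarrow> real \<Rightarrow> 'a \<Rightarrow> real" where
 "bump z \<rho> x = sstep ((-1 / \<rho>\<^sup>2) * ((x - z) \<bullet> (x - z)) + 2)"

lemma smooth_inner_self: "smooth_fun (\<lambda>x::'a::euclidean_space. (x - z) \<bullet> (x - z))"
proof -
 have "smooth_fun (\<lambda>x::'a. \<Sum>b\<in>Basis. ((x \<bullet> b) - z \<bullet> b) * ((x \<bullet> b) - z \<bullet> b))"
  by (intro smooth_fun_sum smooth_fun_mult smooth_fun_diff smooth_fun_const
    smooth_fun_bounded_linear bounded_linear_inner_left)
 moreover have "(\<lambda>x::'a. \<Sum>b\<in>Basis. ((x \<bullet> b) - z \<bullet> b) * ((x \<bullet> b) - z \<bullet> b)) = (\<lambda>x. (x - z) \<bullet> (x - z))"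
  by (rule ext, subst euclidean_inner) (simp add: inner_diff_left)
 ultimately show ?thesis by simp
qed

lemma bump_smooth: "smooth_fun (bump z \<rho>)"
 unfolding bump_def
 by (rule smooth_fun_comp[OF smooth1_comp[OF sstep(1) smooth1_affine] smooth_inner_self])

lemma bump_range: "0 \<le> bump z \<rho> x" "bump z \<rho> x \<le> 1"
 by (simp_all add: bump_def sstep)

lemma bump_one: assumes "\<rho> > 0" "norm (x - z) \<le> \<rho>" shows "bump z \<rho> x = 1"
 unfolding bump_def
proof (rule sstep(5))
 have "(x - z) \<bullet> (x - z) \<le> \<rho>\<^sup>2" using assms by (simp add: dot_square_norm)
 thus "1 \<le> - 1 / \<rho>\<^sup>2 * ((x - z) \<bullet> (x - z)) + 2" using assms by (simp add: field_simps)
qed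

lemma bump_zero: assumes "\<rho> > 0" "norm (x - z) \<ge> 3/2 * \<rho>" shows "bump z \<rho> x = 0"
 unfolding bump_def
proof (rule sstep(4))
 have "(3/2 * \<rho>)\<^sup>2 \<le> (norm (x - z))\<^sup>2" using assms by (intro power_mono) auto
 hence "2 * \<rho>\<^sup>2 \<le> (x - z) \<bullet> (x - z)"
  by (simp add: dot_square_norm power_mult_distrib power2_eq_square) (smt (verit) zero_le_square)
 thus "- 1 / \<rho>\<^sup>2 * ((x - z) \<bullet> (x - z)) + 2 \<le> 0" using assms by (simp add: field_simps)
qed

lemma bump_test: assumes "\<rho> > 0" shows "test_fun (ball z (2 * \<rho>)) (bump z \<rho>)"
 unfolding test_fun_def
proof (intro conjI exI[of _ "cball z (3/2 * \<rho>)"] allI impI)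
 fix x assume "x \<notin> cball z (3/2 * \<rho>)"
 thus "bump z \<rho> x = 0" by (intro bump_zero assms) (simp add: dist_norm norm_minus_commute)
qed (use assms bump_smooth in auto)

text \<open>Every \<open>bump z \<rho>\<close> is a translate and dilate of \<open>bump 0 1\<close>,
  so one constant serves all centres and radii.\<close>

lemma bump_cgrad:
 "\<exists>C>0. \<forall>z \<rho> x. \<rho> > 0 \<longrightarrow> norm (cgrad (bump z \<rho> :: 'a::euclidean_space \<Rightarrow> real) x) \<le> C / \<rho>"
proof -
 obtain B where B: "B > 0" "\<And>x. norm (cgrad (bump (0::'a) 1) x) \<le> B"
  using test_fun_bounded[OF bump_test[OF zero_less_one, of "0::'a"]] by metis
 have "norm (cgrad (bump z \<rho>) x) \<le> B / \<rho>" if "\<rho> > 0" for z x :: 'a and \<rho>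
 proof -
  have eq: "bump z \<rho> = (\<lambda>x. bump 0 1 ((1 / \<rho>) *\<^sub>R (x - z)))"
   using that by (auto simp: bump_def power2_eq_square)
  have "(bump z \<rho> has_derivative (\<lambda>v. ((1/\<rho>) *\<^sub>R cgrad (bump 0 1) ((1/\<rho>) *\<^sub>R (x - z))) \<bullet> v)) (at x)"
   unfolding eq
   by (rule has_derivative_compose[OF _ smooth_has_derivative[OF bump_smooth[of 0 1]], THEN has_derivative_eq_rhs])
     (auto intro!: derivative_eq_intros)
  hence "cgrad (bump z \<rho>) x = (1/\<rho>) *\<^sub>R cgrad (bump 0 1) ((1/\<rho>) *\<^sub>R (x - z))" by (rule cgrad_unique)
  thus ?thesis using B(2)[of "(1/\<rho>) *\<^sub>R (x - z)"] that by (simp add: divide_right_mono)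
 qed
 thus ?thesis using B(1) by blast
qed

definition bumpC :: "'a::euclidean_space itself \<Rightarrow> real" where
 "bumpC _ = (SOME C. C > 0 \<and> (\<forall>z \<rho> x. \<rho> > 0 \<longrightarrow> norm (cgrad (bump z \<rho> :: 'a \<Rightarrow> real) x) \<le> C / \<rho>))"

lemma bumpC: "bumpC TYPE('a::euclidean_space) > 0"
 "\<rho> > 0 \<Longrightarrow> norm (cgrad (bump (z::'a) \<rho>) x) \<le> bumpC TYPE('a) / \<rho>"
proof -
 have "\<exists>C. C > 0 \<and> (\<forall>z \<rho> x. \<rho> > 0 \<longrightarrow> norm (cgrad (bump z \<rho> :: 'a \<Rightarrow> real) x) \<le> C / \<rho>)"
  using bump_cgrad by blast
 from someI_ex[OF this]
 show "bumpC TYPE('a) > 0" "\<rho> > 0 \<Longrightarrow> norm (cgrad (bump (z::'a) \<rho>) x) \<le> bumpC TYPE('a) / \<rho>"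
  unfolding bumpC_def by blast+
qed

lemma cutoff_exists:
 assumes "compact C" "open U" "C \<subseteq> U"
 obtains \<eta> where "test_fun U \<eta>" "\<And>x. 0 \<le> \<eta> x \<and> \<eta> x \<le> 1" "\<And>x. x \<in> C \<Longrightarrow> \<eta> x = 1"
proof -
 have "\<exists>\<rho>>0. ball x (2 * \<rho>) \<subseteq> U" if x: "x \<in> C" for x
 proof -
  obtain e where "e > 0" "ball x e \<subseteq> U" using assms x open_contains_ball by blast
  thus ?thesis by (intro exI[of _ "e/2"]) auto
 qed
 then obtain \<rho> where \<rho>: "\<And>x. x \<in> C \<Longrightarrow> \<rho> x > 0 \<and> ball x (2 * \<rho> x) \<subseteq> U" by metis
 obtain F where F: "finite F" "F \<subseteq> C" "C \<subseteq> (\<Union>x\<in>F. ball x (\<rho> x))"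
 proof (rule compactE_image[OF assms(1), of C "\<lambda>x. ball x (\<rho> x)"])
  show "C \<subseteq> (\<Union>c\<in>C. ball c (\<rho> c))" using \<rho> by force
 qed auto
 \<comment> \<open>One minus a product stays in the unit interval and equals 1 as soon as one of the
   bumps does; a sum of bumps would not stay below 1.\<close>
 define \<eta> where "\<eta> x = 1 - (\<Prod>y\<in>F. 1 - bump y (\<rho> y) x)" for x
 show thesis
 proof (rule that[of \<eta>])
  show "test_fun U \<eta>" unfolding test_fun_def
  proof (intro conjI exI[of _ "\<Union>y\<in>F. cball y (3/2 * \<rho> y)"])
   show "smooth_fun \<eta>" unfolding \<eta>_def
    by (intro smooth_fun_diff smooth_fun_const smooth_fun_prod bump_smooth)
   show "compact (\<Union>y\<in>F. cball y (3/2 * \<rho> y))" using F by (intro compact_UN) auto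
   show "(\<Union>y\<in>F. cball y (3/2 * \<rho> y)) \<subseteq> U"
   proof safe
    fix x y assume "y \<in> F" "x \<in> cball y (3/2 * \<rho> y)"
    hence "0 < \<rho> y" "ball y (2 * \<rho> y) \<subseteq> U" using \<rho> F by auto
    thus "x \<in> U" using \<open>x \<in> cball y (3/2 * \<rho> y)\<close> by (intro subsetD[of "ball y (2 * \<rho> y)" U]) auto
   qed
   have "\<eta> x = 0" if x: "x \<notin> (\<Union>y\<in>F. cball y (3/2 * \<rho> y))" for x
   proof -
    have "bump y (\<rho> y) x = 0" if "y \<in> F" for y
     using x that F \<rho> by (intro bump_zero) (auto simp: dist_norm norm_minus_commute)
    thus ?thesis by (simp add: \<eta>_def)
   qed
   thus "\<forall>x. x \<notin> (\<Union>y\<in>F. cball y (3/2 * \<rho> y)) \<longrightarrow> \<eta> x = 0" by blast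
  qed
  show "0 \<le> \<eta> x \<and> \<eta> x \<le> 1" for x
   using prod_le_1[of F "\<lambda>y. 1 - bump y (\<rho> y) x"] prod_nonneg[of F "\<lambda>y. 1 - bump y (\<rho> y) x"]
   by (auto simp: \<eta>_def bump_range)
  show "\<eta> x = 1" if x: "x \<in> C" for x
  proof -
   obtain y where y: "y \<in> F" "x \<in> ball y (\<rho> y)" using F x by auto
   hence "bump y (\<rho> y) x = 1" using F \<rho> by (intro bump_one) (auto simp: dist_norm norm_minus_commute)
   thus ?thesis using y F by (auto simp: \<eta>_def intro!: prod_zero bexI[of _ y])
  qed
 qed
qed

section \<open>Square-integrable vector fields\<close>

definition L2 :: "'a measure \<Rightarrow> ('a \<Rightarrow> 'b::euclidean_space) \<Rightarrow> bool" where
 "L2 M f \<longleftrightarrow> f \<in> borel_measurable M \<and> integrable M (\<lambda>x. (norm (f x))\<^sup>2)"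

definition l2n :: "'a measure \<Rightarrow> ('a \<Rightarrow> 'b::euclidean_space) \<Rightarrow> real" where
 "l2n M f = sqrt (\<integral>x. (norm (f x))\<^sup>2 \<partial>M)"

abbreviation L2lim :: "'a measure \<Rightarrow> (nat \<Rightarrow> 'a \<Rightarrow> 'b::euclidean_space) \<Rightarrow> ('a \<Rightarrow> 'b) \<Rightarrow> bool" where
 "L2lim M v f \<equiv> (\<lambda>n. l2n M (\<lambda>x. v n x - f x)) \<longlonglongrightarrow> 0"

lemma L2_measurable[measurable_dest]: "L2 M f \<Longrightarrow> f \<in> borel_measurable M" by (simp add: L2_def)
lemma L2_integrable: "L2 M f \<Longrightarrow> integrable M (\<lambda>x. (norm (f x))\<^sup>2)" by (simp add: L2_def)

lemma l2n_nonneg[simp]: "0 \<le> l2n M f" by (simp add: l2n_def)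
lemma l2n_sq: "(l2n M f)\<^sup>2 = (\<integral>x. (norm (f x))\<^sup>2 \<partial>M)" by (simp add: l2n_def)

lemma L2_bound:
 assumes "f \<in> borel_measurable M" "L2 M g" "AE x in M. norm (f x) \<le> norm (g x)"
 shows "L2 M f" "l2n M f \<le> l2n M g"
proof -
 have *: "AE x in M. (norm (f x))\<^sup>2 \<le> (norm (g x))\<^sup>2"
  using assms(3) by (auto elim!: eventually_mono intro: power_mono)
 show L: "L2 M f" unfolding L2_def
 proof
  show "integrable M (\<lambda>x. (norm (f x))\<^sup>2)"
   by (rule Bochner_Integration.integrable_bound[OF L2_integrable[OF assms(2)]]) (use assms(1) * in auto)
 qed (rule assms(1))
 show "l2n M f \<le> l2n M g" unfolding l2n_def
  using integral_mono_AE[OF L2_integrable[OF L] L2_integrable[OF assms(2)] *] by simp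
qed

lemma L2_cong_AE:
 assumes "L2 M g" "f \<in> borel_measurable M" "AE x in M. f x = g x" shows "L2 M f"
 by (rule L2_bound(1)[OF assms(2,1)]) (use assms(3) in auto)

lemma l2n_cong_AE:
 assumes "f \<in> borel_measurable M" "g \<in> borel_measurable M" "AE x in M. norm (f x) = norm (g x)"
 shows "l2n M f = l2n M g"
 unfolding l2n_def using assms by (intro arg_cong[where f=sqrt] integral_cong_AE) auto

lemma L2_zero: "L2 M (\<lambda>x. 0)" by (simp add: L2_def)

lemma L2_scaleR: "L2 M f \<Longrightarrow> L2 M (\<lambda>x. c *\<^sub>R f x)"
 by (auto simp: L2_def power_mult_distrib)

lemma l2n_scaleR: "l2n M (\<lambda>x. c *\<^sub>R f x) = \<bar>c\<bar> * l2n M f"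
 by (simp add: l2n_def power_mult_distrib real_sqrt_mult)

lemma L2_norm: "L2 M f \<Longrightarrow> L2 M (\<lambda>x. norm (f x))" "l2n M (\<lambda>x. norm (f x)) = l2n M f"
 by (auto simp: L2_def l2n_def)

lemma L2_add: assumes "L2 M f" "L2 M g" shows "L2 M (\<lambda>x. f x + g x)"
 unfolding L2_def
proof
 show "integrable M (\<lambda>x. (norm (f x + g x))\<^sup>2)"
 proof (rule Bochner_Integration.integrable_bound)
  show "integrable M (\<lambda>x. 2 * (norm (f x))\<^sup>2 + 2 * (norm (g x))\<^sup>2)"
   by (intro Bochner_Integration.integrable_add integrable_mult_right L2_integrable assms)
  have "(norm (f x + g x))\<^sup>2 \<le> 2 * (norm (f x))\<^sup>2 + 2 * (norm (g x))\<^sup>2" for x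
   using power_mono[OF norm_triangle_ineq[of "f x" "g x"], of 2] zero_le_power2[of "norm (f x) - norm (g x)"]
   by (simp add: power2_sum power2_diff)
  thus "AE x in M. norm ((norm (f x + g x))\<^sup>2) \<le> norm (2 * (norm (f x))\<^sup>2 + 2 * (norm (g x))\<^sup>2)"
   by auto
 qed (use assms in measurable)
qed (use assms in measurable)

lemma L2_diff: assumes "L2 M f" "L2 M g" shows "L2 M (\<lambda>x. f x - g x)"
 using L2_add[OF assms(1) L2_scaleR[OF assms(2), of "-1"]] by simp

lemma L2_integrable_mult:
 assumes "L2 M f" "L2 M g" shows "integrable M (\<lambda>x. norm (f x) * norm (g x))"
proof (rule Bochner_Integration.integrable_bound)
 show "integrable M (\<lambda>x. (norm (f x))\<^sup>2 + (norm (g x))\<^sup>2)"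
  by (intro Bochner_Integration.integrable_add L2_integrable assms)
 have "norm (f x) * norm (g x) \<le> (norm (f x))\<^sup>2 + (norm (g x))\<^sup>2" for x
  using sum_squares_bound[of "norm (f x)" "norm (g x)"]
   mult_nonneg_nonneg[OF norm_ge_zero[of "f x"] norm_ge_zero[of "g x"]] by linarith
 thus "AE x in M. norm (norm (f x) * norm (g x)) \<le> norm ((norm (f x))\<^sup>2 + (norm (g x))\<^sup>2)"
  by auto
qed (use assms in measurable)

lemma L2_integrable_le:
 assumes "L2 M f" "L2 M g" "h \<in> borel_measurable M" "AE x in M. \<bar>h x\<bar> \<le> c * (norm (f x) * norm (g x))"
 shows "integrable M (h :: _ \<Rightarrow> real)"
 by (rule Bochner_Integration.integrable_bound[OF integrable_mult_right[OF L2_integrable_mult[OF assms(1,2)], of c] assms(3)])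
   (use assms(4) in \<open>auto elim!: eventually_mono\<close>)

lemma L2_integrable_inner:
 assumes "L2 M f" "L2 M g" shows "integrable M (\<lambda>x. f x \<bullet> g x)"
 by (rule L2_integrable_le[OF assms, where c=1]) (use assms in \<open>auto intro: Cauchy_Schwarz_ineq2\<close>)

text \<open>The discriminant argument behind every Cauchy-Schwarz inequality below; for
  \<open>b = 0\<close> a large \<open>t\<close> replaces the optimal one.\<close>

lemma discriminant_le:
 fixes I a b :: real
 assumes q: "\<And>t. 2 * t * I \<le> a\<^sup>2 + t\<^sup>2 * b\<^sup>2" and "0 \<le> a" "0 \<le> b"
 shows "I \<le> a * b"
proof (cases "b = 0")
 case True
 show ?thesis
 proof (rule ccontr)
  assume "\<not> I \<le> a * b"
  hence I: "I > 0" using True by simp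
  let ?t = "(a\<^sup>2 + 1) / I"
  have "2 * ?t * I = 2 * (a\<^sup>2 + 1)" using I by simp
  thus False using q[of ?t] True zero_le_power2[of a] by simp
 qed
next
 case False
 hence b: "b\<^sup>2 > 0" by simp
 let ?t = "I / b\<^sup>2"
 have "2 * ?t * I = 2 * (I\<^sup>2 / b\<^sup>2)" by (simp add: power2_eq_square)
 moreover have "?t\<^sup>2 * b\<^sup>2 = I\<^sup>2 / b\<^sup>2" using b by (simp add: power2_eq_square)
 ultimately have "I\<^sup>2 / b\<^sup>2 \<le> a\<^sup>2" using q[of ?t] by linarith
 hence "I\<^sup>2 \<le> (a * b)\<^sup>2" using b by (simp add: pos_divide_le_eq power_mult_distrib)
 thus ?thesis by (rule power2_le_imp_le) (use assms in simp)
qed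

lemma L2_CS:
 assumes "L2 M f" "L2 M g" shows "(\<integral>x. norm (f x) * norm (g x) \<partial>M) \<le> l2n M f * l2n M g"
proof -
 let ?I = "\<integral>x. norm (f x) * norm (g x) \<partial>M"
 have q: "2 * t * ?I \<le> (l2n M f)\<^sup>2 + t\<^sup>2 * (l2n M g)\<^sup>2" for t
 proof -
  have "(\<integral>x. 2 * t * (norm (f x) * norm (g x)) \<partial>M) \<le> (\<integral>x. (norm (f x))\<^sup>2 + t\<^sup>2 * (norm (g x))\<^sup>2 \<partial>M)"
  proof (rule integral_mono)
   show "2 * t * (norm (f x) * norm (g x)) \<le> (norm (f x))\<^sup>2 + t\<^sup>2 * (norm (g x))\<^sup>2" for x
    using sum_squares_bound[of "norm (f x)" "t * norm (g x)"] by (simp add: power_mult_distrib mult.assoc mult.left_commute)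
  qed (intro Bochner_Integration.integrable_add integrable_mult_right L2_integrable L2_integrable_mult assms)+
  thus ?thesis using assms by (simp add: l2n_sq L2_integrable)
 qed
 thus ?thesis by (intro discriminant_le) auto
qed

lemma L2_inner_le: assumes "L2 M f" "L2 M g" shows "\<bar>\<integral>x. f x \<bullet> g x \<partial>M\<bar> \<le> l2n M f * l2n M g"
proof -
 have "\<bar>\<integral>x. f x \<bullet> g x \<partial>M\<bar> \<le> (\<integral>x. norm (f x) * norm (g x) \<partial>M)"
 proof (rule order_trans[OF integral_abs_bound])
  show "(\<integral>x. \<bar>f x \<bullet> g x\<bar> \<partial>M) \<le> (\<integral>x. norm (f x) * norm (g x) \<partial>M)"
   by (intro integral_mono integrable_abs L2_integrable_inner L2_integrable_mult assms Cauchy_Schwarz_ineq2)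
 qed
 thus ?thesis using L2_CS[OF assms] by linarith
qed

lemma l2n_triangle:
 assumes "L2 M f" "L2 M g" shows "l2n M (\<lambda>x. f x + g x) \<le> l2n M f + l2n M g"
proof (rule power2_le_imp_le)
 have "(l2n M (\<lambda>x. f x + g x))\<^sup>2 \<le> (\<integral>x. (norm (f x))\<^sup>2 + 2 * (norm (f x) * norm (g x)) + (norm (g x))\<^sup>2 \<partial>M)"
  unfolding l2n_sq
 proof (rule integral_mono)
  show "(norm (f x + g x))\<^sup>2 \<le> (norm (f x))\<^sup>2 + 2 * (norm (f x) * norm (g x)) + (norm (g x))\<^sup>2" for x
   using power_mono[OF norm_triangle_ineq[of "f x" "g x"], of 2] by (simp add: power2_sum)
 qed (intro Bochner_Integration.integrable_add integrable_mult_right L2_integrable L2_integrable_mult L2_add assms)+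
 also have "\<dots> = (l2n M f)\<^sup>2 + 2 * (\<integral>x. norm (f x) * norm (g x) \<partial>M) + (l2n M g)\<^sup>2"
  using L2_integrable[OF assms(1)] L2_integrable[OF assms(2)] L2_integrable_mult[OF assms] by (simp add: l2n_sq)
 also have "\<dots> \<le> (l2n M f + l2n M g)\<^sup>2" using L2_CS[OF assms] by (simp add: power2_sum)
 finally show "(l2n M (\<lambda>x. f x + g x))\<^sup>2 \<le> (l2n M f + l2n M g)\<^sup>2" .
qed simp

lemma l2n_minus_commute: "l2n M (\<lambda>x. f x - g x) = l2n M (\<lambda>x. g x - f x)"
 by (simp add: l2n_def norm_minus_commute)

lemma l2n_diff_triangle:
 assumes "L2 M f" "L2 M g" "L2 M h"
 shows "l2n M (\<lambda>x. f x - h x) \<le> l2n M (\<lambda>x. f x - g x) + l2n M (\<lambda>x. g x - h x)"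
 using l2n_triangle[OF L2_diff[OF assms(1,2)] L2_diff[OF assms(2,3)]] by simp

lemma l2n_le_add_diff:
 assumes "L2 M f" "L2 M g" shows "l2n M f \<le> l2n M g + l2n M (\<lambda>x. f x - g x)"
 using l2n_triangle[OF assms(2) L2_diff[OF assms]] by simp

lemma L2_dominated:
 assumes "\<And>n. g n \<in> borel_measurable M" "L2 M w" "\<And>n. AE x in M. norm (g n x) \<le> norm (w x)"
  and lim: "AE x in M. (\<lambda>n. g n x) \<longlonglongrightarrow> 0"
 shows "(\<lambda>n. l2n M (g n)) \<longlonglongrightarrow> 0"
proof -
 have "(\<lambda>n. \<integral>x. (norm (g n x))\<^sup>2 \<partial>M) \<longlonglongrightarrow> (\<integral>x. 0 \<partial>M)"
 proof (rule integral_dominated_convergence[OF _ _ L2_integrable[OF assms(2)]])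
  show "AE x in M. (\<lambda>n. (norm (g n x))\<^sup>2) \<longlonglongrightarrow> 0"
   using lim by eventually_elim (auto intro!: tendsto_eq_intros tendsto_norm_zero)
  show "AE x in M. norm ((norm (g n x))\<^sup>2) \<le> (norm (w x))\<^sup>2" for n
   using assms(3)[of n] by eventually_elim (auto intro: power_mono)
 qed (use assms(1) in measurable)
 thus ?thesis unfolding l2n_def using tendsto_real_sqrt by fastforce
qed

lemma L2_subseq:
 assumes "\<And>n. L2 M (f n)" "(\<lambda>n. l2n M (f n)) \<longlonglongrightarrow> 0"
 obtains r where "strict_mono r" "AE x in M. (\<lambda>n. f (r n) x) \<longlonglongrightarrow> 0"
proof -
 have "(\<lambda>n. \<integral>x. norm ((norm (f n x))\<^sup>2) \<partial>M) \<longlonglongrightarrow> 0"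
  using tendsto_power[OF assms(2), of 2] by (simp add: l2n_sq)
 then obtain r where r: "strict_mono r" "AE x in M. (\<lambda>n. (norm (f (r n) x))\<^sup>2) \<longlonglongrightarrow> 0"
  using tendsto_L1_AE_subseq[of M "\<lambda>n x. (norm (f n x))\<^sup>2"] L2_integrable[OF assms(1)] by metis
 have "AE x in M. (\<lambda>n. f (r n) x) \<longlonglongrightarrow> 0"
  using r(2)
 proof eventually_elim
  case (elim x)
  hence "(\<lambda>n. sqrt ((norm (f (r n) x))\<^sup>2)) \<longlonglongrightarrow> sqrt 0" by (intro tendsto_real_sqrt)
  thus ?case by (simp add: tendsto_norm_zero_iff)
 qed
 thus thesis using that r by blast
qed

lemma L2_Fatou:
 assumes "\<And>n. L2 M (f n)" "g \<in> borel_measurable M" "AE x in M. (\<lambda>n. f n x) \<longlonglongrightarrow> g x"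
  and "\<And>n. l2n M (f n) \<le> C"
 shows "L2 M g" "l2n M g \<le> C"
proof -
 have [measurable]: "f n \<in> borel_measurable M" for n using assms(1) by (simp add: L2_def)
 note [measurable] = assms(2)
 have C: "0 \<le> C" using assms(4)[of 0] l2n_nonneg[of M "f 0"] by linarith
 have nn: "(\<integral>\<^sup>+x. ennreal ((norm (f n x))\<^sup>2) \<partial>M) \<le> ennreal (C\<^sup>2)" for n
  using nn_integral_eq_integral[OF L2_integrable[OF assms(1)[of n]]] assms(4)[of n]
  by (simp add: l2n_sq[symmetric] ennreal_leI power_mono)
 have "(\<integral>\<^sup>+x. ennreal ((norm (g x))\<^sup>2) \<partial>M) = (\<integral>\<^sup>+x. liminf (\<lambda>n. ennreal ((norm (f n x))\<^sup>2)) \<partial>M)"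
 proof (rule nn_integral_cong_AE)
  show "AE x in M. ennreal ((norm (g x))\<^sup>2) = liminf (\<lambda>n. ennreal ((norm (f n x))\<^sup>2))"
   using assms(3)
  proof eventually_elim
   case (elim x)
   hence "(\<lambda>n. ennreal ((norm (f n x))\<^sup>2)) \<longlonglongrightarrow> ennreal ((norm (g x))\<^sup>2)"
    by (intro tendsto_ennrealI tendsto_power tendsto_norm)
   thus ?case using lim_imp_Liminf[OF sequentially_bot] by metis
  qed
 qed
 also have "\<dots> \<le> liminf (\<lambda>n. \<integral>\<^sup>+x. ennreal ((norm (f n x))\<^sup>2) \<partial>M)"
  by (rule nn_integral_liminf) measurable
 also have "\<dots> \<le> ennreal (C\<^sup>2)"
  using Liminf_mono[of "\<lambda>n. \<integral>\<^sup>+x. ennreal ((norm (f n x))\<^sup>2) \<partial>M" "\<lambda>_. ennreal (C\<^sup>2)" sequentially] nn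
  by (simp add: Liminf_const)
 finally have le: "(\<integral>\<^sup>+x. ennreal ((norm (g x))\<^sup>2) \<partial>M) \<le> ennreal (C\<^sup>2)" .
 have int: "integrable M (\<lambda>x. (norm (g x))\<^sup>2)"
  by (rule integrableI_nonneg) (use le in \<open>auto simp: le_less_trans[OF _ ennreal_less_top]\<close>)
 thus "L2 M g" by (simp add: L2_def)
 have "(l2n M g)\<^sup>2 \<le> C\<^sup>2"
  using le nn_integral_eq_integral[OF int] by (simp add: l2n_sq)
 thus "l2n M g \<le> C" using C by (rule power2_le_imp_le)
qed

text \<open>Riesz-Fischer: a subsequence with geometrically small steps converges almost everywhere,
  and Fatou carries the Cauchy estimate over to the limit.\<close>

lemma L2_complete:
 fixes f :: "nat \<Rightarrow> 'a \<Rightarrow> 'b::euclidean_space"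
 assumes L: "\<And>n. L2 M (f n)"
  and cau: "\<And>e. e > 0 \<Longrightarrow> \<exists>N. \<forall>m\<ge>N. \<forall>n\<ge>N. l2n M (\<lambda>x. f m x - f n x) < e"
 obtains g where "L2 M g" "L2lim M f g"
proof -
 have [measurable]: "f n \<in> borel_measurable M" for n using L by (simp add: L2_def)
 have "\<exists>N. \<forall>k::nat. (\<forall>m\<ge>N k. \<forall>n\<ge>N k. l2n M (\<lambda>x. f m x - f n x) < (1/2) ^ k)"
  by (rule choice) (use cau in auto)
 then obtain N where N: "\<And>k m n. m \<ge> N k \<Longrightarrow> n \<ge> N k \<Longrightarrow> l2n M (\<lambda>x. f m x - f n x) < (1/2) ^ k" by blast
 define r where "r k = k + (\<Sum>j\<le>k. N j)" for k
 have r: "N k \<le> r k" "r k \<le> r (Suc k)" "k \<le> r k" for k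
  by (auto simp: r_def intro: member_le_sum trans_le_add2)
 define d where "d k x = norm (f (r (Suc k)) x - f (r k) x)" for k x
 have dm[measurable]: "d k \<in> borel_measurable M" for k unfolding d_def by measurable
 \<comment> \<open>The squared steps integrate to at most \<open>(1/4) ^ k\<close>, so the weight
   \<open>2 ^ k\<close> still leaves a summable series. The weight is what allows
   \<open>d k x \<le> 2 ^ k * (d k x) ^ 2 + (1/2) ^ k\<close> to give pointwise summability of the
   steps themselves.\<close>
 have int: "(\<integral>\<^sup>+x. ennreal (2 ^ k * (d k x)\<^sup>2) \<partial>M) \<le> ennreal ((1/2)^k)" for k
 proof -
  have Ld: "L2 M (\<lambda>x. f (r (Suc k)) x - f (r k) x)" by (intro L2_diff L)
  have "(\<integral>\<^sup>+x. ennreal (2 ^ k * (d k x)\<^sup>2) \<partial>M) = ennreal (2^k * (l2n M (\<lambda>x. f (r (Suc k)) x - f (r k) x))\<^sup>2)"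
   unfolding d_def using nn_integral_eq_integral[OF integrable_mult_right[OF L2_integrable[OF Ld], of "2^k"]]
   by (simp add: l2n_sq)
  also have "\<dots> \<le> ennreal (2^k * ((1/2)^k)\<^sup>2)"
   using N[of k "r (Suc k)" "r k"] r[of k] by (intro ennreal_leI mult_left_mono power_mono) auto
  also have "2^k * ((1/2)^k)\<^sup>2 = (1/2::real)^k"
   by (simp add: power2_eq_square flip: power_mult_distrib)
  finally show ?thesis .
 qed
 have "(\<integral>\<^sup>+x. (\<Sum>k. ennreal (2 ^ k * (d k x)\<^sup>2)) \<partial>M) = (\<Sum>k. \<integral>\<^sup>+x. ennreal (2 ^ k * (d k x)\<^sup>2) \<partial>M)"
  by (rule nn_integral_suminf) measurable
 also have "\<dots> \<le> (\<Sum>k. ennreal ((1/2)^k))" by (intro suminf_le int) auto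
 also have "\<dots> < \<infinity>" by (subst suminf_ennreal2) (auto intro: summable_geometric)
 finally have "AE x in M. (\<Sum>k. ennreal (2 ^ k * (d k x)\<^sup>2)) \<noteq> \<infinity>"
  by (intro nn_integral_PInf_AE) auto
 hence conv: "AE x in M. convergent (\<lambda>k. f (r k) x)"
 proof eventually_elim
  case (elim x)
  have "summable (\<lambda>k. 2 ^ k * (d k x)\<^sup>2)"
   by (rule summable_suminf_not_top) (use elim in auto)
  hence "summable (\<lambda>k. 2 ^ k * (d k x)\<^sup>2 + (1/2)^k)" by (intro summable_add summable_geometric) auto
  moreover have "d k x \<le> 2 ^ k * (d k x)\<^sup>2 + (1/2)^k" for k
  proof -
   have "2 * (2^k * d k x) \<le> (2^k * d k x)\<^sup>2 + 1"
    using sum_squares_bound[of "2^k * d k x" 1] by simp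
   hence "2^k * d k x \<le> (2^k * d k x)\<^sup>2 + 1" by (smt (verit) d_def mult_nonneg_nonneg norm_ge_zero zero_le_power)
   thus ?thesis by (simp add: power_mult_distrib power_one_over field_simps power2_eq_square)
  qed
  ultimately have "summable (\<lambda>k. d k x)"
   by (rule_tac summable_comparison_test') (auto simp: d_def)
  hence "summable (\<lambda>k. f (r (Suc k)) x - f (r k) x)" unfolding d_def by (rule summable_norm_cancel)
  hence "convergent (\<lambda>n. \<Sum>k<n. f (r (Suc k)) x - f (r k) x)" by (simp add: summable_iff_convergent)
  hence "convergent (\<lambda>n. f (r n) x - f (r 0) x)" by (simp add: sum_lessThan_telescope[of "\<lambda>k. f (r k) x"])
  thus ?case using convergent_add_const_right_iff[of "\<lambda>n. f (r n) x" "- f (r 0) x"] by simp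
 qed
 define g where "g x = lim (\<lambda>k. f (r k) x)" for x
 have gm[measurable]: "g \<in> borel_measurable M" unfolding g_def by measurable
 have lim: "AE x in M. (\<lambda>k. f (r k) x) \<longlonglongrightarrow> g x"
  using conv by eventually_elim (simp add: g_def convergent_LIMSEQ_iff)
 \<comment> \<open>Fatou along the subsequence with \<open>n\<close> fixed: the distances to late
   members are below \<open>e\<close>, hence so is the distance to the limit.\<close>
 have key: "L2 M (\<lambda>x. f n x - g x) \<and> l2n M (\<lambda>x. f n x - g x) \<le> e"
  if N0: "\<forall>m\<ge>N0. \<forall>n\<ge>N0. l2n M (\<lambda>x. f m x - f n x) < e" and n: "n \<ge> N0" for N0 n e
 proof -
  have 1: "L2 M (\<lambda>x. f n x - f (r (k + N0)) x)" for k by (intro L2_diff L)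
  have 2: "l2n M (\<lambda>x. f n x - f (r (k + N0)) x) \<le> e" for k
   using N0 n r(3)[of "k + N0"] by (simp add: less_imp_le)
  have 3: "AE x in M. (\<lambda>k. f n x - f (r (k + N0)) x) \<longlonglongrightarrow> f n x - g x"
   using lim by eventually_elim (intro tendsto_intros LIMSEQ_ignore_initial_segment)
  show ?thesis using L2_Fatou[OF 1 _ 3 2] by auto
 qed
 obtain N1 where N1: "\<forall>m\<ge>N1. \<forall>n\<ge>N1. l2n M (\<lambda>x. f m x - f n x) < 1" using cau[of 1] by auto
 have "L2 M (\<lambda>x. f N1 x - (f N1 x - g x))" by (rule L2_diff[OF L conjunct1[OF key[OF N1]]]) simp
 hence Lg: "L2 M g" by simp
 have "L2lim M f g"
 proof (rule LIMSEQ_I)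
  fix e :: real assume e: "e > 0"
  obtain N1 where N1: "\<forall>m\<ge>N1. \<forall>n\<ge>N1. l2n M (\<lambda>x. f m x - f n x) < e/2" using cau[of "e/2"] e by auto
  have "norm (l2n M (\<lambda>x. f n x - g x) - 0) < e" if "n \<ge> N1" for n
   using key[OF N1 that] e by simp
  thus "\<exists>no. \<forall>n\<ge>no. norm (l2n M (\<lambda>x. f n x - g x) - 0) < e" by blast
 qed
 thus thesis using that Lg by blast
qed

lemma L2_tendsto_inner:
 assumes "\<And>n. L2 M (f n)" "L2 M f'" "\<And>n. L2 M (g n)" "L2 M g'"
  and f: "L2lim M f f'" and g: "L2lim M g g'"
 shows "(\<lambda>n. \<integral>x. f n x \<bullet> g n x \<partial>M) \<longlonglongrightarrow> (\<integral>x. f' x \<bullet> g' x \<partial>M)"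
proof -
 have "\<bar>(\<integral>x. f n x \<bullet> g n x \<partial>M) - (\<integral>x. f' x \<bullet> g' x \<partial>M)\<bar> \<le>
   l2n M (\<lambda>x. f n x - f' x) * (l2n M g' + l2n M (\<lambda>x. g n x - g' x)) + l2n M f' * l2n M (\<lambda>x. g n x - g' x)" for n
 proof -
  have "(\<integral>x. f n x \<bullet> g n x \<partial>M) - (\<integral>x. f' x \<bullet> g' x \<partial>M) =
   (\<integral>x. (f n x - f' x) \<bullet> g n x \<partial>M) + (\<integral>x. f' x \<bullet> (g n x - g' x) \<partial>M)"
   using assms(1-4) by (simp add: inner_diff_left inner_diff_right L2_integrable_inner)
  also have "\<bar>\<dots>\<bar> \<le> l2n M (\<lambda>x. f n x - f' x) * l2n M (g n) + l2n M f' * l2n M (\<lambda>x. g n x - g' x)"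
   using L2_inner_le[OF L2_diff[OF assms(1,2)] assms(3), of n n] L2_inner_le[OF assms(2) L2_diff[OF assms(3,4)], of n]
   by linarith
  also have "\<dots> \<le> l2n M (\<lambda>x. f n x - f' x) * (l2n M g' + l2n M (\<lambda>x. g n x - g' x)) + l2n M f' * l2n M (\<lambda>x. g n x - g' x)"
   using l2n_le_add_diff[OF assms(3,4), of n] by (intro add_mono mult_left_mono) auto
  finally show ?thesis .
 qed
 moreover have "(\<lambda>n. l2n M (\<lambda>x. f n x - f' x) * (l2n M g' + l2n M (\<lambda>x. g n x - g' x)) + l2n M f' * l2n M (\<lambda>x. g n x - g' x)) \<longlonglongrightarrow> 0"
  using tendsto_add[OF tendsto_mult[OF f tendsto_add[OF tendsto_const[of "l2n M g'"] g]] tendsto_mult[OF tendsto_const[of "l2n M f'"] g]]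
  by simp
 ultimately have "(\<lambda>n. (\<integral>x. f n x \<bullet> g n x \<partial>M) - (\<integral>x. f' x \<bullet> g' x \<partial>M)) \<longlonglongrightarrow> 0"
  by (rule_tac Lim_null_comparison[OF always_eventually]) auto
 thus ?thesis by (rule LIM_zero_cancel)
qed

section \<open>Strong Sobolev closures of classes of smooth functions\<close>

definition approx :: "('a::euclidean_space \<Rightarrow> real) set \<Rightarrow> 'a measure \<Rightarrow> ('a \<Rightarrow> real) \<Rightarrow> ('a \<Rightarrow> 'a) \<Rightarrow> (nat \<Rightarrow> 'a \<Rightarrow> real) \<Rightarrow> bool" where
 "approx V M f G v \<longleftrightarrow> (\<forall>n. v n \<in> V \<and> L2 M (v n) \<and> L2 M (cgrad (v n))) \<and> L2 M f \<and> L2 M G \<and>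
   L2lim M v f \<and> L2lim M (\<lambda>n. cgrad (v n)) G"

text \<open>Closure in the H1 norm, with the gradient field carried along. Leaving the class
  \<open>V\<close> open lets one set of lemmas serve smooth functions, test functions, and smooth
  functions with nearly prescribed boundary values.\<close>

definition clos :: "('a::euclidean_space \<Rightarrow> real) set \<Rightarrow> 'a measure \<Rightarrow> ('a \<Rightarrow> real) \<Rightarrow> ('a \<Rightarrow> 'a) \<Rightarrow> bool" where
 "clos V M f G \<longleftrightarrow> (\<exists>v. approx V M f G v)"

lemma approxD:
 assumes "approx V M f G v"
 shows "v n \<in> V" "L2 M (v n)" "L2 M (cgrad (v n))" "L2 M f" "L2 M G" "L2lim M v f" "L2lim M (\<lambda>n. cgrad (v n)) G"
 using assms by (auto simp: approx_def)

lemma closE: assumes "clos V M f G" obtains v where "approx V M f G v"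
 using assms unfolding clos_def by (elim exE)

lemma closI:
 assumes "\<And>n. v n \<in> V" "\<And>n. L2 M (v n)" "\<And>n. L2 M (cgrad (v n))" "L2 M f" "L2 M G"
  "L2lim M v f" "L2lim M (\<lambda>n. cgrad (v n)) G"
 shows "clos V M f G"
 unfolding clos_def approx_def by (intro exI[of _ v] conjI allI assms)

lemma clos_L2: "clos V M f G \<Longrightarrow> L2 M f" "clos V M f G \<Longrightarrow> L2 M G" by (auto simp: clos_def approx_def)

lemma clos_self: "v \<in> V \<Longrightarrow> L2 M v \<Longrightarrow> L2 M (cgrad v) \<Longrightarrow> clos V M v (cgrad v)"
 by (rule closI[where v="\<lambda>_. v"]) (auto simp: l2n_def)

lemma clos_near:
 assumes "clos V M f G" and e: "e > 0"
 shows "\<exists>v. v \<in> V \<and> L2 M v \<and> L2 M (cgrad v) \<and> l2n M (\<lambda>x. v x - f x) < e \<and> l2n M (\<lambda>x. cgrad v x - G x) < e"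
proof -
 obtain v where "approx V M f G v" by (rule closE[OF assms(1)]) (rule that)
 note v = approxD[OF this]
 from eventually_happens'[OF sequentially_bot eventually_conj[OF order_tendstoD(2)[OF v(6) e] order_tendstoD(2)[OF v(7) e]]]
 show ?thesis using v(1-3) by (elim exE) (intro exI, auto)
qed

lemma clos_limit:
 assumes C: "\<And>n::nat. clos V M (f n) (G n)" and L: "L2 M f'" "L2 M G'"
  and lim: "L2lim M f f'" "L2lim M G G'"
 shows "clos V M f' G'"
proof -
 let ?e = "\<lambda>n. inverse (real (Suc n))"
 have "\<forall>n. \<exists>v. v \<in> V \<and> L2 M v \<and> L2 M (cgrad v) \<and> l2n M (\<lambda>x. v x - f n x) < ?e n \<and> l2n M (\<lambda>x. cgrad v x - G n x) < ?e n"
  by (intro allI clos_near[OF C]) simp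
 from choice[OF this] obtain v where v': "\<forall>n. v n \<in> V \<and> L2 M (v n) \<and> L2 M (cgrad (v n)) \<and>
   l2n M (\<lambda>x. v n x - f n x) < ?e n \<and> l2n M (\<lambda>x. cgrad (v n) x - G n x) < ?e n" by (elim exE)
 have v: "v n \<in> V" "L2 M (v n)" "L2 M (cgrad (v n))" "l2n M (\<lambda>x. v n x - f n x) < ?e n"
  "l2n M (\<lambda>x. cgrad (v n) x - G n x) < ?e n" for n using v' by simp_all
 have Lf: "L2 M (f n)" "L2 M (G n)" for n using clos_L2[OF C] by auto
 have 1: "l2n M (\<lambda>x. v n x - f' x) \<le> ?e n + l2n M (\<lambda>x. f n x - f' x)" for n
  using l2n_diff_triangle[OF v(2)[of n] Lf(1)[of n] L(1)] v(4)[of n] by linarith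
 have 2: "l2n M (\<lambda>x. cgrad (v n) x - G' x) \<le> ?e n + l2n M (\<lambda>x. G n x - G' x)" for n
  using l2n_diff_triangle[OF v(3)[of n] Lf(2)[of n] L(2)] v(5)[of n] by linarith
 show ?thesis
  by (rule closI[where v=v, OF v(1-3) L];
      rule Lim_null_comparison[OF always_eventually tendsto_add_zero[OF LIMSEQ_inverse_real_of_nat lim(1)]]
           Lim_null_comparison[OF always_eventually tendsto_add_zero[OF LIMSEQ_inverse_real_of_nat lim(2)]]) (use 1 2 in auto)
qed

lemma clos_cong_AE:
 assumes "clos V M f G" "f' \<in> borel_measurable M" "G' \<in> borel_measurable M"
  "AE x in M. f x = f' x" "AE x in M. G x = G' x"
 shows "clos V M f' G'"
proof (rule clos_limit[of V M "\<lambda>_. f" "\<lambda>_. G"])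
 note L = clos_L2[OF assms(1)]
 show "L2 M f'" "L2 M G'"
  by (rule L2_cong_AE[OF L(1) assms(2)], use assms in auto)
    (rule L2_cong_AE[OF L(2) assms(3)], use assms in auto)
 have [measurable]: "f \<in> borel_measurable M" "G \<in> borel_measurable M" using L by (auto simp: L2_def)
 note [measurable] = assms(2,3)
 have "l2n M (\<lambda>x. f x - f' x) = l2n M (\<lambda>x. 0 :: real)"
  by (rule l2n_cong_AE) (use assms(4) in auto)
 moreover have "l2n M (\<lambda>x. G x - G' x) = l2n M (\<lambda>x. 0 :: real)"
  by (rule l2n_cong_AE) (use assms(5) in auto)
 ultimately show "L2lim M (\<lambda>n. f) f'" "L2lim M (\<lambda>n. G) G'"
  by (auto simp: l2n_def)
qed (rule assms(1))

lemma clos_mono: "clos V M f G \<Longrightarrow> V \<subseteq> W \<Longrightarrow> clos W M f G"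
 unfolding clos_def approx_def by blast

text \<open>Three independent classes are allowed because the sum of a function with boundary values
  near \<open>\<phi>\<close> and a test function is again of the first kind.\<close>

lemma clos_add:
 assumes f: "clos V M f G" and g: "clos W M g H"
  and S: "\<And>v. v \<in> V \<Longrightarrow> smooth_fun v" "\<And>w. w \<in> W \<Longrightarrow> smooth_fun w"
  and sub: "\<And>v w. v \<in> V \<Longrightarrow> w \<in> W \<Longrightarrow> (\<lambda>x. v x + w x) \<in> X"
 shows "clos X M (\<lambda>x. f x + g x) (\<lambda>x. G x + H x)"
proof -
 obtain v where "approx V M f G v" by (rule closE[OF f]) (rule that)
 note v = approxD[OF this]
 obtain w where "approx W M g H w" by (rule closE[OF g]) (rule that)
 note w = approxD[OF this]
 have cg: "cgrad (\<lambda>x. v n x + w n x) = (\<lambda>x. cgrad (v n) x + cgrad (w n) x)" for n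
  using cgrad_add[OF S(1)[OF v(1)] S(2)[OF w(1)]] by blast
 have "l2n M (\<lambda>x. v n x + w n x - (f x + g x)) \<le> l2n M (\<lambda>x. v n x - f x) + l2n M (\<lambda>x. w n x - g x)" for n
  using l2n_triangle[OF L2_diff[OF v(2,4)] L2_diff[OF w(2,4)], of n n] by (simp add: algebra_simps)
 moreover have "l2n M (\<lambda>x. cgrad (\<lambda>x. v n x + w n x) x - (G x + H x)) \<le> l2n M (\<lambda>x. cgrad (v n) x - G x) + l2n M (\<lambda>x. cgrad (w n) x - H x)" for n
  unfolding cg using l2n_triangle[OF L2_diff[OF v(3,5)] L2_diff[OF w(3,5)], of n n] by (simp add: algebra_simps)
 ultimately show ?thesis
  by (intro closI[where v="\<lambda>n x. v n x + w n x"] sub v(1-5) w(1-5) L2_add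
    Lim_null_comparison[OF always_eventually tendsto_add_zero[OF v(6) w(6)]]
    Lim_null_comparison[OF always_eventually tendsto_add_zero[OF v(7) w(7)]])
   (auto simp: cg intro!: L2_add v w)
qed

lemma clos_mult:
 assumes f: "clos V M f G" and S: "\<And>v. v \<in> V \<Longrightarrow> smooth_fun v"
  and e: "smooth_fun e" "\<And>x. x \<in> space M \<Longrightarrow> \<bar>e x\<bar> \<le> B" "\<And>x. x \<in> space M \<Longrightarrow> norm (cgrad e x) \<le> B"
   "e \<in> borel_measurable M" "cgrad e \<in> borel_measurable M"
  and sub: "\<And>v. v \<in> V \<Longrightarrow> (\<lambda>x. e x * v x) \<in> X"
 shows "clos X M (\<lambda>x. e x * f x) (\<lambda>x. e x *\<^sub>R G x + f x *\<^sub>R cgrad e x)"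
proof -
 note [measurable] = e(4,5)
 obtain v where "approx V M f G v" by (rule closE[OF f]) (rule that)
 note v = approxD[OF this]
 have a: "L2 M (\<lambda>x. e x *\<^sub>R h x) \<and> l2n M (\<lambda>x. e x *\<^sub>R h x) \<le> \<bar>B\<bar> * l2n M h" if "L2 M h" for h :: "'a \<Rightarrow> 'b::euclidean_space"
 proof -
  have [measurable]: "h \<in> borel_measurable M" using that by (simp add: L2_def)
  have *: "AE x in M. norm (e x *\<^sub>R h x) \<le> norm (B *\<^sub>R h x)"
   by (rule AE_I2) (use e(2) in \<open>force intro!: mult_right_mono\<close>)
  show ?thesis using L2_bound[OF _ L2_scaleR[OF that, of B] *] by (simp add: l2n_scaleR)
 qed
 have b: "L2 M (\<lambda>x. h x *\<^sub>R cgrad e x) \<and> l2n M (\<lambda>x. h x *\<^sub>R cgrad e x) \<le> \<bar>B\<bar> * l2n M h" if "L2 M h" for h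
 proof -
  have [measurable]: "h \<in> borel_measurable M" using that by (simp add: L2_def)
  have *: "AE x in M. norm (h x *\<^sub>R cgrad e x) \<le> norm (B *\<^sub>R h x)"
  proof (rule AE_I2)
   fix x assume "x \<in> space M"
   hence "norm (cgrad e x) \<le> \<bar>B\<bar>" using e(3)[of x] by linarith
   thus "norm (h x *\<^sub>R cgrad e x) \<le> norm (B *\<^sub>R h x)"
    using mult_left_mono[of "norm (cgrad e x)" "\<bar>B\<bar>" "\<bar>h x\<bar>"] by (simp add: abs_mult mult.commute)
  qed
  show ?thesis using L2_bound[OF _ L2_scaleR[OF that, of B] *] l2n_scaleR[of M B h] by simp
 qed
 have cg: "cgrad (\<lambda>x. e x * v n x) = (\<lambda>x. e x *\<^sub>R cgrad (v n) x + v n x *\<^sub>R cgrad e x)" for n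
  using cgrad_mult[OF e(1) S[OF v(1)]] by blast
 have L1: "L2 M (\<lambda>x. e x * v n x)" "L2 M (\<lambda>x. e x * f x)" for n using a[OF v(2)] a[OF v(4)] by auto
 have L3: "L2 M (cgrad (\<lambda>x. e x * v n x))" "L2 M (\<lambda>x. e x *\<^sub>R G x + f x *\<^sub>R cgrad e x)" for n
  unfolding cg using a b v(2-5) by (auto intro!: L2_add)
 have "l2n M (\<lambda>x. e x * v n x - e x * f x) \<le> \<bar>B\<bar> * l2n M (\<lambda>x. v n x - f x)" for n
  using a[OF L2_diff[OF v(2,4)], of n] by (simp add: right_diff_distrib)
 moreover have "l2n M (\<lambda>x. cgrad (\<lambda>x. e x * v n x) x - (e x *\<^sub>R G x + f x *\<^sub>R cgrad e x))
   \<le> \<bar>B\<bar> * l2n M (\<lambda>x. cgrad (v n) x - G x) + \<bar>B\<bar> * l2n M (\<lambda>x. v n x - f x)" for n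
 proof -
  have "l2n M (\<lambda>x. e x *\<^sub>R (cgrad (v n) x - G x) + (v n x - f x) *\<^sub>R cgrad e x) \<le>
   l2n M (\<lambda>x. e x *\<^sub>R (cgrad (v n) x - G x)) + l2n M (\<lambda>x. (v n x - f x) *\<^sub>R cgrad e x)"
   by (rule l2n_triangle) (use a[OF L2_diff[OF v(3,5)]] b[OF L2_diff[OF v(2,4)]] in auto)
  also have "\<dots> \<le> \<bar>B\<bar> * l2n M (\<lambda>x. cgrad (v n) x - G x) + \<bar>B\<bar> * l2n M (\<lambda>x. v n x - f x)"
   using a[OF L2_diff[OF v(3,5)], of n] b[OF L2_diff[OF v(2,4)], of n] by linarith
  finally show ?thesis unfolding cg by (simp add: algebra_simps)
 qed
 ultimately show ?thesis
  by (intro closI[where v="\<lambda>n x. e x * v n x"] sub v(1) L1 L3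
    Lim_null_comparison[OF always_eventually tendsto_mult_right_zero[OF v(6), of "\<bar>B\<bar>"]]
    Lim_null_comparison[OF always_eventually tendsto_add_zero[OF tendsto_mult_right_zero[OF v(7), of "\<bar>B\<bar>"] tendsto_mult_right_zero[OF v(6), of "\<bar>B\<bar>"]]])
   auto
qed

text \<open>The chain rule multiplies the gradients by \<open>sstep (v n x / d)\<close>. Along a
  subsequence converging almost everywhere these factors converge, and dominated convergence with
  the fixed majorant \<open>G\<close> handles the error they cause.\<close>

lemma clos_ppos:
 assumes f: "clos W M f G" and S: "\<And>w. w \<in> W \<Longrightarrow> smooth_fun w" and d: "d > 0"
  and sub: "\<And>w. w \<in> W \<Longrightarrow> (\<lambda>x. ppos d (w x)) \<in> V"
 shows "clos V M (\<lambda>x. ppos d (f x)) (\<lambda>x. sstep (f x / d) *\<^sub>R G x)"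
proof -
 obtain v0 where "approx W M f G v0" by (rule closE[OF f]) (rule that)
 note v0 = approxD[OF this]
 obtain r where r: "strict_mono r" "AE x in M. (\<lambda>n. v0 (r n) x - f x) \<longlonglongrightarrow> 0"
  using L2_subseq[OF L2_diff[OF v0(2,4)] v0(6)] by blast
 define v where "v n = v0 (r n)" for n
 have v: "\<And>n. v n \<in> W" "\<And>n. L2 M (v n)" "\<And>n. L2 M (cgrad (v n))"
  "L2lim M v f" "L2lim M (\<lambda>n. cgrad (v n)) G"
  "AE x in M. (\<lambda>n. v n x - f x) \<longlonglongrightarrow> 0"
  using v0(1-3) r LIMSEQ_subseq_LIMSEQ[OF v0(6) r(1)] LIMSEQ_subseq_LIMSEQ[OF v0(7) r(1)]
  by (auto simp: v_def o_def)
 have [measurable]: "f \<in> borel_measurable M" "G \<in> borel_measurable M" "v n \<in> borel_measurable M"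
  "cgrad (v n) \<in> borel_measurable M" for n using v v0 by (auto simp: L2_def)
 have [measurable]: "ppos d \<in> borel_measurable borel" "sstep \<in> borel_measurable borel"
  by (intro borel_measurable_continuous_onI smooth1_continuous ppos_smooth sstep d)+
 have cg: "cgrad (\<lambda>x. ppos d (v n x)) = (\<lambda>x. sstep (v n x / d) *\<^sub>R cgrad (v n) x)" for n
  using cgrad_comp[OF S[OF v(1)] ppos_deriv[OF d]] by blast
 have B1: "L2 M (\<lambda>x. ppos d (h x))" if [measurable]: "L2 M h" for h
  by (rule L2_bound(1)[OF _ that]) (use ppos_lipschitz[OF d, of _ 0] ppos_zero[OF d] in \<open>auto simp: L2_measurable\<close>)
 have B2: "L2 M (\<lambda>x. sstep (h x / d) *\<^sub>R H x)" if [measurable]: "h \<in> borel_measurable M" and H: "L2 M H" for h and H :: "'a \<Rightarrow> 'a"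
 proof -
  have [measurable]: "H \<in> borel_measurable M" using H by (simp add: L2_def)
  show ?thesis by (rule L2_bound(1)[OF _ H]) (auto simp: sstep mult_left_le_one_le)
 qed
 have 1: "l2n M (\<lambda>x. ppos d (v n x) - ppos d (f x)) \<le> l2n M (\<lambda>x. v n x - f x)" for n
  by (rule L2_bound(2)[OF _ L2_diff[OF v(2) v0(4)]]) (auto simp: ppos_lipschitz[OF d])
 have 2: "l2n M (\<lambda>x. sstep (v n x / d) *\<^sub>R cgrad (v n) x - sstep (f x / d) *\<^sub>R G x) \<le>
   l2n M (\<lambda>x. cgrad (v n) x - G x) + l2n M (\<lambda>x. (sstep (v n x / d) - sstep (f x / d)) *\<^sub>R G x)" for n
 proof -
  have La: "L2 M (\<lambda>x. sstep (v n x / d) *\<^sub>R (cgrad (v n) x - G x))" by (intro B2 L2_diff v v0) measurable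
  have Lb: "L2 M (\<lambda>x. (sstep (v n x / d) - sstep (f x / d)) *\<^sub>R G x)"
   unfolding scaleR_left_diff_distrib by (intro L2_diff B2 v0) measurable
  have "l2n M (\<lambda>x. sstep (v n x / d) *\<^sub>R (cgrad (v n) x - G x)) \<le> l2n M (\<lambda>x. cgrad (v n) x - G x)"
   by (rule L2_bound(2)[OF _ L2_diff[OF v(3) v0(5)]]) (auto simp: sstep mult_left_le_one_le)
  moreover have "(\<lambda>x. sstep (v n x / d) *\<^sub>R cgrad (v n) x - sstep (f x / d) *\<^sub>R G x) =
   (\<lambda>x. sstep (v n x / d) *\<^sub>R (cgrad (v n) x - G x) + (sstep (v n x / d) - sstep (f x / d)) *\<^sub>R G x)"
   by (simp add: algebra_simps)
  ultimately show ?thesis using l2n_triangle[OF La Lb] by simp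
 qed
 have 3: "(\<lambda>n. l2n M (\<lambda>x. (sstep (v n x / d) - sstep (f x / d)) *\<^sub>R G x)) \<longlonglongrightarrow> 0"
 proof (rule L2_dominated[OF _ v0(5)])
  show "AE x in M. norm ((sstep (v n x / d) - sstep (f x / d)) *\<^sub>R G x) \<le> norm (G x)" for n
  proof (rule AE_I2)
   fix x
   have "\<bar>sstep (v n x / d) - sstep (f x / d)\<bar> \<le> 1"
    using sstep(2,3)[of "v n x / d"] sstep(2,3)[of "f x / d"] by linarith
   thus "norm ((sstep (v n x / d) - sstep (f x / d)) *\<^sub>R G x) \<le> norm (G x)" by (simp add: mult_left_le_one_le)
  qed
  show "AE x in M. (\<lambda>n. (sstep (v n x / d) - sstep (f x / d)) *\<^sub>R G x) \<longlonglongrightarrow> 0"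
   using v(6)
  proof eventually_elim
   case (elim x)
   hence "(\<lambda>n. v n x) \<longlonglongrightarrow> f x" by (rule LIM_zero_cancel)
   hence "(\<lambda>n. v n x / d) \<longlonglongrightarrow> f x / d" using d by (intro tendsto_intros) auto
   moreover have "isCont sstep (f x / d)"
    using smooth1_continuous[OF sstep(1), of UNIV] continuous_on_eq_continuous_at by blast
   ultimately have "(\<lambda>n. sstep (v n x / d)) \<longlonglongrightarrow> sstep (f x / d)" using isCont_tendsto_compose by blast
   hence "(\<lambda>n. (sstep (v n x / d) - sstep (f x / d)) *\<^sub>R G x) \<longlonglongrightarrow> (sstep (f x / d) - sstep (f x / d)) *\<^sub>R G x"
    by (intro tendsto_intros)
   thus ?case by simp
  qed
 qed measurable
 show ?thesis
  by (intro closI[where v="\<lambda>n x. ppos d (v n x)"] sub v(1) B1 v(2) v0(4) B2 v0(5)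
    Lim_null_comparison[OF always_eventually v(4)]
    Lim_null_comparison[OF always_eventually tendsto_add_zero[OF v(5) 3]])
   (auto simp: cg 1 2 intro!: B2 v)
qed

text \<open>Let the smoothing scale tend to 0. On \<open>f x \<le> 0\<close> the approximating
  gradients vanish identically, so the limit is 0 on the zero set of \<open>f\<close> without prior
  knowledge of \<open>G\<close> there. The cap \<open>d'\<close> matters for boundary values, where
  smoothing is harmless only at small scales.\<close>

lemma clos_pos_upto:
 assumes f: "clos W M f G" and S: "\<And>w. w \<in> W \<Longrightarrow> smooth_fun w" and d': "d' > 0"
  and sub: "\<And>w d. w \<in> W \<Longrightarrow> d > 0 \<Longrightarrow> d \<le> d' \<Longrightarrow> (\<lambda>x. ppos d (w x)) \<in> V"
 shows "clos V M (\<lambda>x. max (f x) 0) (\<lambda>x. if f x > 0 then G x else 0)"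
proof -
 define d where "d n = d' * inverse (real (Suc n))" for n
 have d: "d n > 0" "d n \<le> d'" for n using d' by (auto simp: d_def field_simps)
 have d0: "d \<longlonglongrightarrow> 0" unfolding d_def using tendsto_mult_right_zero[OF LIMSEQ_inverse_real_of_nat] .
 have L: "L2 M f" "L2 M G" using clos_L2[OF f] by auto
 have [measurable]: "f \<in> borel_measurable M" "G \<in> borel_measurable M" using L by (auto simp: L2_def)
 have [measurable]: "ppos (d n) \<in> borel_measurable borel" "sstep \<in> borel_measurable borel" for n
  by (intro borel_measurable_continuous_onI smooth1_continuous ppos_smooth sstep d(1))+
 show ?thesis
 proof (rule clos_limit[OF clos_ppos[OF f S d(1) sub[OF _ d]]])
  show "L2 M (\<lambda>x. max (f x) 0)" by (rule L2_bound(1)[OF _ L(1)]) auto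
  show "L2 M (\<lambda>x. if f x > 0 then G x else 0)" by (rule L2_bound(1)[OF _ L(2)]) auto
  show "L2lim M (\<lambda>n x. ppos (d n) (f x)) (\<lambda>x. max (f x) 0)"
  proof (rule L2_dominated[OF _ L(1)])
   have *: "\<bar>ppos (d n) t - max t 0\<bar> \<le> \<bar>t\<bar>" "\<bar>ppos (d n) t - max t 0\<bar> \<le> d n" for n t
    using ppos_le[OF d(1), of n t] ppos_ge[OF d(1), of t n] ppos_nonneg[OF d(1), of n t] by (auto simp: max_def split: if_splits)
   show "AE x in M. norm (ppos (d n) (f x) - max (f x) 0) \<le> norm (f x)" for n using * by auto
   show "AE x in M. (\<lambda>n. ppos (d n) (f x) - max (f x) 0) \<longlonglongrightarrow> 0"
    by (rule AE_I2, rule Lim_null_comparison[OF always_eventually d0]) (use * in auto)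
  qed measurable
  show "L2lim M (\<lambda>n x. sstep (f x / d n) *\<^sub>R G x) (\<lambda>x. (if f x > 0 then G x else 0))"
  proof (rule L2_dominated[OF _ L(2)])
   show "AE x in M. norm (sstep (f x / d n) *\<^sub>R G x - (if f x > 0 then G x else 0)) \<le> norm (G x)" for n
   proof (rule AE_I2)
    fix x
    have "sstep (f x / d n) *\<^sub>R G x - G x = (sstep (f x / d n) - 1) *\<^sub>R G x" by (simp add: algebra_simps)
    moreover have "\<bar>sstep (f x / d n) - 1\<bar> \<le> 1" using sstep(2,3)[of "f x / d n"] by linarith
    moreover have "f x \<le> 0 \<Longrightarrow> sstep (f x / d n) = 0" using d(1)[of n] by (intro sstep) (auto simp: divide_le_0_iff)
    ultimately show "norm (sstep (f x / d n) *\<^sub>R G x - (if f x > 0 then G x else 0)) \<le> norm (G x)"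
     by (auto simp: mult_left_le_one_le)
   qed
   show "AE x in M. (\<lambda>n. sstep (f x / d n) *\<^sub>R G x - (if f x > 0 then G x else 0)) \<longlonglongrightarrow> 0"
   proof (rule AE_I2)
    fix x
    show "(\<lambda>n. sstep (f x / d n) *\<^sub>R G x - (if f x > 0 then G x else 0)) \<longlonglongrightarrow> 0"
    proof (cases "f x > 0")
     case True
     have "\<forall>\<^sub>F n in sequentially. d n < f x" using order_tendstoD(2)[OF d0] True by auto
     hence "\<forall>\<^sub>F n in sequentially. 0 = sstep (f x / d n) *\<^sub>R G x - (if f x > 0 then G x else 0)"
     proof eventually_elim
      case (elim n)
      hence "sstep (f x / d n) = 1" using d(1)[of n] by (intro sstep) auto
      thus ?case using True by simp
     qed
     thus ?thesis by (rule Lim_transform_eventually[OF tendsto_const])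
    next
     case False
     hence "sstep (f x / d n) = 0" for n using d(1)[of n] by (intro sstep) (auto simp: divide_le_0_iff)
     thus ?thesis using False by simp
    qed
   qed
  qed measurable
 qed
qed

lemma clos_pos:
 assumes "clos W M f G" "\<And>w. w \<in> W \<Longrightarrow> smooth_fun w"
  and "\<And>w d. w \<in> W \<Longrightarrow> d > 0 \<Longrightarrow> (\<lambda>x. ppos d (w x)) \<in> V"
 shows "clos V M (\<lambda>x. max (f x) 0) (\<lambda>x. if f x > 0 then G x else 0)"
 by (rule clos_pos_upto[OF assms(1,2) zero_less_one assms(3)])

text \<open>The approximants are smooth on the whole space, so membership passes to smaller sets by
  mere restriction, and every function that has a trace in the sense of \<open>has_trace\<close>
  belongs to it.\<close>

definition SH :: "'a::euclidean_space set \<Rightarrow> ('a \<Rightarrow> real) \<Rightarrow> ('a \<Rightarrow> 'a) \<Rightarrow> bool" where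
 "SH U f G \<longleftrightarrow> clos {v. smooth_fun v} (Leb U) f G"

definition H10 :: "'a::euclidean_space set \<Rightarrow> ('a \<Rightarrow> real) \<Rightarrow> ('a \<Rightarrow> 'a) \<Rightarrow> bool" where
 "H10 U f G \<longleftrightarrow> clos {v. test_fun U v} (Leb U) f G"

lemma SH_L2: "SH U f G \<Longrightarrow> L2 (Leb U) f" "SH U f G \<Longrightarrow> L2 (Leb U) G"
 unfolding SH_def by (erule clos_L2)+
lemma H10_L2: "H10 U f G \<Longrightarrow> L2 (Leb U) f" "H10 U f G \<Longrightarrow> L2 (Leb U) G"
 unfolding H10_def by (erule clos_L2)+
lemma SH_meas: "SH U f G \<Longrightarrow> f \<in> borel_measurable (Leb U)" "SH U f G \<Longrightarrow> G \<in> borel_measurable (Leb U)"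
 using SH_L2[of U f G] by (auto simp: L2_def)
lemma H10_meas: "H10 U f G \<Longrightarrow> f \<in> borel_measurable (Leb U)" "H10 U f G \<Longrightarrow> G \<in> borel_measurable (Leb U)"
 using H10_L2[of U f G] by (auto simp: L2_def)

lemma H10_SH: "H10 U f G \<Longrightarrow> SH U f G"
 unfolding H10_def SH_def by (erule clos_mono) (auto simp: test_fun_smooth)

lemma continuous_measurable_lebesgue_on:
 fixes f :: "'a::euclidean_space \<Rightarrow> 'b::euclidean_space"
 assumes "continuous_on U f" "open U" shows "f \<in> borel_measurable (Leb U)"
 using assms by (intro continuous_imp_measurable_on_sets_lebesgue) auto

lemma finite_measure_bounded_open:
 "open U \<Longrightarrow> bounded U \<Longrightarrow> finite_measure (Leb (U::'a::euclidean_space set))"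
 by (intro finite_measure_lebesgue_on bounded_set_imp_lmeasurable) auto

lemma L2_boundedI:
 fixes f :: "'a::euclidean_space \<Rightarrow> 'b::euclidean_space"
 assumes "open U" "bounded U" "f \<in> borel_measurable (Leb U)" "AE x in Leb U. norm (f x) \<le> B"
 shows "L2 (Leb U) f"
 unfolding L2_def
proof
 interpret finite_measure "Leb U" by (rule finite_measure_bounded_open[OF assms(1,2)])
 note [measurable] = assms(3)
 show "integrable (Leb U) (\<lambda>x. (norm (f x))\<^sup>2)"
 proof (rule integrable_const_bound)
  show "AE x in Leb U. norm ((norm (f x))\<^sup>2) \<le> B\<^sup>2"
   using assms(4) by eventually_elim (auto intro: power_mono)
 qed measurable
qed (rule assms(3))

lemma smooth_meas:
 assumes "smooth_fun v" "open U"
 shows "v \<in> borel_measurable (Leb U)" "cgrad v \<in> borel_measurable (Leb U)"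
 using assms by (auto intro!: continuous_measurable_lebesgue_on smooth_fun_continuous smooth_cgrad_continuous)

lemma smooth_L2:
 assumes "smooth_fun v" "open U" "bounded U"
 shows "L2 (Leb U) v" "L2 (Leb U) (cgrad v)"
proof -
 obtain B where "\<And>x. x \<in> U \<Longrightarrow> \<bar>v x\<bar> \<le> B" "\<And>x. x \<in> U \<Longrightarrow> norm (cgrad v x) \<le> B"
  using smooth_bounded_on[OF assms(1,3)] by metis
 thus "L2 (Leb U) v" "L2 (Leb U) (cgrad v)"
  by (intro L2_boundedI[where B=B] smooth_meas assms; auto)+
qed

lemma SH_smooth: "smooth_fun v \<Longrightarrow> open U \<Longrightarrow> bounded U \<Longrightarrow> SH U v (cgrad v)"
 unfolding SH_def by (intro clos_self smooth_L2) auto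

lemma H10_test: "test_fun U v \<Longrightarrow> open U \<Longrightarrow> bounded U \<Longrightarrow> H10 U v (cgrad v)"
 unfolding H10_def by (intro clos_self smooth_L2) (auto simp: test_fun_smooth)

lemma SH_const: assumes "open U" "bounded U" shows "SH U (\<lambda>x. c) (\<lambda>x. 0)"
 using SH_smooth[OF smooth_fun_const assms, of c] by (simp add: cgrad_const[abs_def])

lemma SH_add: "SH U f G \<Longrightarrow> SH U g H \<Longrightarrow> SH U (\<lambda>x. f x + g x) (\<lambda>x. G x + H x)"
 unfolding SH_def by (erule clos_add, assumption) (auto intro: smooth_fun_add)
lemma H10_add: "H10 U f G \<Longrightarrow> H10 U g H \<Longrightarrow> H10 U (\<lambda>x. f x + g x) (\<lambda>x. G x + H x)"
 unfolding H10_def by (erule clos_add, assumption) (auto intro: test_fun_add test_fun_smooth)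

lemma H10_test_mult:
 assumes "SH U f G" "test_fun U e" "open U" "bounded U"
 shows "H10 U (\<lambda>x. e x * f x) (\<lambda>x. e x *\<^sub>R G x + f x *\<^sub>R cgrad e x)"
proof -
 have e: "smooth_fun e" using assms test_fun_smooth by blast
 obtain B where "\<And>x. x \<in> U \<Longrightarrow> \<bar>e x\<bar> \<le> B" "\<And>x. x \<in> U \<Longrightarrow> norm (cgrad e x) \<le> B"
  using smooth_bounded_on[OF e assms(4)] by metis
 moreover have "test_fun U (\<lambda>x. e x * v x)" if "smooth_fun v" for v
  using test_fun_mult[OF assms(2) that] by (simp add: mult.commute)
 ultimately show ?thesis using assms e unfolding SH_def H10_def
  by (intro clos_mult[where B=B and V="{v. smooth_fun v}"] smooth_meas) auto
qed

lemma SH_cmult: assumes "SH U f G" shows "SH U (\<lambda>x. c * f x) (\<lambda>x. c *\<^sub>R G x)"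
 using clos_mult[OF assms[unfolded SH_def], of "\<lambda>_. c" "\<bar>c\<bar>" "{v. smooth_fun v}"]
 unfolding SH_def by (simp add: cgrad_const[abs_def] smooth_fun_const smooth_fun_cmult)
lemma H10_cmult: assumes "H10 U f G" shows "H10 U (\<lambda>x. c * f x) (\<lambda>x. c *\<^sub>R G x)"
 using clos_mult[OF assms[unfolded H10_def], of "\<lambda>_. c" "\<bar>c\<bar>" "{v. test_fun U v}"]
 unfolding H10_def by (simp add: cgrad_const[abs_def] smooth_fun_const test_fun_cmult test_fun_smooth)

lemma SH_minus: "SH U f G \<Longrightarrow> SH U (\<lambda>x. - f x) (\<lambda>x. - G x)"
 using SH_cmult[of U f G "-1"] by simp
lemma H10_minus: "H10 U f G \<Longrightarrow> H10 U (\<lambda>x. - f x) (\<lambda>x. - G x)"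
 using H10_cmult[of U f G "-1"] by simp
lemma SH_diff: "SH U f G \<Longrightarrow> SH U g H \<Longrightarrow> SH U (\<lambda>x. f x - g x) (\<lambda>x. G x - H x)"
 using SH_add[OF _ SH_minus, of U f G g H] by simp
lemma H10_diff: "H10 U f G \<Longrightarrow> H10 U g H \<Longrightarrow> H10 U (\<lambda>x. f x - g x) (\<lambda>x. G x - H x)"
 using H10_add[OF _ H10_minus, of U f G g H] by simp

lemma SH_cong_AE:
 "SH U f G \<Longrightarrow> f' \<in> borel_measurable (Leb U) \<Longrightarrow> G' \<in> borel_measurable (Leb U) \<Longrightarrow>
  AE x in Leb U. f x = f' x \<Longrightarrow> AE x in Leb U. G x = G' x \<Longrightarrow> SH U f' G'"
 unfolding SH_def by (rule clos_cong_AE)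
lemma H10_cong_AE:
 "H10 U f G \<Longrightarrow> f' \<in> borel_measurable (Leb U) \<Longrightarrow> G' \<in> borel_measurable (Leb U) \<Longrightarrow>
  AE x in Leb U. f x = f' x \<Longrightarrow> AE x in Leb U. G x = G' x \<Longrightarrow> H10 U f' G'"
 unfolding H10_def by (rule clos_cong_AE)

lemma SH_pos:
 assumes "SH U f G" shows "SH U (\<lambda>x. max (f x) 0) (\<lambda>x. if f x > 0 then G x else 0)"
 using assms unfolding SH_def
 by (rule clos_pos) (auto intro: smooth_fun_comp[OF ppos_smooth])

text \<open>The positive part of \<open>f\<close> is approximated by nonnegative smooth
  \<open>s\<close>. If \<open>t\<close> is a test function, then \<open>t - s \<le> 0\<close>
  wherever \<open>t\<close> vanishes, so \<open>ppos d\<close> of it has its support in that of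
  \<open>t\<close>. All truncations with zero boundary values are obtained from this lemma.\<close>

lemma H10_pos_diff:
 fixes p f :: "'a::euclidean_space \<Rightarrow> real"
 assumes p: "H10 U p P" and f: "SH U f F"
 shows "H10 U (\<lambda>x. max (p x - max (f x) 0) 0)
  (\<lambda>x. if p x - max (f x) 0 > 0 then P x - (if f x > 0 then F x else 0) else 0)"
proof -
 define S :: "('a \<Rightarrow> real) set" where "S = {v. \<exists>s. v = (\<lambda>x. - s x) \<and> smooth_fun s \<and> (\<forall>x. 0 \<le> s x)}"
 define W :: "('a \<Rightarrow> real) set" where "W = {v. \<exists>s t. v = (\<lambda>x. t x + s x) \<and> s \<in> S \<and> test_fun U t}"
 have sm: "smooth_fun v" if "v \<in> S" for v
  using that smooth_fun_cmult[where c="-1"] by (auto simp: S_def)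
 have "clos {v. smooth_fun v \<and> (\<forall>x. 0 \<le> v x)} (Leb U) (\<lambda>x. max (f x) 0) (\<lambda>x. if f x > 0 then F x else 0)"
  using f unfolding SH_def by (rule clos_pos) (auto intro: smooth_fun_comp[OF ppos_smooth] ppos_nonneg)
 hence "clos S (Leb U) (\<lambda>x. (-1) * max (f x) 0) (\<lambda>x. (-1) *\<^sub>R (if f x > 0 then F x else 0) + max (f x) 0 *\<^sub>R cgrad (\<lambda>x. -1) x)"
  by (rule clos_mult[where B=1]) (auto simp: cgrad_const cgrad_const[abs_def] S_def smooth_fun_const)
 hence "clos S (Leb U) (\<lambda>x. - max (f x) 0) (\<lambda>x. - (if f x > 0 then F x else 0))"
  by (simp add: cgrad_const)
 with p have "clos W (Leb U) (\<lambda>x. p x + - max (f x) 0) (\<lambda>x. P x + - (if f x > 0 then F x else 0))"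
  unfolding H10_def by (rule clos_add) (auto simp: W_def sm intro: test_fun_smooth)
 hence "clos {v. test_fun U v} (Leb U) (\<lambda>x. max (p x + - max (f x) 0) 0)
  (\<lambda>x. if p x + - max (f x) 0 > 0 then P x + - (if f x > 0 then F x else 0) else 0)"
 proof (rule clos_pos)
  show "smooth_fun w" if "w \<in> W" for w
   using that sm unfolding W_def by (auto intro!: smooth_fun_add intro: test_fun_smooth)
  fix w and d :: real assume "w \<in> W" and d: "0 < d"
  then obtain s t where w: "w = (\<lambda>x. t x - s x)" "smooth_fun s" "\<And>x. 0 \<le> s x" "test_fun U t"
   unfolding W_def S_def by auto
  obtain C where C: "compact C" "C \<subseteq> U" "\<And>x. x \<notin> C \<Longrightarrow> t x = 0" using test_fun_support[OF w(4)] by metis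
  have "smooth_fun w" unfolding w(1) by (intro smooth_fun_diff w test_fun_smooth[OF w(4)])
  hence "smooth_fun (\<lambda>x. ppos d (w x))" by (rule smooth_fun_comp[OF ppos_smooth[OF d]])
  moreover have "ppos d (w x) = 0" if "x \<notin> C" for x
   using C(3)[OF that] w(1) w(3)[of x] ppos_nonpos[OF d, of "w x"] by simp
  ultimately show "(\<lambda>x. ppos d (w x)) \<in> {v. test_fun U v}"
   using C unfolding test_fun_def by blast
 qed
 thus ?thesis unfolding H10_def diff_conv_add_uminus .
qed

lemma L2_restrict:
 assumes "V \<subseteq> U" "V \<in> sets lebesgue" "U \<in> sets lebesgue" "L2 (Leb U) f"
 shows "L2 (Leb V) f" "l2n (Leb V) f \<le> l2n (Leb U) f"
proof -
 have eq: "Leb V = restrict_space (Leb U) V"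
  using assms by (simp add: restrict_restrict_space Int_absorb1)
 have VU: "V \<inter> space (Leb U) \<in> sets (Leb U)"
  using assms by (auto simp: sets_restrict_space Int_absorb2 intro!: image_eqI[of _ _ V])
 have VU': "V \<in> sets (Leb U)" using VU assms(1) by (simp add: Int_absorb2)
 have int: "integrable (Leb U) (\<lambda>x. indicator V x *\<^sub>R (norm (f x))\<^sup>2)"
  by (rule integrable_mult_indicator[OF VU' L2_integrable[OF assms(4)]])
 show "L2 (Leb V) f"
  unfolding L2_def eq
 proof
  show "f \<in> borel_measurable (restrict_space (Leb U) V)"
   using L2_measurable[OF assms(4)] by (rule measurable_restrict_space1)
  show "integrable (restrict_space (Leb U) V) (\<lambda>x. (norm (f x))\<^sup>2)"
   unfolding integrable_restrict_space[OF VU] by (rule int)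
 qed
 have "(\<integral>x. (norm (f x))\<^sup>2 \<partial>Leb V) \<le> (\<integral>x. (norm (f x))\<^sup>2 \<partial>Leb U)"
  unfolding eq integral_restrict_space[OF VU]
  by (rule integral_mono[OF int L2_integrable[OF assms(4)]]) (auto split: split_indicator)
 thus "l2n (Leb V) f \<le> l2n (Leb U) f" unfolding l2n_def by simp
qed

lemma SH_restrict:
 assumes "SH U f G" "V \<subseteq> U" "V \<in> sets lebesgue" "U \<in> sets lebesgue"
 shows "SH V f G"
proof -
 obtain v where "approx {v. smooth_fun v} (Leb U) f G v" by (rule closE[OF assms(1)[unfolded SH_def]]) (rule that)
 note v = approxD[OF this]
 note R = L2_restrict[OF assms(2-4)]
 show ?thesis unfolding SH_def
  by (rule closI[where v=v, OF v(1) R(1)[OF v(2)] R(1)[OF v(3)] R(1)[OF v(4)] R(1)[OF v(5)]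
     Lim_null_comparison[OF always_eventually v(6)] Lim_null_comparison[OF always_eventually v(7)]])
    (auto intro!: R(2) L2_diff v)
qed

lemma L2_extend:
 fixes f :: "'a::euclidean_space \<Rightarrow> 'b::euclidean_space"
 assumes "V \<subseteq> U" "V \<in> sets lebesgue" "U \<in> sets lebesgue" "L2 (Leb V) f"
 shows "L2 (Leb U) (\<lambda>x. if x \<in> V then f x else 0)"
  "l2n (Leb U) (\<lambda>x. if x \<in> V then f x else 0) = l2n (Leb V) f"
proof -
 have eq: "Leb V = restrict_space (Leb U) V"
  using assms by (simp add: restrict_restrict_space Int_absorb1)
 have VU: "V \<inter> space (Leb U) \<in> sets (Leb U)"
  using assms by (auto simp: sets_restrict_space Int_absorb2 intro!: image_eqI[of _ _ V])
 have i: "(\<lambda>x. (norm (if x \<in> V then f x else 0))\<^sup>2) = (\<lambda>x. indicator V x *\<^sub>R (norm (f x))\<^sup>2)"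
  "(\<lambda>x. if x \<in> V then f x else 0) = (\<lambda>x. indicator V x *\<^sub>R f x)" by auto
 have "f \<in> borel_measurable (restrict_space (Leb U) V)" using assms(4) by (simp add: L2_def eq)
 hence m: "(\<lambda>x. indicator V x *\<^sub>R f x) \<in> borel_measurable (Leb U)"
  by (simp add: borel_measurable_restrict_space_iff[OF VU])
 have "integrable (restrict_space (Leb U) V) (\<lambda>x. (norm (f x))\<^sup>2)" using assms(4) by (simp add: L2_def eq)
 hence int: "integrable (Leb U) (\<lambda>x. indicator V x *\<^sub>R (norm (f x))\<^sup>2)"
  unfolding integrable_restrict_space[OF VU] .
 show "L2 (Leb U) (\<lambda>x. if x \<in> V then f x else 0)"
  using m int unfolding L2_def i(1)[symmetric] i(2)[symmetric] by (rule conjI)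
 show "l2n (Leb U) (\<lambda>x. if x \<in> V then f x else 0) = l2n (Leb V) f"
  unfolding l2n_def i(1) eq integral_restrict_space[OF VU] ..
qed

text \<open>Test functions on \<open>V\<close> vanish outside \<open>V\<close> and are their own
  extensions. This turns a perturbation inside a ball into an admissible perturbation on the whole
  domain.\<close>

lemma H10_extend:
 assumes "H10 V f G" "V \<subseteq> U" "V \<in> sets lebesgue" "U \<in> sets lebesgue"
 shows "H10 U (\<lambda>x. if x \<in> V then f x else 0) (\<lambda>x. if x \<in> V then G x else 0)"
proof -
 obtain v where "approx {v. test_fun V v} (Leb V) f G v" by (rule closE[OF assms(1)[unfolded H10_def]]) (rule that)
 note v = approxD[OF this]
 have t: "test_fun V (v n)" for n using v(1) by simp
 note E = L2_extend[OF assms(2-4)]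
 have a: "(\<lambda>x. if x \<in> V then v n x else 0) = v n" "(\<lambda>x. if x \<in> V then cgrad (v n) x else 0) = cgrad (v n)" for n
  using test_fun_outside[OF t[of n]] by auto
 have b: "(\<lambda>x. if x \<in> V then v n x - f x else 0) = (\<lambda>x. v n x - (if x \<in> V then f x else 0))"
   "(\<lambda>x. if x \<in> V then cgrad (v n) x - G x else 0) = (\<lambda>x. cgrad (v n) x - (if x \<in> V then G x else 0))" for n
  using test_fun_outside[OF t[of n]] by auto
 show ?thesis unfolding H10_def
 proof (rule closI[where v=v])
  show "v n \<in> {v. test_fun U v}" for n using test_fun_mono[OF t assms(2)] by simp
  show "L2 (Leb U) (v n)" "L2 (Leb U) (cgrad (v n))" for n
   using E(1)[OF v(2)[of n]] E(1)[OF v(3)[of n]] unfolding a .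
  show "L2lim (Leb U) v (\<lambda>x. (if x \<in> V then f x else 0))"
   using v(6) unfolding E(2)[OF L2_diff[OF v(2,4)], symmetric] b .
  show "L2lim (Leb U) (\<lambda>n. cgrad (v n)) (\<lambda>x. (if x \<in> V then G x else 0))"
   using v(7) unfolding E(2)[OF L2_diff[OF v(3,5)], symmetric] b .
 qed (intro E(1) v)+
qed

subsection \<open>Weak gradients\<close>

lemma test_fun_lipschitz:
 assumes "test_fun U (\<psi> :: 'a::euclidean_space \<Rightarrow> real)"
 obtains B where "B > 0" "\<And>x y. \<bar>\<psi> x - \<psi> y\<bar> \<le> B * norm (x - y)"
proof -
 obtain B where B: "B > 0" "\<And>x. norm (cgrad \<psi> x) \<le> B"
  using test_fun_bounded[OF assms] by metis
 have "norm (\<psi> x - \<psi> y) \<le> B * norm (x - y)" for x y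
 proof (rule differentiable_bound[of UNIV \<psi> "\<lambda>x v. cgrad \<psi> x \<bullet> v"])
  show "onorm ((\<bullet>) (cgrad \<psi> z)) \<le> B" for z
  proof (rule onorm_le)
   fix v show "norm (cgrad \<psi> z \<bullet> v) \<le> B * norm v"
    using Cauchy_Schwarz_ineq2[of "cgrad \<psi> z" v] mult_right_mono[OF B(2)[of z] norm_ge_zero[of v]] by simp
  qed
 qed (auto intro: smooth_has_derivative test_fun_smooth[OF assms])
 thus thesis using that B by simp
qed

text \<open>By translation invariance every difference quotient has integral 0; the Lipschitz bound
  and the bounded support provide a majorant for passing to the derivative. Steps of length at most
  1 keep all supports in one ball.\<close>

lemma test_fun_integral_deriv:
 assumes t: "test_fun U (\<psi> :: 'a::euclidean_space \<Rightarrow> real)"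
 shows "(\<integral>x. cgrad \<psi> x \<bullet> b \<partial>lborel) = 0"
proof -
 obtain B where B: "B > 0" "\<And>x y. \<bar>\<psi> x - \<psi> y\<bar> \<le> B * norm (x - y)" by (rule test_fun_lipschitz[OF t]) (rule that; assumption)
 have sm: "smooth_fun \<psi>" using test_fun_smooth[OF t] .
 have cont: "continuous_on UNIV \<psi>" using smooth_fun_continuous[OF sm] .
 have [measurable]: "\<psi> \<in> borel_measurable borel" using cont by (rule borel_measurable_continuous_onI)
 have [measurable]: "cgrad \<psi> \<in> borel_measurable borel"
  using smooth_cgrad_continuous[OF sm] by (rule borel_measurable_continuous_onI)
 obtain C where C: "compact C" "\<And>x. x \<notin> C \<Longrightarrow> \<psi> x = 0" using test_fun_support[OF t] by metis
 obtain R where R: "C \<subseteq> cball 0 R" using bounded_subset_ballD[OF compact_imp_bounded[OF C(1)], of 0] ball_subset_cball by blast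
 have "(\<lambda>x. indicator C x *\<^sub>R \<psi> x) = \<psi>" using C(2) by (auto split: split_indicator)
 hence int: "integrable lborel \<psi>"
  using borel_integrable_compact[OF C(1) continuous_on_subset[OF cont subset_UNIV]] by (simp add: indicator_def)
 define t where "t n = inverse (real (Suc n))" for n
 have t: "t n > 0" "t n \<le> 1" for n by (auto simp: t_def inverse_le_1_iff)
 define q where "q n x = (\<psi> (t n *\<^sub>R b + x) - \<psi> x) / t n" for n x
 have [measurable]: "q n \<in> borel_measurable borel" for n unfolding q_def by measurable
 have intq: "(\<integral>x. q n x \<partial>lborel) = 0" for n
 proof -
  have i1: "integrable (distr lborel borel ((+) (t n *\<^sub>R b))) \<psi>" using int by (simp add: lborel_distr_plus)
  have i2: "integrable lborel (\<lambda>x. \<psi> (t n *\<^sub>R b + x))" using i1 by (subst (asm) integrable_distr_eq) auto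
  have "(\<integral>x. \<psi> (t n *\<^sub>R b + x) \<partial>lborel) = (\<integral>x. \<psi> x \<partial>distr lborel borel ((+) (t n *\<^sub>R b)))"
   by (subst integral_distr) auto
  thus ?thesis using int i2 unfolding q_def by (simp add: lborel_distr_plus)
 qed
 have "(\<lambda>n. \<integral>x. q n x \<partial>lborel) \<longlonglongrightarrow> (\<integral>x. cgrad \<psi> x \<bullet> b \<partial>lborel)"
 proof (rule integral_dominated_convergence[where w="\<lambda>x. B * norm b * indicator (cball 0 (R + norm b)) x"])
  show "integrable lborel (\<lambda>x. B * norm b * indicator (cball 0 (R + norm b)) x :: real)"
   by (intro integrable_mult_right integrable_real_indicator) (auto simp: emeasure_compact_finite[OF compact_cball, simplified])
  show "AE x in lborel. norm (q n x) \<le> B * norm b * indicator (cball 0 (R + norm b)) x" for n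
  proof (rule AE_I2)
   fix x
   show "norm (q n x) \<le> B * norm b * indicator (cball 0 (R + norm b)) x"
   proof (cases "x \<in> cball 0 (R + norm b)")
    case True
    have "\<bar>\<psi> (t n *\<^sub>R b + x) - \<psi> x\<bar> \<le> B * (t n * norm b)"
     using B(2)[of "t n *\<^sub>R b + x" x] t(1)[of n] by simp
    thus ?thesis using True t(1)[of n] by (simp add: q_def abs_divide pos_divide_le_eq algebra_simps)
   next
    case False
    have "norm (t n *\<^sub>R b) \<le> norm b" using t[of n] by (simp add: mult_left_le_one_le)
    hence "norm (t n *\<^sub>R b + x) > R" using False norm_diff_triangle_ineq[of x 0 "- (t n *\<^sub>R b)" 0]
      norm_triangle_ineq4[of "t n *\<^sub>R b + x" "t n *\<^sub>R b"] by simp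
    moreover have "norm x > R" using False norm_ge_zero[of b] unfolding mem_cball dist_0_norm by linarith
    ultimately have "x \<notin> C" "t n *\<^sub>R b + x \<notin> C" using R by (auto simp: subset_iff)
    thus ?thesis using C(2) B(1) by (simp add: q_def)
   qed
  qed
  show "AE x in lborel. (\<lambda>n. q n x) \<longlonglongrightarrow> cgrad \<psi> x \<bullet> b"
  proof (rule AE_I2)
   fix x
   have "((\<lambda>s. \<psi> (s *\<^sub>R b + x)) has_derivative (\<lambda>s. cgrad \<psi> (0 *\<^sub>R b + x) \<bullet> (s *\<^sub>R b))) (at 0)"
    by (rule has_derivative_compose[OF _ smooth_has_derivative[OF sm]]) (auto intro!: derivative_eq_intros)
   hence "((\<lambda>s. \<psi> (s *\<^sub>R b + x)) has_real_derivative cgrad \<psi> x \<bullet> b) (at 0)"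
    unfolding has_field_derivative_def by (simp add: mult_commute_abs)
   hence "((\<lambda>s. (\<psi> (s *\<^sub>R b + x) - \<psi> x) / s) \<longlongrightarrow> cgrad \<psi> x \<bullet> b) (at 0)"
    by (simp add: has_field_derivative_iff)
   moreover have "filterlim t (at 0) sequentially"
    unfolding filterlim_at using t(1) LIMSEQ_inverse_real_of_nat[folded t_def] less_imp_neq[OF t(1)] by auto
   ultimately show "(\<lambda>n. q n x) \<longlonglongrightarrow> cgrad \<psi> x \<bullet> b"
    unfolding q_def by (rule filterlim_compose)
  qed
 qed measurable
 thus ?thesis using intq by (simp add: LIMSEQ_const_iff)
qed

lemma integral_lebesgue_on_zero_outside:
 fixes f :: "'a::euclidean_space \<Rightarrow> real"
 assumes "f \<in> borel_measurable borel" "\<And>x. x \<notin> U \<Longrightarrow> f x = 0" "U \<in> sets lebesgue"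
 shows "(\<integral>x. f x \<partial>Leb U) = (\<integral>x. f x \<partial>lborel)"
proof -
 have "(\<lambda>x. indicator U x *\<^sub>R f x) = f" using assms(2) by (auto split: split_indicator)
 hence "(\<integral>x. f x \<partial>Leb U) = (\<integral>x. f x \<partial>lebesgue)"
  using assms(3) by (subst integral_restrict_space) auto
 also have "\<dots> = (\<integral>x. f x \<partial>lborel)" using assms(1) by (intro integral_completion) auto
 finally show ?thesis .
qed

lemma smooth_int_by_parts:
 assumes v: "smooth_fun v" and t: "test_fun U \<psi>" and U: "open U" "bounded U"
 shows "(\<integral>x. v x * (cgrad \<psi> x \<bullet> b) \<partial>Leb U) = - (\<integral>x. (cgrad v x \<bullet> b) * \<psi> x \<partial>Leb U)"
proof -
 have p: "smooth_fun \<psi>" using test_fun_smooth[OF t] .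
 have T: "test_fun U (\<lambda>x. v x * \<psi> x)" using test_fun_mult[OF t v] .
 have i1: "integrable (Leb U) (\<lambda>x. v x \<bullet> (cgrad \<psi> x \<bullet> b))"
  by (intro L2_integrable_inner smooth_L2 v U smooth_fun_cgrad_inner p)
 have i2: "integrable (Leb U) (\<lambda>x. \<psi> x \<bullet> (cgrad v x \<bullet> b))"
  by (intro L2_integrable_inner smooth_L2 v U smooth_fun_cgrad_inner p)
 have eq: "cgrad (\<lambda>x. v x * \<psi> x) x \<bullet> b = v x * (cgrad \<psi> x \<bullet> b) + \<psi> x * (cgrad v x \<bullet> b)" for x
  by (simp add: cgrad_mult[OF v p] inner_add_left)
 have "0 = (\<integral>x. cgrad (\<lambda>x. v x * \<psi> x) x \<bullet> b \<partial>Leb U)"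
 proof (subst integral_lebesgue_on_zero_outside)
  show "(\<lambda>x. cgrad (\<lambda>x. v x * \<psi> x) x \<bullet> b) \<in> borel_measurable borel"
   by (intro borel_measurable_continuous_onI smooth_fun_continuous smooth_fun_cgrad_inner test_fun_smooth[OF T])
 qed (use T U test_fun_outside[OF T] test_fun_integral_deriv[OF T] in auto)
 also have "\<dots> = (\<integral>x. v x * (cgrad \<psi> x \<bullet> b) \<partial>Leb U) + (\<integral>x. \<psi> x * (cgrad v x \<bullet> b) \<partial>Leb U)"
  unfolding eq using i1 i2 by (intro Bochner_Integration.integral_add) (simp_all add: inner_real_def)
 finally show ?thesis by (simp add: mult.commute)
qed

lemma L2_inner_const: assumes "L2 M G" shows "L2 M (\<lambda>x. G x \<bullet> b)"
proof (rule L2_bound(1)[OF _ L2_scaleR[OF assms, of "norm b"]])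
 show "AE x in M. norm (G x \<bullet> b) \<le> norm (norm b *\<^sub>R G x)"
  by (rule AE_I2) (simp add: Cauchy_Schwarz_ineq2[of "G _" b, simplified mult.commute[of "norm (G _)"]])
qed (use assms in measurable)

lemma l2n_inner_const: assumes "L2 M G" shows "l2n M (\<lambda>x. G x \<bullet> b) \<le> norm b * l2n M G"
proof -
 have "l2n M (\<lambda>x. G x \<bullet> b) \<le> l2n M (\<lambda>x. norm b *\<^sub>R G x)"
 proof (rule L2_bound(2)[OF _ L2_scaleR[OF assms, of "norm b"]])
  show "AE x in M. norm (G x \<bullet> b) \<le> norm (norm b *\<^sub>R G x)"
   by (rule AE_I2) (simp add: Cauchy_Schwarz_ineq2[of "G _" b, simplified mult.commute[of "norm (G _)"]])
 qed (use assms in measurable)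
 thus ?thesis by (simp add: l2n_scaleR)
qed

lemma SH_int_by_parts:
 assumes f: "SH U f G" and t: "test_fun U \<psi>" and U: "open U" "bounded U"
 shows "(\<integral>x. f x * (cgrad \<psi> x \<bullet> b) \<partial>Leb U) = - (\<integral>x. (G x \<bullet> b) * \<psi> x \<partial>Leb U)"
proof -
 obtain v where "approx {v. smooth_fun v} (Leb U) f G v" by (rule closE[OF assms(1)[unfolded SH_def]]) (rule that)
 note v = approxD[OF this]
 have sm: "smooth_fun (v n)" for n using v(1) by simp
 have p: "smooth_fun \<psi>" using test_fun_smooth[OF t] .
 have L: "L2 (Leb U) (\<lambda>x. cgrad \<psi> x \<bullet> b)" "L2 (Leb U) \<psi>"
  by (intro L2_inner_const smooth_L2 p U)+
 have z: "(\<lambda>n::nat. l2n (Leb U) (\<lambda>x. w x - w x)) \<longlonglongrightarrow> 0" for w :: "'a \<Rightarrow> real" by (simp add: l2n_def)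
 have c: "L2lim (Leb U) (\<lambda>n x. cgrad (v n) x \<bullet> b) (\<lambda>x. G x \<bullet> b)"
  by (rule Lim_null_comparison[OF always_eventually tendsto_mult_right_zero[OF v(7), of "norm b"]])
    (use l2n_inner_const[OF L2_diff[OF v(3,5)]] in \<open>auto simp: inner_diff_left\<close>)
 have "(\<lambda>n. \<integral>x. v n x \<bullet> (cgrad \<psi> x \<bullet> b) \<partial>Leb U) \<longlonglongrightarrow> (\<integral>x. f x \<bullet> (cgrad \<psi> x \<bullet> b) \<partial>Leb U)"
  by (rule L2_tendsto_inner[OF v(2,4) L(1) L(1) v(6) z])
 moreover have "(\<lambda>n. \<integral>x. (cgrad (v n) x \<bullet> b) \<bullet> \<psi> x \<partial>Leb U) \<longlonglongrightarrow> (\<integral>x. (G x \<bullet> b) \<bullet> \<psi> x \<partial>Leb U)"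
  by (rule L2_tendsto_inner[OF L2_inner_const[OF v(3)] L2_inner_const[OF v(5)] L(2) L(2) c z])
 hence "(\<lambda>n. - (\<integral>x. (cgrad (v n) x \<bullet> b) \<bullet> \<psi> x \<partial>Leb U)) \<longlonglongrightarrow> - (\<integral>x. (G x \<bullet> b) \<bullet> \<psi> x \<partial>Leb U)"
  by (rule tendsto_minus)
 ultimately have "(\<integral>x. f x \<bullet> (cgrad \<psi> x \<bullet> b) \<partial>Leb U) = - (\<integral>x. (G x \<bullet> b) \<bullet> \<psi> x \<partial>Leb U)"
  unfolding inner_real_def smooth_int_by_parts[OF sm t U] by (rule LIMSEQ_unique)
 thus ?thesis by simp
qed

lemma L2_imp_L2_on: "L2 (Leb U) f \<Longrightarrow> L2_on U f"
 unfolding L2_def L2_on_def by simp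

lemma L2_on_imp_L2: "L2_on U f \<Longrightarrow> L2 (Leb U) f"
 unfolding L2_def L2_on_def by simp

lemma SH_weak_grad:
 assumes f: "SH U f G" and U: "open U" "bounded U" shows "is_weak_grad U f G"
 unfolding is_weak_grad_def
proof (intro conjI ballI allI impI)
 show "L2_on U (\<lambda>x. G x \<bullet> b)" for b
  by (intro L2_imp_L2_on L2_inner_const SH_L2[OF f])
 fix \<psi> and b :: 'a assume "test_fun U \<psi>" and b: "b \<in> Basis"
 thus "(\<integral>x. f x * pderiv \<psi> b x \<partial>Leb U) = - (\<integral>x. (G x \<bullet> b) * \<psi> x \<partial>Leb U)"
  using SH_int_by_parts[OF f _ U, of \<psi> b] by (simp add: cgrad_inner_Basis)
qed

lemma SH_H1: "SH U f G \<Longrightarrow> open U \<Longrightarrow> bounded U \<Longrightarrow> H1 U f"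
 unfolding H1_def using SH_weak_grad L2_imp_L2_on[OF SH_L2(1)] by blast

lemma compact_cutoff_limit:
 assumes "compact C" "open U" "C \<subseteq> U" "C \<noteq> {}"
 obtains \<eta> where "\<And>n::nat. test_fun U (\<eta> n)" "\<And>n x. 0 \<le> \<eta> n x \<and> \<eta> n x \<le> 1"
  "\<And>x. (\<lambda>n. \<eta> n x) \<longlonglongrightarrow> indicator C x"
proof -
 define O' where "O' n = U \<inter> {x. infdist x C < inverse (real (Suc n))}" for n
 have "\<exists>e. test_fun (O' n) e \<and> (\<forall>x. 0 \<le> e x \<and> e x \<le> 1) \<and> (\<forall>x\<in>C. e x = 1)" for n
 proof -
  have "open (O' n)" unfolding O'_def
   by (intro open_Int assms open_Collect_less continuous_intros)
  moreover have "C \<subseteq> O' n" using assms(3) by (auto simp: O'_def)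
  ultimately obtain e where "test_fun (O' n) e" "\<And>x. 0 \<le> e x \<and> e x \<le> 1" "\<And>x. x \<in> C \<Longrightarrow> e x = 1"
   by (rule cutoff_exists[OF assms(1)]) (rule that; assumption)
  thus ?thesis by (intro exI[of _ e]) auto
 qed
 hence "\<forall>n. \<exists>e. test_fun (O' n) e \<and> (\<forall>x. 0 \<le> e x \<and> e x \<le> 1) \<and> (\<forall>x\<in>C. e x = 1)" by simp
 from choice[OF this] obtain \<eta> where e: "\<forall>n. test_fun (O' n) (\<eta> n) \<and> (\<forall>x. 0 \<le> \<eta> n x \<and> \<eta> n x \<le> 1) \<and> (\<forall>x\<in>C. \<eta> n x = 1)"
  by (elim exE)
 show thesis
 proof (rule that[of \<eta>])
  show "test_fun U (\<eta> n)" for n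
  proof -
   have "test_fun (O' n) (\<eta> n)" using e by simp
   thus ?thesis by (rule test_fun_mono) (auto simp: O'_def)
  qed
  show "0 \<le> \<eta> n x \<and> \<eta> n x \<le> 1" for n x using e by simp
  fix x show "(\<lambda>n. \<eta> n x) \<longlonglongrightarrow> indicator C x"
  proof (cases "x \<in> C")
   case True
   thus ?thesis using e by simp
  next
   case False
   \<comment> \<open>The distance to the empty set is 0 by convention, which is why \<open>C\<close>
     is assumed nonempty.\<close>
   hence "infdist x C > 0"
    using assms(1) assms(4) infdist_nonneg[of x C] in_closed_iff_infdist_zero[of C x] by (simp add: compact_imp_closed less_le)
   hence "\<forall>\<^sub>F n in sequentially. inverse (real (Suc n)) < infdist x C"
    using order_tendstoD(2)[OF LIMSEQ_inverse_real_of_nat] by blast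
   hence "\<forall>\<^sub>F n in sequentially. indicator C x = \<eta> n x"
   proof eventually_elim
    case (elim n)
    hence "x \<notin> O' n" by (auto simp: O'_def)
    moreover have "test_fun (O' n) (\<eta> n)" using e by simp
    ultimately show ?case using test_fun_outside(1) False by (simp add: indicator_def)
   qed
   thus ?thesis by (rule Lim_transform_eventually[OF tendsto_const])
  qed
 qed
qed

text \<open>Cutoffs shrinking to a compact set inside \<open>{g > 0}\<close> show that
  \<open>g\<close> has integral 0 over it, so the compact set is null; inner regularity then makes
  \<open>{g > 0}\<close> null. The same applies to \<open>- g\<close>.\<close>

lemma weak_zero:
 fixes g :: "'a::euclidean_space \<Rightarrow> real"
 assumes U: "open U" "bounded U" and g: "L2 (Leb U) g"
  and z: "\<And>\<psi>. test_fun U \<psi> \<Longrightarrow> (\<integral>x. g x * \<psi> x \<partial>Leb U) = 0"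
 shows "AE x in Leb U. g x = 0"
proof -
 have half: "AE x in Leb U. g x \<le> 0"
  if g: "L2 (Leb U) g" and z: "\<And>\<psi>. test_fun U \<psi> \<Longrightarrow> (\<integral>x. g x * \<psi> x \<partial>Leb U) = 0" for g :: "'a \<Rightarrow> real"
 proof -
  have gm[measurable]: "g \<in> borel_measurable (Leb U)" using g by (simp add: L2_def)
  interpret finite_measure "Leb U" by (rule finite_measure_bounded_open[OF U])
  have L1: "L2 (Leb U) (\<lambda>x. 1 :: real)" using SH_L2(1)[OF SH_const[OF U]] .
  have ig: "integrable (Leb U) g" using L2_integrable_inner[OF g L1] by simp
  have C0: "AE x in Leb U. x \<notin> C" if C: "compact C" "C \<subseteq> U" "\<And>x. x \<in> C \<Longrightarrow> g x > 0" for C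
  proof (cases "C = {}")
   case False
   obtain \<eta> where e: "\<And>n::nat. test_fun U (\<eta> n)" "\<And>n x. 0 \<le> \<eta> n x \<and> \<eta> n x \<le> 1"
    "\<And>x. (\<lambda>n. \<eta> n x) \<longlonglongrightarrow> indicator C x"
    by (rule compact_cutoff_limit[OF C(1) U(1) C(2) False]) (rule that; assumption)
   have [measurable]: "\<eta> n \<in> borel_measurable (Leb U)" for n
    by (intro smooth_meas test_fun_smooth[OF e(1)] U)
   have [measurable]: "C \<in> sets (Leb U)"
    using C compact_imp_closed[OF C(1)] by (auto simp: sets_restrict_space intro!: image_eqI[of _ _ C])
   have "(\<lambda>n. \<integral>x. g x * \<eta> n x \<partial>Leb U) \<longlonglongrightarrow> (\<integral>x. g x * indicator C x \<partial>Leb U)"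
   proof (rule integral_dominated_convergence[where w="\<lambda>x. \<bar>g x\<bar>"])
    show "AE x in Leb U. (\<lambda>n. g x * \<eta> n x) \<longlonglongrightarrow> g x * indicator C x"
     by (intro AE_I2 tendsto_intros e)
    show "AE x in Leb U. norm (g x * \<eta> n x) \<le> \<bar>g x\<bar>" for n
     using e(2) by (intro AE_I2) (auto simp: abs_mult mult_left_le)
   qed (use ig in auto)
   hence "(\<integral>x. g x * indicator C x \<partial>Leb U) = 0"
    unfolding z[OF e(1)] by (simp add: LIMSEQ_const_iff)
   moreover have "integrable (Leb U) (\<lambda>x. g x * indicator C x)"
    by (rule Bochner_Integration.integrable_bound[OF ig]) (auto split: split_indicator)
   moreover have "AE x in Leb U. 0 \<le> g x * indicator C x"
    using C(3) by (intro AE_I2) (auto split: split_indicator simp: less_imp_le)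
   ultimately have "AE x in Leb U. g x * indicator C x = 0"
    by (simp add: integral_nonneg_eq_0_iff_AE)
   thus ?thesis
    by eventually_elim (use C(3) in \<open>force split: split_indicator_asm\<close>)
  qed simp
  define E where "E = {x \<in> U. g x > 0}"
  have "{x \<in> space (Leb U). g x > 0} \<in> sets (Leb U)" by measurable
  hence E: "E \<in> sets lebesgue"
   using U by (auto simp: E_def sets_restrict_space intro!: sets.Int)
  obtain K C where KC: "negligible K" "\<And>n::nat. compact (C n)" "E = (\<Union>n. C n) \<union> K"
   by (rule lebesgue_regular_inner[OF E]) (rule that; assumption)
  have 1: "AE x in Leb U. \<forall>n. x \<notin> C n"
   unfolding AE_all_countable
  proof
   fix n
   have "C n \<subseteq> E" using KC(3) by blast
   thus "AE x in Leb U. x \<notin> C n" by (intro C0 KC(2)) (auto simp: E_def)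
  qed
  have 2: "AE x in Leb U. x \<notin> K"
  proof -
   have "AE x in lebesgue. x \<notin> K"
    using KC(1) by (intro AE_not_in) (simp add: negligible_iff_null_sets)
   thus ?thesis using U by (subst AE_restrict_space_iff) auto
  qed
  have "AE x in Leb U. x \<in> U" using AE_space[of "Leb U"] by simp
  with 1 2 show ?thesis
   by eventually_elim (use KC(3) in \<open>auto simp: E_def not_less[symmetric]\<close>)
 qed
 have 1: "AE x in Leb U. g x \<le> 0" by (rule half[OF g z])
 have 2: "AE x in Leb U. - g x \<le> 0"
  by (rule half) (use L2_scaleR[OF g, of "-1"] z in auto)
 show ?thesis using 1 2 by eventually_elim auto
qed

lemma weak_grad_unique:
 assumes G: "is_weak_grad U f G" "is_weak_grad U f' G'" and U: "open U" "bounded U"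
  and f: "f \<in> borel_measurable (Leb U)" "f' \<in> borel_measurable (Leb U)" "AE x in Leb U. f x = f' x"
 shows "AE x in Leb U. G x = G' x"
proof -
 have "AE x in Leb U. (G x - G' x) \<bullet> b = 0" if b: "b \<in> Basis" for b
 proof (rule weak_zero[OF U])
  have L: "L2 (Leb U) (\<lambda>x. G x \<bullet> b)" "L2 (Leb U) (\<lambda>x. G' x \<bullet> b)"
   using G b by (auto simp: is_weak_grad_def intro!: L2_on_imp_L2)
  thus "L2 (Leb U) (\<lambda>x. (G x - G' x) \<bullet> b)" unfolding inner_diff_left by (rule L2_diff)
  fix \<psi> assume t: "test_fun U \<psi>"
  have m[measurable]: "pderiv \<psi> b \<in> borel_measurable (Leb U)"
   by (intro smooth_meas smooth_fun_pderiv test_fun_smooth[OF t] U)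
  note [measurable] = f(1,2)
  have "- (\<integral>x. (G x \<bullet> b) * \<psi> x \<partial>Leb U) = (\<integral>x. f x * pderiv \<psi> b x \<partial>Leb U)"
   using G(1) t b unfolding is_weak_grad_def by simp
  also have "\<dots> = (\<integral>x. f' x * pderiv \<psi> b x \<partial>Leb U)"
   using f(3) by (intro integral_cong_AE) auto
  also have "\<dots> = - (\<integral>x. (G' x \<bullet> b) * \<psi> x \<partial>Leb U)"
   using G(2) t b unfolding is_weak_grad_def by simp
  finally have "(\<integral>x. (G x \<bullet> b) * \<psi> x \<partial>Leb U) = (\<integral>x. (G' x \<bullet> b) * \<psi> x \<partial>Leb U)" by simp
  moreover have "integrable (Leb U) (\<lambda>x. (G x \<bullet> b) \<bullet> \<psi> x)" "integrable (Leb U) (\<lambda>x. (G' x \<bullet> b) \<bullet> \<psi> x)"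
   by (intro L2_integrable_inner L smooth_L2 test_fun_smooth[OF t] U)+
  ultimately show "(\<integral>x. (G x - G' x) \<bullet> b * \<psi> x \<partial>Leb U) = 0"
   by (simp add: inner_diff_left left_diff_distrib)
 qed
 hence "AE x in Leb U. \<forall>b\<in>Basis. (G x - G' x) \<bullet> b = 0" by (intro AE_finite_allI) auto
 thus ?thesis by eventually_elim (simp add: euclidean_eq_iff[of "G _"] inner_diff_left)
qed

lemma SH_unique:
 assumes "SH U f G" "SH U f' G'" "open U" "bounded U" "AE x in Leb U. f x = f' x"
 shows "AE x in Leb U. G x = G' x"
 by (rule weak_grad_unique[OF SH_weak_grad[OF assms(1,3,4)] SH_weak_grad[OF assms(2,3,4)] assms(3,4)
    SH_meas(1)[OF assms(1)] SH_meas(1)[OF assms(2)] assms(5)])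

text \<open>Writing \<open>f\<close> as the difference of its positive and negative parts yields a
  gradient that is 0 on the zero set, and gradients are unique.\<close>

lemma SH_grad_zero:
 assumes "SH U f G" "open U" "bounded U" shows "AE x in Leb U. f x = 0 \<longrightarrow> G x = 0"
proof -
 have "SH U (\<lambda>x. max (f x) 0 - max (- f x) 0) (\<lambda>x. (if f x > 0 then G x else 0) - (if - f x > 0 then - G x else 0))"
  by (rule SH_diff[OF SH_pos[OF assms(1)] SH_pos[OF SH_minus[OF assms(1)]]])
 from SH_unique[OF assms(1) this assms(2,3)]
 have "AE x in Leb U. G x = (if f x > 0 then G x else 0) - (if - f x > 0 then - G x else 0)"
  by (auto simp: max_def)
 thus ?thesis by eventually_elim (auto split: if_splits)
qed

subsection \<open>Poincare-type inequalities\<close>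

text \<open>The Jacobian factor \<open>1 / s ^ n\<close> is at most \<open>2 ^ n\<close> because
  \<open>s\<close> is at least one half.\<close>

lemma nn_integral_affine_le:
 fixes g :: "'a::euclidean_space \<Rightarrow> ennreal"
 assumes [measurable]: "g \<in> borel_measurable borel" and s: "1/2 \<le> s"
 shows "(\<integral>\<^sup>+x. g (c + s *\<^sub>R x) \<partial>lborel) \<le> ennreal (2 ^ DIM('a)) * (\<integral>\<^sup>+x. g x \<partial>lborel)"
proof -
 have "(\<integral>\<^sup>+x. g x \<partial>lborel) = (\<integral>\<^sup>+x. g x \<partial>density (distr lborel borel (\<lambda>x. c + s *\<^sub>R x)) (\<lambda>_. \<bar>s\<bar>^DIM('a)))"
  using s by (subst lborel_affine[of s c]) auto
 also have "\<dots> = (\<integral>\<^sup>+x. ennreal (s ^ DIM('a)) * g (c + s *\<^sub>R x) \<partial>lborel)"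
  using s by (subst nn_integral_density) (auto simp: nn_integral_distr)
 also have "\<dots> = ennreal (s ^ DIM('a)) * (\<integral>\<^sup>+x. g (c + s *\<^sub>R x) \<partial>lborel)"
  by (rule nn_integral_cmult) measurable
 finally have eq: "(\<integral>\<^sup>+x. g x \<partial>lborel) = ennreal (s ^ DIM('a)) * (\<integral>\<^sup>+x. g (c + s *\<^sub>R x) \<partial>lborel)" .
 have "1 \<le> (2 * s) ^ DIM('a)" using s by (intro one_le_power) simp
 hence "1 \<le> ennreal (2 ^ DIM('a)) * ennreal (s ^ DIM('a))"
  using s by (subst ennreal_mult[symmetric]) (auto simp: power_mult_distrib)
 from mult_right_mono[OF this, of "\<integral>\<^sup>+x. g (c + s *\<^sub>R x) \<partial>lborel"]
 show ?thesis by (simp add: eq mult.assoc)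
qed

text \<open>Only the excess over slope \<open>L\<close> is measured, since \<open>ennreal\<close>
  sends negative numbers to 0. The case \<open>L = 0\<close> leads to the Poincare inequality,
  general \<open>L\<close> to Lipschitz representatives.\<close>

lemma smooth_line_bound:
 fixes v :: "'a::euclidean_space \<Rightarrow> real"
 assumes v: "smooth_fun v"
 shows "ennreal (\<bar>v x - v y\<bar> - L * norm (x - y)) \<le>
  ennreal (norm (x - y)) * (\<integral>\<^sup>+t. ennreal (max (norm (cgrad v (y + t *\<^sub>R (x - y))) - L) 0) * indicator {0..1} t \<partial>lborel)"
proof -
 let ?p = "\<lambda>t. y + t *\<^sub>R (x - y)"
 let ?h = "\<lambda>t. cgrad v (?p t) \<bullet> (x - y)"
 let ?m = "\<lambda>t. max (norm (cgrad v (?p t)) - L) 0"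
 have cg: "continuous_on UNIV (cgrad v)" using smooth_cgrad_continuous[OF v] .
 have cp: "continuous_on {0..1} (\<lambda>t. cgrad v (?p t))"
  by (rule continuous_on_compose2[OF cg]) (auto intro!: continuous_intros)
 have m: "(?m has_integral integral {0..1} ?m) {0..1}"
  by (intro integrable_integral integrable_continuous_interval continuous_intros cp)
 have d: "((\<lambda>t. v (?p t)) has_vector_derivative ?h t) (at t within {0..1})" for t
 proof -
  have "((\<lambda>t. v (?p t)) has_derivative (\<lambda>s. cgrad v (?p t) \<bullet> (s *\<^sub>R (x - y)))) (at t)"
   by (rule has_derivative_compose[OF _ smooth_has_derivative[OF v]]) (auto intro!: derivative_eq_intros)
  thus ?thesis unfolding has_vector_derivative_def by (auto intro: has_derivative_at_withinI)
 qed
 have i: "(?h has_integral v (?p 1) - v (?p 0)) {0..1}"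
  by (rule fundamental_theorem_of_calculus[OF _ d]) auto
 have i2: "((\<lambda>t. norm (x - y) * ?m t + L * norm (x - y)) has_integral norm (x - y) * integral {0..1} ?m + L * norm (x - y)) {0..1}"
  using has_integral_add[OF has_integral_mult_right[OF m, of "norm (x - y)"] has_integral_const_real[of "L * norm (x - y)" 0 1]] by simp
 have b: "norm (?h t) \<le> norm (x - y) * ?m t + L * norm (x - y)" for t
 proof -
  have "norm (?h t) \<le> norm (cgrad v (?p t)) * norm (x - y)" by (simp add: Cauchy_Schwarz_ineq2)
  also have "\<dots> \<le> (?m t + L) * norm (x - y)" by (intro mult_right_mono) auto
  finally show ?thesis by (simp add: algebra_simps)
 qed
 have "\<bar>v x - v y\<bar> \<le> norm (x - y) * integral {0..1} ?m + L * norm (x - y)"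
  using integral_norm_bound_integral[OF has_integral_integrable[OF i] has_integral_integrable[OF i2] b]
  by (simp add: integral_unique[OF i] integral_unique[OF i2])
 hence "ennreal (\<bar>v x - v y\<bar> - L * norm (x - y)) \<le> ennreal (norm (x - y) * integral {0..1} ?m)"
  by (intro ennreal_leI) simp
 also have "\<dots> = ennreal (norm (x - y)) * ennreal (integral {0..1} ?m)"
  by (intro ennreal_mult integral_nonneg has_integral_integrable[OF m]) auto
 also have "ennreal (integral {0..1} ?m) = (\<integral>\<^sup>+t. ennreal (?m t) * indicator {0..1} t \<partial>lborel)"
  by (rule nn_integral_has_integral_lebesgue'[symmetric, OF _ m]) auto
 finally show ?thesis .
qed

lemma ball_measurable[measurable]: "ball (c::'a::euclidean_space) R \<in> sets borel" by simp

definition ballI :: "'a::euclidean_space \<Rightarrow> real \<Rightarrow> ('a \<Rightarrow> ennreal) \<Rightarrow> ennreal" where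
 "ballI c R f = (\<integral>\<^sup>+x. f x * indicator (ball c R) x \<partial>lborel)"

text \<open>By convexity the segments stay in the ball, so \<open>g\<close> may be cut off outside
  it. For \<open>t \<le> 1/2\<close> the substitution is made in \<open>y\<close>, otherwise in
  \<open>x\<close>; the scaling factor \<open>1 - t\<close> or \<open>t\<close> is then at least one
  half.\<close>

lemma double_segment_bound:
 fixes g :: "'a::euclidean_space \<Rightarrow> ennreal"
 assumes gm[measurable]: "g \<in> borel_measurable borel"
 shows "ballI c R (\<lambda>x. ballI c R (\<lambda>y. \<integral>\<^sup>+t. g (y + t *\<^sub>R (x - y)) * indicator {0..1} t \<partial>lborel))
  \<le> ennreal (2 ^ DIM('a)) * emeasure lborel (ball c R) * ballI c R g"
proof -
 define B where "B = ball c R"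
 have [measurable]: "B \<in> sets borel" by (simp add: B_def)
 define g' where "g' z = g z * indicator B z" for z
 have [measurable]: "g' \<in> borel_measurable borel" unfolding g'_def by measurable
 have seg: "y + t *\<^sub>R (x - y) \<in> B" if "x \<in> B" "y \<in> B" "0 \<le> t" "t \<le> 1" for x y t
 proof -
  have "(1 - t) *\<^sub>R y + t *\<^sub>R x \<in> B" using that convex_ball[of c R] unfolding B_def convex_alt by blast
  thus ?thesis by (simp add: algebra_simps)
 qed
 let ?h = "\<lambda>x y t. g' (y + t *\<^sub>R (x - y)) * indicator {0..1} t * indicator B x * indicator B y"
 have "ballI c R (\<lambda>x. ballI c R (\<lambda>y. \<integral>\<^sup>+t. g (y + t *\<^sub>R (x - y)) * indicator {0..1} t \<partial>lborel))
  = (\<integral>\<^sup>+x. \<integral>\<^sup>+y. \<integral>\<^sup>+t. ?h x y t \<partial>lborel \<partial>lborel \<partial>lborel)"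
  unfolding ballI_def B_def[symmetric]
 proof (intro nn_integral_cong)
  fix x
  have "(\<integral>\<^sup>+y. (\<integral>\<^sup>+t. g (y + t *\<^sub>R (x - y)) * indicator {0..1} t \<partial>lborel) * indicator B y \<partial>lborel) * indicator B x
   = (\<integral>\<^sup>+y. (\<integral>\<^sup>+t. g (y + t *\<^sub>R (x - y)) * indicator {0..1} t \<partial>lborel) * indicator B y * indicator B x \<partial>lborel)"
   by (rule nn_integral_multc[symmetric]) measurable
  also have "\<dots> = (\<integral>\<^sup>+y. \<integral>\<^sup>+t. ?h x y t \<partial>lborel \<partial>lborel)"
  proof (intro nn_integral_cong)
   fix y
   show "(\<integral>\<^sup>+t. g (y + t *\<^sub>R (x - y)) * indicator {0..1} t \<partial>lborel) * indicator B y * indicator B x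
    = (\<integral>\<^sup>+t. ?h x y t \<partial>lborel)"
    by (cases "x \<in> B \<and> y \<in> B")
      (auto simp: g'_def seg split: split_indicator intro!: nn_integral_cong)
  qed
  finally show "(\<integral>\<^sup>+y. (\<integral>\<^sup>+t. g (y + t *\<^sub>R (x - y)) * indicator {0..1} t \<partial>lborel) * indicator B y \<partial>lborel) * indicator B x
   = (\<integral>\<^sup>+y. \<integral>\<^sup>+t. ?h x y t \<partial>lborel \<partial>lborel)" .
 qed
 also have "\<dots> = (\<integral>\<^sup>+x. \<integral>\<^sup>+t. \<integral>\<^sup>+y. ?h x y t \<partial>lborel \<partial>lborel \<partial>lborel)"
  by (intro nn_integral_cong lborel_pair.Fubini') measurable
 also have "\<dots> = (\<integral>\<^sup>+t. \<integral>\<^sup>+x. \<integral>\<^sup>+y. ?h x y t \<partial>lborel \<partial>lborel \<partial>lborel)"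
  by (intro lborel_pair.Fubini'[symmetric]) measurable
 also have "\<dots> \<le> (\<integral>\<^sup>+t. ennreal (2 ^ DIM('a)) * emeasure lborel B * (\<integral>\<^sup>+z. g' z \<partial>lborel) * indicator {0..1::real} t \<partial>lborel)"
 proof (intro nn_integral_mono)
  fix t :: real
  let ?K = "ennreal (2 ^ DIM('a)) * (\<integral>\<^sup>+z. g' z \<partial>lborel)"
  show "(\<integral>\<^sup>+x. \<integral>\<^sup>+y. ?h x y t \<partial>lborel \<partial>lborel)
   \<le> ennreal (2 ^ DIM('a)) * emeasure lborel B * (\<integral>\<^sup>+z. g' z \<partial>lborel) * indicator {0..1} t"
  proof (cases "t \<in> {0..1}")
   case False
   hence "indicator {0..1} t = (0::ennreal)" by (rule indicator_simps(2))
   thus ?thesis by simp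
  next
   case t: True
   show ?thesis
   proof (cases "t \<le> 1/2")
    case True
    have "(\<integral>\<^sup>+x. \<integral>\<^sup>+y. ?h x y t \<partial>lborel \<partial>lborel)
     \<le> (\<integral>\<^sup>+x. ?K * indicator B x \<partial>lborel)"
    proof (intro nn_integral_mono)
     fix x
     have "(\<integral>\<^sup>+y. ?h x y t \<partial>lborel)
      \<le> (\<integral>\<^sup>+y. g' (t *\<^sub>R x + (1 - t) *\<^sub>R y) * indicator B x \<partial>lborel)"
      by (intro nn_integral_mono) (auto split: split_indicator simp: algebra_simps)
     also have "\<dots> = (\<integral>\<^sup>+y. g' (t *\<^sub>R x + (1 - t) *\<^sub>R y) \<partial>lborel) * indicator B x"
      by (rule nn_integral_multc) measurable
     also have "\<dots> \<le> ?K * indicator B x"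
      by (intro mult_right_mono nn_integral_affine_le) (use True in auto)
     finally show "(\<integral>\<^sup>+y. ?h x y t \<partial>lborel)
      \<le> ?K * indicator B x" .
    qed
    also have "\<dots> = ?K * emeasure lborel B" by (rule nn_integral_cmult_indicator) simp
    finally show ?thesis using t by (simp add: mult_ac)
   next
    case False
    have "(\<integral>\<^sup>+x. \<integral>\<^sup>+y. ?h x y t \<partial>lborel \<partial>lborel)
     = (\<integral>\<^sup>+y. \<integral>\<^sup>+x. ?h x y t \<partial>lborel \<partial>lborel)"
     by (intro lborel_pair.Fubini'[symmetric]) measurable
    also have "\<dots> \<le> (\<integral>\<^sup>+y. ?K * indicator B y \<partial>lborel)"
    proof (intro nn_integral_mono)
     fix y
     have "(\<integral>\<^sup>+x. ?h x y t \<partial>lborel)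
      \<le> (\<integral>\<^sup>+x. g' ((1 - t) *\<^sub>R y + t *\<^sub>R x) * indicator B y \<partial>lborel)"
      by (intro nn_integral_mono) (auto split: split_indicator simp: algebra_simps)
     also have "\<dots> = (\<integral>\<^sup>+x. g' ((1 - t) *\<^sub>R y + t *\<^sub>R x) \<partial>lborel) * indicator B y"
      by (rule nn_integral_multc) measurable
     also have "\<dots> \<le> ?K * indicator B y"
      by (intro mult_right_mono nn_integral_affine_le) (use False in auto)
     finally show "(\<integral>\<^sup>+x. ?h x y t \<partial>lborel)
      \<le> ?K * indicator B y" .
    qed
    also have "\<dots> = ?K * emeasure lborel B" by (rule nn_integral_cmult_indicator) simp
    finally show ?thesis using t by (simp add: mult_ac)
   qed
  qed
 qed
 also have "\<dots> = ennreal (2 ^ DIM('a)) * emeasure lborel B * (\<integral>\<^sup>+z. g' z \<partial>lborel)"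
  by (subst nn_integral_cmult_indicator) auto
 finally show ?thesis unfolding ballI_def g'_def B_def .
qed

lemma ballI_mono: "(\<And>x. x \<in> ball c R \<Longrightarrow> f x \<le> g x) \<Longrightarrow> ballI c R f \<le> ballI c R g"
 unfolding ballI_def by (intro nn_integral_mono) (auto split: split_indicator)

lemma ballI_add:
 assumes [measurable]: "f \<in> borel_measurable borel" "g \<in> borel_measurable borel"
 shows "ballI c R (\<lambda>x. f x + g x) = ballI c R f + ballI c R g"
 unfolding ballI_def distrib_right
 by (rule nn_integral_add) (auto intro!: borel_measurable_times_ennreal borel_measurable_indicator)

lemma ballI_const: "ballI c R (\<lambda>x. k) = k * emeasure lborel (ball c R)"
 unfolding ballI_def by (rule nn_integral_cmult_indicator) simp

lemma ballI_cmult: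
 assumes [measurable]: "f \<in> borel_measurable borel"
 shows "ballI c R (\<lambda>x. k * f x) = k * ballI c R f"
 unfolding ballI_def mult.assoc
 by (rule nn_integral_cmult) (auto intro!: borel_measurable_times_ennreal borel_measurable_indicator)

lemma ballI_measurable[measurable]:
 fixes f :: "'a::euclidean_space \<Rightarrow> 'a \<Rightarrow> ennreal"
 assumes [measurable]: "case_prod f \<in> borel_measurable (borel \<Otimes>\<^sub>M borel)"
 shows "(\<lambda>x. ballI c R (f x)) \<in> borel_measurable borel"
 unfolding ballI_def by measurable

lemma smooth_double_bound:
 fixes v :: "'a::euclidean_space \<Rightarrow> real"
 assumes v: "smooth_fun v" and R: "R > 0"
 shows "ballI c R (\<lambda>x. ballI c R (\<lambda>y. ennreal (\<bar>v x - v y\<bar> - L * norm (x - y)))) \<le>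
   ennreal (2 * R * 2 ^ DIM('a)) * emeasure lborel (ball c R) * ballI c R (\<lambda>x. ennreal (max (norm (cgrad v x) - L) 0))"
proof -
 have [measurable]: "cgrad v \<in> borel_measurable borel"
  using smooth_cgrad_continuous[OF v] by (rule borel_measurable_continuous_onI)
 let ?g = "\<lambda>x. ennreal (max (norm (cgrad v x) - L) 0)"
 let ?I = "\<lambda>x y. \<integral>\<^sup>+t. ?g (y + t *\<^sub>R (x - y)) * indicator {0..1} t \<partial>lborel"
 have "ballI c R (\<lambda>x. ballI c R (\<lambda>y. ennreal (\<bar>v x - v y\<bar> - L * norm (x - y))))
  \<le> ballI c R (\<lambda>x. ballI c R (\<lambda>y. ennreal (2 * R) * ?I x y))"
 proof (intro ballI_mono)
  fix x y assume "x \<in> ball c R" "y \<in> ball c R"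
  hence "norm (x - y) \<le> 2 * R"
   using dist_triangle[of x y c] by (simp add: dist_norm norm_minus_commute)
  thus "ennreal (\<bar>v x - v y\<bar> - L * norm (x - y)) \<le> ennreal (2 * R) * ?I x y"
   by (intro order_trans[OF smooth_line_bound[OF v]] mult_right_mono ennreal_leI) auto
 qed
 also have "\<dots> = ennreal (2 * R) * ballI c R (\<lambda>x. ballI c R (\<lambda>y. ?I x y))"
  by (simp add: ballI_cmult)
 also have "\<dots> \<le> ennreal (2 * R) * (ennreal (2 ^ DIM('a)) * emeasure lborel (ball c R) * ballI c R ?g)"
  by (intro mult_left_mono double_segment_bound) auto
 finally show ?thesis using R by (simp add: ennreal_mult mult.assoc)
qed

lemma ballI_eq_lebesgue:
 "f \<in> borel_measurable borel \<Longrightarrow> ballI c R f = (\<integral>\<^sup>+x. f x \<partial>Leb (ball c R))"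
 unfolding ballI_def by (subst nn_integral_restrict_space) (auto simp: nn_integral_completion)

lemma ballI_eq_integral:
 assumes "f \<in> borel_measurable borel" "integrable (Leb (ball c R)) f" "\<And>x. 0 \<le> f x"
 shows "ballI c R (\<lambda>x. ennreal (f x)) = ennreal (\<integral>x. f x \<partial>Leb (ball c R))"
 using assms by (subst ballI_eq_lebesgue) (auto intro!: nn_integral_eq_integral)

lemma l2n_norm_diff_le:
 assumes "L2 M f" "L2 M g" shows "l2n M (\<lambda>x. norm (f x) - norm (g x)) \<le> l2n M (\<lambda>x. f x - g x)"
proof (rule L2_bound(2)[OF _ L2_diff[OF assms]])
 show "AE x in M. norm (norm (f x) - norm (g x)) \<le> norm (f x - g x)"
  by (rule AE_I2) (simp add: norm_triangle_ineq3)
qed (use assms in measurable)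

lemma L2_tendsto_norm:
 assumes "\<And>n. L2 M (f n)" "L2 M g" "L2lim M f g" "L2 M w"
 shows "(\<lambda>n. \<integral>x. w x * norm (f n x) \<partial>M) \<longlonglongrightarrow> (\<integral>x. w x * norm (g x) \<partial>M)"
proof -
 have z: "(\<lambda>n::nat. l2n M (\<lambda>x. w x - w x)) \<longlonglongrightarrow> 0" by (simp add: l2n_def)
 have "L2lim M (\<lambda>n x. norm (f n x)) (\<lambda>x. norm (g x))"
  by (rule Lim_null_comparison[OF always_eventually assms(3)]) (use l2n_norm_diff_le[OF assms(1,2)] in auto)
 from L2_tendsto_inner[OF assms(4) assms(4) L2_norm(1)[OF assms(1)] L2_norm(1)[OF assms(2)] z this]
 show ?thesis by simp
qed

lemma measure_ball_scale:
 assumes "s > 0" "r \<ge> 0"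
 shows "measure lborel (ball (c::'a::euclidean_space) (s * r)) = s ^ DIM('a) * measure lborel (ball (d::'a) r)"
 using assms content_ball_conv_unit_ball[of "s * r" c] content_ball_conv_unit_ball[of r d]
 by (simp add: power_mult_distrib)

lemma measure_ball_pos: "r > 0 \<Longrightarrow> measure lborel (ball (c::'a::euclidean_space) r) > 0"
 using content_ball_pos[of r c] by simp

lemma emeasure_ball: "emeasure lborel (ball (c::'a::euclidean_space) R) = ennreal (measure lborel (ball c R))"
 by (rule emeasure_eq_ennreal_measure) (use emeasure_lborel_ball_finite[of c R] in \<open>simp add: less_top\<close>)

lemma smooth_integrable_ball:
 assumes "continuous_on UNIV (f::'a::euclidean_space \<Rightarrow> real)" shows "integrable (Leb (ball c R)) f"
proof -
 interpret finite_measure "Leb (ball c R)" by (rule finite_measure_bounded_open) auto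
 have "bounded (f ` cball c R)"
  by (intro compact_imp_bounded compact_continuous_image continuous_on_subset[OF assms]) auto
 then obtain B where "\<forall>x\<in>cball c R. norm (f x) \<le> B" unfolding bounded_iff by auto
 thus ?thesis
  by (intro integrable_const_bound[where B=B] continuous_measurable_lebesgue_on continuous_on_subset[OF assms])
    (auto intro!: AE_I2)
qed

text \<open>Integrate \<open>abs (v x) \<le> abs (v y) + abs (v y - v x)\<close> over
  \<open>y\<close> in \<open>A\<close> and \<open>x\<close> in the ball; in the difference term
  \<open>A\<close> is enlarged to the ball so that the double integral bound applies.\<close>

lemma smooth_poincare:
 fixes v :: "'a::euclidean_space \<Rightarrow> real"
 assumes v: "smooth_fun v" and R: "R > 0" and A[measurable]: "A \<in> sets borel" "A \<subseteq> ball c R"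
 shows "measure lborel A * (\<integral>x. \<bar>v x\<bar> \<partial>Leb (ball c R)) \<le>
   measure lborel (ball c R) * (\<integral>x. indicator A x * \<bar>v x\<bar> \<partial>Leb (ball c R)) +
   2 * R * 2 ^ DIM('a) * measure lborel (ball c R) * (\<integral>x. norm (cgrad v x) \<partial>Leb (ball c R))"
proof -
 have cv: "continuous_on UNIV v" "continuous_on UNIV (cgrad v)"
  using smooth_fun_continuous[OF v] smooth_cgrad_continuous[OF v] by auto
 have [measurable]: "v \<in> borel_measurable borel" "cgrad v \<in> borel_measurable borel"
  using cv by (auto intro: borel_measurable_continuous_onI)
 let ?B = "ball c R" let ?M = "Leb ?B"
 have iv: "integrable ?M (\<lambda>x. \<bar>v x\<bar>)" "integrable ?M (\<lambda>x. norm (cgrad v x))"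
  by (intro smooth_integrable_ball continuous_intros cv)+
 have A': "A \<in> sets ?M" using A by (auto simp: sets_restrict_space intro!: image_eqI[of _ _ A])
 have iA: "integrable ?M (\<lambda>x. indicator A x * \<bar>v x\<bar>)"
  using integrable_mult_indicator[OF A' iv(1)] by simp
 have Ai: "ballI c R (\<lambda>y. indicator A y) = emeasure lborel A"
  unfolding ballI_def using A(2) by (simp flip: indicator_inter_arith add: Int_absorb2)
 have fA: "emeasure lborel A = ennreal (measure lborel A)"
 proof (rule emeasure_eq_ennreal_measure)
  show "emeasure lborel A \<noteq> top"
   using emeasure_mono[OF A(2), of lborel] emeasure_ball[of c R] by (auto simp: top_unique)
 qed
 have "ennreal (measure lborel A * (\<integral>x. \<bar>v x\<bar> \<partial>?M)) = emeasure lborel A * ballI c R (\<lambda>x. ennreal \<bar>v x\<bar>)"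
  by (subst ballI_eq_integral) (auto simp: iv fA ennreal_mult)
 also have "\<dots> = ballI c R (\<lambda>y. ballI c R (\<lambda>x. ennreal \<bar>v x\<bar>) * indicator A y)"
  by (subst ballI_cmult) (auto simp: Ai mult.commute)
 also have "\<dots> \<le> ballI c R (\<lambda>y. ballI c R (\<lambda>x. indicator A y * ennreal \<bar>v y\<bar>) + ballI c R (\<lambda>x. ennreal (\<bar>v y - v x\<bar> - 0 * norm (y - x))))"
 proof (intro ballI_mono)
  fix y
  have "ballI c R (\<lambda>x. ennreal \<bar>v x\<bar>) * indicator A y = ballI c R (\<lambda>x. indicator A y * ennreal \<bar>v x\<bar>)"
   by (subst ballI_cmult) (auto simp: mult.commute)
  also have "\<dots> \<le> ballI c R (\<lambda>x. indicator A y * ennreal \<bar>v y\<bar> + ennreal (\<bar>v y - v x\<bar> - 0 * norm (y - x)))"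
  proof (intro ballI_mono)
   fix x
   have "ennreal \<bar>v x\<bar> \<le> ennreal (\<bar>v y\<bar> + \<bar>v y - v x\<bar>)" by (intro ennreal_leI) linarith
   thus "indicator A y * ennreal \<bar>v x\<bar> \<le> indicator A y * ennreal \<bar>v y\<bar> + ennreal (\<bar>v y - v x\<bar> - 0 * norm (y - x))"
    by (simp add: ennreal_plus split: split_indicator)
  qed
  also have "\<dots> = ballI c R (\<lambda>x. indicator A y * ennreal \<bar>v y\<bar>) + ballI c R (\<lambda>x. ennreal (\<bar>v y - v x\<bar> - 0 * norm (y - x)))"
   by (rule ballI_add) auto
  finally show "ballI c R (\<lambda>x. ennreal \<bar>v x\<bar>) * indicator A y \<le> \<dots>" .
 qed
 also have "\<dots> = ballI c R (\<lambda>y. ballI c R (\<lambda>x. indicator A y * ennreal \<bar>v y\<bar>)) + ballI c R (\<lambda>y. ballI c R (\<lambda>x. ennreal (\<bar>v y - v x\<bar> - 0 * norm (y - x))))"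
  by (rule ballI_add) measurable
 also have "\<dots> \<le> ennreal (measure lborel ?B) * ballI c R (\<lambda>y. ennreal (indicator A y * \<bar>v y\<bar>)) +
   ennreal (2 * R * 2 ^ DIM('a)) * emeasure lborel ?B * ballI c R (\<lambda>x. ennreal (max (norm (cgrad v x) - 0) 0))"
 proof (intro add_mono smooth_double_bound v R)
  have "ballI c R (\<lambda>y. ballI c R (\<lambda>x. indicator A y * ennreal \<bar>v y\<bar>)) = ballI c R (\<lambda>y. ennreal (measure lborel ?B) * ennreal (indicator A y * \<bar>v y\<bar>))"
   unfolding ballI_const emeasure_ball by (intro arg_cong[where f="ballI c R"] ext) (auto simp: mult.commute split: split_indicator)
  also have "\<dots> = ennreal (measure lborel ?B) * ballI c R (\<lambda>y. ennreal (indicator A y * \<bar>v y\<bar>))"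
   by (rule ballI_cmult) measurable
  finally show "ballI c R (\<lambda>y. ballI c R (\<lambda>x. indicator A y * ennreal \<bar>v y\<bar>)) \<le> \<dots>" by simp
 qed
 also have "\<dots> = ennreal (measure lborel ?B * (\<integral>x. indicator A x * \<bar>v x\<bar> \<partial>?M) +
   2 * R * 2 ^ DIM('a) * measure lborel ?B * (\<integral>x. norm (cgrad v x) \<partial>?M))"
 proof -
  have "ballI c R (\<lambda>y. ennreal (indicator A y * \<bar>v y\<bar>)) = ennreal (\<integral>x. indicator A x * \<bar>v x\<bar> \<partial>?M)"
   by (rule ballI_eq_integral[OF _ iA]) auto
  moreover have "ballI c R (\<lambda>x. ennreal (norm (cgrad v x))) = ennreal (\<integral>x. norm (cgrad v x) \<partial>?M)"
   by (rule ballI_eq_integral[OF _ iv(2)]) auto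
  ultimately show ?thesis using R by (simp add: emeasure_ball max_absorb1 ennreal_mult ennreal_plus integral_nonneg_AE)
 qed
 finally show ?thesis
  by (subst (asm) ennreal_le_iff) (use R in \<open>auto intro!: add_nonneg_nonneg mult_nonneg_nonneg integral_nonneg_AE\<close>)
qed

lemma SH_poincare:
 fixes f :: "'a::euclidean_space \<Rightarrow> real"
 assumes f: "SH (ball c R) f G" and R: "R > 0" and A: "A \<in> sets borel" "A \<subseteq> ball c R"
 shows "measure lborel A * (\<integral>x. \<bar>f x\<bar> \<partial>Leb (ball c R)) \<le>
   measure lborel (ball c R) * (\<integral>x. indicator A x * \<bar>f x\<bar> \<partial>Leb (ball c R)) +
   2 * R * 2 ^ DIM('a) * measure lborel (ball c R) * (\<integral>x. norm (G x) \<partial>Leb (ball c R))"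
proof -
 let ?M = "Leb (ball c R)"
 obtain v where "approx {v. smooth_fun v} ?M f G v" by (rule closE[OF f[unfolded SH_def]]) (rule that)
 note v = approxD[OF this]
 have L1: "L2 ?M (\<lambda>x. 1::real)" by (rule L2_boundedI[where B=1]) auto
 have A': "A \<in> sets ?M" using A by (auto simp: sets_restrict_space intro!: image_eqI[of _ _ A])
 have LA: "L2 ?M (\<lambda>x. indicator A x :: real)"
  by (rule L2_boundedI[where B=1]) (use A' in \<open>auto intro!: AE_I2 split: split_indicator\<close>)
 have t1: "(\<lambda>n. \<integral>x. \<bar>v n x\<bar> \<partial>?M) \<longlonglongrightarrow> (\<integral>x. \<bar>f x\<bar> \<partial>?M)"
  using L2_tendsto_norm[OF v(2,4,6) L1] by simp
 have t2: "(\<lambda>n. \<integral>x. indicator A x * \<bar>v n x\<bar> \<partial>?M) \<longlonglongrightarrow> (\<integral>x. indicator A x * \<bar>f x\<bar> \<partial>?M)"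
  using L2_tendsto_norm[OF v(2,4,6) LA] by simp
 have t3: "(\<lambda>n. \<integral>x. norm (cgrad (v n) x) \<partial>?M) \<longlonglongrightarrow> (\<integral>x. norm (G x) \<partial>?M)"
  using L2_tendsto_norm[OF v(3,5,7) L1] by simp
 show ?thesis
  by (rule LIMSEQ_le[OF tendsto_mult[OF tendsto_const t1] tendsto_add[OF tendsto_mult[OF tendsto_const t2] tendsto_mult[OF tendsto_const t3]]])
    (use smooth_poincare[OF _ R A] v(1) in auto)
qed

text \<open>The L1 inequality is applied to \<open>\<psi> * \<psi>\<close> on the ball of radius
  \<open>3 * r\<close>, with a ball of radius \<open>r\<close> disjoint from the support as the set
  \<open>A\<close>. Its gradient is twice \<open>\<psi>\<close> times the gradient of
  \<open>\<psi>\<close>, so Cauchy-Schwarz gives the L2 form. The constant is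
  \<open>2 * 3 * 2 ^ n * 3 ^ n * 2\<close>, where \<open>3 ^ n\<close> is the ratio of the
  volumes.\<close>

lemma test_poincare:
 fixes \<psi> :: "'a::euclidean_space \<Rightarrow> real"
 assumes t: "test_fun (ball c r) \<psi>" and r: "r > 0"
 shows "l2n (Leb (ball c r)) \<psi> \<le> 12 * 6 ^ DIM('a) * r * l2n (Leb (ball c r)) (cgrad \<psi>)"
proof -
 have sm: "smooth_fun \<psi>" using test_fun_smooth[OF t] .
 let ?B = "ball c (3 * r)" let ?M = "Leb ?B"
 have sub: "ball c r \<subseteq> ?B" using r by (intro subset_ball) simp
 obtain e :: 'a where e: "norm e = 1" using vector_choose_size[of 1] by auto
 define A where "A = ball (c + (2 * r) *\<^sub>R e) r"
 have A: "A \<in> sets borel" "A \<subseteq> ?B"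
 proof -
  show "A \<subseteq> ?B"
  proof
   fix x assume "x \<in> A"
   hence "dist (c + (2 * r) *\<^sub>R e) x < r" by (simp add: A_def)
   moreover have "dist c (c + (2 * r) *\<^sub>R e) = 2 * r" using r e by (simp add: dist_norm)
   ultimately show "x \<in> ?B" using dist_triangle[of c x "c + (2 * r) *\<^sub>R e"] by simp
  qed
 qed (simp add: A_def)
 have z: "\<psi> x = 0" if "x \<in> A" for x
 proof (rule test_fun_outside(1)[OF t])
  show "x \<notin> ball c r"
  proof
   assume "x \<in> ball c r"
   moreover have "dist (c + (2 * r) *\<^sub>R e) x < r" using that by (simp add: A_def)
   moreover have "dist c (c + (2 * r) *\<^sub>R e) = 2 * r" using r e by (simp add: dist_norm)
   ultimately show False using dist_triangle[of c "c + (2 * r) *\<^sub>R e" x] by (simp add: dist_commute)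
  qed
 qed
 have mA: "measure lborel ?B = 3 ^ DIM('a) * measure lborel A"
  using measure_ball_scale[of 3 r c "c + (2 * r) *\<^sub>R e"] r by (simp add: A_def)
 have mA0: "measure lborel A > 0" using measure_ball_pos[OF r] by (simp add: A_def)
 have s2: "smooth_fun (\<lambda>x. \<psi> x * \<psi> x)" by (intro smooth_fun_mult sm)
 have cg: "norm (cgrad (\<lambda>x. \<psi> x * \<psi> x) x) = 2 * (norm (\<psi> x) * norm (cgrad \<psi> x))" for x
  by (simp add: cgrad_mult[OF sm sm] abs_mult flip: scaleR_left_distrib)
 have zA: "(\<lambda>x. indicator A x * \<bar>\<psi> x * \<psi> x\<bar>) = (\<lambda>x. 0)" using z by (auto split: split_indicator)
 have L: "L2 ?M \<psi>" "L2 ?M (cgrad \<psi>)" using smooth_L2[OF sm] by auto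
 have sq: "(l2n ?M \<psi>)\<^sup>2 = (\<integral>x. \<bar>\<psi> x * \<psi> x\<bar> \<partial>?M)" unfolding l2n_sq by (simp add: power2_eq_square abs_mult)
 have "measure lborel A * (l2n ?M \<psi>)\<^sup>2 \<le> 2 * (3 * r) * 2 ^ DIM('a) * measure lborel ?B * (\<integral>x. 2 * (norm (\<psi> x) * norm (cgrad \<psi> x)) \<partial>?M)"
  using smooth_poincare[OF s2 _ A] r unfolding zA cg sq by simp
 also have "\<dots> \<le> 2 * (3 * r) * 2 ^ DIM('a) * measure lborel ?B * (2 * (l2n ?M \<psi> * l2n ?M (cgrad \<psi>)))"
  using L2_CS[OF L] r by (intro mult_left_mono) auto
 also have "\<dots> = measure lborel A * (12 * 6 ^ DIM('a) * r * l2n ?M (cgrad \<psi>) * l2n ?M \<psi>)"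
  unfolding mA by (simp add: mult_ac flip: power_mult_distrib)
 finally have "(l2n ?M \<psi>)\<^sup>2 \<le> 12 * 6 ^ DIM('a) * r * l2n ?M (cgrad \<psi>) * l2n ?M \<psi>" using mA0 by simp
 hence le: "l2n ?M \<psi> \<le> 12 * 6 ^ DIM('a) * r * l2n ?M (cgrad \<psi>)"
  using r l2n_nonneg[of ?M \<psi>] by (cases "l2n ?M \<psi> = 0") (auto simp: power2_eq_square)
 have "(\<lambda>x. if x \<in> ball c r then \<psi> x else 0) = \<psi>" "(\<lambda>x. if x \<in> ball c r then cgrad \<psi> x else 0) = cgrad \<psi>"
  using test_fun_outside[OF t] by auto
 moreover have "l2n ?M (\<lambda>x. if x \<in> ball c r then \<psi> x else 0) = l2n (Leb (ball c r)) \<psi>"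
  "l2n ?M (\<lambda>x. if x \<in> ball c r then cgrad \<psi> x else 0) = l2n (Leb (ball c r)) (cgrad \<psi>)"
  by (rule L2_extend[OF sub]; auto intro!: smooth_L2 sm)+
 ultimately show ?thesis using le by simp
qed

lemma H10_poincare:
 fixes p :: "'a::euclidean_space \<Rightarrow> real"
 assumes p: "H10 (ball c r) p P" and r: "r > 0"
 shows "l2n (Leb (ball c r)) p \<le> 12 * 6 ^ DIM('a) * r * l2n (Leb (ball c r)) P"
proof -
 let ?M = "Leb (ball c r)"
 obtain v where "approx {v. test_fun (ball c r) v} ?M p P v" by (rule closE[OF p[unfolded H10_def]]) (rule that)
 note v = approxD[OF this]
 let ?K = "12 * 6 ^ DIM('a) * r"
 have K: "?K \<ge> 0" using r by simp
 have "l2n ?M p \<le> l2n ?M (\<lambda>x. v n x - p x) + ?K * (l2n ?M P + l2n ?M (\<lambda>x. cgrad (v n) x - P x))" for n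
 proof -
  have "l2n ?M p \<le> l2n ?M (v n) + l2n ?M (\<lambda>x. v n x - p x)"
   using l2n_le_add_diff[OF v(4) v(2)[of n]] by (simp add: l2n_minus_commute)
  moreover have "l2n ?M (v n) \<le> ?K * l2n ?M (cgrad (v n))" using test_poincare[OF _ r] v(1) by blast
  moreover have "?K * l2n ?M (cgrad (v n)) \<le> ?K * (l2n ?M P + l2n ?M (\<lambda>x. cgrad (v n) x - P x))"
   by (intro mult_left_mono l2n_le_add_diff v K)
  ultimately show ?thesis by linarith
 qed
 moreover have "(\<lambda>n. l2n ?M (\<lambda>x. v n x - p x) + ?K * (l2n ?M P + l2n ?M (\<lambda>x. cgrad (v n) x - P x))) \<longlonglongrightarrow> 0 + ?K * (l2n ?M P + 0)"
  by (intro tendsto_intros v)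
 ultimately show ?thesis by (intro LIMSEQ_le_const[of _ "?K * l2n ?M P"]) auto
qed

subsection \<open>Bounded gradients and Lipschitz representatives\<close>

lemma AE_open_nonempty:
 fixes U :: "'a::euclidean_space set"
 assumes "open U" "U \<noteq> {}" "AE x in Leb U. P x" shows "\<exists>x\<in>U. P x"
proof (rule ccontr)
 assume "\<not> (\<exists>x\<in>U. P x)"
 hence "AE x in lebesgue. x \<notin> U"
  using assms(3) by (subst (asm) AE_restrict_space_iff) (use assms(1) in \<open>auto elim!: eventually_mono\<close>)
 hence "U \<in> null_sets lebesgue"
  using assms(1) by (simp add: AE_iff_null_sets)
 hence "negligible U" by (simp add: negligible_iff_null_sets)
 thus False using open_not_negligible assms by blast
qed

lemma AE_lebesgue_on_subset:
 fixes U V :: "'a::euclidean_space set"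
 assumes "AE x in Leb U. P x" "V \<subseteq> U" "U \<in> sets lebesgue" "V \<in> sets lebesgue"
 shows "AE x in Leb V. P x"
 using assms(1) by (subst (asm) AE_restrict_space_iff, use assms in simp, subst AE_restrict_space_iff)
  (use assms in \<open>auto elim!: eventually_mono\<close>)

lemma continuous_AE_le:
 fixes f g :: "'a::euclidean_space \<Rightarrow> real"
 assumes U: "open U" and c: "continuous_on U f" "continuous_on U g" and ae: "AE x in Leb U. f x \<le> g x"
  and x: "x \<in> U"
 shows "f x \<le> g x"
proof (rule ccontr)
 assume n: "\<not> f x \<le> g x"
 define V where "V = {y \<in> U. 0 < f y - g y}"
 have V: "open V" unfolding V_def
  using continuous_open_preimage[OF continuous_on_diff[OF c] U open_greaterThan, of 0]
  by (simp add: vimage_def Int_def)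
 have "x \<in> V" using n x by (simp add: V_def)
 moreover have "AE x in Leb V. f x \<le> g x"
  by (rule AE_lebesgue_on_subset[OF ae]) (use U V in \<open>auto simp: V_def\<close>)
 ultimately obtain y where "y \<in> V" "f y \<le> g y" using AE_open_nonempty[OF V] by blast
 thus False by (simp add: V_def)
qed

lemma L2_L1_bound:
 fixes f :: "'a::euclidean_space \<Rightarrow> 'b::euclidean_space"
 assumes "L2 (Leb (ball c R)) f"
 shows "(\<integral>x. norm (f x) \<partial>Leb (ball c R)) \<le> sqrt (measure lborel (ball c R)) * l2n (Leb (ball c R)) f"
  "integrable (Leb (ball c R)) (\<lambda>x. norm (f x))"
proof -
 let ?M = "Leb (ball c R)"
 have L1: "L2 ?M (\<lambda>x. 1::real)" by (rule L2_boundedI[where B=1]) auto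
 have "l2n ?M (\<lambda>x. 1::real) = sqrt (measure lborel (ball c R))"
  by (simp add: l2n_def measure_restrict_space)
 thus "(\<integral>x. norm (f x) \<partial>?M) \<le> sqrt (measure lborel (ball c R)) * l2n ?M f"
  using L2_CS[OF L1 assms] by simp
 show "integrable ?M (\<lambda>x. norm (f x))" using L2_integrable_mult[OF L1 assms] by simp
qed

lemma ballI_AE_le_L2:
 fixes f :: "'a::euclidean_space \<Rightarrow> 'b::euclidean_space"
 assumes [measurable]: "h \<in> borel_measurable borel" and L: "L2 (Leb (ball c R)) f"
  and ae: "AE x in Leb (ball c R). h x \<le> norm (f x)"
 shows "ballI c R (\<lambda>x. ennreal (h x)) \<le> ennreal (sqrt (measure lborel (ball c R)) * l2n (Leb (ball c R)) f)"
proof -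
 let ?M = "Leb (ball c R)"
 have "ballI c R (\<lambda>x. ennreal (h x)) = (\<integral>\<^sup>+x. ennreal (h x) \<partial>?M)" by (rule ballI_eq_lebesgue) measurable
 also have "\<dots> \<le> (\<integral>\<^sup>+x. ennreal (norm (f x)) \<partial>?M)"
  by (rule nn_integral_mono_AE) (use ae in \<open>auto elim!: eventually_mono intro: ennreal_leI\<close>)
 also have "\<dots> = ennreal (\<integral>x. norm (f x) \<partial>?M)"
  by (rule nn_integral_eq_integral[OF L2_L1_bound(2)[OF L]]) simp
 also have "\<dots> \<le> ennreal (sqrt (measure lborel (ball c R)) * l2n ?M f)"
  by (intro ennreal_leI L2_L1_bound L)
 finally show ?thesis .
qed

text \<open>McShane's formula: the infimum of the cones of slope \<open>L\<close> standing on the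
  graph over \<open>S\<close>.\<close>

lemma lipschitz_extension:
 fixes F :: "'a::real_normed_vector \<Rightarrow> real"
 assumes S: "S \<noteq> {}" and L: "L \<ge> 0" and F: "\<And>x y. x \<in> S \<Longrightarrow> y \<in> S \<Longrightarrow> \<bar>F x - F y\<bar> \<le> L * norm (x - y)"
 obtains h where "\<And>x y. \<bar>h x - h y\<bar> \<le> L * norm (x - y)" "\<And>x. x \<in> S \<Longrightarrow> h x = F x"
proof -
 define h where "h x = (INF s\<in>S. F s + L * norm (x - s))" for x
 obtain s0 where s0: "s0 \<in> S" using S by blast
 have bdd: "bdd_below ((\<lambda>s. F s + L * norm (x - s)) ` S)" for x
 proof (rule bdd_belowI2)
  fix s assume s: "s \<in> S"
  have "L * norm (s0 - s) \<le> L * (norm (s0 - x) + norm (x - s))"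
   using norm_triangle_ineq[of "s0 - x" "x - s"] L by (intro mult_left_mono) auto
  thus "F s0 - L * norm (s0 - x) \<le> F s + L * norm (x - s)"
   using F[OF s0 s] by (simp add: distrib_left)
 qed
 have le: "h x \<le> h y + L * norm (x - y)" for x y
 proof -
  have "h x - L * norm (x - y) \<le> F s + L * norm (y - s)" if s: "s \<in> S" for s
  proof -
   have "h x \<le> F s + L * norm (x - s)" unfolding h_def by (rule cINF_lower[OF bdd s])
   moreover have "L * norm (x - s) \<le> L * (norm (x - y) + norm (y - s))"
    using norm_triangle_ineq[of "x - y" "y - s"] L by (intro mult_left_mono) auto
   ultimately show ?thesis by (simp add: distrib_left)
  qed
  hence "h x - L * norm (x - y) \<le> h y" unfolding h_def[of y] by (intro cINF_greatest S)
  thus ?thesis by simp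
 qed
 show thesis
 proof (rule that[of h])
  show "\<bar>h x - h y\<bar> \<le> L * norm (x - y)" for x y
   using le[of x y] le[of y x] by (simp add: norm_minus_commute)
  show "h x = F x" if x: "x \<in> S" for x
  proof (rule antisym)
   show "h x \<le> F x" unfolding h_def using cINF_lower[OF bdd x, of x] by simp
   show "F x \<le> h x" unfolding h_def
    by (rule cINF_greatest[OF S]) (use F[OF x] in \<open>force simp: abs_le_iff algebra_simps\<close>)
  qed
 qed
qed

lemma ennreal_combine:
 "0 \<le> m \<Longrightarrow> 0 \<le> a \<Longrightarrow> 0 \<le> k \<Longrightarrow> 0 \<le> b \<Longrightarrow>
  ennreal m * ennreal a + ennreal m * ennreal a + ennreal k * ennreal m * ennreal b = ennreal (2 * (m * a) + k * m * b)"
 by (simp add: ennreal_mult[symmetric] ennreal_plus[symmetric] del: ennreal_plus)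

text \<open>For smooth approximants the excess of the gradient over \<open>L\<close> is at most its
  distance from \<open>G\<close>, because \<open>G\<close> is bounded by \<open>L\<close>. Hence the
  double integral of the excess of \<open>abs (f x - f y)\<close> over
  \<open>L * norm (x - y)\<close> vanishes, which is the Lipschitz property up to null sets.\<close>

lemma SH_lipschitz_rep:
 fixes f :: "'a::euclidean_space \<Rightarrow> real"
 assumes f: "SH (ball c R) f G" and R: "R > 0" and L: "L \<ge> 0" and G: "AE x in Leb (ball c R). norm (G x) \<le> L"
 obtains h where "\<And>x y. \<bar>h x - h y\<bar> \<le> L * norm (x - y)" "AE x in Leb (ball c R). f x = h x"
proof -
 let ?B = "ball c R" let ?M = "Leb ?B" let ?m = "measure lborel ?B"
 obtain v where "approx {v. smooth_fun v} ?M f G v" by (rule closE[OF f[unfolded SH_def]]) (rule that)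
 note v = approxD[OF this]
 have sm: "smooth_fun (v n)" for n using v(1) by simp
 have [measurable]: "v n \<in> borel_measurable borel" "cgrad (v n) \<in> borel_measurable borel" for n
  by (intro borel_measurable_continuous_onI smooth_fun_continuous smooth_cgrad_continuous sm)+
 have "(\<lambda>x. indicator ?B x *\<^sub>R f x) \<in> borel_measurable lebesgue"
  using SH_meas(1)[OF f] by (subst (asm) borel_measurable_restrict_space_iff) auto
 \<comment> \<open>A Borel representative makes the integrand jointly measurable, as the iterated
   integrals require.\<close>
 then obtain F where Fm[measurable]: "F \<in> borel_measurable lborel" and "AE x in lborel. indicator ?B x *\<^sub>R f x = F x"
  using completion_ex_borel_measurable_real by blast
 hence "AE x in lebesgue. x \<in> ?B \<longrightarrow> f x = F x"
  by (intro AE_completion) (auto elim!: eventually_mono)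
 hence fF: "AE x in ?M. f x = F x" by (subst AE_restrict_space_iff) auto
 define \<Phi> where "\<Phi> = ballI c R (\<lambda>x. ballI c R (\<lambda>y. ennreal (\<bar>F x - F y\<bar> - L * norm (x - y))))"
 define K where "K n = 2 * (?m * (sqrt ?m * l2n ?M (\<lambda>x. v n x - f x))) +
   2 * R * 2 ^ DIM('a) * ?m * (sqrt ?m * l2n ?M (\<lambda>x. cgrad (v n) x - G x))" for n
 have "\<Phi> \<le> ennreal (K n)" for n
 proof -
  let ?e = "\<lambda>x. \<bar>F x - v n x\<bar>"
  have "\<Phi> \<le> ballI c R (\<lambda>x. ballI c R (\<lambda>y. (ennreal (?e x) + ennreal (?e y)) + ennreal (\<bar>v n x - v n y\<bar> - L * norm (x - y))))"
   unfolding \<Phi>_def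
  proof (intro ballI_mono)
   fix x y
   have "\<bar>F x - F y\<bar> - L * norm (x - y) \<le> (?e x + ?e y) + max 0 (\<bar>v n x - v n y\<bar> - L * norm (x - y))" by linarith
   hence "ennreal (\<bar>F x - F y\<bar> - L * norm (x - y)) \<le> ennreal ((?e x + ?e y) + max 0 (\<bar>v n x - v n y\<bar> - L * norm (x - y)))"
    by (rule ennreal_leI)
   thus "ennreal (\<bar>F x - F y\<bar> - L * norm (x - y)) \<le> (ennreal (?e x) + ennreal (?e y)) + ennreal (\<bar>v n x - v n y\<bar> - L * norm (x - y))"
    by (simp add: ennreal_plus ennreal_max_0)
  qed
  also have "\<dots> = (ballI c R (\<lambda>x. ennreal (?e x) * emeasure lborel ?B) + ballI c R (\<lambda>x. ballI c R (\<lambda>y. ennreal (?e y)))) +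
    ballI c R (\<lambda>x. ballI c R (\<lambda>y. ennreal (\<bar>v n x - v n y\<bar> - L * norm (x - y))))"
   by (simp add: ballI_add ballI_const)
  also have "ballI c R (\<lambda>x. ennreal (?e x) * emeasure lborel ?B) = ennreal ?m * ballI c R (\<lambda>x. ennreal (?e x))"
   by (subst ballI_cmult[symmetric]) (auto simp: emeasure_ball mult.commute)
  also have "ballI c R (\<lambda>x. ballI c R (\<lambda>y. ennreal (?e y))) = ennreal ?m * ballI c R (\<lambda>x. ennreal (?e x))"
   by (simp add: ballI_const emeasure_ball mult.commute)
  also have "(ennreal ?m * ballI c R (\<lambda>x. ennreal (?e x)) + ennreal ?m * ballI c R (\<lambda>x. ennreal (?e x))) +
    ballI c R (\<lambda>x. ballI c R (\<lambda>y. ennreal (\<bar>v n x - v n y\<bar> - L * norm (x - y))))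
   \<le> (ennreal ?m * ennreal (sqrt ?m * l2n ?M (\<lambda>x. v n x - f x)) + ennreal ?m * ennreal (sqrt ?m * l2n ?M (\<lambda>x. v n x - f x)))
    + ennreal (2 * R * 2 ^ DIM('a)) * emeasure lborel ?B * ennreal (sqrt ?m * l2n ?M (\<lambda>x. cgrad (v n) x - G x))"
  proof (intro add_mono mult_left_mono order_trans[OF smooth_double_bound[OF sm R]] ballI_AE_le_L2 L2_diff v)
   show "AE x in ?M. \<bar>F x - v n x\<bar> \<le> norm (v n x - f x)" "AE x in ?M. \<bar>F x - v n x\<bar> \<le> norm (v n x - f x)"
    using fF by (eventually_elim, simp)+
   show "AE x in ?M. max (norm (cgrad (v n) x) - L) 0 \<le> norm (cgrad (v n) x - G x)"
    using G
   proof eventually_elim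
    case (elim x)
    thus ?case using norm_triangle_ineq2[of "cgrad (v n) x" "G x"] by auto
   qed
  qed auto
  also have "\<dots> = ennreal (K n)"
   unfolding K_def emeasure_ball by (rule ennreal_combine) (use R in auto)
  finally show ?thesis .
 qed
 moreover have "K \<longlonglongrightarrow> 2 * (?m * (sqrt ?m * 0)) + 2 * R * 2 ^ DIM('a) * ?m * (sqrt ?m * 0)"
  unfolding K_def by (intro tendsto_intros v)
 hence "(\<lambda>n. ennreal (K n)) \<longlonglongrightarrow> ennreal 0" by (intro tendsto_ennrealI) simp
 ultimately have "\<Phi> \<le> 0" by (intro LIMSEQ_le_const[where X="\<lambda>n. ennreal (K n)"]) auto
 hence "\<Phi> = 0" by simp
 hence "AE x in lborel. ballI c R (\<lambda>y. ennreal (\<bar>F x - F y\<bar> - L * norm (x - y))) * indicator ?B x = 0"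
  unfolding \<Phi>_def ballI_def[of c R "\<lambda>x. ballI c R (\<lambda>y. ennreal (\<bar>F x - F y\<bar> - L * norm (x - y)))"]
  by (subst (asm) nn_integral_0_iff_AE) auto
 hence ae1: "AE x in lborel. x \<in> ?B \<longrightarrow> (AE y in lborel. y \<in> ?B \<longrightarrow> \<bar>F x - F y\<bar> \<le> L * norm (x - y))"
 proof eventually_elim
  case (elim x)
  show ?case
  proof
   assume "x \<in> ?B"
   hence "ballI c R (\<lambda>y. ennreal (\<bar>F x - F y\<bar> - L * norm (x - y))) = 0" using elim by simp
   hence "AE y in lborel. ennreal (\<bar>F x - F y\<bar> - L * norm (x - y)) * indicator ?B y = 0"
    unfolding ballI_def by (subst (asm) nn_integral_0_iff_AE) auto
   thus "AE y in lborel. y \<in> ?B \<longrightarrow> \<bar>F x - F y\<bar> \<le> L * norm (x - y)"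
    by eventually_elim (auto simp: ennreal_eq_0_iff)
  qed
 qed
 \<comment> \<open>Points for which the bound holds against almost every other point. Two such
   points are compared through a third point close to the first that is good for both.\<close>
 define S where "S = {x \<in> ?B. AE y in lborel. y \<in> ?B \<longrightarrow> \<bar>F x - F y\<bar> \<le> L * norm (x - y)}"
 have aeS: "AE x in ?M. x \<in> S"
  using AE_completion[OF ae1] by (subst AE_restrict_space_iff) (auto simp: S_def elim!: eventually_mono)
 have SL: "\<bar>F x - F y\<bar> \<le> L * norm (x - y)" if x: "x \<in> S" and y: "y \<in> S" for x y
 proof (rule field_le_epsilon)
  fix e :: real assume e: "e > 0"
  \<comment> \<open>The detour through a point at distance at most \<open>d\<close> costs
    \<open>2 * L * d \<le> e\<close>; adding 1 avoids division by 0.\<close>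
  define d where "d = e / (2 * L + 1)"
  have d: "d > 0" using e L by (simp add: d_def)
  have Ld: "2 * L * d \<le> e" using L e by (simp add: d_def field_simps)
  let ?V = "ball x d \<inter> ?B"
  have "x \<in> ?V" using x d by (auto simp: S_def)
  hence V: "open ?V" "?V \<noteq> {}" by blast+
  have "AE z in lborel. z \<in> ?B \<longrightarrow> \<bar>F x - F z\<bar> \<le> L * norm (x - z) \<and> \<bar>F y - F z\<bar> \<le> L * norm (y - z)"
   using x y unfolding S_def by (auto elim!: eventually_elim2)
  hence "AE z in Leb ?V. \<bar>F x - F z\<bar> \<le> L * norm (x - z) \<and> \<bar>F y - F z\<bar> \<le> L * norm (y - z)"
   by (subst AE_restrict_space_iff) (auto dest!: AE_completion elim!: eventually_mono)
  then obtain z where z: "z \<in> ?V" "\<bar>F x - F z\<bar> \<le> L * norm (x - z)" "\<bar>F y - F z\<bar> \<le> L * norm (y - z)"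
   using AE_open_nonempty[OF V] by blast
  have "norm (x - z) \<le> d" using z by (simp add: dist_norm)
  hence "L * norm (x - z) \<le> L * d" "L * norm (y - z) \<le> L * (norm (x - y) + d)"
   using norm_triangle_ineq[of "y - x" "x - z"] L by (auto intro!: mult_left_mono simp: norm_minus_commute)
  thus "\<bar>F x - F y\<bar> \<le> L * norm (x - y) + e" using z Ld by (simp add: distrib_left)
 qed
 have "S \<noteq> {}" using AE_open_nonempty[OF _ _ aeS] R by auto
 from lipschitz_extension[OF this L SL] obtain h where h: "\<And>x y. \<bar>h x - h y\<bar> \<le> L * norm (x - y)" "\<And>x. x \<in> S \<Longrightarrow> h x = F x"
  by metis
 have "AE x in ?M. f x = h x" using fF aeS by eventually_elim (simp add: h)
 thus thesis using that h(1) by blast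
qed

lemma lipschitz_continuous:
 fixes h :: "'a::real_normed_vector \<Rightarrow> real"
 assumes "\<And>x y. \<bar>h x - h y\<bar> \<le> L * norm (x - y)" shows "continuous_on S h"
proof (rule continuous_onI)
 fix x and e :: real assume e: "e > 0"
 have L: "\<bar>L\<bar> + 1 > 0" by simp
 show "\<exists>d>0. \<forall>x'\<in>S. dist x' x < d \<longrightarrow> dist (h x') (h x) \<le> e"
 proof (intro exI[of _ "e / (\<bar>L\<bar> + 1)"] conjI ballI impI)
  fix x' assume "dist x' x < e / (\<bar>L\<bar> + 1)"
  hence "(\<bar>L\<bar> + 1) * norm (x' - x) \<le> e" using L by (simp add: dist_norm field_simps)
  moreover have "L * norm (x' - x) \<le> (\<bar>L\<bar> + 1) * norm (x' - x)" by (intro mult_right_mono) auto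
  ultimately show "dist (h x') (h x) \<le> e" using assms[of x' x] by (simp add: dist_real_def)
 qed (use e in auto)
qed

lemma SH_lipschitz:
 fixes f :: "'a::euclidean_space \<Rightarrow> real"
 assumes f: "SH (ball c R) f G" and R: "R > 0" and L: "L \<ge> 0" and G: "AE x in Leb (ball c R). norm (G x) \<le> L"
  and c: "continuous_on (ball c R) f" and x: "x \<in> ball c R" and y: "y \<in> ball c R"
 shows "\<bar>f x - f y\<bar> \<le> L * norm (x - y)"
proof -
 from SH_lipschitz_rep[OF f R L G] obtain h where h: "\<And>x y. \<bar>h x - h y\<bar> \<le> L * norm (x - y)" "AE x in Leb (ball c R). f x = h x"
  by metis
 have ch: "continuous_on (ball c R) h" using lipschitz_continuous h(1) by blast
 have ae: "AE x in Leb (ball c R). f x \<le> h x" "AE x in Leb (ball c R). h x \<le> f x"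
  using h(2) by (auto elim!: eventually_mono)
 have "f z = h z" if "z \<in> ball c R" for z
  using continuous_AE_le[OF open_ball c ch ae(1) that] continuous_AE_le[OF open_ball ch c ae(2) that] by simp
 thus ?thesis using h(1) x y by simp
qed

section \<open>Elliptic operators and harmonic replacement\<close>

lemma quad_add_left: "quad a x (\<xi> + \<xi>') \<zeta> = quad a x \<xi> \<zeta> + quad a x \<xi>' \<zeta>"
 and quad_add_right: "quad a x \<xi> (\<zeta> + \<zeta>') = quad a x \<xi> \<zeta> + quad a x \<xi> \<zeta>'"
 and quad_scaleR_left: "quad a x (c *\<^sub>R \<xi>) \<zeta> = c * quad a x \<xi> \<zeta>"
 and quad_scaleR_right: "quad a x \<xi> (c *\<^sub>R \<zeta>) = c * quad a x \<xi> \<zeta>"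
 by (simp_all add: quad_def inner_add_left algebra_simps sum.distrib sum_distrib_left)

lemma quad_zero: "quad a x 0 \<zeta> = 0" "quad a x \<xi> 0 = 0" by (simp_all add: quad_def)

lemma quad_minus_left: "quad a x (- \<xi>) \<zeta> = - quad a x \<xi> \<zeta>"
 using quad_scaleR_left[of a x "-1"] by simp
lemma quad_minus_right: "quad a x \<xi> (- \<zeta>) = - quad a x \<xi> \<zeta>"
 using quad_scaleR_right[of a x _ "-1"] by simp
lemma quad_diff_left: "quad a x (\<xi> - \<xi>') \<zeta> = quad a x \<xi> \<zeta> - quad a x \<xi>' \<zeta>"
 using quad_add_left[of a x \<xi> "- \<xi>'"] by (simp add: quad_minus_left)
lemma quad_diff_right: "quad a x \<xi> (\<zeta> - \<zeta>') = quad a x \<xi> \<zeta> - quad a x \<xi> \<zeta>'"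
 using quad_add_right[of a x _ \<zeta> "- \<zeta>'"] by (simp add: quad_minus_right)

lemma Ball_nonneg_quadratic:
 fixes A B C :: real
 assumes "\<And>t. 0 \<le> A + 2 * t * B + t\<^sup>2 * C" "0 \<le> A" "0 \<le> C" shows "\<bar>B\<bar> \<le> sqrt A * sqrt C"
proof -
 have "2 * t * \<bar>B\<bar> \<le> (sqrt A)\<^sup>2 + t\<^sup>2 * (sqrt C)\<^sup>2" for t
  using assms(1)[of "t"] assms(1)[of "- t"] assms(2,3) by (simp add: abs_if)
 thus ?thesis by (rule discriminant_le) (use assms in auto)
qed

text \<open>The first variation argument: a small step against the sign of \<open>B\<close> would
  make the expression negative.\<close>

lemma linear_term_zero:
 fixes B C :: real
 assumes "\<And>t. 0 \<le> 2 * t * B + t\<^sup>2 * C" shows "B = 0"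
proof (rule ccontr)
 assume B: "B \<noteq> 0"
 define s where "s = 1 / (\<bar>C\<bar> + 1)"
 have s: "s > 0" by (simp add: s_def)
 have sC: "s * \<bar>C\<bar> \<le> 1" by (simp add: s_def field_simps)
 have "2 * (- s * B) * B + (- s * B)\<^sup>2 * C = - (s * B\<^sup>2) * (2 - s * C)" by (simp add: power2_eq_square algebra_simps)
 moreover have "2 - s * C > 0" using sC s by (smt (verit) abs_le_iff mult_left_mono)
 moreover have "s * B\<^sup>2 > 0" using s B by simp
 ultimately show False using assms[of "- s * B"] by (smt (verit) mult_pos_pos mult_minus_left)
qed

locale elliptic =
 fixes \<Omega> :: "'a::euclidean_space set" and a :: "'a \<Rightarrow> 'a \<Rightarrow> 'a \<Rightarrow> real" and lam Lam K :: real
 assumes openO: "open \<Omega>" and bddO: "bounded \<Omega>" and ell: "elliptic_field \<Omega> a lam Lam"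
  and Kpos: "K > 0" and Klip: "K_Lip \<Omega> a K"
begin

lemma lam: "0 < lam" "lam \<le> Lam" "0 < Lam" using ell by (auto simp: elliptic_field_def)

definition good :: "'a \<Rightarrow> bool" where
 "good x \<longleftrightarrow> (\<forall>i\<in>Basis. \<forall>j\<in>Basis. a x i j = a x j i) \<and>
   (\<forall>\<xi>. lam * (norm \<xi>)\<^sup>2 \<le> quad a x \<xi> \<xi> \<and> quad a x \<xi> \<xi> \<le> Lam * (norm \<xi>)\<^sup>2)"

lemma good_sym: assumes "good x" shows "quad a x \<xi> \<zeta> = quad a x \<zeta> \<xi>"
proof -
 have "quad a x \<xi> \<zeta> = (\<Sum>j\<in>Basis. \<Sum>i\<in>Basis. a x i j * (\<xi> \<bullet> j) * (\<zeta> \<bullet> i))"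
  unfolding quad_def by (rule sum.swap)
 also have "\<dots> = quad a x \<zeta> \<xi>" unfolding quad_def
  using assms by (intro sum.cong refl) (simp add: good_def mult_ac)
 finally show ?thesis .
qed

lemma good_bound: assumes "good x" shows "\<bar>quad a x \<xi> \<zeta>\<bar> \<le> Lam * (norm \<xi> * norm \<zeta>)"
proof -
 have b: "0 \<le> quad a x v v" "quad a x v v \<le> Lam * (norm v)\<^sup>2" for v
  using assms lam(1) mult_nonneg_nonneg[of lam "(norm v)\<^sup>2"] unfolding good_def by (smt (verit) zero_le_power2)+
 have "\<bar>quad a x \<xi> \<zeta>\<bar> \<le> sqrt (quad a x \<xi> \<xi>) * sqrt (quad a x \<zeta> \<zeta>)"
 proof (rule Ball_nonneg_quadratic)
  fix t
  have "quad a x (\<xi> + t *\<^sub>R \<zeta>) (\<xi> + t *\<^sub>R \<zeta>) = quad a x \<xi> \<xi> + 2 * t * quad a x \<xi> \<zeta> + t\<^sup>2 * quad a x \<zeta> \<zeta>"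
   using good_sym[OF assms, of \<zeta> \<xi>]
   by (simp add: quad_add_left quad_add_right quad_scaleR_left quad_scaleR_right power2_eq_square algebra_simps)
  thus "0 \<le> quad a x \<xi> \<xi> + 2 * t * quad a x \<xi> \<zeta> + t\<^sup>2 * quad a x \<zeta> \<zeta>" using b(1) by metis
 qed (rule b)+
 also have "\<dots> \<le> sqrt (Lam * (norm \<xi>)\<^sup>2) * sqrt (Lam * (norm \<zeta>)\<^sup>2)"
  by (intro mult_mono real_sqrt_le_mono b real_sqrt_ge_zero mult_nonneg_nonneg) (use lam in auto)
 also have "\<dots> = Lam * (norm \<xi> * norm \<zeta>)" using lam by (simp add: real_sqrt_mult)
 finally show ?thesis .
qed

lemma setsO: "\<Omega> \<in> sets lebesgue" using openO by simp

lemma AE_good: assumes "U \<subseteq> \<Omega>" "open U" shows "AE x in Leb U. good x"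
 using ell assms setsO unfolding good_def elliptic_field_def
 by (intro AE_lebesgue_on_subset[OF _ assms(1)]) auto

lemma quad_meas:
 assumes U: "U \<subseteq> \<Omega>" "open U" and [measurable]: "F \<in> borel_measurable (Leb U)" "G \<in> borel_measurable (Leb U)"
 shows "(\<lambda>x. quad a x (F x) (G x)) \<in> borel_measurable (Leb U)"
proof -
 have eq: "Leb U = restrict_space (Leb \<Omega>) U"
  using U setsO by (simp add: restrict_restrict_space Int_absorb1)
 have "(\<lambda>x. a x i j) \<in> borel_measurable (Leb U)" if "i \<in> Basis" "j \<in> Basis" for i j
 proof -
  have "(\<lambda>x. a x i j) \<in> borel_measurable (Leb \<Omega>)" using ell that unfolding elliptic_field_def by blast
  thus ?thesis unfolding eq by (rule measurable_restrict_space1)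
 qed
 thus ?thesis unfolding quad_def by (intro borel_measurable_sum borel_measurable_times borel_measurable_inner borel_measurable_const assms) auto
qed

definition E :: "'a set \<Rightarrow> ('a \<Rightarrow> 'a) \<Rightarrow> ('a \<Rightarrow> 'a) \<Rightarrow> real" where
 "E U F G = (\<integral>x. quad a x (F x) (G x) \<partial>Leb U)"

context
 fixes U assumes U: "U \<subseteq> \<Omega>" "open U"
begin

lemma E_integrable: assumes "L2 (Leb U) F" "L2 (Leb U) G"
 shows "integrable (Leb U) (\<lambda>x. quad a x (F x) (G x))"
proof (rule L2_integrable_le[OF assms quad_meas[OF U], where c=Lam])
 show "AE x in Leb U. \<bar>quad a x (F x) (G x)\<bar> \<le> Lam * (norm (F x) * norm (G x))"
  using AE_good[OF U] by eventually_elim (rule good_bound)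
qed (use assms in \<open>simp_all add: L2_def\<close>)

lemma E_add_left: "L2 (Leb U) F \<Longrightarrow> L2 (Leb U) F' \<Longrightarrow> L2 (Leb U) G \<Longrightarrow>
 E U (\<lambda>x. F x + F' x) G = E U F G + E U F' G"
 unfolding E_def quad_add_left by (intro Bochner_Integration.integral_add E_integrable)

lemma E_sym: assumes "L2 (Leb U) F" "L2 (Leb U) G" shows "E U F G = E U G F"
 unfolding E_def
 by (rule integral_cong_AE)
   (use AE_good[OF U] in \<open>auto elim!: eventually_mono simp: good_sym intro!: borel_measurable_integrable E_integrable assms\<close>)

lemma E_bound: assumes "L2 (Leb U) F" "L2 (Leb U) G"
 shows "\<bar>E U F G\<bar> \<le> Lam * (l2n (Leb U) F * l2n (Leb U) G)"
proof -
 have "\<bar>E U F G\<bar> \<le> (\<integral>x. \<bar>quad a x (F x) (G x)\<bar> \<partial>Leb U)" unfolding E_def by (rule integral_abs_bound)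
 also have "\<dots> \<le> (\<integral>x. Lam * (norm (F x) * norm (G x)) \<partial>Leb U)"
  by (rule integral_mono_AE)
    (use AE_good[OF U] in \<open>auto intro!: integrable_abs E_integrable assms integrable_mult_right L2_integrable_mult good_bound elim!: eventually_mono\<close>)
 also have "\<dots> \<le> Lam * (l2n (Leb U) F * l2n (Leb U) G)"
  using L2_CS[OF assms] lam by simp
 finally show ?thesis .
qed

lemma E_lower: assumes "L2 (Leb U) F" shows "lam * (l2n (Leb U) F)\<^sup>2 \<le> E U F F"
proof -
 have "(\<integral>x. lam * (norm (F x))\<^sup>2 \<partial>Leb U) \<le> E U F F" unfolding E_def
 proof (rule integral_mono_AE[OF integrable_mult_right[OF L2_integrable[OF assms]] E_integrable[OF assms assms]])
  show "AE x in Leb U. lam * (norm (F x))\<^sup>2 \<le> quad a x (F x) (F x)"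
   using AE_good[OF U] by eventually_elim (simp add: good_def)
 qed
 thus ?thesis by (simp add: l2n_sq)
qed

lemma E_nonneg: "L2 (Leb U) F \<Longrightarrow> 0 \<le> E U F F"
 using E_lower[of F] lam(1) by (smt (verit) mult_nonneg_nonneg zero_le_power2)

lemma E_scaleR_left: "E U (\<lambda>x. c *\<^sub>R F x) G = c * E U F G" unfolding E_def quad_scaleR_left by simp
lemma E_scaleR_right: "E U G (\<lambda>x. c *\<^sub>R F x) = c * E U G F" unfolding E_def quad_scaleR_right by simp
lemma E_minus_left: "E U (\<lambda>x. - F x) G = - E U F G" unfolding E_def quad_minus_left by simp
lemma E_minus_right: "E U G (\<lambda>x. - F x) = - E U G F" unfolding E_def quad_minus_right by simp
lemma E_add_right: "L2 (Leb U) F \<Longrightarrow> L2 (Leb U) F' \<Longrightarrow> L2 (Leb U) G \<Longrightarrow>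
 E U G (\<lambda>x. F x + F' x) = E U G F + E U G F'"
 unfolding E_def quad_add_right by (intro Bochner_Integration.integral_add E_integrable)
lemma E_diff_left: "L2 (Leb U) F \<Longrightarrow> L2 (Leb U) F' \<Longrightarrow> L2 (Leb U) G \<Longrightarrow>
 E U (\<lambda>x. F x - F' x) G = E U F G - E U F' G"
 unfolding E_def quad_diff_left by (intro Bochner_Integration.integral_diff E_integrable)
lemma E_diff_right: "L2 (Leb U) F \<Longrightarrow> L2 (Leb U) F' \<Longrightarrow> L2 (Leb U) G \<Longrightarrow>
 E U G (\<lambda>x. F x - F' x) = E U G F - E U G F'"
 unfolding E_def quad_diff_right by (intro Bochner_Integration.integral_diff E_integrable)

lemma E_square: "L2 (Leb U) F \<Longrightarrow> L2 (Leb U) G \<Longrightarrow>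
 E U (\<lambda>x. F x + t *\<^sub>R G x) (\<lambda>x. F x + t *\<^sub>R G x) = E U F F + 2 * t * E U F G + t\<^sup>2 * E U G G"
 using L2_scaleR[of "Leb U" G t] L2_add[of "Leb U" F "\<lambda>x. t *\<^sub>R G x"]
 by (simp add: E_add_left E_add_right E_scaleR_left E_scaleR_right E_sym[of F G] power2_eq_square algebra_simps)

lemma E_tendsto:
 assumes F: "\<And>n. L2 (Leb U) (F n)" "L2 (Leb U) F'" "L2lim (Leb U) F F'"
  and G: "\<And>n. L2 (Leb U) (G n)" "L2 (Leb U) G'" "L2lim (Leb U) G G'"
 shows "(\<lambda>n. E U (F n) (G n)) \<longlonglongrightarrow> E U F' G'"
proof -
 let ?n = "l2n (Leb U)"
 let ?b = "\<lambda>n. Lam * (?n (\<lambda>x. F n x - F' x) * (?n G' + ?n (\<lambda>x. G n x - G' x))) + Lam * (?n F' * ?n (\<lambda>x. G n x - G' x))"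
 have bd: "norm (E U (F n) (G n) - E U F' G') \<le> ?b n" for n
 proof -
  have "E U (F n) (G n) - E U F' G' = E U (\<lambda>x. F n x - F' x) (G n) + E U F' (\<lambda>x. G n x - G' x)"
   using F G by (simp add: E_diff_left E_diff_right)
  moreover have "\<bar>E U (\<lambda>x. F n x - F' x) (G n)\<bar> \<le> Lam * (?n (\<lambda>x. F n x - F' x) * ?n (G n))"
   by (intro E_bound L2_diff F G)
  moreover have "Lam * (?n (\<lambda>x. F n x - F' x) * ?n (G n)) \<le> Lam * (?n (\<lambda>x. F n x - F' x) * (?n G' + ?n (\<lambda>x. G n x - G' x)))"
   using l2n_le_add_diff[OF G(1,2), of n] lam by (intro mult_left_mono) auto
  moreover have "\<bar>E U F' (\<lambda>x. G n x - G' x)\<bar> \<le> Lam * (?n F' * ?n (\<lambda>x. G n x - G' x))"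
   by (intro E_bound L2_diff F G)
  ultimately show ?thesis by simp
 qed
 have "?b \<longlonglongrightarrow> Lam * (0 * (?n G' + 0)) + Lam * (?n F' * 0)"
  by (rule tendsto_add[OF tendsto_mult[OF tendsto_const tendsto_mult[OF F(3) tendsto_add[OF tendsto_const G(3)]]]
     tendsto_mult[OF tendsto_const tendsto_mult[OF tendsto_const G(3)]]])
 hence lim: "?b \<longlonglongrightarrow> 0" by simp
 have "(\<lambda>n. E U (F n) (G n) - E U F' G') \<longlonglongrightarrow> 0"
  by (rule Lim_null_comparison[OF always_eventually[OF allI[OF bd]] lim])
 thus ?thesis by (rule LIM_zero_cancel)
qed

end

lemma E_restrict:
 assumes "V \<subseteq> U" "U \<subseteq> \<Omega>" "open U" "open V"
 shows "E U F (\<lambda>x. if x \<in> V then G x else 0) = E V F G"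
proof -
 have eq: "Leb V = restrict_space (Leb U) V"
  using assms by (simp add: restrict_restrict_space Int_absorb1)
 have VU: "V \<inter> space (Leb U) \<in> sets (Leb U)"
  using assms by (auto simp: sets_restrict_space Int_absorb2 intro!: image_eqI[of _ _ V])
 show ?thesis unfolding E_def eq integral_restrict_space[OF VU]
  by (intro Bochner_Integration.integral_cong refl) (auto simp: quad_zero)
qed

definition harm :: "'a set \<Rightarrow> ('a \<Rightarrow> real) \<Rightarrow> ('a \<Rightarrow> 'a) \<Rightarrow> bool" where
 "harm U h H \<longleftrightarrow> SH U h H \<and> (\<forall>\<psi>. test_fun U \<psi> \<longrightarrow> E U H (cgrad \<psi>) = 0)"

text \<open>Testing with nonnegative members of \<open>H10\<close>, rather than nonnegative test
  functions, makes truncations and functions like \<open>z * z * max u 0\<close> directly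
  admissible.\<close>

definition subsol :: "'a set \<Rightarrow> ('a \<Rightarrow> real) \<Rightarrow> ('a \<Rightarrow> 'a) \<Rightarrow> bool" where
 "subsol U u G \<longleftrightarrow> SH U u G \<and> (\<forall>p P. H10 U p P \<longrightarrow> (AE x in Leb U. 0 \<le> p x) \<longrightarrow> E U G P \<le> 0)"

lemma harm_H10:
 assumes h: "harm U h H" and p: "H10 U p P" and U: "U \<subseteq> \<Omega>" "open U"
 shows "E U H P = 0"
proof -
 let ?M = "Leb U"
 have L: "L2 ?M H" using h SH_L2(2) by (auto simp: harm_def)
 obtain v where "approx {v. test_fun U v} ?M p P v" by (rule closE[OF p[unfolded H10_def]]) (rule that)
 note v = approxD[OF this]
 have z: "(\<lambda>n::nat. l2n ?M (\<lambda>x. H x - H x)) \<longlonglongrightarrow> 0" by (simp add: l2n_def)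
 have "(\<lambda>n. E U H (cgrad (v n))) \<longlonglongrightarrow> E U H P"
  by (rule E_tendsto[OF U L L z v(3,5,7)])
 moreover have "E U H (cgrad (v n)) = 0" for n using h v(1) by (auto simp: harm_def)
 ultimately show ?thesis by (simp add: LIMSEQ_const_iff)
qed

lemma harm_subsol: "harm U h H \<Longrightarrow> U \<subseteq> \<Omega> \<Longrightarrow> open U \<Longrightarrow> subsol U h H"
 unfolding subsol_def using harm_H10 by (auto simp: harm_def)

lemma subset_bounded: "U \<subseteq> \<Omega> \<Longrightarrow> bounded U" using bddO bounded_subset by blast

lemma harm_add:
 assumes h: "harm U h H" and k: "harm U k H'" and U: "U \<subseteq> \<Omega>" "open U"
 shows "harm U (\<lambda>x. h x + k x) (\<lambda>x. H x + H' x)"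
 unfolding harm_def
proof (intro conjI allI impI)
 have S: "SH U h H" "SH U k H'" using h k by (auto simp: harm_def)
 thus "SH U (\<lambda>x. h x + k x) (\<lambda>x. H x + H' x)" by (rule SH_add)
 fix \<psi> assume t: "test_fun U \<psi>"
 have "L2 (Leb U) (cgrad \<psi>)" by (rule smooth_L2(2)[OF test_fun_smooth[OF t] U(2) subset_bounded[OF U(1)]])
 thus "E U (\<lambda>x. H x + H' x) (cgrad \<psi>) = 0"
  using E_add_left[OF U SH_L2(2)[OF S(1)] SH_L2(2)[OF S(2)]] h k t by (simp add: harm_def)
qed

lemma harm_cmult: "harm U h H \<Longrightarrow> U \<subseteq> \<Omega> \<Longrightarrow> open U \<Longrightarrow> harm U (\<lambda>x. c * h x) (\<lambda>x. c *\<^sub>R H x)"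
 unfolding harm_def by (simp add: SH_cmult E_scaleR_left)

lemma harm_const: "U \<subseteq> \<Omega> \<Longrightarrow> open U \<Longrightarrow> harm U (\<lambda>x. c) (\<lambda>x. 0)"
 unfolding harm_def by (simp add: SH_const subset_bounded E_def quad_zero)

lemma harm_diff:
 assumes h: "harm U h H" and k: "harm U k H'" and U: "U \<subseteq> \<Omega>" "open U"
 shows "harm U (\<lambda>x. h x - k x) (\<lambda>x. H x - H' x)"
 using harm_add[OF h harm_cmult[OF k U, of "-1"] U] by simp

lemma harm_const_diff: "harm U h H \<Longrightarrow> U \<subseteq> \<Omega> \<Longrightarrow> open U \<Longrightarrow> harm U (\<lambda>x. c - h x) (\<lambda>x. - H x)"
 using harm_diff[OF harm_const, of U h H c] by simp

lemma harm_restrict: assumes "harm U h H" "V \<subseteq> U" "U \<subseteq> \<Omega>" "open U" "open V" shows "harm V h H"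
 unfolding harm_def
proof (intro conjI allI impI)
 show "SH V h H" by (rule SH_restrict[OF _ assms(2)]) (use assms in \<open>auto simp: harm_def\<close>)
 fix \<psi> assume t: "test_fun V \<psi>"
 have "(\<lambda>x. if x \<in> V then cgrad \<psi> x else 0) = cgrad \<psi>" using test_fun_outside[OF t] by auto
 thus "E V H (cgrad \<psi>) = 0"
  using E_restrict[OF assms(2-5), of H "cgrad \<psi>"] assms(1) test_fun_mono[OF t assms(2)] by (simp add: harm_def)
qed

lemma subsol_restrict: assumes "subsol U h H" "V \<subseteq> U" "U \<subseteq> \<Omega>" "open U" "open V" shows "subsol V h H"
 unfolding subsol_def
proof (intro conjI allI impI)
 show "SH V h H" by (rule SH_restrict[OF _ assms(2)]) (use assms in \<open>auto simp: subsol_def\<close>)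
 fix p P assume p: "H10 V p P" "AE x in Leb V. 0 \<le> p x"
 have "AE x in lebesgue. x \<in> V \<longrightarrow> 0 \<le> p x" using p(2) assms(5) by (subst (asm) AE_restrict_space_iff) auto
 hence "AE x in Leb U. 0 \<le> (if x \<in> V then p x else 0)"
  using assms(4) by (subst AE_restrict_space_iff) (auto elim!: eventually_mono)
 thus "E V H P \<le> 0"
  using H10_extend[OF p(1) assms(2)] assms(1,4,5) unfolding subsol_def E_restrict[OF assms(2-5), of H P, symmetric]
  by simp
qed

text \<open>The direct method. Gradients of a minimizing sequence of test functions are Cauchy by
  the parallelogram identity, the functions themselves by \<open>test_poincare\<close>, and
  vanishing of the first variation at the limit is the equation.\<close>

lemma replacement_exists:
 assumes B: "ball c r \<subseteq> \<Omega>" and r: "r > 0" and u: "SH (ball c r) u G"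
 obtains p P where "H10 (ball c r) p P" "harm (ball c r) (\<lambda>x. u x + p x) (\<lambda>x. G x + P x)"
proof -
 let ?B = "ball c r" let ?M = "Leb ?B" let ?n = "l2n ?M"
 note U = B open_ball[of c r]
 have G: "L2 ?M G" using SH_L2(2)[OF u] .
 have Lt: "L2 ?M (cgrad \<psi>)" "L2 ?M \<psi>" if "test_fun ?B \<psi>" for \<psi>
  using smooth_L2[OF test_fun_smooth[OF that]] by auto
 define I where "I F = E ?B (\<lambda>x. G x + F x) (\<lambda>x. G x + F x)" for F
 have I0: "0 \<le> I F" if "L2 ?M F" for F unfolding I_def by (intro E_nonneg[OF U] L2_add G that)
 define S where "S = (\<lambda>\<psi>. I (cgrad \<psi>)) ` {\<psi>. test_fun ?B \<psi>}"
 define m where "m = Inf S"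
 have bS: "bdd_below S" unfolding S_def by (rule bdd_belowI2[where m=0]) (auto intro: I0 Lt)
 have Sne: "S \<noteq> {}" unfolding S_def using test_fun_zero by blast
 have mle: "m \<le> I (cgrad \<psi>)" if "test_fun ?B \<psi>" for \<psi>
  unfolding m_def by (rule cInf_lower[OF _ bS]) (use that in \<open>auto simp: S_def\<close>)
 have "\<forall>n. \<exists>\<psi>. test_fun ?B \<psi> \<and> I (cgrad \<psi>) < m + inverse (real (Suc n))"
 proof
  fix n
  have "Inf S < m + inverse (real (Suc n))" unfolding m_def by simp
  then obtain s where "s \<in> S" "s < m + inverse (real (Suc n))" using cInf_less_iff[OF Sne bS] by blast
  thus "\<exists>\<psi>. test_fun ?B \<psi> \<and> I (cgrad \<psi>) < m + inverse (real (Suc n))" by (auto simp: S_def)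
 qed
 from choice[OF this] obtain \<psi> where \<psi>: "\<forall>n. test_fun ?B (\<psi> n) \<and> I (cgrad (\<psi> n)) < m + inverse (real (Suc n))"
  by (elim exE)
 have t: "test_fun ?B (\<psi> n)" for n using \<psi> by simp
 have Il: "I (cgrad (\<psi> n)) < m + inverse (real (Suc n))" for n using \<psi> by simp
 have cg: "cgrad (\<lambda>x. \<psi> n x - \<psi> k x) = (\<lambda>x. cgrad (\<psi> n) x - cgrad (\<psi> k) x)" for n k
  using cgrad_diff[OF test_fun_smooth[OF t] test_fun_smooth[OF t]] by blast
 \<comment> \<open>At the midpoint of two members the functional is at least \<open>m\<close>, while
   the parallelogram identity puts it below the mean of the two values by a quarter of the energy of
   half their difference squared out, that is, by one eighth... of \<open>E ?B ?D ?D\<close> twice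
   over; solving for \<open>E ?B ?D ?D\<close> leaves twice the sum of the two errors.\<close>
 have cau: "lam * (?n (\<lambda>x. cgrad (\<psi> n) x - cgrad (\<psi> k) x))\<^sup>2 \<le> 2 * inverse (real (Suc n)) + 2 * inverse (real (Suc k))" for n k
 proof -
  let ?F = "cgrad (\<psi> n)" let ?F' = "cgrad (\<psi> k)"
  have L: "L2 ?M ?F" "L2 ?M ?F'" by (intro Lt t)+
  let ?h = "\<lambda>x. (1/2) * (\<psi> n x + \<psi> k x)"
  have th: "test_fun ?B ?h" by (intro test_fun_cmult test_fun_add t)
  have ch: "cgrad ?h = (\<lambda>x. (1/2) *\<^sub>R (?F x + ?F' x))"
   using cgrad_cmult[OF smooth_fun_add[OF test_fun_smooth[OF t[of n]] test_fun_smooth[OF t[of k]]], of "1/2"]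
    cgrad_add[OF test_fun_smooth[OF t[of n]] test_fun_smooth[OF t[of k]]] by auto
  let ?A = "\<lambda>x. G x + ?F x" let ?D = "\<lambda>x. ?F' x - ?F x"
  have LA: "L2 ?M ?A" "L2 ?M ?D" by (intro L2_add L2_diff G L)+
  have 1: "I ?F = E ?B ?A ?A" by (simp add: I_def)
  have 2: "I ?F' = E ?B ?A ?A + 2 * E ?B ?A ?D + E ?B ?D ?D"
   using E_square[OF U LA, of 1] by (simp add: I_def)
  have e3: "(\<lambda>x. G x + (1/2) *\<^sub>R (?F x + ?F' x)) = (\<lambda>x. ?A x + (1/2) *\<^sub>R ?D x)"
   by (auto simp: algebra_simps simp flip: scaleR_add_left)
  have 3: "I (cgrad ?h) = E ?B ?A ?A + E ?B ?A ?D + (1/4) * E ?B ?D ?D"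
   unfolding I_def ch e3 using E_square[OF U LA, of "1/2"] by (simp add: power2_eq_square)
  have "lam * (?n ?D)\<^sup>2 \<le> E ?B ?D ?D" by (rule E_lower[OF U LA(2)])
  moreover have "?n ?D = ?n (\<lambda>x. ?F x - ?F' x)" by (rule l2n_minus_commute)
  ultimately show ?thesis using 1 2 3 mle[OF th] Il[of n] Il[of k] by simp
 qed
 have small: "\<exists>N. \<forall>m\<ge>N. \<forall>n\<ge>N. ?n (\<lambda>x. cgrad (\<psi> m) x - cgrad (\<psi> n) x) < e" if e: "e > 0" for e
 proof -
  have "0 < lam * e\<^sup>2 / 4" using lam e by simp
  then obtain N where N: "inverse (real (Suc N)) < lam * e\<^sup>2 / 4" using reals_Archimedean by blast
  have "?n (\<lambda>x. cgrad (\<psi> m) x - cgrad (\<psi> n) x) < e" if "m \<ge> N" "n \<ge> N" for m n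
  proof -
   have "inverse (real (Suc m)) \<le> inverse (real (Suc N))" "inverse (real (Suc n)) \<le> inverse (real (Suc N))"
    using that by (auto intro!: le_imp_inverse_le)
   hence "lam * (?n (\<lambda>x. cgrad (\<psi> m) x - cgrad (\<psi> n) x))\<^sup>2 < lam * e\<^sup>2" using cau[of m n] N by linarith
   hence "(?n (\<lambda>x. cgrad (\<psi> m) x - cgrad (\<psi> n) x))\<^sup>2 < e\<^sup>2" using lam by simp
   thus ?thesis by (rule power2_less_imp_less) (use e in simp)
  qed
  thus ?thesis by blast
 qed
 obtain P where P: "L2 ?M P" "(\<lambda>n. ?n (\<lambda>x. cgrad (\<psi> n) x - P x)) \<longlonglongrightarrow> 0"
  by (rule L2_complete[OF Lt(1)[OF t] small], assumption) (rule that; assumption)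
 let ?K = "12 * 6 ^ DIM('a) * r"
 have K: "?K > 0" using r by simp
 have small2: "\<exists>N. \<forall>m\<ge>N. \<forall>n\<ge>N. ?n (\<lambda>x. \<psi> m x - \<psi> n x) < e" if e: "e > 0" for e
 proof -
  obtain N where N: "\<forall>m\<ge>N. \<forall>n\<ge>N. ?n (\<lambda>x. cgrad (\<psi> m) x - cgrad (\<psi> n) x) < e / ?K" using small[of "e / ?K"] e K by auto
  have "?n (\<lambda>x. \<psi> m x - \<psi> n x) \<le> ?K * ?n (\<lambda>x. cgrad (\<psi> m) x - cgrad (\<psi> n) x)" for m n
   using test_poincare[OF test_fun_diff[OF t t] r, of m n] unfolding cg .
  moreover have "?K * ?n (\<lambda>x. cgrad (\<psi> m) x - cgrad (\<psi> n) x) < e" if "m \<ge> N" "n \<ge> N" for m n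
   using N that K by (simp add: pos_less_divide_eq mult.commute)
  ultimately show ?thesis by (meson le_less_trans)
 qed
 obtain p where p: "L2 ?M p" "(\<lambda>n. ?n (\<lambda>x. \<psi> n x - p x)) \<longlonglongrightarrow> 0"
  by (rule L2_complete[OF Lt(2)[OF t] small2], assumption) (rule that; assumption)
 have H: "H10 ?B p P" unfolding H10_def
  by (rule closI[where v=\<psi>]) (use t Lt[OF t] p P in auto)
 have conv: "(\<lambda>n. ?n (\<lambda>x. (G x + (cgrad (\<psi> n) x + T x)) - (G x + (P x + T x)))) \<longlonglongrightarrow> 0" for T
  using P(2) by simp
 have Ilim: "(\<lambda>n. I (\<lambda>x. cgrad (\<psi> n) x + T x)) \<longlonglongrightarrow> I (\<lambda>x. P x + T x)" if T: "L2 ?M T" for T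
  unfolding I_def by (intro E_tendsto[OF U] L2_add G P(1) T Lt(1)[OF t] conv)
 have IP: "I P \<le> m"
 proof (rule LIMSEQ_le[of "\<lambda>n. I (cgrad (\<psi> n))" _ "\<lambda>n. m + inverse (real (Suc n))"])
  show "(\<lambda>n. I (cgrad (\<psi> n))) \<longlonglongrightarrow> I P" using Ilim[OF L2_zero] by simp
  show "(\<lambda>n. m + inverse (real (Suc n))) \<longlonglongrightarrow> m" using tendsto_add[OF tendsto_const LIMSEQ_inverse_real_of_nat] by simp
 qed (use Il in \<open>auto intro: less_imp_le\<close>)
 have "E ?B (\<lambda>x. G x + P x) (cgrad e) = 0" if e: "test_fun ?B e" for e
 proof (rule linear_term_zero)
  fix s :: real
  have "m \<le> I (\<lambda>x. cgrad (\<psi> n) x + s *\<^sub>R cgrad e x)" for n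
  proof -
   have "test_fun ?B (\<lambda>x. \<psi> n x + s * e x)" by (intro test_fun_add test_fun_cmult t e)
   moreover have "cgrad (\<lambda>x. \<psi> n x + s * e x) = (\<lambda>x. cgrad (\<psi> n) x + s *\<^sub>R cgrad e x)"
    using cgrad_add[OF test_fun_smooth[OF t] smooth_fun_cmult[OF test_fun_smooth[OF e]]] cgrad_cmult[OF test_fun_smooth[OF e]] by auto
   ultimately show ?thesis using mle by metis
  qed
  hence "m \<le> I (\<lambda>x. P x + s *\<^sub>R cgrad e x)"
   by (intro LIMSEQ_le_const[OF Ilim[OF L2_scaleR[OF Lt(1)[OF e]]]]) auto
  also have "I (\<lambda>x. P x + s *\<^sub>R cgrad e x) = I P + 2 * s * E ?B (\<lambda>x. G x + P x) (cgrad e) + s\<^sup>2 * E ?B (cgrad e) (cgrad e)"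
   using E_square[OF U L2_add[OF G P(1)] Lt(1)[OF e], of s] by (simp add: I_def add.assoc)
  finally show "0 \<le> 2 * s * E ?B (\<lambda>x. G x + P x) (cgrad e) + s\<^sup>2 * E ?B (cgrad e) (cgrad e)" using IP by simp
 qed
 hence "harm ?B (\<lambda>x. u x + p x) (\<lambda>x. G x + P x)"
  unfolding harm_def using SH_add[OF u H10_SH[OF H]] by simp
 thus thesis using that H by blast
qed

end

section \<open>Comparison principle and interior bounds for solutions\<close>

context elliptic
begin

text \<open>If \<open>w \<le> q\<close> then \<open>q - max (q - w) 0 = w\<close>, so the positive
  part of \<open>w\<close> has exactly the form treated in \<open>H10_pos_diff\<close>.\<close>

lemma H10_dominated:
 assumes w: "SH U w W" and q: "H10 U q Q" and le: "AE x in Leb U. w x \<le> q x" and U: "U \<subseteq> \<Omega>" "open U"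
 shows "H10 U (\<lambda>x. max (w x) 0) (\<lambda>x. if w x > 0 then W x else 0)"
proof -
 note b = subset_bounded[OF U(1)]
 have S: "SH U (\<lambda>x. q x - w x) (\<lambda>x. Q x - W x)" by (rule SH_diff[OF H10_SH[OF q] w])
 note H = H10_pos_diff[OF q S]
 have ae: "AE x in Leb U. max (q x - max (q x - w x) 0) 0 = max (w x) 0"
  using le by eventually_elim auto
 show ?thesis
  by (rule H10_cong_AE[OF H SH_meas[OF SH_pos[OF w]] ae SH_unique[OF H10_SH[OF H] SH_pos[OF w] U(2) b ae]])
qed

lemma l2n_zero_AE: assumes "L2 M f" "l2n M f \<le> 0" shows "AE x in M. f x = 0"
proof -
 have "(l2n M f)\<^sup>2 = 0" using assms(2) l2n_nonneg[of M f] by simp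
 hence "AE x in M. (norm (f x))\<^sup>2 = 0"
  using L2_integrable[OF assms(1)] unfolding l2n_sq by (subst (asm) integral_nonneg_eq_0_iff_AE) auto
 thus ?thesis by eventually_elim simp
qed

text \<open>Domination by a member of \<open>H10\<close> expresses that \<open>w\<close> is
  nonpositive on the sphere. Testing with the positive part of \<open>w\<close> annihilates its
  gradient, and the Poincare inequality then annihilates the positive part.\<close>

lemma subsol_comparison:
 assumes B: "ball c r \<subseteq> \<Omega>" and r: "r > 0" and w: "subsol (ball c r) w W" and q: "H10 (ball c r) q Q"
  and le: "AE x in Leb (ball c r). w x \<le> q x"
 shows "AE x in Leb (ball c r). w x \<le> 0"
proof -
 let ?B = "ball c r" let ?M = "Leb ?B"
 have S: "SH ?B w W" using w by (simp add: subsol_def)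
 let ?P = "\<lambda>x. if w x > 0 then W x else 0"
 have H: "H10 ?B (\<lambda>x. max (w x) 0) ?P" by (rule H10_dominated[OF S q le B open_ball])
 have "E ?B W ?P \<le> 0" using w H unfolding subsol_def by simp
 moreover have "E ?B W ?P = E ?B ?P ?P"
  unfolding E_def by (intro Bochner_Integration.integral_cong refl) (simp add: quad_zero)
 moreover have "lam * (l2n ?M ?P)\<^sup>2 \<le> E ?B ?P ?P" by (rule E_lower[OF B open_ball H10_L2(2)[OF H]])
 ultimately have "lam * (l2n ?M ?P)\<^sup>2 \<le> 0" by linarith
 hence "l2n ?M ?P = 0" using lam(1) by (simp add: mult_le_0_iff)
 hence "l2n ?M (\<lambda>x. max (w x) 0) \<le> 0" using H10_poincare[OF H r] by simp
 from l2n_zero_AE[OF H10_L2(1)[OF H] this] show ?thesis by eventually_elim auto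
qed

text \<open>The single point where (K-Lip) enters; every regularity statement about solutions is
  drawn from this bound.\<close>

lemma harm_gradient_bound:
 assumes h: "harm (ball c d) h H" and B: "ball c d \<subseteq> \<Omega>" and d: "0 < d" "d < 1"
  and S: "AE x in Leb (ball c d). \<bar>h x\<bar> \<le> S"
 shows "AE x in Leb (ball c (d/2)). norm (H x) \<le> K / d * S"
proof -
 let ?M = "Leb (ball c d)"
 have SHh: "SH (ball c d) h H" using h by (simp add: harm_def)
 have m[measurable]: "h \<in> borel_measurable ?M" using SH_meas(1)[OF SHh] .
 have "esssup (Leb (ball c (d/2))) (\<lambda>x. ereal (norm (H x))) \<le> ereal (K / d) * esssup ?M (\<lambda>x. ereal \<bar>h x\<bar>)"
  using Klip d B SH_H1[OF SHh] SH_weak_grad[OF SHh] h unfolding K_Lip_def harm_def E_def by auto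
 also have "\<dots> \<le> ereal (K / d) * ereal S"
  by (intro ereal_mult_left_mono esssup_I) (use S Kpos d in auto)
 finally have "esssup (Leb (ball c (d/2))) (\<lambda>x. ereal (norm (H x))) \<le> ereal (K / d * S)" by simp
 thus ?thesis
  using esssup_AE[of "\<lambda>x. ereal (norm (H x))" "Leb (ball c (d/2))"]
  by (auto elim!: eventually_mono dest: order_trans)
qed

lemma harm_cong_AE:
 assumes "harm U h H" "h' \<in> borel_measurable (Leb U)" "AE x in Leb U. h x = h' x"
 shows "harm U h' H"
 using assms SH_cong_AE[of U h H h' H] SH_meas(2)[of U h H] unfolding harm_def by auto

text \<open>Comparison with the constants \<open>m\<close> and \<open>M\<close> bounds the
  replacement, and boundedness is what makes the gradient estimate usable. That estimate holds on
  the half ball only, hence continuity is claimed only there.\<close>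

lemma harmonic_replacement:
 assumes B: "ball c (2 * r) \<subseteq> \<Omega>" and r: "r > 0" "2 * r < 1" and u: "SH (ball c (2 * r)) u G"
  and m: "AE x in Leb (ball c (2 * r)). m \<le> u x" and M: "AE x in Leb (ball c (2 * r)). u x \<le> M"
 obtains h H where "harm (ball c (2 * r)) h H" "H10 (ball c (2 * r)) (\<lambda>x. h x - u x) (\<lambda>x. H x - G x)"
  "continuous_on (ball c r) h" "\<And>x. x \<in> ball c r \<Longrightarrow> m \<le> h x \<and> h x \<le> M"
  "AE x in Leb (ball c (2 * r)). m \<le> h x \<and> h x \<le> M"
proof -
 let ?B = "ball c (2 * r)" let ?M = "Leb ?B"
 have r2: "2 * r > 0" using r by simp
 note U = B open_ball[of c "2 * r"]
 obtain p P where p: "H10 ?B p P" and h0: "harm ?B (\<lambda>x. u x + p x) (\<lambda>x. G x + P x)"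
  by (rule replacement_exists[OF B r2 u]) (rule that; assumption)
 let ?h = "\<lambda>x. u x + p x" let ?H = "\<lambda>x. G x + P x"
 have hm: "harm ?B (\<lambda>x. m - ?h x) (\<lambda>x. - ?H x)" by (rule harm_const_diff[OF h0 U])
 have hM: "harm ?B (\<lambda>x. ?h x - M) (\<lambda>x. ?H x - 0)" by (rule harm_diff[OF h0 harm_const[OF U] U])
 have 1: "AE x in ?M. m - ?h x \<le> 0"
  by (rule subsol_comparison[OF B r2 harm_subsol[OF hm U] H10_minus[OF p]]) (use m in \<open>eventually_elim, simp\<close>)
 have 2: "AE x in ?M. ?h x - M \<le> 0"
  by (rule subsol_comparison[OF B r2 harm_subsol[OF hM U] p]) (use M in \<open>eventually_elim, simp\<close>)
 have bd: "AE x in ?M. m \<le> ?h x \<and> ?h x \<le> M" using 1 2 by eventually_elim auto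
 define S where "S = max \<bar>m\<bar> \<bar>M\<bar>"
 have bdS: "AE x in ?M. \<bar>?h x\<bar> \<le> S" using bd by eventually_elim (auto simp: S_def)
 have "AE x in Leb (ball c (2 * r / 2)). norm (?H x) \<le> K / (2 * r) * S"
  by (rule harm_gradient_bound[OF h0 B r2 r(2) bdS])
 hence gb: "AE x in Leb (ball c r). norm (?H x) \<le> K / (2 * r) * S"
  by (simp only: nonzero_mult_div_cancel_left[OF zero_neq_numeral[symmetric]])
 have sub: "ball c r \<subseteq> ?B" using r by (intro subset_ball) simp
 have SHs: "SH (ball c r) ?h ?H" by (rule SH_restrict[OF _ sub]) (use h0 in \<open>auto simp: harm_def\<close>)
 have "0 \<le> K / (2 * r) * S" using Kpos r by (simp add: S_def)
 from SH_lipschitz_rep[OF SHs r(1) this gb] obtain g where g: "\<And>x y. \<bar>g x - g y\<bar> \<le> K / (2 * r) * S * norm (x - y)"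
  "AE x in Leb (ball c r). ?h x = g x" by metis
 have cg: "continuous_on X g" for X using lipschitz_continuous g(1) by blast
 \<comment> \<open>The Lipschitz representative is inserted on the half ball; elsewhere the
   replacement keeps its original values.\<close>
 define h where "h x = (if x \<in> ball c r then g x else ?h x)" for x
 have hae: "AE x in ?M. ?h x = h x"
  using g(2) by (subst (asm) AE_restrict_space_iff, simp, subst AE_restrict_space_iff) (auto simp: h_def elim!: eventually_mono)
 have mh: "?h \<in> borel_measurable ?M" using h0 SH_meas(1) by (auto simp: harm_def)
 have "h \<in> borel_measurable ?M" unfolding h_def
  by (rule measurable_If_set[OF continuous_measurable_lebesgue_on[OF cg open_ball] mh])
   (use sub in \<open>auto simp: sets_restrict_space Int_absorb1 intro!: image_eqI[of _ _ "ball c r"]\<close>)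
 hence hh: "harm ?B h ?H" by (rule harm_cong_AE[OF h0 _ hae])
 have mu: "u \<in> borel_measurable ?M" by (rule SH_meas(1)[OF u])
 show thesis
 proof (rule that[OF hh])
  have eqP: "(\<lambda>x. G x + P x - G x) = P" by simp
  have ae: "AE x in ?M. p x = h x - u x" using hae by eventually_elim simp
  show "H10 ?B (\<lambda>x. h x - u x) (\<lambda>x. ?H x - G x)" unfolding eqP
   by (rule H10_cong_AE[OF p borel_measurable_diff[OF \<open>h \<in> borel_measurable ?M\<close> mu] H10_meas(2)[OF p] ae]) simp
  show ch: "continuous_on (ball c r) h" using cg by (subst continuous_on_cong[of _ "ball c r" h g]) (auto simp: h_def)
  show ae: "AE x in ?M. m \<le> h x \<and> h x \<le> M" using bd hae by eventually_elim auto
  have ae': "AE x in Leb (ball c r). m \<le> h x \<and> h x \<le> M" by (rule AE_lebesgue_on_subset[OF ae sub]) auto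
  show "m \<le> h x \<and> h x \<le> M" if "x \<in> ball c r" for x
   using continuous_AE_le[OF open_ball continuous_on_const ch _ that, of m] continuous_AE_le[OF open_ball ch continuous_on_const _ that, of M] ae'
   by (auto elim!: eventually_mono)
 qed
qed

text \<open>Near the weighted maximum \<open>y\<close> one has
  \<open>abs h \<le> 2 ^ Q * abs (h y)\<close> in a ball of radius \<open>d\<close>, so the slope
  there is at most \<open>K / d * 2 ^ Q * abs (h y)\<close>. Over the distance
  \<open>sig Q * d\<close> the function changes by at most half of \<open>abs (h y)\<close>. The
  bound \<open>1/64\<close> leaves the room that \<open>spread\<close> requires.\<close>

definition sig :: "nat \<Rightarrow> real" where "sig Q = min (1/64) (1 / (2 * K * 2 ^ Q))"

lemma sig: "0 < sig Q" "sig Q \<le> 1/64" "K * 2 ^ Q * sig Q \<le> 1/2"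
proof -
 show "0 < sig Q" "sig Q \<le> 1/64" using Kpos by (auto simp: sig_def)
 have "K * 2 ^ Q * sig Q \<le> K * 2 ^ Q * (1 / (2 * K * 2 ^ Q))" using Kpos by (intro mult_left_mono) (auto simp: sig_def)
 thus "K * 2 ^ Q * sig Q \<le> 1/2" using Kpos by simp
qed

text \<open>At a maximum point of \<open>(R - norm (x - c)) ^ Q * abs (h x)\<close> the sup of \<open>h\<close> on a comparable ball is
 controlled by the value at the point, so the gradient bound makes \<open>h\<close> almost constant nearby.\<close>
lemma weighted_maximum:
 assumes h: "harm (ball c R) h H" and B: "ball c R \<subseteq> \<Omega>" and R: "0 < R" "R < 1" and ch: "continuous_on (cball c R) h"
  and Q: "Q > 0"
 obtains y d where "0 < d" "2 * d = R - norm (y - c)" "\<And>x. x \<in> cball c (R/2) \<Longrightarrow> (R/2) ^ Q * \<bar>h x\<bar> \<le> (2 * d) ^ Q * \<bar>h y\<bar>"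
   "\<And>x. norm (x - y) \<le> sig Q * d \<Longrightarrow> \<bar>h x - h y\<bar> \<le> \<bar>h y\<bar> / 2"
proof -
 define f where "f x = (R - norm (x - c)) ^ Q * \<bar>h x\<bar>" for x
 show thesis
 proof (cases "\<forall>x\<in>ball c R. h x = 0")
  case True
  have s: "sig Q * (R/2) \<le> 1/64 * (R/2)" using sig(2)[of Q] R by (intro mult_right_mono) auto
  show thesis
  proof (rule that[of "R/2" c])
   show "\<bar>h x - h c\<bar> \<le> \<bar>h c\<bar> / 2" if "norm (x - c) \<le> sig Q * (R/2)" for x
   proof -
    have "norm (x - c) < R" using that s R by linarith
    thus ?thesis using True R by (simp add: dist_norm norm_minus_commute)
   qed
   show "x \<in> cball c (R/2) \<Longrightarrow> (R/2) ^ Q * \<bar>h x\<bar> \<le> (2 * (R/2)) ^ Q * \<bar>h c\<bar>" for x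
    using True R by (simp add: dist_norm norm_minus_commute)
  qed (use R in auto)
 next
  case False
  then obtain x0 where x0: "x0 \<in> ball c R" "h x0 \<noteq> 0" by blast
  have "continuous_on (cball c R) f" unfolding f_def by (intro continuous_intros ch)
  then obtain y where y: "y \<in> cball c R" "\<And>x. x \<in> cball c R \<Longrightarrow> f x \<le> f y"
   using continuous_attains_sup[of "cball c R" f] R by auto
  have "0 < f x0" using x0 by (simp add: f_def dist_norm norm_minus_commute)
  also have "f x0 \<le> f y" using x0 by (intro y) auto
  finally have fy: "0 < f y" .
  have "R - norm (y - c) \<noteq> 0" "h y \<noteq> 0" using fy Q by (auto simp: f_def zero_power)
  hence d2: "R - norm (y - c) > 0" using y(1) by (simp add: dist_norm norm_minus_commute)
  \<comment> \<open>In the ball of radius \<open>d\<close> about \<open>y\<close> the distance to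
    the sphere is at least half of its value at \<open>y\<close>, whence the factor
    \<open>2 ^ Q\<close> in the bound for \<open>h\<close>.\<close>
  define d where "d = (R - norm (y - c)) / 2"
  have d: "d > 0" "2 * d = R - norm (y - c)" using d2 by (auto simp: d_def)
  define T where "T = \<bar>h y\<bar>"
  have T: "T > 0" using \<open>h y \<noteq> 0\<close> by (simp add: T_def)
  have fy2: "f y = (2 * d) ^ Q * T" by (simp add: f_def d T_def)
  have d1: "d < 1" using d R norm_ge_zero[of "y - c"] by linarith
  have far: "d \<le> R - norm (x - c) \<and> x \<in> ball c R" if "x \<in> ball y d" for x
  proof -
   have "norm (x - y) < d" using that by (simp add: dist_norm norm_minus_commute)
   hence "norm (x - c) < R - d" using norm_triangle_ineq[of "x - y" "y - c"] d(2) by simp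
   thus ?thesis using d(1) by (simp add: dist_norm norm_minus_commute)
  qed
  have sub: "ball y d \<subseteq> ball c R" using far by blast
  have bd: "\<bar>h x\<bar> \<le> 2 ^ Q * T" if "x \<in> ball y d" for x
  proof -
   have "d ^ Q * \<bar>h x\<bar> \<le> f x" unfolding f_def using far[OF that] d by (intro mult_right_mono power_mono) auto
   also have "f x \<le> f y" using far[OF that] by (intro y) auto
   finally have "d ^ Q * \<bar>h x\<bar> \<le> d ^ Q * (2 ^ Q * T)" unfolding fy2 by (simp add: power_mult_distrib mult_ac)
   thus ?thesis using d by simp
  qed
  note U = B open_ball[of c R]
  have hy: "harm (ball y d) h H" by (rule harm_restrict[OF h sub U open_ball])
  have By: "ball y d \<subseteq> \<Omega>" using sub B by blast
  have "AE x in Leb (ball y d). \<bar>h x\<bar> \<le> 2 ^ Q * T" using bd by (intro AE_I2) simp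
  from harm_gradient_bound[OF hy By d(1) d1 this]
  have gb: "AE x in Leb (ball y (d/2)). norm (H x) \<le> K / d * (2 ^ Q * T)" .
  have sub2: "ball y (d/2) \<subseteq> ball y d" using d by (intro subset_ball) simp
  have SHy: "SH (ball y (d/2)) h H" by (rule SH_restrict[OF _ sub2]) (use hy in \<open>auto simp: harm_def\<close>)
  have c2: "continuous_on (ball y (d/2)) h"
   by (rule continuous_on_subset[OF ch]) (use sub sub2 ball_subset_cball in blast)
  have L0: "0 \<le> K / d * (2 ^ Q * T)" using Kpos d T by simp
  have lip: "\<bar>h x - h y\<bar> \<le> T / 2" if "norm (x - y) \<le> sig Q * d" for x
  proof -
   have "sig Q * d \<le> 1/64 * d" using sig(2)[of Q] d by (intro mult_right_mono) auto
   hence "norm (x - y) < d/2" using that d(1) by linarith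
   hence x: "x \<in> ball y (d/2)" "y \<in> ball y (d/2)" using d(1) by (auto simp: dist_norm norm_minus_commute)
   have "\<bar>h x - h y\<bar> \<le> K / d * (2 ^ Q * T) * norm (x - y)"
    by (rule SH_lipschitz[OF SHy _ L0 gb c2 x]) (use d in simp)
   also have "\<dots> \<le> K / d * (2 ^ Q * T) * (sig Q * d)" by (rule mult_left_mono[OF that L0])
   also have "\<dots> = (K * 2 ^ Q * sig Q) * T" using d by simp
   also have "\<dots> \<le> 1/2 * T" using sig(3)[of Q] T by (intro mult_right_mono) auto
   finally show ?thesis by simp
  qed
  show thesis
  proof (rule that[OF d])
   fix x assume x: "x \<in> cball c (R/2)"
   hence "(R/2) ^ Q * \<bar>h x\<bar> \<le> f x" unfolding f_def using R
    by (intro mult_right_mono power_mono) (auto simp: dist_norm norm_minus_commute)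
   also have "f x \<le> f y" using x R by (intro y) auto
   finally show "(R/2) ^ Q * \<bar>h x\<bar> \<le> (2 * d) ^ Q * \<bar>h y\<bar>" by (simp add: fy2 T_def)
  qed (use lip in \<open>simp add: T_def\<close>)
 qed
qed

text \<open>The 4 comes from \<open>abs h\<close> being at least half of \<open>abs (h y)\<close> on
  the small ball, whose volume gives the denominator; \<open>16 ^ n\<close> is the square of the
  weight ratio \<open>4 ^ n\<close>.\<close>

definition CLB :: real where
 "CLB = 16 ^ DIM('a) * 4 / (sig DIM('a) ^ DIM('a) * measure lborel (ball (0::'a) 1))"

lemma CLB_pos: "CLB > 0"
 unfolding CLB_def using sig(1) measure_ball_pos[of 1 "0::'a"] by (intro divide_pos_pos mult_pos_pos) auto

lemma measure_ball_unit: "r \<ge> 0 \<Longrightarrow> measure lborel (ball (c::'a) r) = r ^ DIM('a) * measure lborel (ball (0::'a) 1)"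
 using content_ball_conv_unit_ball[of r c] by simp

lemma l2n_lower:
 assumes f: "L2 (Leb U) f" and V: "V \<in> lmeasurable" "V \<subseteq> U" "U \<in> sets lebesgue" and t: "t \<ge> 0" "\<And>x. x \<in> V \<Longrightarrow> t \<le> \<bar>f x\<bar>"
 shows "t\<^sup>2 * measure lebesgue V \<le> (l2n (Leb U) (f :: 'a \<Rightarrow> real))\<^sup>2"
proof -
 have V': "V \<in> sets lebesgue" using V(1) by auto
 interpret finite_measure "Leb V" by (rule finite_measure_lebesgue_on[OF V(1)])
 note R = L2_restrict[OF V(2) V' V(3) f]
 have "t\<^sup>2 * measure lebesgue V = (\<integral>x. t\<^sup>2 \<partial>Leb V)" using V' by (simp add: measure_restrict_space)
 also have "\<dots> \<le> (l2n (Leb V) f)\<^sup>2" unfolding l2n_sq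
  by (rule integral_mono[OF _ L2_integrable[OF R(1)]]) (use t in \<open>auto simp: abs_le_square_iff[symmetric]\<close>)
 also have "\<dots> \<le> (l2n (Leb U) f)\<^sup>2" by (rule power_mono[OF R(2)]) simp
 finally show ?thesis .
qed

text \<open>The ball of radius \<open>sig n * d\<close> about the weighted maximum carries L2 mass
  of order \<open>d ^ n * (h y) ^ 2\<close>. The weight with exponent \<open>n\<close>, squared,
  supplies \<open>d ^ (2 * n)\<close>; one factor \<open>d ^ n\<close> is matched by that mass, the
  other is bounded by \<open>R ^ n\<close>.\<close>

lemma harm_local_bound:
 assumes h: "harm (ball c R) h H" and B: "ball c R \<subseteq> \<Omega>" and R: "0 < R" "R < 1" and ch: "continuous_on (cball c R) h"
  and x: "x \<in> cball c (R/2)"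
 shows "R ^ DIM('a) * (h x)\<^sup>2 \<le> CLB * (l2n (Leb (ball c R)) h)\<^sup>2"
proof -
 let ?n = "DIM('a)" let ?w = "measure lborel (ball (0::'a) 1)"
 obtain y d where y: "0 < d" "2 * d = R - norm (y - c)" "\<And>x. x \<in> cball c (R/2) \<Longrightarrow> (R/2) ^ ?n * \<bar>h x\<bar> \<le> (2 * d) ^ ?n * \<bar>h y\<bar>"
   "\<And>x. norm (x - y) \<le> sig ?n * d \<Longrightarrow> \<bar>h x - h y\<bar> \<le> \<bar>h y\<bar> / 2"
  using weighted_maximum[OF h B R ch, of ?n] by (metis DIM_positive)
 have dR: "d \<le> R" using y(1,2) norm_ge_zero[of "y - c"] by linarith
 have s: "sig ?n * d > 0" "sig ?n * d \<le> d" using sig(1,2)[of ?n] y(1) by (auto simp: mult_le_cancel_right1)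
 have "ball y (sig ?n * d) \<subseteq> ball c R"
 proof
  fix z assume "z \<in> ball y (sig ?n * d)"
  hence "norm (z - y) < d" using s by (simp add: dist_norm norm_minus_commute)
  hence "norm (z - c) < R" using norm_triangle_ineq[of "z - y" "y - c"] y(1,2) by simp
  thus "z \<in> ball c R" by (simp add: dist_norm norm_minus_commute)
 qed
 moreover have "\<bar>h y\<bar> / 2 \<le> \<bar>h z\<bar>" if "z \<in> ball y (sig ?n * d)" for z
  using y(4)[of z] that by (simp add: dist_norm norm_minus_commute abs_if split: if_splits)
 ultimately have "(\<bar>h y\<bar> / 2)\<^sup>2 * measure lebesgue (ball y (sig ?n * d)) \<le> (l2n (Leb (ball c R)) h)\<^sup>2"
  using h SH_L2(1) by (intro l2n_lower) (auto simp: harm_def)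
 hence low: "(h y)\<^sup>2 / 4 * ((sig ?n * d) ^ ?n * ?w) \<le> (l2n (Leb (ball c R)) h)\<^sup>2"
  using measure_ball_unit[of "sig ?n * d" y] s by (simp add: power_divide measure_completion)
 have "R ^ ?n * \<bar>h x\<bar> \<le> 4 ^ ?n * d ^ ?n * \<bar>h y\<bar>"
 proof -
  have "R ^ ?n * \<bar>h x\<bar> = 2 ^ ?n * ((R/2) ^ ?n * \<bar>h x\<bar>)" by (simp add: power_divide)
  also have "\<dots> \<le> 2 ^ ?n * ((2 * d) ^ ?n * \<bar>h y\<bar>)" by (intro mult_left_mono y(3) x) auto
  also have "\<dots> = (2 * 2) ^ ?n * d ^ ?n * \<bar>h y\<bar>" unfolding power_mult_distrib by (simp only: mult_ac)
  also have "\<dots> = 4 ^ ?n * d ^ ?n * \<bar>h y\<bar>" by simp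
  finally show ?thesis .
 qed
 hence "(R ^ ?n * \<bar>h x\<bar>)\<^sup>2 \<le> (4 ^ ?n * d ^ ?n * \<bar>h y\<bar>)\<^sup>2" using R by (intro power_mono) auto
 moreover have "((4::real) ^ ?n)\<^sup>2 = 16 ^ ?n" by (simp add: power2_eq_square flip: power_mult_distrib)
 ultimately have "R ^ ?n * R ^ ?n * (h x)\<^sup>2 \<le> 16 ^ ?n * (d ^ ?n * d ^ ?n) * (h y)\<^sup>2"
  unfolding power_mult_distrib power2_abs power2_eq_square[of "R ^ _"] power2_eq_square[of "d ^ _"] by simp
 hence "R ^ ?n * (R ^ ?n * (h x)\<^sup>2) \<le> 16 ^ ?n * (d ^ ?n * d ^ ?n * (h y)\<^sup>2)" by (simp only: mult.assoc)
 also have "\<dots> \<le> 16 ^ ?n * (R ^ ?n * d ^ ?n * (h y)\<^sup>2)"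
  using dR y(1) by (intro mult_left_mono mult_right_mono power_mono) auto
 finally have "R ^ ?n * (R ^ ?n * (h x)\<^sup>2) \<le> R ^ ?n * (16 ^ ?n * d ^ ?n * (h y)\<^sup>2)" by (simp add: mult_ac)
 hence "R ^ ?n * (h x)\<^sup>2 \<le> 16 ^ ?n * d ^ ?n * (h y)\<^sup>2" using R by simp
 also have "\<dots> = CLB * ((h y)\<^sup>2 / 4 * ((sig ?n * d) ^ ?n * ?w))"
  using sig(1)[of ?n] measure_ball_pos[of 1 "0::'a"] by (simp add: CLB_def power_mult_distrib)
 also have "\<dots> \<le> CLB * (l2n (Leb (ball c R)) h)\<^sup>2" using CLB_pos by (intro mult_left_mono low) auto
 finally show ?thesis .
qed

end

context elliptic
begin

subsection \<open>Caccioppoli inequality and the mean value property\<close>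

text \<open>Test with \<open>z * z * max u 0\<close>. With \<open>A = z\<close> times the gradient
  of the positive part and \<open>B\<close> the positive part times the gradient of
  \<open>z\<close>, the inequality reads \<open>E A A + 2 * E A B \<le> 0\<close>; ellipticity
  bounds the first term from below and boundedness the second from above.\<close>

lemma caccioppoli:
 assumes u: "subsol U u G" and z: "test_fun U z" and U: "U \<subseteq> \<Omega>" "open U"
 shows "l2n (Leb U) (\<lambda>x. z x *\<^sub>R (if u x > 0 then G x else 0))
  \<le> 2 * Lam / lam * l2n (Leb U) (\<lambda>x. max (u x) 0 *\<^sub>R cgrad z x)"
proof -
 let ?M = "Leb U"
 note b = subset_bounded[OF U(1)]
 have S: "SH U u G" using u by (simp add: subsol_def)
 note Sp = SH_pos[OF S]
 let ?u = "\<lambda>x. max (u x) 0" let ?G = "\<lambda>x. if u x > 0 then G x else 0"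
 let ?A = "\<lambda>x. z x *\<^sub>R ?G x" let ?B = "\<lambda>x. ?u x *\<^sub>R cgrad z x"
 note H1 = H10_test_mult[OF Sp z U(2) b]
 note H2 = H10_test_mult[OF H10_SH[OF H1] z U(2) b]
 let ?P = "\<lambda>x. z x *\<^sub>R (?A x + ?B x) + (z x * ?u x) *\<^sub>R cgrad z x"
 have zs: "smooth_fun z" using test_fun_smooth[OF z] .
 obtain C where C: "\<And>x. x \<in> U \<Longrightarrow> \<bar>z x\<bar> \<le> C" "\<And>x. x \<in> U \<Longrightarrow> norm (cgrad z x) \<le> C"
  using smooth_bounded_on[OF zs b] by metis
 note zm[measurable] = smooth_meas[OF zs U(2)]
 have LG: "L2 ?M ?G" "L2 ?M ?u" using SH_L2[OF Sp] by auto
 have LA: "L2 ?M ?A"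
  by (rule L2_bound(1)[OF _ L2_scaleR[OF LG(1), of C]])
    (use C LG zm in \<open>auto intro!: AE_I2 mult_right_mono borel_measurable_scaleR simp: L2_def intro: order_trans[OF _ abs_ge_self]\<close>)
 have LAB: "L2 ?M (\<lambda>x. ?A x + ?B x)" using H10_L2(2)[OF H1] .
 have LB: "L2 ?M ?B" using L2_diff[OF LAB LA] by simp
 have "AE x in ?M. 0 \<le> z x * (z x * ?u x)"
  by (rule AE_I2) (simp add: mult.assoc[symmetric])
 hence "E U G ?P \<le> 0" using u H2 unfolding subsol_def by blast
 moreover have "E U G ?P = E U ?A ?A + 2 * E U ?A ?B"
 proof -
  have "quad a x (G x) (?P x) = quad a x (?A x) (?A x) + 2 * quad a x (?A x) (?B x)" for x
   by (auto simp: quad_zero quad_add_right quad_scaleR_right quad_scaleR_left max_def algebra_simps)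
  hence "E U G ?P = (\<integral>x. quad a x (?A x) (?A x) + 2 * quad a x (?A x) (?B x) \<partial>?M)" unfolding E_def by simp
  also have "\<dots> = E U ?A ?A + 2 * E U ?A ?B"
   unfolding E_def using E_integrable[OF U LA LA] E_integrable[OF U LA LB] by simp
  finally show ?thesis .
 qed
 ultimately have "lam * (l2n ?M ?A)\<^sup>2 \<le> 2 * (Lam * (l2n ?M ?A * l2n ?M ?B))"
  using E_lower[OF U LA] E_bound[OF U LA LB] by linarith
 hence "lam * l2n ?M ?A \<le> 2 * Lam * l2n ?M ?B"
 proof (cases "l2n ?M ?A = 0")
  case False
  hence "l2n ?M ?A > 0" using l2n_nonneg[of ?M ?A] by linarith
  moreover have "l2n ?M ?A * (lam * l2n ?M ?A) \<le> l2n ?M ?A * (2 * Lam * l2n ?M ?B)"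
   using \<open>lam * (l2n ?M ?A)\<^sup>2 \<le> _\<close> by (simp add: power2_eq_square mult_ac)
  ultimately show ?thesis by simp
 qed (use lam in simp)
 thus ?thesis using lam by (simp add: field_simps)
qed

definition CC :: real where "CC = 2 * Lam / lam * bumpC TYPE('a)"

lemma CC_pos: "CC > 0" unfolding CC_def using lam bumpC(1)[where 'a='a] by simp

lemma caccioppoli_ball:
 assumes u: "subsol (ball c (2 * r)) u G" and B: "ball c (2 * r) \<subseteq> \<Omega>" and r: "r > 0"
 shows "l2n (Leb (ball c r)) (\<lambda>x. if u x > 0 then G x else 0)
  \<le> CC / r * l2n (Leb (ball c (2 * r))) (\<lambda>x. max (u x) 0)"
proof -
 let ?B = "ball c (2 * r)" let ?M = "Leb ?B" let ?z = "bump c r"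
 have S: "SH ?B u G" using u by (simp add: subsol_def)
 note LG = SH_L2[OF SH_pos[OF S]]
 have sub: "ball c r \<subseteq> ?B" using r by (intro subset_ball) simp
 have zt: "test_fun ?B ?z" by (rule bump_test[OF r])
 note zm[measurable] = smooth_meas[OF bump_smooth open_ball, of c r c "2 * r"]
 have [measurable]: "(\<lambda>x. max (u x) 0) \<in> borel_measurable ?M" "(\<lambda>x. if u x > 0 then G x else 0) \<in> borel_measurable ?M"
  using LG by (simp_all add: L2_def)
 have Lz: "L2 ?M (\<lambda>x. ?z x *\<^sub>R (if u x > 0 then G x else 0))"
  by (rule L2_bound(1)[OF _ LG(2)]) (auto intro!: AE_I2 simp: bump_range mult_left_le_one_le)
 have nB: "l2n ?M (\<lambda>x. max (u x) 0 *\<^sub>R cgrad ?z x) \<le> l2n ?M (\<lambda>x. (bumpC TYPE('a) / r) *\<^sub>R max (u x) 0)"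
 proof (rule L2_bound(2)[OF _ L2_scaleR[OF LG(1)]])
  show "AE x in ?M. norm (max (u x) 0 *\<^sub>R cgrad ?z x) \<le> norm ((bumpC TYPE('a) / r) *\<^sub>R max (u x) 0)"
  proof (rule AE_I2)
   fix x
   have "0 \<le> bumpC TYPE('a) / r" using r bumpC(1)[where 'a='a] by simp
   hence "norm ((bumpC TYPE('a) / r) *\<^sub>R max (u x) 0) = bumpC TYPE('a) / r * max (u x) 0"
    by (simp only: norm_scaleR abs_of_nonneg) simp
   thus "norm (max (u x) 0 *\<^sub>R cgrad ?z x) \<le> norm ((bumpC TYPE('a) / r) *\<^sub>R max (u x) 0)"
    using mult_right_mono[OF bumpC(2)[OF r, of c x], of "max (u x) 0"] by (simp add: mult.commute)
  qed
 qed measurable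
 have "l2n (Leb (ball c r)) (\<lambda>x. if u x > 0 then G x else 0) = l2n (Leb (ball c r)) (\<lambda>x. ?z x *\<^sub>R (if u x > 0 then G x else 0))"
  unfolding l2n_def
  by (intro arg_cong[where f=sqrt] Bochner_Integration.integral_cong refl) (simp add: bump_one[OF r] dist_norm norm_minus_commute)
 also have "\<dots> \<le> l2n ?M (\<lambda>x. ?z x *\<^sub>R (if u x > 0 then G x else 0))"
  by (rule L2_restrict(2)[OF sub _ _ Lz]) auto
 also have "\<dots> \<le> 2 * Lam / lam * l2n ?M (\<lambda>x. max (u x) 0 *\<^sub>R cgrad ?z x)"
  by (rule caccioppoli[OF u zt B open_ball])
 also have "\<dots> \<le> 2 * Lam / lam * l2n ?M (\<lambda>x. (bumpC TYPE('a) / r) *\<^sub>R max (u x) 0)"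
  by (rule mult_left_mono[OF nB]) (use lam in simp)
 also have "\<dots> = CC / r * l2n ?M (\<lambda>x. max (u x) 0)"
  unfolding l2n_scaleR CC_def using r bumpC(1)[where 'a='a] by simp
 finally show ?thesis .
qed

text \<open>Testing the equation of \<open>H\<close> with \<open>H - G\<close> leaves only the
  pairing of \<open>G\<close> with \<open>H - G\<close>.\<close>

lemma replacement_energy:
 assumes h: "harm U h H" and q: "H10 U q (\<lambda>x. H x - G x)" and G: "L2 (Leb U) G" and U: "U \<subseteq> \<Omega>" "open U"
 shows "l2n (Leb U) (\<lambda>x. H x - G x) \<le> Lam / lam * l2n (Leb U) G"
proof -
 let ?n = "l2n (Leb U)" let ?Q = "\<lambda>x. H x - G x"
 have LH: "L2 (Leb U) H" using h SH_L2(2) by (auto simp: harm_def)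
 have LQ: "L2 (Leb U) ?Q" by (rule L2_diff[OF LH G])
 have "E U ?Q ?Q = - E U G ?Q" using E_diff_left[OF U LH G LQ] harm_H10[OF h q U] by simp
 hence "lam * (?n ?Q)\<^sup>2 \<le> Lam * (?n G * ?n ?Q)"
  using E_lower[OF U LQ] E_bound[OF U G LQ] by linarith
 hence "lam * ?n ?Q \<le> Lam * ?n G"
  using lam l2n_nonneg[of "Leb U" ?Q]
  by (cases "?n ?Q = 0") (auto simp: power2_eq_square mult.assoc[symmetric] less_le)
 thus ?thesis using lam by (simp add: field_simps)
qed

definition KP :: real where "KP = 12 * 6 ^ DIM('a)"
definition CMV :: real where "CMV = 2 ^ DIM('a) * CLB * (1 + KP * (Lam / lam) * CC)\<^sup>2"

lemma CMV_pos: "CMV > 0" "KP > 0"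
proof -
 have "1 + KP * (Lam / lam) * CC > 0" using lam CC_pos by (auto simp: KP_def intro!: add_pos_nonneg)
 thus "CMV > 0" unfolding CMV_def using CLB_pos by simp
qed (simp add: KP_def)

lemma subsol_minus_harm:
 assumes u: "subsol U u G" and h: "harm U h H" and U: "U \<subseteq> \<Omega>" "open U"
 shows "subsol U (\<lambda>x. u x - h x) (\<lambda>x. G x - H x)"
 unfolding subsol_def
proof (intro conjI allI impI)
 have S: "SH U u G" "SH U h H" using u h by (auto simp: subsol_def harm_def)
 thus "SH U (\<lambda>x. u x - h x) (\<lambda>x. G x - H x)" by (rule SH_diff)
 fix p P assume p: "H10 U p P" "AE x in Leb U. 0 \<le> p x"
 have "E U (\<lambda>x. G x - H x) P = E U G P - E U H P"
  by (rule E_diff_left[OF U SH_L2(2)[OF S(1)] SH_L2(2)[OF S(2)] H10_L2(2)[OF p(1)]])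
 thus "E U (\<lambda>x. G x - H x) P \<le> 0"
  using u p harm_H10[OF h p(1) U] by (simp add: subsol_def)
qed

text \<open>The positive part lies below its harmonic replacement on the ball of radius
  \<open>2 * r\<close>, and \<open>harm_local_bound\<close> controls the latter by its L2 norm.
  Poincare, \<open>replacement_energy\<close> and Caccioppoli bound the change of the L2 norm under
  replacement. The bound \<open>S\<close> serves only to make the replacement bounded; the constant
  is independent of it.\<close>

lemma mean_value:
 assumes u: "subsol (ball c (4 * r)) u G" and B: "ball c (4 * r) \<subseteq> \<Omega>" and r: "0 < r" "2 * r < 1"
  and S: "AE x in Leb (ball c (4 * r)). u x \<le> S" and cu: "continuous_on (ball c r) u"
  and x: "x \<in> cball c (r/4)"
 shows "r ^ DIM('a) * (max (u x) 0)\<^sup>2 \<le> CMV * (l2n (Leb (ball c (4 * r))) (\<lambda>x. max (u x) 0))\<^sup>2"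
proof -
 let ?n4 = "l2n (Leb (ball c (4 * r)))" let ?n2 = "l2n (Leb (ball c (2 * r)))"
 let ?s = "\<lambda>x. max (u x) 0" let ?G = "\<lambda>x. if u x > 0 then G x else 0"
 have sub: "ball c (2 * r) \<subseteq> ball c (4 * r)" using r by (intro subset_ball) simp
 have B2: "ball c (2 * r) \<subseteq> \<Omega>" using sub B by blast
 have u2: "subsol (ball c (2 * r)) u G" by (rule subsol_restrict[OF u sub B open_ball open_ball])
 have SH2: "SH (ball c (2 * r)) u G" using u2 by (simp add: subsol_def)
 note Sp = SH_pos[OF SH2]
 have S2: "AE x in Leb (ball c (2 * r)). u x \<le> S" by (rule AE_lebesgue_on_subset[OF S sub]) auto
 obtain h H where h: "harm (ball c (2 * r)) h H" "H10 (ball c (2 * r)) (\<lambda>x. h x - ?s x) (\<lambda>x. H x - ?G x)"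
  "continuous_on (ball c r) h" "\<And>x. x \<in> ball c r \<Longrightarrow> 0 \<le> h x \<and> h x \<le> max S 0"
  "AE x in Leb (ball c (2 * r)). 0 \<le> h x \<and> h x \<le> max S 0"
 proof (rule harmonic_replacement[OF B2 r Sp, of 0 "max S 0"])
  show "AE x in Leb (ball c (2 * r)). max (u x) 0 \<le> max S 0" using S2 by eventually_elim auto
 qed (auto intro: that)
 have Lh: "L2 (Leb (ball c (2 * r))) h" using h(1) SH_L2(1) by (auto simp: harm_def)
 have le: "AE x in Leb (ball c (2 * r)). u x - h x \<le> 0"
  by (rule subsol_comparison[OF B2 _ subsol_minus_harm[OF u2 h(1) B2 open_ball] H10_minus[OF h(2)]]) (use r in \<open>auto intro!: AE_I2\<close>)
 have subr: "ball c r \<subseteq> ball c (2 * r)" using r by (intro subset_ball) simp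
 have "AE x in Leb (ball c r). u x \<le> h x"
  using AE_lebesgue_on_subset[OF le subr] by (auto elim!: eventually_mono)
 note leq = continuous_AE_le[OF open_ball cu h(3) this]
 have xr: "x \<in> ball c r" using x r by auto
 have ux: "max (u x) 0 \<le> h x" "0 \<le> h x" using leq[OF xr] h(4)[OF xr] by auto
 have r2: "0 < 2 * r" using r by simp
 have sub3: "ball c (r/2) \<subseteq> ball c (2 * r)" "cball c (r/2) \<subseteq> ball c r" "ball c (r/2) \<subseteq> \<Omega>"
  using r B2 by (auto simp: subset_ball intro!: order_trans[OF _ B2])
 have hr: "harm (ball c (r/2)) h H" by (rule harm_restrict[OF h(1) sub3(1) B2 open_ball open_ball])
 have n2: "?n2 h \<le> (1 + KP * (Lam / lam) * CC) * ?n4 ?s"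
 proof -
  have "?n2 h \<le> ?n2 ?s + ?n2 (\<lambda>x. h x - ?s x)" by (rule l2n_le_add_diff[OF Lh SH_L2(1)[OF Sp]])
  moreover have "?n2 ?s \<le> ?n4 ?s"
   by (rule L2_restrict(2)[OF sub]) (use u SH_L2(1)[OF SH_pos] in \<open>auto simp: subsol_def\<close>)
  moreover have "?n2 (\<lambda>x. h x - ?s x) \<le> KP * (2 * r) * ?n2 (\<lambda>x. H x - ?G x)"
   using H10_poincare[OF h(2) r2] by (simp add: KP_def)
  moreover have "KP * (2 * r) * ?n2 (\<lambda>x. H x - ?G x) \<le> KP * (2 * r) * (Lam / lam * ?n2 ?G)"
   by (intro mult_left_mono replacement_energy[OF h(1,2) SH_L2(2)[OF Sp] B2 open_ball]) (use r CMV_pos in auto)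
  moreover have "?n2 ?G \<le> CC / (2 * r) * ?n4 ?s"
   using caccioppoli_ball[of c "2 * r" u G] u B r by simp
  hence "KP * (2 * r) * (Lam / lam * ?n2 ?G) \<le> KP * (2 * r) * (Lam / lam * (CC / (2 * r) * ?n4 ?s))"
   by (intro mult_left_mono) (use r lam CMV_pos in auto)
  moreover have "KP * (2 * r) * (Lam / lam * (CC / (2 * r) * ?n4 ?s)) = KP * (Lam / lam) * CC * ?n4 ?s" using r by simp
  ultimately show ?thesis by (simp add: distrib_right)
 qed
 have "(r/2) ^ DIM('a) * (h x)\<^sup>2 \<le> CLB * (l2n (Leb (ball c (r/2))) h)\<^sup>2"
  by (rule harm_local_bound[OF hr sub3(3) _ _ continuous_on_subset[OF h(3) sub3(2)]]) (use r x in auto)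
 also have "\<dots> \<le> CLB * (?n2 h)\<^sup>2"
  using CLB_pos L2_restrict(2)[OF sub3(1) _ _ Lh] by (intro mult_left_mono power_mono) auto
 also have "\<dots> \<le> CLB * ((1 + KP * (Lam / lam) * CC) * ?n4 ?s)\<^sup>2"
  by (intro mult_left_mono power_mono n2) (use CLB_pos in auto)
 finally have "(r/2) ^ DIM('a) * (h x)\<^sup>2 \<le> CLB * ((1 + KP * (Lam / lam) * CC) * ?n4 ?s)\<^sup>2" .
 hence "r ^ DIM('a) * (h x)\<^sup>2 \<le> CMV * (?n4 ?s)\<^sup>2"
  by (simp add: CMV_def power_divide power_mult_distrib pos_divide_le_eq mult_ac)
 moreover have "r ^ DIM('a) * (max (u x) 0)\<^sup>2 \<le> r ^ DIM('a) * (h x)\<^sup>2"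
  using ux r by (intro mult_left_mono power_mono) auto
 ultimately show ?thesis by linarith
qed

end

context elliptic
begin

subsection \<open>Harnack inequality\<close>

text \<open>Collects the factors of one level step in \<open>spread\<close>:
  \<open>2 * 2 ^ n\<close> from Poincare, \<open>32 ^ n\<close> from the ratio of volumes,
  \<open>CC\<close> from Caccioppoli and 2 from consecutive levels. The radius cancels.\<close>

definition C1 :: real where "C1 = 4 * 64 ^ DIM('a) * CC"
definition w1 :: real where "w1 = measure lborel (ball (0::'a) 1)"
text \<open>The number of dyadic levels. The measure of the lowest sublevel set is of order
  \<open>1 / sqrt N0\<close>, and \<open>N0\<close> is large enough for \<open>mean_value\<close> to
  yield half of the lowest level; \<open>gam\<close> is that half relative to the starting
  level.\<close>

definition N0 :: nat where "N0 = Suc (nat \<lceil>(4 * CMV * C1 * 8 ^ DIM('a) * w1)\<^sup>2\<rceil>)"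
definition gam :: real where "gam = (1/2) ^ Suc N0"

lemma w1_pos: "w1 > 0" using measure_ball_pos[of 1 "0::'a"] by (simp add: w1_def)
lemma C1_pos: "C1 > 0" using CC_pos by (simp add: C1_def)
lemma gam: "0 < gam" "gam \<le> 1" unfolding gam_def by (simp, rule power_le_one) auto

lemma N0: "4 * CMV * C1 * 8 ^ DIM('a) * w1 \<le> sqrt N0" "N0 > 0"
proof -
 have "(4 * CMV * C1 * 8 ^ DIM('a) * w1)\<^sup>2 \<le> real N0" unfolding N0_def by linarith
 thus "4 * CMV * C1 * 8 ^ DIM('a) * w1 \<le> sqrt N0" by (rule real_le_rsqrt)
qed (simp add: N0_def)

text \<open>De Giorgi's level-set argument: between consecutive levels \<open>k j = T / 2 ^ j\<close> the Poincare and
 Caccioppoli inequalities bound the measure of the lowest sublevel set by that of the shell, and the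
 shells are disjoint.\<close>
lemma spread:
 assumes h: "harm (ball z (64 * \<rho>)) h H" and B: "ball z (64 * \<rho>) \<subseteq> \<Omega>" and \<rho>: "0 < \<rho>" "64 * \<rho> < 1"
  and ch: "continuous_on (ball z (64 * \<rho>)) h" and h0: "\<And>x. x \<in> ball z (64 * \<rho>) \<Longrightarrow> 0 \<le> h x"
  and T: "0 < T" "\<And>x. x \<in> ball z \<rho> \<Longrightarrow> T \<le> h x" and x: "x \<in> cball z (2 * \<rho>)"
 shows "gam * T \<le> h x"
proof -
 \<comment> \<open>The radii fit together as follows: \<open>mean_value\<close> at radius
   \<open>8 * \<rho>\<close> uses the ball of radius \<open>32 * \<rho>\<close> and controls
   \<open>cball z (2 * \<rho>)\<close>; Caccioppoli doubles the larger ball to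
   \<open>64 * \<rho>\<close>.\<close>
 let ?n = "DIM('a)" let ?B = "ball z (32 * \<rho>)" let ?B2 = "ball z (64 * \<rho>)" let ?M = "Leb ?B"
 let ?m = "measure lborel ?B" let ?m2 = "measure lborel ?B2" let ?A = "ball z \<rho>"
 define k where "k j = (1/2) ^ j * T" for j :: nat
 have k: "k j > 0" "k j = 2 * k (Suc j)" for j using T by (auto simp: k_def)
 have kle: "k i \<le> k j" if "j \<le> i" for i j using T that by (simp add: k_def power_decreasing)
 have k0: "k j \<le> T" for j using T by (simp add: k_def mult_left_le_one_le power_le_one)
 have sub: "?B \<subseteq> ?B2" "?A \<subseteq> ?B" using \<rho> by (auto intro: subset_ball)
 have BO: "?B \<subseteq> \<Omega>" using sub(1) B by blast
 have hB: "harm ?B h H" by (rule harm_restrict[OF h sub(1) B open_ball open_ball])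
 have SHB: "SH ?B h H" using hB by (simp add: harm_def)
 have hm[measurable]: "h \<in> borel_measurable ?M" by (rule SH_meas(1)[OF SHB])
 have h0B: "0 \<le> h y" if "y \<in> ?B" for y using h0 sub that by blast
 have L1: "L2 ?M (\<lambda>x. 1::real)" by (rule L2_boundedI[where B=1]) auto
 have i1: "(\<integral>x. 1 \<partial>?M) = ?m" by (simp add: measure_restrict_space)
 define P where "P j x = max (k j - h x) 0" for j x
 define W where "W j x = (if k j - h x > 0 then - H x else 0)" for j x
 have sub_j: "subsol ?B2 (\<lambda>x. k j - h x) (\<lambda>x. - H x)" for j
  by (rule harm_subsol[OF harm_const_diff[OF h B open_ball] B open_ball])
 have SHP: "SH ?B (P j) (W j)" for j unfolding P_def[abs_def] W_def[abs_def]
  by (rule SH_pos) (use harm_const_diff[OF hB BO open_ball, of "k j"] in \<open>simp add: harm_def\<close>)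
 have cacc: "l2n ?M (W j) \<le> CC / (32 * \<rho>) * (k j * sqrt ?m2)" for j
 proof -
  have "l2n (Leb ?B2) (\<lambda>x. max (k j - h x) 0) \<le> l2n (Leb ?B2) (\<lambda>x. k j *\<^sub>R (1::real))"
  proof (rule L2_bound(2))
   have "h \<in> borel_measurable (Leb ?B2)" using h SH_meas(1) by (auto simp: harm_def)
   thus "(\<lambda>x. max (k j - h x) 0) \<in> borel_measurable (Leb ?B2)" by measurable
   show "L2 (Leb ?B2) (\<lambda>x. k j *\<^sub>R (1::real))" by (rule L2_boundedI[where B="k j"]) (use k(1)[of j] in auto)
   show "AE x in Leb ?B2. norm (max (k j - h x) 0) \<le> norm (k j *\<^sub>R (1::real))"
    by (rule AE_I2) (use h0 k(1)[of j] in \<open>auto simp: max_def\<close>)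
  qed
  also have "\<dots> = k j * sqrt ?m2" unfolding l2n_scaleR using k(1)[of j] by (simp add: l2n_def measure_restrict_space)
  finally have "CC / (32 * \<rho>) * l2n (Leb ?B2) (\<lambda>x. max (k j - h x) 0) \<le> CC / (32 * \<rho>) * (k j * sqrt ?m2)"
   using CC_pos \<rho> by (intro mult_left_mono) auto
  moreover have "l2n ?M (W j) \<le> CC / (32 * \<rho>) * l2n (Leb ?B2) (\<lambda>x. max (k j - h x) 0)"
   using caccioppoli_ball[of z "32 * \<rho>" "\<lambda>x. k j - h x" "\<lambda>x. - H x"] sub_j B \<rho> unfolding W_def[abs_def] by simp
  ultimately show ?thesis by linarith
 qed
 define iD where "iD j x = (if h x < k j then 1 else 0::real)" for j x
 have iDm[measurable]: "iD j \<in> borel_measurable ?M" for j unfolding iD_def by measurable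
 have LD: "L2 ?M (iD j)" for j by (rule L2_boundedI[where B=1]) (auto simp: iD_def)
 have intD: "integrable ?M (iD j)" for j using L2_integrable_inner[OF LD L1, of j] by simp
 define iA where "iA j x = iD j x - iD (Suc j) x" for j x
 have iA01: "iA j x = 0 \<or> iA j x = 1" for j x using kle[of j "Suc j"] by (auto simp: iA_def iD_def)
 have LA: "L2 ?M (iA j)" for j unfolding iA_def by (intro L2_diff LD)
 define \<delta> where "\<delta> = (\<integral>x. iD N0 x \<partial>?M)"
 have \<delta>0: "\<delta> \<ge> 0" unfolding \<delta>_def by (intro integral_nonneg_AE AE_I2) (simp add: iD_def)
 have mA: "?m = 32 ^ ?n * measure lborel ?A" using measure_ball_scale[of 32 \<rho> z z] \<rho> by simp
 have mA0: "measure lborel ?A > 0" using measure_ball_pos[OF \<rho>(1)] .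
 \<comment> \<open>The difference of the truncations at levels \<open>k j\<close> and
   \<open>k (Suc j)\<close> vanishes on the ball where \<open>h \<ge> T\<close>, equals
   \<open>k (Suc j)\<close> on the lowest sublevel set, and has its gradient on the shell between
   the two levels.\<close>
 have step: "\<delta> \<le> C1 * (l2n ?M (iA j) * sqrt ?m2)" if j: "j < N0" for j
 proof -
  define w where "w x = P j x - P (Suc j) x" for x
  have SHw: "SH ?B w (\<lambda>x. W j x - W (Suc j) x)" unfolding w_def[abs_def] by (rule SH_diff[OF SHP SHP])
  have wA: "(\<lambda>x. indicator ?A x * \<bar>w x\<bar>) = (\<lambda>x. 0)"
   using T(2) k0[of j] k0[of "Suc j"] by (force simp: w_def P_def max_def split: split_indicator)
  have nW: "norm (W j x - W (Suc j) x) = norm (iA j x) * norm (W j x)" for x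
   using kle[of j "Suc j"] by (auto simp: W_def iA_def iD_def)
  have "k (Suc j) * \<delta> = (\<integral>x. k (Suc j) * iD N0 x \<partial>?M)" by (simp add: \<delta>_def)
  also have "\<dots> \<le> (\<integral>x. \<bar>w x\<bar> \<partial>?M)"
  proof (rule integral_mono)
   show "integrable ?M (\<lambda>x. \<bar>w x\<bar>)" using L2_integrable_mult[OF L1 SH_L2(1)[OF SHw]] by simp
   show "k (Suc j) * iD N0 x \<le> \<bar>w x\<bar>" for x
    using kle[of "Suc j" N0] k(2)[of j] j k(1)[of "Suc j"] by (auto simp: iD_def w_def P_def max_def)
  qed (use intD in auto)
  finally have 1: "measure lborel ?A * (k (Suc j) * \<delta>) \<le> measure lborel ?A * (\<integral>x. \<bar>w x\<bar> \<partial>?M)"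
   using mA0 by simp
  have "measure lborel ?A * (\<integral>x. \<bar>w x\<bar> \<partial>?M) \<le> 2 * (32 * \<rho>) * 2 ^ ?n * ?m * (\<integral>x. norm (iA j x) * norm (W j x) \<partial>?M)"
   using SH_poincare[OF SHw _ _ sub(2)] \<rho> unfolding wA nW by simp
  also have "\<dots> \<le> 2 * (32 * \<rho>) * 2 ^ ?n * ?m * (l2n ?M (iA j) * (CC / (32 * \<rho>) * (k j * sqrt ?m2)))"
   by (intro mult_left_mono order_trans[OF L2_CS[OF LA SH_L2(2)[OF SHP]]] cacc) (use \<rho> in auto)
  also have "\<dots> = measure lborel ?A * (k (Suc j) * (C1 * (l2n ?M (iA j) * sqrt ?m2)))"
  proof -
   have "(64::real) ^ ?n = 32 ^ ?n * 2 ^ ?n" by (simp flip: power_mult_distrib)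
   thus ?thesis unfolding mA k(2)[of j] C1_def using \<rho> by simp
  qed
  finally have "measure lborel ?A * (k (Suc j) * \<delta>) \<le> measure lborel ?A * (k (Suc j) * (C1 * (l2n ?M (iA j) * sqrt ?m2)))"
   using 1 by linarith
  thus ?thesis using mA0 k(1)[of "Suc j"] by simp
 qed
 have "\<delta>\<^sup>2 \<le> C1\<^sup>2 * ?m2 * (\<integral>x. iA j x \<partial>?M)" if j: "j < N0" for j
 proof -
  have "\<delta>\<^sup>2 \<le> (C1 * (l2n ?M (iA j) * sqrt ?m2))\<^sup>2" by (rule power_mono[OF step[OF j] \<delta>0])
  also have "(l2n ?M (iA j))\<^sup>2 = (\<integral>x. iA j x \<partial>?M)" unfolding l2n_sq
   by (intro Bochner_Integration.integral_cong refl) (use iA01[of j] in \<open>force simp: power2_eq_square\<close>)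
  hence "(C1 * (l2n ?M (iA j) * sqrt ?m2))\<^sup>2 = C1\<^sup>2 * ?m2 * (\<integral>x. iA j x \<partial>?M)"
   by (simp add: power_mult_distrib)
  finally show ?thesis .
 qed
 \<comment> \<open>Each shell measure bounds the same \<open>\<delta>\<close> squared; summing and
   telescoping the disjoint shells gains the factor \<open>N0\<close>.\<close>
 hence "(\<Sum>j<N0. \<delta>\<^sup>2) \<le> (\<Sum>j<N0. C1\<^sup>2 * ?m2 * (\<integral>x. iA j x \<partial>?M))" by (intro sum_mono) simp
 also have "\<dots> = C1\<^sup>2 * ?m2 * (\<integral>x. (\<Sum>j<N0. iA j x) \<partial>?M)"
  using L2_integrable_inner[OF LA L1] by (subst Bochner_Integration.integral_sum) (auto simp: sum_distrib_left)
 also have "\<dots> \<le> C1\<^sup>2 * ?m2 * ?m2"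
 proof (intro mult_left_mono)
  have "(\<integral>x. (\<Sum>j<N0. iA j x) \<partial>?M) \<le> (\<integral>x. 1 \<partial>?M)"
  proof (rule integral_mono)
   show "integrable ?M (\<lambda>x. \<Sum>j<N0. iA j x)" using L2_integrable_inner[OF LA L1] by (intro Bochner_Integration.integrable_sum) simp
   show "(\<Sum>j<N0. iA j x) \<le> 1" for x
   proof -
    have "(\<Sum>j<N0. iA j x) = iD 0 x - iD N0 x" unfolding iA_def by (rule sum_lessThan_telescope')
    thus ?thesis by (simp add: iD_def)
   qed
   show "integrable ?M (\<lambda>x. 1::real)" using L2_integrable_inner[OF L1 L1] by simp
  qed
  also have "\<dots> \<le> ?m2" unfolding i1 using sub(1) by (intro measure_mono_fmeasurable) (auto simp: fmeasurable_def emeasure_ball)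
  finally show "(\<integral>x. (\<Sum>j<N0. iA j x) \<partial>?M) \<le> ?m2" .
 qed auto
 finally have "(sqrt N0 * \<delta>)\<^sup>2 \<le> (C1 * ?m2)\<^sup>2" by (simp add: power_mult_distrib power2_eq_square mult_ac)
 hence \<delta>le: "sqrt N0 * \<delta> \<le> C1 * ?m2" by (rule power2_le_imp_le) (use C1_pos in simp)
 let ?v = "max (k N0 - h x) 0"
 \<comment> \<open>The function \<open>k N0 - h\<close> is a subsolution whose positive part lives
   on a set of measure \<open>\<delta>\<close>, so its supremum on the smaller ball is a small
   multiple of \<open>k N0\<close>.\<close>
 have "(8 * \<rho>) ^ ?n * ?v\<^sup>2 \<le> CMV * (l2n ?M (P N0))\<^sup>2"
 proof -
  have e: "4 * (8 * \<rho>) = 32 * \<rho>" by simp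
  have sB: "subsol ?B (\<lambda>x. k N0 - h x) (\<lambda>x. - H x)" by (rule subsol_restrict[OF sub_j sub(1) B open_ball open_ball])
  have c8: "continuous_on (ball z (8 * \<rho>)) (\<lambda>x. k N0 - h x)"
   by (intro continuous_on_diff continuous_on_const continuous_on_subset[OF ch]) (use \<rho> in \<open>auto intro: subset_ball\<close>)
  have "AE x in ?M. k N0 - h x \<le> k N0" using h0B by (intro AE_I2) auto
  thus ?thesis unfolding P_def[abs_def]
   using mean_value[of z "8 * \<rho>" "\<lambda>x. k N0 - h x" "\<lambda>x. - H x" "k N0" x] sB BO c8 \<rho> x unfolding e by simp
 qed
 also have "(l2n ?M (P N0))\<^sup>2 \<le> (k N0)\<^sup>2 * \<delta>"
 proof -
  have "(l2n ?M (P N0))\<^sup>2 \<le> (\<integral>x. (k N0)\<^sup>2 * iD N0 x \<partial>?M)" unfolding l2n_sq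
  proof (rule integral_mono[OF L2_integrable[OF SH_L2(1)[OF SHP]]])
   show "(norm (P N0 x))\<^sup>2 \<le> (k N0)\<^sup>2 * iD N0 x" if "x \<in> space ?M" for x
    using h0B[of x] that by (auto simp: P_def iD_def max_def abs_le_square_iff[symmetric])
  qed (use intD in auto)
  thus ?thesis by (simp add: \<delta>_def)
 qed
 finally have 1: "(8 * \<rho>) ^ ?n * ?v\<^sup>2 \<le> CMV * ((k N0)\<^sup>2 * \<delta>)" using CMV_pos by (simp add: mult_left_mono)
 have m2: "?m2 = 8 ^ ?n * (8 * \<rho>) ^ ?n * w1"
 proof -
  have "?m2 = (8 * (8 * \<rho>)) ^ ?n * w1" using measure_ball_unit[of "64 * \<rho>" z] \<rho> by (simp add: w1_def)
  thus ?thesis by (simp only: power_mult_distrib)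
 qed
 have sN: "sqrt N0 > 0" using N0(2) by simp
 have "sqrt N0 * ((8 * \<rho>) ^ ?n * ?v\<^sup>2) \<le> CMV * (k N0)\<^sup>2 * (sqrt N0 * \<delta>)"
  using mult_left_mono[OF 1, of "sqrt N0"] sN by (simp add: mult_ac)
 also have "\<dots> \<le> CMV * (k N0)\<^sup>2 * (C1 * ?m2)" using CMV_pos by (intro mult_left_mono \<delta>le) auto
 also have "\<dots> = (8 * \<rho>) ^ ?n * (k N0)\<^sup>2 * (4 * CMV * C1 * 8 ^ ?n * w1) / 4" unfolding m2 by simp
 also have "\<dots> \<le> (8 * \<rho>) ^ ?n * (k N0)\<^sup>2 * sqrt N0 / 4" using \<rho> by (intro divide_right_mono mult_left_mono N0) auto
 finally have "(sqrt N0 * (8 * \<rho>) ^ ?n) * ?v\<^sup>2 \<le> (sqrt N0 * (8 * \<rho>) ^ ?n) * ((k N0 / 2)\<^sup>2)" by (simp add: power_divide mult_ac)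
 hence "?v\<^sup>2 \<le> (k N0 / 2)\<^sup>2" using sN \<rho> by simp
 hence "?v \<le> k N0 / 2" by (rule power2_le_imp_le) (use k(1)[of N0] in simp)
 moreover have "k N0 - h x \<le> ?v" by simp
 ultimately have "k N0 / 2 \<le> h x" by linarith
 thus ?thesis by (simp add: k_def gam_def)
qed

text \<open>Each step moves the centre by \<open>64/65 * \<rho>\<close> towards \<open>c\<close> and
  enlarges the radius by \<open>66/65\<close>. The two numbers add up to 2, so the new ball lies
  where \<open>spread\<close> applies, and \<open>64 * 66/65 = 64 + 64/65\<close> preserves the
  distance condition. Once \<open>c\<close> is within \<open>2 * \<rho>\<close> the value at
  \<open>c\<close> is reached; the growth of the radius excludes more than \<open>m\<close>
  steps.\<close>

lemma harnack_chain:
 assumes h: "harm (ball c R) h H" and B: "ball c R \<subseteq> \<Omega>" and R: "0 < R" "R < 1"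
  and ch: "continuous_on (ball c R) h" and h0: "\<And>x. x \<in> ball c R \<Longrightarrow> 0 \<le> h x"
 shows "0 < \<rho> \<Longrightarrow> 64 * \<rho> \<le> R - norm (z - c) \<Longrightarrow> 0 < T \<Longrightarrow> (\<And>x. x \<in> ball z \<rho> \<Longrightarrow> T \<le> h x) \<Longrightarrow>
  R \<le> \<rho> * (66/65) ^ m \<Longrightarrow> gam ^ Suc m * T \<le> h c"
proof (induction m arbitrary: z \<rho> T)
 case 0
 hence "64 * \<rho> \<le> R" using norm_ge_zero[of "z - c"] by linarith
 thus ?case using 0 by simp
next
 case (Suc m)
 have inB: "ball z (64 * \<rho>) \<subseteq> ball c R"
 proof
  fix x assume "x \<in> ball z (64 * \<rho>)"
  hence "norm (x - c) < R" using norm_triangle_ineq[of "x - z" "z - c"] Suc.prems(2) by (simp add: dist_norm norm_minus_commute)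
  thus "x \<in> ball c R" by (simp add: dist_norm norm_minus_commute)
 qed
 have r1: "64 * \<rho> < 1" using Suc.prems(2) R norm_ge_zero[of "z - c"] by linarith
 have sp: "gam * T \<le> h x" if "x \<in> cball z (2 * \<rho>)" for x
  by (rule spread[OF harm_restrict[OF h inB B open_ball open_ball] _ Suc.prems(1) r1 continuous_on_subset[OF ch inB]])
    (use inB B h0 Suc.prems that in auto)
 have gT: "0 < gam * T" using gam Suc.prems by simp
 show ?case
 proof (cases "norm (z - c) \<le> 2 * \<rho>")
  case True
  hence "gam * T \<le> h c" by (intro sp) (simp add: dist_norm)
  moreover have "gam ^ Suc (Suc m) * T = gam ^ Suc m * (gam * T)" by simp
  moreover have "gam ^ Suc m * (gam * T) \<le> gam * T"
   using gam gT by (intro mult_left_le_one_le zero_le_power power_le_one) auto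
  ultimately show ?thesis by linarith
 next
  case False
  define e where "e = (1 / norm (z - c)) *\<^sub>R (c - z)"
  have ne: "norm (z - c) > 0" using False Suc.prems(1) by linarith
  hence e: "norm e = 1" by (simp add: e_def norm_minus_commute)
  define z' where "z' = z + (64/65 * \<rho>) *\<^sub>R e"
  have "z' - c = (1 - 64/65 * \<rho> / norm (z - c)) *\<^sub>R (z - c)"
   by (simp add: z'_def e_def algebra_simps)
  hence "norm (z' - c) = \<bar>1 - 64/65 * \<rho> / norm (z - c)\<bar> * norm (z - c)" by simp
  also have "\<dots> = (1 - 64/65 * \<rho> / norm (z - c)) * norm (z - c)"
   using ne False Suc.prems(1) by (subst abs_of_nonneg) (auto simp: pos_divide_le_eq)
  also have "\<dots> = norm (z - c) - 64/65 * \<rho>" using ne by (simp add: left_diff_distrib)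
  finally have nz: "norm (z' - c) = norm (z - c) - 64/65 * \<rho>" .
  have "gam ^ Suc m * (gam * T) \<le> h c"
  proof (rule Suc.IH[of "66/65 * \<rho>" z'])
   show "64 * (66/65 * \<rho>) \<le> R - norm (z' - c)" using nz Suc.prems(2) by simp
   show "gam * T \<le> h x" if "x \<in> ball z' (66/65 * \<rho>)" for x
   proof (rule sp)
    have "norm (z - z') = 64/65 * \<rho>" using e Suc.prems(1) by (simp add: z'_def)
    thus "x \<in> cball z (2 * \<rho>)"
     using that norm_triangle_ineq[of "z - z'" "z' - x"] by (simp add: dist_norm)
   qed
  qed (use Suc.prems gT in \<open>auto simp: mult_ac\<close>)
  thus ?thesis by (simp add: mult_ac)
 qed
qed

text \<open>A chain from radius \<open>\<rho>\<close> to radius \<open>R\<close> loses a factor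
  \<open>gam\<close> per step, in all a power of \<open>\<rho> / R\<close>; \<open>QH\<close> is an
  exponent for that power, and the weighted maximum is taken with the same exponent.\<close>

definition QH :: nat where "QH = (SOME Q. Q > 0 \<and> 1 / gam \<le> (66/65) ^ Q)"

lemma QH: "QH > 0" "1 / gam \<le> (66/65) ^ QH"
proof -
 obtain n where n: "1 / gam < (66/65::real) ^ n" using real_arch_pow[of "66/65"] by auto
 have "(66/65::real) ^ n \<le> (66/65) ^ Suc n" by (rule power_increasing) auto
 hence "\<exists>Q>0. 1 / gam \<le> (66/65) ^ Q" using n by (intro exI[of _ "Suc n"]) linarith+
 from someI_ex[OF this] show "QH > 0" "1 / gam \<le> (66/65) ^ QH" unfolding QH_def by blast+
qed

lemma gam_power: "(65/66) ^ (QH * m) \<le> gam ^ m"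
proof -
 have "(65/66::real) ^ QH = 1 / (66/65) ^ QH" by (simp add: power_divide)
 also have "\<dots> \<le> gam" using QH(2) gam(1) by (simp add: field_simps)
 finally show ?thesis unfolding power_mult by (rule power_mono) simp
qed

definition CH :: real where "CH = 2 * (8 / sig QH) ^ QH"

lemma CH_pos: "CH > 0" using sig(1)[of QH] by (simp add: CH_def)

text \<open>At the weighted maximum \<open>y\<close> the function is at least \<open>h y / 2\<close>
  on a ball of radius \<open>sig QH * d\<close>. The chain to \<open>c\<close> costs a factor of
  order \<open>(d / R) ^ QH\<close>, while the weight bounds \<open>h x\<close> by a multiple of
  \<open>(d / R) ^ QH * h y\<close>; the powers cancel.\<close>

lemma harnack:
 assumes h: "harm (ball c R) h H" and B: "ball c R \<subseteq> \<Omega>" and R: "0 < R" "R < 1"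
  and ch: "continuous_on (cball c R) h" and h0: "\<And>x. x \<in> cball c R \<Longrightarrow> 0 \<le> h x"
  and x: "x \<in> cball c (R/2)"
 shows "h x \<le> CH * h c"
proof -
 obtain y d where y: "0 < d" "2 * d = R - norm (y - c)" "\<And>x. x \<in> cball c (R/2) \<Longrightarrow> (R/2) ^ QH * \<bar>h x\<bar> \<le> (2 * d) ^ QH * \<bar>h y\<bar>"
   "\<And>x. norm (x - y) \<le> sig QH * d \<Longrightarrow> \<bar>h x - h y\<bar> \<le> \<bar>h y\<bar> / 2"
  using weighted_maximum[OF h B R ch QH(1)] by metis
 have yB: "y \<in> cball c R" using y(1,2) by (simp add: dist_norm norm_minus_commute)
 have hc0: "0 \<le> h c" and hx0: "0 \<le> h x" using h0 R x by auto
 show ?thesis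
 proof (cases "h y = 0")
  case True
  hence "(R/2) ^ QH * \<bar>h x\<bar> \<le> 0" using y(3)[OF x] by simp
  moreover have "(R/2) ^ QH > 0" using R by simp
  ultimately have "h x \<le> 0" by (simp add: mult_le_0_iff)
  thus ?thesis using CH_pos hc0 mult_nonneg_nonneg[of CH "h c"] by linarith
 next
  case False
  define T where "T = h y / 2"
  have T: "T > 0" using False h0[OF yB] by (simp add: T_def)
  define \<rho> where "\<rho> = sig QH * d"
  have \<rho>: "\<rho> > 0" using sig(1)[of QH] y(1) by (simp add: \<rho>_def)
  have \<rho>d: "64 * \<rho> \<le> d" using mult_right_mono[OF sig(2)[of QH], of d] y(1) by (simp add: \<rho>_def)
  have dR: "d < R" using y(1,2) norm_ge_zero[of "y - c"] by linarith
  obtain m0 where "R / \<rho> < (66/65::real) ^ m0" using real_arch_pow[of "66/65"] by auto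
  hence ex: "R / \<rho> \<le> (66/65::real) ^ m0" by simp
  \<comment> \<open>Minimality keeps \<open>(66/65) ^ m\<close> comparable to
    \<open>R / \<rho>\<close>, so that the loss along the chain is a power of
    \<open>\<rho> / R\<close>.\<close>
  define m where "m = (LEAST m. R / \<rho> \<le> (66/65::real) ^ m)"
  have m1: "R / \<rho> \<le> (66/65) ^ m" unfolding m_def by (rule LeastI[of "\<lambda>m. R / \<rho> \<le> (66/65::real) ^ m", OF ex])
  have "m \<noteq> 0"
  proof
   assume "m = 0" hence "R \<le> \<rho>" using m1 \<rho> by (simp add: field_simps)
   thus False using \<rho>d dR \<rho> by linarith
  qed
  then obtain m' where m': "m = Suc m'" using not0_implies_Suc by blast
  have m2: "(66/65) ^ m' < R / \<rho>"
   using not_less_Least[of m' "\<lambda>m. R / \<rho> \<le> (66/65::real) ^ m"] m' unfolding m_def by (simp add: not_le)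
  have low: "gam ^ Suc m * T \<le> h c"
  proof (rule harnack_chain[OF h B R continuous_on_subset[OF ch ball_subset_cball] _ \<rho> _ T])
   show "64 * \<rho> \<le> R - norm (y - c)" using \<rho>d y(1,2) by linarith
   show "T \<le> h v" if "v \<in> ball y \<rho>" for v
   proof -
    have "\<bar>h v - h y\<bar> \<le> \<bar>h y\<bar> / 2" using that by (intro y(4)) (simp add: \<rho>_def dist_norm norm_minus_commute)
    thus ?thesis using h0[OF yB] unfolding T_def by linarith
   qed
   show "R \<le> \<rho> * (66/65) ^ m" using m1 \<rho> by (simp add: field_simps)
  qed (use h0 in auto)
  \<comment> \<open>The factor 2 absorbs the two surplus steps between \<open>m'\<close> and
    \<open>Suc m\<close>, since \<open>(65/66) ^ 2\<close> exceeds one half.\<close>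
  have "\<rho> / (2 * R) \<le> (65/66) ^ Suc m"
  proof -
   have "\<rho> / R \<le> (65/66) ^ m'" using m2 \<rho> R by (simp add: power_divide field_simps)
   hence "(65/66)\<^sup>2 * (\<rho> / R) \<le> (65/66)\<^sup>2 * (65/66) ^ m'" by (rule mult_left_mono) simp
   moreover have "\<rho> / (2 * R) \<le> (65/66)\<^sup>2 * (\<rho> / R)" using \<rho> R by (simp add: field_simps power2_eq_square)
   ultimately show ?thesis by (simp add: m' power2_eq_square)
  qed
  hence "(\<rho> / (2 * R)) ^ QH \<le> ((65/66) ^ Suc m) ^ QH" using \<rho> R by (intro power_mono) auto
  also have "\<dots> = (65/66) ^ (QH * Suc m)" by (metis power_mult mult.commute)
  also have "\<dots> \<le> gam ^ Suc m" by (rule gam_power)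
  finally have "(\<rho> / (2 * R)) ^ QH * T \<le> gam ^ Suc m * T" using T by (intro mult_right_mono) auto
  with low have low2: "(\<rho> / (2 * R)) ^ QH * T \<le> h c" by linarith
  have "(2 / R) ^ QH * ((R/2) ^ QH * \<bar>h x\<bar>) \<le> (2 / R) ^ QH * ((2 * d) ^ QH * \<bar>h y\<bar>)"
   using y(3)[OF x] R by (intro mult_left_mono) auto
  hence "h x \<le> (2 / R * (2 * d)) ^ QH * h y"
  proof -
   have "(2 / R) ^ QH * (R/2) ^ QH = 1" unfolding power_mult_distrib[of "2 / R" "R/2", symmetric] using R by simp
   thus ?thesis
    using \<open>_ \<le> (2 / R) ^ QH * ((2 * d) ^ QH * \<bar>h y\<bar>)\<close> hx0 h0[OF yB]
    unfolding power_mult_distrib[of "2 / R" "2 * d"] unfolding mult.assoc[symmetric] by simp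
  qed
  also have "2 / R * (2 * d) = 8 / sig QH * (\<rho> / (2 * R))" using sig(1)[of QH] by (simp add: \<rho>_def)
  also have "(8 / sig QH * (\<rho> / (2 * R))) ^ QH * h y = CH * ((\<rho> / (2 * R)) ^ QH * T)"
   unfolding power_mult_distrib CH_def T_def by simp
  also have "\<dots> \<le> CH * h c" using CH_pos by (intro mult_left_mono low2) auto
  finally show ?thesis .
 qed
qed

end

section \<open>The singular perturbation problem\<close>

lemma beta_integrable: assumes "admissible_beta \<beta>" shows "integrable lborel \<beta>"
proof -
 obtain M where M: "AE t in lborel. \<bar>\<beta> t\<bar> \<le> M" using assms by (auto simp: admissible_beta_def)
 have [measurable]: "\<beta> \<in> borel_measurable lborel" using assms by (simp add: admissible_beta_def)
 show ?thesis
 proof (rule Bochner_Integration.integrable_bound[where f="\<lambda>t. M * indicator {0..1} t :: real"])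
  show "AE t in lborel. norm (\<beta> t) \<le> norm (M * indicator {0..1} t :: real)"
   using M by eventually_elim (use assms in \<open>auto simp: admissible_beta_def split: split_indicator\<close>)
 qed auto
qed

definition Mb :: "(real \<Rightarrow> real) \<Rightarrow> real" where "Mb \<beta> = (\<integral>t. \<beta> t \<partial>lborel)"

context
 fixes \<beta> :: "real \<Rightarrow> real" and \<epsilon> :: real
 assumes beta: "admissible_beta \<beta>" and eps: "\<epsilon> > 0"
begin

lemma beta_eps_nonneg: "0 \<le> beta_eps \<beta> \<epsilon> t"
 using beta eps by (auto simp: admissible_beta_def beta_eps_def)

lemma beta_eps_zero: "t < 0 \<or> t > \<epsilon> \<Longrightarrow> beta_eps \<beta> \<epsilon> t = 0"
proof -
 assume "t < 0 \<or> t > \<epsilon>"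
 hence "t / \<epsilon> < 0 \<or> t / \<epsilon> > 1" using eps by (auto simp: divide_less_0_iff)
 hence "t / \<epsilon> \<notin> {0..1}" by auto
 thus ?thesis using beta by (simp add: admissible_beta_def beta_eps_def)
qed

lemma beta_eps_integral: "integrable lborel (beta_eps \<beta> \<epsilon>)" "(\<integral>t. beta_eps \<beta> \<epsilon> t \<partial>lborel) = Mb \<beta>"
proof -
 have i: "integrable lborel (\<lambda>t. \<beta> (0 + (1/\<epsilon>) * t))"
  using lborel_integrable_real_affine[OF beta_integrable[OF beta], of "1/\<epsilon>" 0] eps by simp
 thus "integrable lborel (beta_eps \<beta> \<epsilon>)" unfolding beta_eps_def by simp
 have "Mb \<beta> = \<bar>1/\<epsilon>\<bar> *\<^sub>R (\<integral>t. \<beta> (0 + (1/\<epsilon>) * t) \<partial>lborel)"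
  unfolding Mb_def by (rule lborel_integral_real_affine) (use eps in simp)
 thus "(\<integral>t. beta_eps \<beta> \<epsilon> t \<partial>lborel) = Mb \<beta>" using eps unfolding beta_eps_def by simp
qed

lemma B_eps_eq: "B_eps \<beta> \<epsilon> s = (\<integral>t. indicator {0<..<s} t * beta_eps \<beta> \<epsilon> t \<partial>lborel)"
proof (cases "0 \<le> s")
 case True
 thus ?thesis by (simp add: B_eps_def interval_lebesgue_integral_def set_lebesgue_integral_def)
next
 case False
 hence "(\<lambda>t. indicator {s<..<0} t * beta_eps \<beta> \<epsilon> t) = (\<lambda>t. 0)" using beta_eps_zero by (auto split: split_indicator)
 thus ?thesis using False by (simp add: B_eps_def interval_lebesgue_integral_def set_lebesgue_integral_def)
qed

lemma B_integrable: "integrable lborel (\<lambda>t. indicator {0<..<s} t * beta_eps \<beta> \<epsilon> t)"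
 using integrable_mult_indicator[OF _ beta_eps_integral(1), of "{0<..<s}"] by simp

lemma B_mono: "s \<le> s' \<Longrightarrow> B_eps \<beta> \<epsilon> s \<le> B_eps \<beta> \<epsilon> s'"
 unfolding B_eps_eq by (rule integral_mono[OF B_integrable B_integrable]) (auto simp: beta_eps_nonneg split: split_indicator)

lemma B_nonpos: "s \<le> 0 \<Longrightarrow> B_eps \<beta> \<epsilon> s = 0"
 unfolding B_eps_eq by simp

lemma B_nonneg: "0 \<le> B_eps \<beta> \<epsilon> s"
 unfolding B_eps_eq by (intro integral_nonneg_AE AE_I2) (simp add: beta_eps_nonneg)

lemma B_le: "B_eps \<beta> \<epsilon> s \<le> Mb \<beta>"
 unfolding B_eps_eq beta_eps_integral(2)[symmetric]
 by (rule integral_mono[OF B_integrable beta_eps_integral(1)]) (auto simp: beta_eps_nonneg split: split_indicator)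

lemma B_full: "\<epsilon> \<le> s \<Longrightarrow> B_eps \<beta> \<epsilon> s = Mb \<beta>"
 unfolding B_eps_eq beta_eps_integral(2)[symmetric]
proof (rule integral_cong_AE)
 assume s: "\<epsilon> \<le> s"
 have "AE t in lborel. t \<noteq> 0 \<and> t \<noteq> s" using AE_lborel_singleton[of 0] AE_lborel_singleton[of s] by eventually_elim simp
 thus "AE t in lborel. indicator {0<..<s} t * beta_eps \<beta> \<epsilon> t = beta_eps \<beta> \<epsilon> t"
  by eventually_elim (use s beta_eps_zero in \<open>auto split: split_indicator simp: not_less\<close>)
qed (use B_integrable beta_eps_integral in \<open>auto intro: borel_measurable_integrable\<close>)

lemma B_measurable: "B_eps \<beta> \<epsilon> \<in> borel_measurable borel"
 by (rule borel_measurable_mono) (auto simp: mono_def B_mono)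

end

lemma Mb_pos: "admissible_beta \<beta> \<Longrightarrow> Mb \<beta> > 0" by (simp add: Mb_def admissible_beta_def)

subsection \<open>Traces\<close>

lemma weak_grad_L2: assumes "is_weak_grad U f G" shows "L2 (Leb U) G"
proof -
 have b: "L2 (Leb U) (\<lambda>x. G x \<bullet> b)" if "b \<in> Basis" for b
  using assms that by (intro L2_on_imp_L2) (simp add: is_weak_grad_def)
 have "finite B \<Longrightarrow> B \<subseteq> Basis \<Longrightarrow> L2 (Leb U) (\<lambda>x. \<Sum>b\<in>B. (G x \<bullet> b) *\<^sub>R b)" for B :: "'a set"
 proof (induction B rule: finite_induct)
  case (insert c B)
  have "L2 (Leb U) (\<lambda>x. (G x \<bullet> c) *\<^sub>R c)"
   by (rule L2_bound(1)[OF _ b[of c]]) (use insert b[of c] in \<open>auto simp: L2_def\<close>)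
  thus ?case using insert by (auto intro!: L2_add)
 qed (simp add: L2_zero)
 from this[OF finite_Basis order_refl] show ?thesis by (simp add: euclidean_representation)
qed

lemma nn_pair_l2n:
 assumes "L2 M f" "L2 M G"
 shows "(\<integral>\<^sup>+x. ennreal ((f x)\<^sup>2 + (norm (G x))\<^sup>2) \<partial>M) = ennreal ((l2n M f)\<^sup>2 + (l2n M G)\<^sup>2)"
proof -
 have "(\<integral>\<^sup>+x. ennreal ((f x)\<^sup>2 + (norm (G x))\<^sup>2) \<partial>M) = ennreal (\<integral>x. (norm (f x))\<^sup>2 + (norm (G x))\<^sup>2 \<partial>M)"
  using nn_integral_eq_integral[OF Bochner_Integration.integrable_add[OF L2_integrable[OF assms(1)] L2_integrable[OF assms(2)]]] by simp
 thus ?thesis unfolding l2n_sq using L2_integrable[OF assms(1)] L2_integrable[OF assms(2)] by simp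
qed

lemma pair_l2n_tendsto:
 fixes f :: "nat \<Rightarrow> 'a \<Rightarrow> real" and G :: "nat \<Rightarrow> 'a \<Rightarrow> 'b::euclidean_space"
 assumes L: "\<And>n. L2 M (f n)" "\<And>n. L2 M (G n)"
 shows "(\<lambda>n. \<integral>\<^sup>+x. ennreal ((f n x)\<^sup>2 + (norm (G n x))\<^sup>2) \<partial>M) \<longlonglongrightarrow> 0 \<longleftrightarrow>
  (\<lambda>n. l2n M (f n)) \<longlonglongrightarrow> 0 \<and> (\<lambda>n. l2n M (G n)) \<longlonglongrightarrow> 0"
proof -
 have "(\<lambda>n. \<integral>\<^sup>+x. ennreal ((f n x)\<^sup>2 + (norm (G n x))\<^sup>2) \<partial>M) \<longlonglongrightarrow> 0 \<longleftrightarrow>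
  (\<lambda>n. (l2n M (f n))\<^sup>2 + (l2n M (G n))\<^sup>2) \<longlonglongrightarrow> 0"
  unfolding nn_pair_l2n[OF L] using tendsto_ennreal_iff[of "\<lambda>n. (l2n M (f n))\<^sup>2 + (l2n M (G n))\<^sup>2" sequentially 0] by simp
 also have "\<dots> \<longleftrightarrow> (\<lambda>n. l2n M (f n)) \<longlonglongrightarrow> 0 \<and> (\<lambda>n. l2n M (G n)) \<longlonglongrightarrow> 0"
 proof
  assume t: "(\<lambda>n. (l2n M (f n))\<^sup>2 + (l2n M (G n))\<^sup>2) \<longlonglongrightarrow> 0"
  hence s: "(\<lambda>n. sqrt ((l2n M (f n))\<^sup>2 + (l2n M (G n))\<^sup>2)) \<longlonglongrightarrow> 0" using tendsto_real_sqrt by fastforce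
  show "(\<lambda>n. l2n M (f n)) \<longlonglongrightarrow> 0 \<and> (\<lambda>n. l2n M (G n)) \<longlonglongrightarrow> 0"
   by (intro conjI Lim_null_comparison[OF always_eventually s] allI) (auto intro!: real_le_rsqrt)
 next
  assume "(\<lambda>n. l2n M (f n)) \<longlonglongrightarrow> 0 \<and> (\<lambda>n. l2n M (G n)) \<longlonglongrightarrow> 0"
  thus "(\<lambda>n. (l2n M (f n))\<^sup>2 + (l2n M (G n))\<^sup>2) \<longlonglongrightarrow> 0"
   using tendsto_add[OF tendsto_power[of "\<lambda>n. l2n M (f n)" 0 sequentially 2] tendsto_power[of "\<lambda>n. l2n M (G n)" 0 sequentially 2]] by simp
 qed
 finally show ?thesis .
qed

text \<open>Membership in the closure of \<open>near_trace \<Omega> \<phi> e\<close> for every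
  \<open>e > 0\<close> recasts the trace condition in terms of \<open>clos\<close>, so that boundary
  values inherit its calculus.\<close>

definition near_trace :: "'a::euclidean_space set \<Rightarrow> ('a \<Rightarrow> real) \<Rightarrow> real \<Rightarrow> ('a \<Rightarrow> real) set" where
 "near_trace \<Omega> \<phi> e = {w. smooth_fun w \<and> (\<integral>\<^sup>+x. ennreal ((w x - \<phi> x)\<^sup>2) \<partial>bdry_measure \<Omega>) \<le> ennreal e}"

text \<open>From left to right the first approximants are dropped for each \<open>e\<close>;
  conversely a diagonal sequence makes the interior and the boundary errors small together.\<close>

lemma H1_phi_iff:
 assumes O: "open \<Omega>" "bounded \<Omega>"
 shows "H1_phi \<Omega> \<phi> u \<longleftrightarrow> (\<exists>G. \<forall>e>0. clos (near_trace \<Omega> \<phi> e) (Leb \<Omega>) u G)"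
proof
 let ?M = "Leb \<Omega>"
 assume H: "H1_phi \<Omega> \<phi> u"
 hence u: "L2 ?M u" unfolding H1_phi_def H1_def using L2_on_imp_L2 by blast
 from H obtain v G where v: "\<forall>k. smooth_fun (v k)" "is_weak_grad \<Omega> u G"
   "(\<lambda>k. \<integral>\<^sup>+x. ennreal ((v k x - u x)\<^sup>2 + (norm (cgrad (v k) x - G x))\<^sup>2) \<partial>?M) \<longlonglongrightarrow> 0"
   "(\<lambda>k. \<integral>\<^sup>+x. ennreal ((v k x - \<phi> x)\<^sup>2) \<partial>bdry_measure \<Omega>) \<longlonglongrightarrow> 0"
  unfolding H1_phi_def has_trace_def by (elim conjE exE) (rule that; assumption)
 have L: "L2 ?M (v k)" "L2 ?M (cgrad (v k))" for k using smooth_L2[OF _ O] v(1) by auto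
 note G = weak_grad_L2[OF v(2)]
 note lim = pair_l2n_tendsto[OF L2_diff[OF L(1) u] L2_diff[OF L(2) G], THEN iffD1, OF v(3)]
 have "clos (near_trace \<Omega> \<phi> e) ?M u G" if e: "e > 0" for e
 proof -
  from order_tendstoD(2)[OF v(4), of "ennreal e"] e
  obtain N where N: "\<And>k. k \<ge> N \<Longrightarrow> (\<integral>\<^sup>+x. ennreal ((v k x - \<phi> x)\<^sup>2) \<partial>bdry_measure \<Omega>) < ennreal e"
   unfolding eventually_sequentially by auto
  show ?thesis
  proof (rule closI[where v="\<lambda>k. v (k + N)"])
   show "v (k + N) \<in> near_trace \<Omega> \<phi> e" for k using N[of "k + N"] v(1) by (simp add: near_trace_def less_imp_le)
  qed (intro L u G LIMSEQ_ignore_initial_segment conjunct1[OF lim] conjunct2[OF lim])+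
 qed
 thus "\<exists>G. \<forall>e>0. clos (near_trace \<Omega> \<phi> e) ?M u G" by blast
next
 let ?M = "Leb \<Omega>" let ?e = "\<lambda>n. inverse (real (Suc n))"
 assume "\<exists>G. \<forall>e>0. clos (near_trace \<Omega> \<phi> e) ?M u G"
 then obtain G where G: "\<forall>e>0. clos (near_trace \<Omega> \<phi> e) ?M u G" by (elim exE)
 have "\<forall>n. \<exists>v. v \<in> near_trace \<Omega> \<phi> (?e n) \<and> L2 ?M v \<and> L2 ?M (cgrad v) \<and> l2n ?M (\<lambda>x. v x - u x) < ?e n \<and> l2n ?M (\<lambda>x. cgrad v x - G x) < ?e n"
  using G by (intro allI clos_near) auto
 from choice[OF this] obtain v where v: "\<forall>n. v n \<in> near_trace \<Omega> \<phi> (?e n) \<and> L2 ?M (v n) \<and> L2 ?M (cgrad (v n)) \<and> l2n ?M (\<lambda>x. v n x - u x) < ?e n \<and> l2n ?M (\<lambda>x. cgrad (v n) x - G x) < ?e n"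
  by (elim exE)
 note inv = LIMSEQ_inverse_real_of_nat
 have uG: "L2 ?M u" "L2 ?M G" using G clos_L2 zero_less_one by blast+
 have lim: "L2lim ?M v u" "L2lim ?M (\<lambda>k. cgrad (v k)) G"
  by (rule Lim_null_comparison[OF always_eventually inv], use v in \<open>simp add: less_imp_le\<close>)+
 have S: "SH \<Omega> u G" unfolding SH_def by (rule closI[where v=v]) (use v uG lim in \<open>auto simp: near_trace_def\<close>)
 show "H1_phi \<Omega> \<phi> u" unfolding H1_phi_def has_trace_def
 proof (intro conjI exI[of _ v] exI[of _ G])
  show "H1 \<Omega> u" by (rule SH_H1[OF S O])
  show "is_weak_grad \<Omega> u G" by (rule SH_weak_grad[OF S O])
  show "(\<lambda>k. \<integral>\<^sup>+x. ennreal ((v k x - u x)\<^sup>2 + (norm (cgrad (v k) x - G x))\<^sup>2) \<partial>?M) \<longlonglongrightarrow> 0"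
   using v uG by (intro pair_l2n_tendsto[THEN iffD2] L2_diff conjI lim) auto
  have inv': "(\<lambda>n. ennreal (?e n)) \<longlonglongrightarrow> 0" using tendsto_ennrealI[OF inv] by simp
  show "(\<lambda>k. \<integral>\<^sup>+x. ennreal ((v k x - \<phi> x)\<^sup>2) \<partial>bdry_measure \<Omega>) \<longlonglongrightarrow> 0"
   by (rule tendsto_sandwich[OF always_eventually always_eventually tendsto_const inv']) (use v in \<open>auto simp: near_trace_def\<close>)
 qed (use v in \<open>simp add: near_trace_def\<close>)
qed

lemma space_bdry: "space (bdry_measure \<Omega>) = frontier \<Omega>"
 unfolding bdry_measure_def by (rule space_measure_of) (auto simp: sets_restrict_space)

lemma bdry_measurable:
 assumes "continuous_on UNIV (f::'a::euclidean_space \<Rightarrow> real)" shows "f \<in> borel_measurable (bdry_measure \<Omega>)"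
proof -
 have "sets (bdry_measure \<Omega>) = sigma_sets (frontier \<Omega>) (sets (restrict_space borel (frontier \<Omega>)))"
  unfolding bdry_measure_def by (rule sets_measure_of) (auto simp: sets_restrict_space)
 also have "\<dots> = sets (restrict_space borel (frontier \<Omega>))"
  using sets.sigma_sets_eq[of "restrict_space borel (frontier \<Omega>)"] by (simp add: space_restrict_space)
 finally have "sets (bdry_measure \<Omega>) = sets (restrict_space borel (frontier \<Omega>))" .
 moreover have "f \<in> borel_measurable (restrict_space borel (frontier \<Omega>))"
  by (intro measurable_restrict_space1 borel_measurable_continuous_onI assms)
 ultimately show ?thesis using measurable_cong_sets by blast
qed

lemma H1_phi_add:
 assumes O: "open \<Omega>" "bounded \<Omega>" and u: "H1_phi \<Omega> \<phi> u" and p: "H10 \<Omega> p P"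
 shows "H1_phi \<Omega> \<phi> (\<lambda>x. u x + p x)"
proof -
 from u[unfolded H1_phi_iff[OF O]] obtain G where G: "\<forall>e>0. clos (near_trace \<Omega> \<phi> e) (Leb \<Omega>) u G" by (elim exE)
 have "clos (near_trace \<Omega> \<phi> e) (Leb \<Omega>) (\<lambda>x. u x + p x) (\<lambda>x. G x + P x)" if e: "e > 0" for e
 proof (rule clos_add[OF _ p[unfolded H10_def]])
  show "clos (near_trace \<Omega> \<phi> e) (Leb \<Omega>) u G" using G e by simp
  fix v w assume v: "v \<in> near_trace \<Omega> \<phi> e" and "w \<in> {v. test_fun \<Omega> v}"
  hence w: "test_fun \<Omega> w" by simp
  have "(\<integral>\<^sup>+x. ennreal ((v x + w x - \<phi> x)\<^sup>2) \<partial>bdry_measure \<Omega>) = (\<integral>\<^sup>+x. ennreal ((v x - \<phi> x)\<^sup>2) \<partial>bdry_measure \<Omega>)"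
  proof (rule nn_integral_cong)
   fix x assume "x \<in> space (bdry_measure \<Omega>)"
   hence "x \<notin> \<Omega>" using O(1) by (simp add: space_bdry frontier_def interior_open)
   thus "ennreal ((v x + w x - \<phi> x)\<^sup>2) = ennreal ((v x - \<phi> x)\<^sup>2)" using test_fun_outside(1)[OF w] by simp
  qed
  thus "(\<lambda>x. v x + w x) \<in> near_trace \<Omega> \<phi> e"
   using v test_fun_smooth[OF w] by (simp add: near_trace_def smooth_fun_add)
 qed (auto simp: near_trace_def test_fun_smooth)
 thus ?thesis unfolding H1_phi_iff[OF O] by (intro exI[of _ "\<lambda>x. G x + P x"]) simp
qed

text \<open>Smoothed positive parts are 1-Lipschitz, so boundary approximation survives truncation
  up to the error \<open>ppos d \<phi> - \<phi>\<close>, which is small for small \<open>d\<close>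
  because \<open>\<phi>\<close> is nonnegative.\<close>

lemma H1_phi_pos:
 assumes O: "open \<Omega>" "bounded \<Omega>" and u: "H1_phi \<Omega> \<phi> u" and \<phi>: "L2_bdry \<Omega> \<phi>" "\<forall>x\<in>frontier \<Omega>. 0 \<le> \<phi> x"
 shows "H1_phi \<Omega> \<phi> (\<lambda>x. max (u x) 0)"
proof -
 let ?N = "bdry_measure \<Omega>"
 have \<phi>m[measurable]: "\<phi> \<in> borel_measurable ?N" using \<phi> by (simp add: L2_bdry_def)
 from u[unfolded H1_phi_iff[OF O]] obtain G where G: "\<forall>e>0. clos (near_trace \<Omega> \<phi> e) (Leb \<Omega>) u G" by (elim exE)
 \<comment> \<open>For nonnegative \<open>\<phi>\<close> the pointwise error is at most the minimum
   of \<open>d\<close> and \<open>\<phi>\<close>; it tends to 0 and is dominated by the square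
   integrable \<open>\<phi>\<close>.\<close>
 have pp: "\<exists>d'>0. \<forall>d. 0 < d \<longrightarrow> d \<le> d' \<longrightarrow> (\<integral>\<^sup>+x. ennreal ((ppos d (\<phi> x) - \<phi> x)\<^sup>2) \<partial>?N) \<le> ennreal e" if e: "e > 0" for e
 proof -
  let ?h = "\<lambda>n x. ennreal ((min (inverse (real (Suc n))) (\<bar>\<phi> x\<bar>))\<^sup>2)"
  have "(\<lambda>n. \<integral>\<^sup>+x. ?h n x \<partial>?N) \<longlonglongrightarrow> (\<integral>\<^sup>+x. 0 \<partial>?N)"
  proof (rule nn_integral_dominated_convergence[where w="\<lambda>x. ennreal ((\<phi> x)\<^sup>2)"])
   show "(\<integral>\<^sup>+x. ennreal ((\<phi> x)\<^sup>2) \<partial>?N) < \<infinity>" using \<phi> by (simp add: L2_bdry_def)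
   show "AE x in ?N. ?h n x \<le> ennreal ((\<phi> x)\<^sup>2)" for n
    by (intro AE_I2 ennreal_leI) (simp add: abs_le_square_iff[symmetric])
   show "AE x in ?N. (\<lambda>n. ?h n x) \<longlonglongrightarrow> 0"
   proof (rule AE_I2)
    fix x
    have "(\<lambda>n. min (inverse (real (Suc n))) \<bar>\<phi> x\<bar>) \<longlonglongrightarrow> min 0 \<bar>\<phi> x\<bar>"
     by (intro tendsto_min LIMSEQ_inverse_real_of_nat tendsto_const)
    hence "(\<lambda>n. (min (inverse (real (Suc n))) \<bar>\<phi> x\<bar>)\<^sup>2) \<longlonglongrightarrow> 0\<^sup>2" by (intro tendsto_power) simp
    thus "(\<lambda>n. ?h n x) \<longlonglongrightarrow> 0" using tendsto_ennrealI by fastforce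
   qed
  qed measurable
  hence "\<forall>\<^sub>F n in sequentially. (\<integral>\<^sup>+x. ?h n x \<partial>?N) < ennreal e" using order_tendstoD(2) e by fastforce
  then obtain n where n: "(\<integral>\<^sup>+x. ?h n x \<partial>?N) < ennreal e" using eventually_happens'[OF sequentially_bot] by blast
  show ?thesis
  proof (intro exI[of _ "inverse (real (Suc n))"] conjI allI impI)
   fix d assume d: "0 < d" "d \<le> inverse (real (Suc n))"
   have "(\<integral>\<^sup>+x. ennreal ((ppos d (\<phi> x) - \<phi> x)\<^sup>2) \<partial>?N) \<le> (\<integral>\<^sup>+x. ?h n x \<partial>?N)"
   proof (intro nn_integral_mono ennreal_leI)
    fix x assume "x \<in> space ?N"
    hence "0 \<le> \<phi> x" using \<phi> by (simp add: space_bdry)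
    hence "\<bar>ppos d (\<phi> x) - \<phi> x\<bar> \<le> min (inverse (real (Suc n))) \<bar>\<phi> x\<bar>"
     using ppos_le[OF d(1), of "\<phi> x"] ppos_ge[OF d(1), of "\<phi> x"] ppos_nonneg[OF d(1), of "\<phi> x"] d(2) by (auto simp: max_def)
    thus "(ppos d (\<phi> x) - \<phi> x)\<^sup>2 \<le> (min (inverse (real (Suc n))) \<bar>\<phi> x\<bar>)\<^sup>2" by (simp add: abs_le_square_iff[symmetric])
   qed
   thus "(\<integral>\<^sup>+x. ennreal ((ppos d (\<phi> x) - \<phi> x)\<^sup>2) \<partial>?N) \<le> ennreal e" using n by simp
  qed simp
 qed
  have "clos (near_trace \<Omega> \<phi> e) (Leb \<Omega>) (\<lambda>x. max (u x) 0) (\<lambda>x. if u x > 0 then G x else 0)" if e: "e > 0" for e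
 proof -
  obtain d' where d': "d' > 0" "\<And>d. 0 < d \<Longrightarrow> d \<le> d' \<Longrightarrow> (\<integral>\<^sup>+x. ennreal ((ppos d (\<phi> x) - \<phi> x)\<^sup>2) \<partial>?N) \<le> ennreal (e/4)"
   using pp[of "e/4"] e by auto
  show ?thesis
  proof (rule clos_pos_upto[OF _ _ d'(1)])
   show "clos (near_trace \<Omega> \<phi> (e/4)) (Leb \<Omega>) u G" using G e by simp
   fix w d assume w: "w \<in> near_trace \<Omega> \<phi> (e/4)" and d: "0 < d" "d \<le> d'"
   have sw: "smooth_fun w" using w by (simp add: near_trace_def)
   have [measurable]: "w \<in> borel_measurable ?N" by (rule bdry_measurable[OF smooth_fun_continuous[OF sw]])
   have [measurable]: "ppos d \<in> borel_measurable borel"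
    by (intro borel_measurable_continuous_onI smooth1_continuous ppos_smooth d)
   have "(\<integral>\<^sup>+x. ennreal ((ppos d (w x) - \<phi> x)\<^sup>2) \<partial>?N) \<le> (\<integral>\<^sup>+x. 2 * ennreal ((w x - \<phi> x)\<^sup>2) + 2 * ennreal ((ppos d (\<phi> x) - \<phi> x)\<^sup>2) \<partial>?N)"
   proof (rule nn_integral_mono)
    fix x
    have "\<bar>ppos d (w x) - ppos d (\<phi> x)\<bar> \<le> \<bar>w x - \<phi> x\<bar>" by (rule ppos_lipschitz[OF d(1)])
    hence a: "(ppos d (w x) - ppos d (\<phi> x))\<^sup>2 \<le> (w x - \<phi> x)\<^sup>2" by (simp add: abs_le_square_iff)
    have "(ppos d (w x) - \<phi> x)\<^sup>2 \<le> 2 * (ppos d (w x) - ppos d (\<phi> x))\<^sup>2 + 2 * (ppos d (\<phi> x) - \<phi> x)\<^sup>2"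
     using zero_le_power2[of "(ppos d (w x) - ppos d (\<phi> x)) - (ppos d (\<phi> x) - \<phi> x)"] by (simp add: power2_eq_square algebra_simps)
    with a have "(ppos d (w x) - \<phi> x)\<^sup>2 \<le> 2 * (w x - \<phi> x)\<^sup>2 + 2 * (ppos d (\<phi> x) - \<phi> x)\<^sup>2" by linarith
    from ennreal_leI[OF this] show "ennreal ((ppos d (w x) - \<phi> x)\<^sup>2) \<le> 2 * ennreal ((w x - \<phi> x)\<^sup>2) + 2 * ennreal ((ppos d (\<phi> x) - \<phi> x)\<^sup>2)"
     by (simp add: ennreal_mult)
   qed
   also have "\<dots> = 2 * (\<integral>\<^sup>+x. ennreal ((w x - \<phi> x)\<^sup>2) \<partial>?N) + 2 * (\<integral>\<^sup>+x. ennreal ((ppos d (\<phi> x) - \<phi> x)\<^sup>2) \<partial>?N)"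
    by (subst nn_integral_add) (auto simp: nn_integral_cmult)
   also have "\<dots> \<le> 2 * ennreal (e/4) + 2 * ennreal (e/4)"
    using w d'(2)[OF d] by (intro add_mono mult_left_mono) (auto simp: near_trace_def)
   also have "\<dots> = ennreal e" using e by (simp flip: ennreal_numeral ennreal_mult ennreal_plus)
   finally show "(\<lambda>x. ppos d (w x)) \<in> near_trace \<Omega> \<phi> e" unfolding near_trace_def using smooth_fun_comp[OF ppos_smooth[OF d(1)] sw] by simp
  qed (simp add: near_trace_def)
 qed
 thus ?thesis unfolding H1_phi_iff[OF O] by (intro exI[of _ "\<lambda>x. if u x > 0 then G x else 0"]) simp
qed

section \<open>From minimizers to a variational inequality\<close>

context elliptic
begin

text \<open>The definition of a minimizer provides some weak gradient, the trace a strong limit of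
  smooth gradients; by uniqueness they agree almost everywhere and give the same energy.\<close>

lemma minimizer_energy:
 assumes m: "is_minimizer \<Omega> a \<beta> \<phi> \<epsilon> u" and b: "admissible_beta \<beta>" "\<epsilon> > 0"
 obtains G where "SH \<Omega> u G" "\<And>v Gv. H1_phi \<Omega> \<phi> v \<Longrightarrow> SH \<Omega> v Gv \<Longrightarrow>
   1/2 * E \<Omega> G G + (\<integral>x. B_eps \<beta> \<epsilon> (u x) \<partial>Leb \<Omega>) \<le> 1/2 * E \<Omega> Gv Gv + (\<integral>x. B_eps \<beta> \<epsilon> (v x) \<partial>Leb \<Omega>)"
proof -
 let ?M = "Leb \<Omega>"
 note O = openO bddO
 note U = order_refl[of \<Omega>] openO
 interpret finite_measure ?M by (rule finite_measure_bounded_open[OF O])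
 note Bm[measurable] = B_measurable[OF b]
 from m obtain G1 where phi: "H1_phi \<Omega> \<phi> u" and G1: "is_weak_grad \<Omega> u G1"
  "\<And>v Gv. H1_phi \<Omega> \<phi> v \<Longrightarrow> is_weak_grad \<Omega> v Gv \<Longrightarrow> energy \<Omega> a \<beta> \<epsilon> u G1 \<le> energy \<Omega> a \<beta> \<epsilon> v Gv"
  unfolding is_minimizer_def by (elim conjE exE) blast
 from phi[unfolded H1_phi_iff[OF O]] obtain G where "\<forall>e>0. clos (near_trace \<Omega> \<phi> e) ?M u G" by (elim exE)
 hence "clos (near_trace \<Omega> \<phi> 1) ?M u G" by simp
 hence S: "SH \<Omega> u G" unfolding SH_def by (rule clos_mono) (auto simp: near_trace_def)
 note v = S SH_L2[OF S]
 have en: "energy \<Omega> a \<beta> \<epsilon> w W = 1/2 * E \<Omega> W W + (\<integral>x. B_eps \<beta> \<epsilon> (w x) \<partial>?M)" if "L2 ?M w" "L2 ?M W" for w W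
 proof -
  have wm[measurable]: "w \<in> borel_measurable ?M" using that by (simp add: L2_def)
  have "integrable ?M (\<lambda>x. B_eps \<beta> \<epsilon> (w x))"
   by (rule integrable_const_bound[where B="Mb \<beta>"]) (auto simp: B_nonneg[OF b] B_le[OF b])
  thus ?thesis unfolding energy_def E_def using E_integrable[OF U that(2,2)] by simp
 qed
 have ae: "AE x in ?M. G1 x = G x"
  using weak_grad_unique[OF G1(1) SH_weak_grad[OF S O] O] v(2) by (simp add: L2_def)
 have "E \<Omega> G1 G1 = E \<Omega> G G" unfolding E_def
  by (rule integral_cong_AE) (use ae weak_grad_L2[OF G1(1)] v(3) in \<open>auto elim!: eventually_mono intro!: borel_measurable_integrable E_integrable[OF U]\<close>)
 hence eq: "energy \<Omega> a \<beta> \<epsilon> u G1 = energy \<Omega> a \<beta> \<epsilon> u G" using en[OF v(2)] weak_grad_L2[OF G1(1)] v(3) by simp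
 show thesis
 proof (rule that[OF S])
  fix w W assume w: "H1_phi \<Omega> \<phi> w" "SH \<Omega> w W"
  from G1(2)[OF w(1) SH_weak_grad[OF w(2) O]]
  show "1/2 * E \<Omega> G G + (\<integral>x. B_eps \<beta> \<epsilon> (u x) \<partial>?M) \<le> 1/2 * E \<Omega> W W + (\<integral>x. B_eps \<beta> \<epsilon> (w x) \<partial>?M)"
   unfolding eq en[OF v(2,3)] en[OF SH_L2[OF w(2)]] .
 qed
qed

text \<open>The positive part is a competitor with the same penalty, so the negative part has zero
  gradient. It is then locally constant, hence constant on the connected domain: either 0, or a
  positive number, in which case \<open>u\<close> is negative everywhere.\<close>

lemma minimizer_nonneg_or_nonpos:
 assumes m: "is_minimizer \<Omega> a \<beta> \<phi> \<epsilon> u" and b: "admissible_beta \<beta>" "\<epsilon> > 0"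
  and \<phi>: "L2_bdry \<Omega> \<phi>" "\<forall>x\<in>frontier \<Omega>. 0 \<le> \<phi> x" and conn: "connected \<Omega>" and cu: "continuous_on \<Omega> u"
 shows "(\<forall>x\<in>\<Omega>. 0 \<le> u x) \<or> (\<forall>x\<in>\<Omega>. u x \<le> 0)"
proof -
 let ?M = "Leb \<Omega>"
 note U = order_refl[of \<Omega>] openO
 obtain G where G: "SH \<Omega> u G" "\<And>v Gv. H1_phi \<Omega> \<phi> v \<Longrightarrow> SH \<Omega> v Gv \<Longrightarrow>
   1/2 * E \<Omega> G G + (\<integral>x. B_eps \<beta> \<epsilon> (u x) \<partial>?M) \<le> 1/2 * E \<Omega> Gv Gv + (\<integral>x. B_eps \<beta> \<epsilon> (v x) \<partial>?M)"
  using minimizer_energy[OF m b] by metis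
 have phi: "H1_phi \<Omega> \<phi> u" using m by (simp add: is_minimizer_def)
 let ?P = "\<lambda>x. if u x > 0 then G x else 0" let ?N = "\<lambda>x. if - u x > 0 then - G x else 0"
 note SP = SH_pos[OF G(1)] and SN = SH_pos[OF SH_minus[OF G(1)]]
 have "B_eps \<beta> \<epsilon> (max t 0) = B_eps \<beta> \<epsilon> t" for t using B_nonpos[OF b, of t] B_nonpos[OF b, of 0] by (auto simp: max_def)
 hence le: "E \<Omega> G G \<le> E \<Omega> ?P ?P" using G(2)[OF H1_phi_pos[OF openO bddO phi \<phi>] SP] by simp
 have "E \<Omega> G G = E \<Omega> ?P ?P + E \<Omega> ?N ?N"
 proof -
  note i = E_integrable[OF U SH_L2(2)[OF SP] SH_L2(2)[OF SP]] E_integrable[OF U SH_L2(2)[OF SN] SH_L2(2)[OF SN]]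
  have "E \<Omega> G G = (\<integral>x. quad a x (?P x) (?P x) + quad a x (?N x) (?N x) \<partial>?M)" unfolding E_def
  proof (rule integral_cong_AE)
   show "AE x in ?M. quad a x (G x) (G x) = quad a x (?P x) (?P x) + quad a x (?N x) (?N x)"
    using SH_grad_zero[OF G(1) openO bddO] by eventually_elim (auto simp: quad_zero quad_minus_left quad_minus_right)
  qed (intro borel_measurable_integrable Bochner_Integration.integrable_add i E_integrable[OF U] SH_L2(2)[OF G(1)])+
  also have "\<dots> = E \<Omega> ?P ?P + E \<Omega> ?N ?N" unfolding E_def by (rule Bochner_Integration.integral_add[OF i])
  finally show ?thesis .
 qed
 hence "lam * (l2n ?M ?N)\<^sup>2 \<le> 0" using le E_lower[OF U SH_L2(2)[OF SN]] by linarith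
 hence "l2n ?M ?N \<le> 0" using lam(1) by (simp add: mult_le_0_iff)
 from l2n_zero_AE[OF SH_L2(2)[OF SN] this] have N0: "AE x in ?M. ?N x = 0" .
 let ?n = "\<lambda>x. max (- u x) 0"
 have cn: "continuous_on \<Omega> ?n" by (intro continuous_intros cu)
 have loc: "\<forall>\<^sub>F y in at x within \<Omega>. ?n x = ?n y" if x: "x \<in> \<Omega>" for x
 proof -
  obtain r where r: "r > 0" "ball x r \<subseteq> \<Omega>" using openO x open_contains_ball by blast
  have S: "SH (ball x r) ?n ?N" by (rule SH_restrict[OF SN r(2)]) (use openO in auto)
  have "AE y in Leb (ball x r). norm (?N y) \<le> 0"
   using AE_lebesgue_on_subset[OF N0 r(2)] openO by (auto elim!: eventually_mono)
  note L = SH_lipschitz[OF S r(1) order_refl this continuous_on_subset[OF cn r(2)]]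
  have "?n x = ?n y" if "y \<in> ball x r" for y
  proof -
   have "x \<in> ball x r" using r(1) by simp
   from L[OF this that] have "\<bar>?n x - ?n y\<bar> \<le> 0" unfolding mult_zero_left .
   thus ?thesis by linarith
  qed
  thus ?thesis unfolding eventually_at using r(1) by (intro exI[of _ r]) (auto simp: dist_commute)
 qed
 have locb: "\<forall>x\<in>\<Omega>. \<forall>\<^sub>F y in at x within \<Omega>. ?n x = ?n y" using loc by (rule ballI)
 note const = connected_local_const[OF conn _ _ locb]
 show ?thesis
 proof (cases "\<exists>x\<in>\<Omega>. u x < 0")
  case True
  then obtain x where x: "x \<in> \<Omega>" "u x < 0" by blast
  have "u y \<le> 0" if "y \<in> \<Omega>" for y using const[OF x(1) that] x(2) by (auto simp: max_def split: if_splits)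
  thus ?thesis by blast
 qed (auto simp: not_less)
qed

lemma minimizer_variation:
 assumes m: "is_minimizer \<Omega> a \<beta> \<phi> \<epsilon> u" and b: "admissible_beta \<beta>" "\<epsilon> > 0"
 obtains G where "SH \<Omega> u G" "\<And>p P. H10 \<Omega> p P \<Longrightarrow>
   0 \<le> E \<Omega> G P + 1/2 * E \<Omega> P P + (\<integral>x. B_eps \<beta> \<epsilon> (u x + p x) - B_eps \<beta> \<epsilon> (u x) \<partial>Leb \<Omega>)"
proof -
 let ?M = "Leb \<Omega>"
 note O = openO bddO
 note U = order_refl[of \<Omega>] openO
 interpret finite_measure ?M by (rule finite_measure_bounded_open[OF O])
 note Bm[measurable] = B_measurable[OF b]
 obtain G where G: "SH \<Omega> u G" "\<And>v Gv. H1_phi \<Omega> \<phi> v \<Longrightarrow> SH \<Omega> v Gv \<Longrightarrow>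
   1/2 * E \<Omega> G G + (\<integral>x. B_eps \<beta> \<epsilon> (u x) \<partial>?M) \<le> 1/2 * E \<Omega> Gv Gv + (\<integral>x. B_eps \<beta> \<epsilon> (v x) \<partial>?M)"
  using minimizer_energy[OF m b] by metis
 have phi: "H1_phi \<Omega> \<phi> u" using m by (simp add: is_minimizer_def)
 have iB: "integrable ?M (\<lambda>x. B_eps \<beta> \<epsilon> (w x))" if [measurable]: "w \<in> borel_measurable ?M" for w
  by (rule integrable_const_bound[where B="Mb \<beta>"]) (auto simp: B_nonneg[OF b] B_le[OF b])
 show thesis
 proof (rule that[OF G(1)])
  fix p P assume p: "H10 \<Omega> p P"
  note S = SH_add[OF G(1) H10_SH[OF p]]
  note i = iB[OF SH_meas(1)[OF S]] iB[OF SH_meas(1)[OF G(1)]]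
  have "E \<Omega> (\<lambda>x. G x + P x) (\<lambda>x. G x + P x) = E \<Omega> G G + 2 * E \<Omega> G P + E \<Omega> P P"
   using E_square[OF U SH_L2(2)[OF G(1)] H10_L2(2)[OF p], of 1] by simp
  thus "0 \<le> E \<Omega> G P + 1/2 * E \<Omega> P P + (\<integral>x. B_eps \<beta> \<epsilon> (u x + p x) - B_eps \<beta> \<epsilon> (u x) \<partial>?M)"
   using G(2)[OF H1_phi_add[OF O phi p] S] unfolding Bochner_Integration.integral_diff[OF i] by (simp add: add_divide_distrib)
 qed
qed

end

text \<open>The boundary datum has been eliminated: what is kept of minimality is an inequality for
  perturbations in \<open>H10\<close>, with the quadratic form expanded.\<close>

locale minimizer = elliptic \<Omega> a lam Lam K
 for \<Omega> :: "'a::euclidean_space set" and a lam Lam K +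
 fixes \<beta> :: "real \<Rightarrow> real" and \<epsilon> :: real and u :: "'a \<Rightarrow> real" and G :: "'a \<Rightarrow> 'a"
 assumes beta: "admissible_beta \<beta>" and eps: "\<epsilon> > 0" and SHu: "SH \<Omega> u G"
  and variation: "\<And>p P. H10 \<Omega> p P \<Longrightarrow>
    0 \<le> E \<Omega> G P + 1/2 * E \<Omega> P P + (\<integral>x. B_eps \<beta> \<epsilon> (u x + p x) - B_eps \<beta> \<epsilon> (u x) \<partial>Leb \<Omega>)"
  and cu: "continuous_on \<Omega> u" and u0: "\<And>x. x \<in> \<Omega> \<Longrightarrow> 0 \<le> u x"
begin

abbreviation "Be \<equiv> B_eps \<beta> \<epsilon>"
lemmas U\<Omega> = order_refl[of \<Omega>] openO
lemmas LG = SH_L2(2)[OF SHu]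
lemmas Bfacts = B_mono[OF beta eps] B_nonpos[OF beta eps] B_nonneg[OF beta eps] B_le[OF beta eps] B_full[OF beta eps]
lemma Bm[measurable]: "Be \<in> borel_measurable borel" by (rule B_measurable[OF beta eps])
lemma um[measurable]: "u \<in> borel_measurable (Leb \<Omega>)" by (rule SH_meas(1)[OF SHu])
lemma Gm[measurable]: "G \<in> borel_measurable (Leb \<Omega>)" by (rule SH_meas(2)[OF SHu])

lemma B_int: assumes [measurable]: "w \<in> borel_measurable (Leb V)" and V: "open V" "bounded V"
 shows "integrable (Leb V) (\<lambda>x. Be (w x))"
proof -
 interpret finite_measure "Leb V" by (rule finite_measure_bounded_open[OF V])
 show ?thesis by (rule integrable_const_bound[where B="Mb \<beta>"]) (auto simp: Bfacts)
qed

text \<open>Lowering \<open>u\<close> by \<open>t * p\<close> cannot increase the penalty, because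
  \<open>B_eps\<close> is monotone; hence \<open>E \<Omega> G P \<le> t * E \<Omega> P P\<close> for
  every \<open>t > 0\<close>.\<close>

lemma u_subsol: "subsol \<Omega> u G"
 unfolding subsol_def
proof (intro conjI SHu allI impI)
 fix p P assume p: "H10 \<Omega> p P" "AE x in Leb \<Omega>. 0 \<le> p x"
 have "E \<Omega> G P \<le> t * E \<Omega> P P" if t: "t > 0" for t
 proof -
  let ?q = "\<lambda>x. (- t) * p x"
  note q = H10_cmult[OF p(1), of "- t"]
  have pm[measurable]: "p \<in> borel_measurable (Leb \<Omega>)" by (rule H10_meas(1)[OF p(1)])
  have "(\<integral>x. Be (u x + ?q x) - Be (u x) \<partial>Leb \<Omega>) \<le> (\<integral>x. 0 \<partial>Leb \<Omega>)"
  proof (rule integral_mono_AE)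
   show "AE x in Leb \<Omega>. Be (u x + ?q x) - Be (u x) \<le> 0"
    using p(2) by eventually_elim (use t in \<open>auto intro!: Bfacts(1)\<close>)
  qed (auto intro!: Bochner_Integration.integrable_diff B_int openO bddO)
  hence "0 \<le> - t * E \<Omega> G P + 1/2 * ((- t) * ((- t) * E \<Omega> P P))"
   using variation[OF q] unfolding E_scaleR_right[OF U\<Omega>] E_scaleR_left[OF U\<Omega>] by simp
  hence "t * E \<Omega> G P \<le> t * (1/2 * t * E \<Omega> P P)" by simp
  hence "E \<Omega> G P \<le> 1/2 * t * E \<Omega> P P" by (rule mult_left_le_imp_le[OF _ t])
  also have "\<dots> \<le> t * E \<Omega> P P" using E_nonneg[OF U\<Omega> H10_L2(2)[OF p(1)]] t by simp
  finally show ?thesis .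
 qed
 note le = this
 show "E \<Omega> G P \<le> 0"
 proof (rule LIMSEQ_le_const)
  show "(\<lambda>n. inverse (real (Suc n)) * E \<Omega> P P) \<longlonglongrightarrow> 0"
   using tendsto_mult_left_zero[OF LIMSEQ_inverse_real_of_nat] .
 qed (use le in auto)
qed

text \<open>The penalty that is not yet saturated in the ball: an upper bound for what a change of
  \<open>u\<close> inside the ball can add to it.\<close>

definition gap :: "'a \<Rightarrow> real \<Rightarrow> real" where "gap c r = (\<integral>x. Mb \<beta> - Be (u x) \<partial>Leb (ball c r))"

lemma gap_le: assumes "ball c r \<subseteq> \<Omega>" shows "gap c r \<le> Mb \<beta> * measure lborel (ball c r)"
proof -
 let ?M = "Leb (ball c r)"
 have m: "u \<in> borel_measurable ?M"
  by (rule continuous_measurable_lebesgue_on[OF continuous_on_subset[OF cu assms] open_ball])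
 interpret finite_measure ?M by (rule finite_measure_bounded_open) auto
 have "gap c r \<le> (\<integral>x. Mb \<beta> \<partial>?M)" unfolding gap_def
  by (rule integral_mono) (auto simp: Bfacts intro!: Bochner_Integration.integrable_diff B_int m)
 thus ?thesis by (simp add: measure_restrict_space mult.commute)
qed

text \<open>By minimality the replacement gains at most the part of the penalty that is not yet saturated.\<close>
lemma replacement_close:
 assumes h: "harm (ball c r) h H" and q: "H10 (ball c r) (\<lambda>x. h x - u x) (\<lambda>x. H x - G x)" and B: "ball c r \<subseteq> \<Omega>" and r: "r > 0"
 shows "(l2n (Leb (ball c r)) (\<lambda>x. h x - u x))\<^sup>2 \<le> (KP * r)\<^sup>2 * (2 / lam) * gap c r"
proof -
 let ?B = "ball c r" let ?M = "Leb ?B" let ?Q = "\<lambda>x. H x - G x"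
 let ?p = "\<lambda>x. if x \<in> ?B then h x - u x else 0" let ?P = "\<lambda>x. if x \<in> ?B then H x - G x else 0"
 note UB = B open_ball[of c r]
 have LH: "L2 ?M H" using h SH_L2(2) by (auto simp: harm_def)
 have LGB: "L2 ?M G" by (rule L2_restrict(1)[OF B _ _ LG]) (use openO in auto)
 have p: "H10 \<Omega> ?p ?P" by (rule H10_extend[OF q B]) (use openO in auto)
 have pm[measurable]: "?p \<in> borel_measurable (Leb \<Omega>)" by (rule H10_meas(1)[OF p])
 \<comment> \<open>Since \<open>H\<close> is orthogonal to \<open>?Q\<close>, the linear term is
   minus the full energy of \<open>?Q\<close>. Together with the quadratic half, minimality reads:
   half the energy of \<open>?Q\<close> is at most the change of the penalty.\<close>
 have e1: "E \<Omega> G ?P = - E ?B ?Q ?Q"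
  using E_restrict[OF B order_refl openO open_ball, of G ?Q] E_diff_left[OF UB LH LGB H10_L2(2)[OF q]] harm_H10[OF h q UB] by simp
 have "E \<Omega> ?P ?P = E ?B ?P ?Q" by (rule E_restrict[OF B order_refl openO open_ball])
 also have "\<dots> = E ?B ?Q ?Q" unfolding E_def by (intro Bochner_Integration.integral_cong refl) simp
 finally have e2: "E \<Omega> ?P ?P = E ?B ?Q ?Q" .
 have BO: "?B \<inter> space lebesgue \<in> sets lebesgue" by simp
 have O': "\<Omega> \<inter> space lebesgue \<in> sets lebesgue" using openO by simp
 have "(\<integral>x. Be (u x + ?p x) - Be (u x) \<partial>Leb \<Omega>) \<le> (\<integral>x. indicator ?B x * (Mb \<beta> - Be (u x)) \<partial>Leb \<Omega>)"
 proof (rule integral_mono)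
  show "integrable (Leb \<Omega>) (\<lambda>x. indicator ?B x * (Mb \<beta> - Be (u x)))"
  proof -
   interpret finite_measure "Leb \<Omega>" by (rule finite_measure_bounded_open[OF openO bddO])
   have s: "?B \<in> sets (Leb \<Omega>)" using B by (auto simp: sets_restrict_space intro!: image_eqI[of _ _ ?B])
   show ?thesis using integrable_mult_indicator[OF s Bochner_Integration.integrable_diff[OF integrable_const B_int[OF um openO bddO]], of "Mb \<beta>"] by simp
  qed
  show "Be (u x + ?p x) - Be (u x) \<le> indicator ?B x * (Mb \<beta> - Be (u x))" for x
   by (auto simp: Bfacts split: split_indicator)
  show "integrable (Leb \<Omega>) (\<lambda>x. Be (u x + ?p x) - Be (u x))"
   by (rule Bochner_Integration.integrable_diff[OF B_int[OF borel_measurable_add[OF um pm] openO bddO] B_int[OF um openO bddO]])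
 qed
 also have "\<dots> = gap c r" unfolding gap_def integral_restrict_space[OF BO] integral_restrict_space[OF O']
  by (intro Bochner_Integration.integral_cong refl) (use B in \<open>auto split: split_indicator\<close>)
 finally have g: "E ?B ?Q ?Q \<le> 2 * gap c r" using variation[OF p] unfolding e1 e2 by simp
 have "lam * (l2n ?M ?Q)\<^sup>2 \<le> 2 * gap c r" using E_lower[OF UB H10_L2(2)[OF q]] g by linarith
 hence "(l2n ?M ?Q)\<^sup>2 \<le> (2 / lam) * gap c r" using lam by (simp add: field_simps)
 hence "(KP * r)\<^sup>2 * (l2n ?M ?Q)\<^sup>2 \<le> (KP * r)\<^sup>2 * ((2 / lam) * gap c r)" by (rule mult_left_mono) simp
 moreover have "(l2n ?M (\<lambda>x. h x - u x))\<^sup>2 \<le> (KP * r * l2n ?M ?Q)\<^sup>2"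
  using H10_poincare[OF q r] by (intro power_mono) (auto simp: KP_def)
 ultimately show ?thesis by (simp add: power_mult_distrib)
qed

lemma replacement_u:
 assumes B: "cball c (2 * r) \<subseteq> \<Omega>" and r: "0 < r" "2 * r < 1"
 obtains h H where "harm (ball c (2 * r)) h H" "continuous_on (ball c r) h" "L2 (Leb (ball c (2 * r))) h"
  "\<And>m M x. (\<And>y. y \<in> cball c (2 * r) \<Longrightarrow> m \<le> u y \<and> u y \<le> M) \<Longrightarrow> x \<in> ball c r \<Longrightarrow> m \<le> h x \<and> h x \<le> M"
  "\<And>x. x \<in> ball c r \<Longrightarrow> u x \<le> h x"
  "(l2n (Leb (ball c (2 * r))) (\<lambda>x. h x - u x))\<^sup>2 \<le> (KP * (2 * r))\<^sup>2 * (2 / lam) * gap c (2 * r)"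
proof -
 let ?B = "ball c (2 * r)"
 have cc: "continuous_on (cball c (2 * r)) u" by (rule continuous_on_subset[OF cu B])
 have ne: "cball c (2 * r) \<noteq> {}" using r by simp
 obtain y1 where y1: "y1 \<in> cball c (2 * r)" "\<And>y. y \<in> cball c (2 * r) \<Longrightarrow> u y \<le> u y1"
  using continuous_attains_sup[OF compact_cball ne cc] by blast
 obtain y0 where y0: "y0 \<in> cball c (2 * r)" "\<And>y. y \<in> cball c (2 * r) \<Longrightarrow> u y0 \<le> u y"
  using continuous_attains_inf[OF compact_cball ne cc] by blast
 have BO: "?B \<subseteq> \<Omega>" using B ball_subset_cball by blast
 have Su: "subsol ?B u G" by (rule subsol_restrict[OF u_subsol BO order_refl openO open_ball])
 hence S: "SH ?B u G" by (simp add: subsol_def)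
 have ae: "AE x in Leb ?B. u y0 \<le> u x" "AE x in Leb ?B. u x \<le> u y1"
  using y0 y1 by (auto intro!: AE_I2)
 obtain h H where h: "harm ?B h H" "H10 ?B (\<lambda>x. h x - u x) (\<lambda>x. H x - G x)"
  "continuous_on (ball c r) h" "\<And>x. x \<in> ball c r \<Longrightarrow> u y0 \<le> h x \<and> h x \<le> u y1"
  by (rule harmonic_replacement[OF BO r S ae]) (rule that; assumption)
 have r2: "0 < 2 * r" using r by simp
 have le: "AE x in Leb ?B. u x - h x \<le> 0"
  by (rule subsol_comparison[OF BO r2 subsol_minus_harm[OF Su h(1) BO open_ball] H10_minus[OF h(2)]]) auto
 have sub: "ball c r \<subseteq> ?B" using r by (intro subset_ball) simp
 have ae2: "AE x in Leb (ball c r). u x \<le> h x"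
  using AE_lebesgue_on_subset[OF le sub] by (auto elim!: eventually_mono)
 show thesis
 proof (rule that[OF h(1,3)])
  show "L2 (Leb ?B) h" using h(1) SH_L2(1) by (auto simp: harm_def)
  show "m \<le> h x \<and> h x \<le> M" if "\<And>y. y \<in> cball c (2 * r) \<Longrightarrow> m \<le> u y \<and> u y \<le> M" "x \<in> ball c r" for m M x
   using that(1)[OF y0(1)] that(1)[OF y1(1)] h(4)[OF that(2)] by linarith
  show "u x \<le> h x" if "x \<in> ball c r" for x
   by (rule continuous_AE_le[OF open_ball continuous_on_subset[OF cu order_trans[OF sub BO]] h(3) ae2 that])
  show "(l2n (Leb ?B) (\<lambda>x. h x - u x))\<^sup>2 \<le> (KP * (2 * r))\<^sup>2 * (2 / lam) * gap c (2 * r)"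
   by (rule replacement_close[OF h(1,2) BO r2])
 qed
qed

end

section \<open>Linear growth and nondegeneracy of minimizers\<close>

lemma l2n_upper:
 fixes f :: "'a::euclidean_space \<Rightarrow> 'b::euclidean_space"
 assumes f: "L2 (Leb U) f" and V: "V \<in> lmeasurable" "V \<subseteq> U" "U \<in> sets lebesgue"
  and C: "\<And>x. x \<in> V \<Longrightarrow> norm (f x) \<le> C" "\<And>x. x \<in> U - V \<Longrightarrow> f x = 0"
 shows "(l2n (Leb U) f)\<^sup>2 \<le> C\<^sup>2 * measure lebesgue V"
proof -
 have s: "V \<in> sets (Leb U)" using V by (auto simp: sets_restrict_space intro!: image_eqI[of _ _ V])
 have e: "emeasure (Leb U) V = emeasure lebesgue V" using V by (intro emeasure_restrict_space) auto
 have fin: "emeasure (Leb U) V < \<infinity>" unfolding e using V(1) by (simp only: fmeasurable_def mem_Collect_eq infinity_ennreal_def)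
 have "(l2n (Leb U) f)\<^sup>2 \<le> (\<integral>x. C\<^sup>2 * indicator V x \<partial>Leb U)" unfolding l2n_sq
 proof (rule integral_mono)
  show "integrable (Leb U) (\<lambda>x. (norm (f x))\<^sup>2)" by (rule L2_integrable[OF f])
  show "integrable (Leb U) (\<lambda>x. C\<^sup>2 * indicator V x)" using s fin by (simp add: integrable_real_indicator)
  fix x assume "x \<in> space (Leb U)"
  hence "x \<in> U" by (simp add: space_restrict_space)
  thus "(norm (f x))\<^sup>2 \<le> C\<^sup>2 * indicator V x" using C by (auto intro!: power_mono split: split_indicator)
 qed
 also have "\<dots> = C\<^sup>2 * measure (Leb U) V" using s fin
  by (simp add: space_restrict_space) (metis V(2) Int_absorb2)
 also have "measure (Leb U) V = measure lebesgue V" by (simp add: measure_def e)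
 finally show ?thesis .
qed

lemma bump_energy:
 assumes "ball (c::'a::euclidean_space) (2 * \<rho>) \<subseteq> U" "open U" "bounded U" "\<rho> > 0"
 shows "(l2n (Leb U) (cgrad (bump c \<rho>)))\<^sup>2 \<le> (bumpC TYPE('a) / \<rho>)\<^sup>2 * measure lborel (ball c (2 * \<rho>))"
proof -
 have "(l2n (Leb U) (cgrad (bump c \<rho>)))\<^sup>2 \<le> (bumpC TYPE('a) / \<rho>)\<^sup>2 * measure lebesgue (ball c (2 * \<rho>))"
  by (rule l2n_upper[OF smooth_L2(2)[OF bump_smooth assms(2,3)]])
    (use assms bumpC(2)[OF assms(4)] test_fun_outside(2)[OF bump_test[OF assms(4)]] in auto)
 thus ?thesis by simp
qed

context elliptic
begin

text \<open>Stated before \<open>\<epsilon>\<close> and \<open>u\<close> are fixed, so it is uniform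
  along a sequence of minimizers. The 4 stems from comparing two replacements, \<open>8 ^ n\<close>
  from evaluating their difference on the ball of radius \<open>s/8\<close>, and the last factor is
  the bound for the squared L2 distance of a replacement from \<open>u\<close>, divided by
  \<open>s ^ (n + 2)\<close>.\<close>

definition CG :: "(real \<Rightarrow> real) \<Rightarrow> real" where
 "CG \<beta> = sqrt (4 * 8 ^ DIM('a) * CLB * (KP\<^sup>2 * (2 / lam) * (Mb \<beta> * w1)))"

text \<open>The bound of \<open>energy_decay\<close> with \<open>\<delta> = 2 * S\<close> and bump
  cutoffs, divided by the saturated penalty \<open>Mb \<beta>\<close>: it controls the volume where
  \<open>u \<ge> \<epsilon>\<close>.\<close>

definition CN :: "(real \<Rightarrow> real) \<Rightarrow> real" where
 "CN \<beta> = (4 * Lam\<^sup>2 / lam + 2 * Lam) * (bumpC TYPE('a))\<^sup>2 * w1 * 4 ^ DIM('a) / Mb \<beta>"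
definition CD :: "(real \<Rightarrow> real) \<Rightarrow> real" where "CD \<beta> = sqrt (4 ^ DIM('a) * CMV * CN \<beta>)"

lemma measure_ball_w1: "r \<ge> 0 \<Longrightarrow> measure lborel (ball (c::'a) r) = r ^ DIM('a) * w1"
 unfolding w1_def by (rule measure_ball_unit)

end

context minimizer
begin

text \<open>Says that \<open>t\<close> is the central value of a solution on the ball that is
  L2-close to \<open>u\<close>. Hiding the solution lets a real number be chosen at each dyadic
  scale.\<close>

definition repl :: "'a \<Rightarrow> real \<Rightarrow> real \<Rightarrow> bool" where
 "repl c s t \<longleftrightarrow> (\<exists>h H. harm (ball c s) h H \<and> continuous_on (ball c (s/2)) h \<and> h c = t \<and>
   l2n (Leb (ball c s)) (\<lambda>x. h x - u x) \<le> sqrt (KP\<^sup>2 * (2 / lam) * (Mb \<beta> * w1) * s ^ DIM('a) * s\<^sup>2))"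

lemma repl_exists:
 assumes B: "cball c s \<subseteq> \<Omega>" and s: "0 < s" "s < 1"
 obtains t where "repl c s t" "\<And>x. x \<in> cball c (s/8) \<Longrightarrow> u x \<le> CH * t"
  "\<And>m M. (\<And>y. y \<in> cball c s \<Longrightarrow> m \<le> u y \<and> u y \<le> M) \<Longrightarrow> m \<le> t \<and> t \<le> M"
proof -
 have B2: "cball c (2 * (s/2)) \<subseteq> \<Omega>" and s2: "0 < s/2" "2 * (s/2) < 1" using B s by auto
 have e: "2 * (s/2) = s" by simp
 obtain h H where h: "harm (ball c s) h H" "continuous_on (ball c (s/2)) h" "L2 (Leb (ball c s)) h"
  "\<And>m M x. (\<And>y. y \<in> cball c s \<Longrightarrow> m \<le> u y \<and> u y \<le> M) \<Longrightarrow> x \<in> ball c (s/2) \<Longrightarrow> m \<le> h x \<and> h x \<le> M"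
  "\<And>x. x \<in> ball c (s/2) \<Longrightarrow> u x \<le> h x"
  "(l2n (Leb (ball c s)) (\<lambda>x. h x - u x))\<^sup>2 \<le> (KP * s)\<^sup>2 * (2 / lam) * gap c s"
  by (fact replacement_u[OF B2 s2, unfolded e])
 have BO: "ball c s \<subseteq> \<Omega>" using B ball_subset_cball by blast
 have g: "gap c s \<le> Mb \<beta> * (s ^ DIM('a) * w1)" using gap_le[OF BO] measure_ball_w1[of s c] s by simp
 have "(KP * s)\<^sup>2 * (2 / lam) * gap c s \<le> (KP * s)\<^sup>2 * (2 / lam) * (Mb \<beta> * (s ^ DIM('a) * w1))"
  by (rule mult_left_mono[OF g]) (use lam in auto)
 also have "\<dots> = KP\<^sup>2 * (2 / lam) * (Mb \<beta> * w1) * s ^ DIM('a) * s\<^sup>2" by (simp add: power_mult_distrib)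
 finally have le: "l2n (Leb (ball c s)) (\<lambda>x. h x - u x) \<le> sqrt (KP\<^sup>2 * (2 / lam) * (Mb \<beta> * w1) * s ^ DIM('a) * s\<^sup>2)"
  using h(6) by (intro real_le_rsqrt) linarith
 have cs: "c \<in> ball c (s/2)" using s by simp
 show thesis
 proof (rule that[of "h c"])
  show "repl c s (h c)" unfolding repl_def using h(1,2) le by blast
  show "m \<le> h c \<and> h c \<le> M" if "\<And>y. y \<in> cball c s \<Longrightarrow> m \<le> u y \<and> u y \<le> M" for m M
   by (rule h(4)[OF that cs])
  fix x assume x: "x \<in> cball c (s/8)"
  have sub: "ball c (s/4) \<subseteq> ball c s" "cball c (s/4) \<subseteq> ball c (s/2)" using s by (auto simp: subset_iff)
  have s4: "0 < s/4" "s/4 < 1" and x2: "x \<in> cball c (s/4/2)" and xb: "x \<in> ball c (s/2)" using s x by auto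
  have "h x \<le> CH * h c"
  proof (rule harnack[OF harm_restrict[OF h(1) sub(1) BO open_ball open_ball] order_trans[OF sub(1) BO] s4 continuous_on_subset[OF h(2) sub(2)] _ x2])
   fix y assume y: "y \<in> cball c (s/4)"
   hence yb: "y \<in> ball c (s/2)" using sub by blast
   have "y \<in> cball c s" using yb s by auto
   hence "0 \<le> u y" using B u0 by blast
   thus "0 \<le> h y" using h(5)[OF yb] by linarith
  qed
  thus "u x \<le> CH * h c" using h(5)[OF xb] by linarith
 qed
qed

lemma CG_nonneg: "CG \<beta> \<ge> 0"
 unfolding CG_def using lam Mb_pos[OF beta] w1_pos CLB_pos by simp

text \<open>Both solutions are within order \<open>s ^ (n/2 + 1)\<close> of \<open>u\<close> in L2
  on the ball of radius \<open>s/8\<close>, and their difference is again a solution there, so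
  \<open>harm_local_bound\<close> controls it at the centre by a multiple of
  \<open>s\<close>.\<close>

lemma repl_step:
 assumes B: "cball c s \<subseteq> \<Omega>" and s: "0 < s" "s < 1" and t: "repl c s t" "repl c (s/2) t'"
 shows "t \<le> t' + CG \<beta> * s"
proof -
 let ?D = "KP\<^sup>2 * (2 / lam) * (Mb \<beta> * w1)" let ?n = "DIM('a)"
 have D0: "?D \<ge> 0" using lam Mb_pos[OF beta] w1_pos by simp
 from t(1) obtain h H where h: "harm (ball c s) h H" "continuous_on (ball c (s/2)) h" "h c = t"
   "l2n (Leb (ball c s)) (\<lambda>x. h x - u x) \<le> sqrt (?D * s ^ ?n * s\<^sup>2)" unfolding repl_def by blast
 from t(2) obtain h' H' where h': "harm (ball c (s/2)) h' H'" "continuous_on (ball c (s/2/2)) h'" "h' c = t'"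
   "l2n (Leb (ball c (s/2))) (\<lambda>x. h' x - u x) \<le> sqrt (?D * (s/2) ^ ?n * (s/2)\<^sup>2)" unfolding repl_def by blast
 let ?R = "s/8" let ?M = "Leb (ball c ?R)"
 have sub: "ball c ?R \<subseteq> ball c s" "ball c ?R \<subseteq> ball c (s/2)" "cball c ?R \<subseteq> ball c (s/2)" "cball c ?R \<subseteq> ball c (s/2/2)" "ball c (s/2) \<subseteq> ball c s"
  using s by (auto simp: subset_iff)
 have BO: "ball c s \<subseteq> \<Omega>" using B ball_subset_cball by blast
 note BO2 = order_trans[OF sub(5) BO] and BR = order_trans[OF sub(1) BO]
 have Lu: "L2 (Leb \<Omega>) u" by (rule SH_L2(1)[OF SHu])
 have Lh: "L2 (Leb (ball c s)) (\<lambda>x. h x - u x)"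
  by (intro L2_diff L2_restrict(1)[OF BO _ _ Lu]) (use h(1) SH_L2(1) openO in \<open>auto simp: harm_def\<close>)
 have Lh': "L2 (Leb (ball c (s/2))) (\<lambda>x. h' x - u x)"
  by (intro L2_diff L2_restrict(1)[OF BO2 _ _ Lu]) (use h'(1) SH_L2(1) openO in \<open>auto simp: harm_def\<close>)
 have r1: "L2 ?M (\<lambda>x. h x - u x)" "l2n ?M (\<lambda>x. h x - u x) \<le> l2n (Leb (ball c s)) (\<lambda>x. h x - u x)"
  by (auto intro!: L2_restrict[OF sub(1) _ _ Lh])
 have r2: "L2 ?M (\<lambda>x. h' x - u x)" "l2n ?M (\<lambda>x. h' x - u x) \<le> l2n (Leb (ball c (s/2))) (\<lambda>x. h' x - u x)"
  by (auto intro!: L2_restrict[OF sub(2) _ _ Lh'])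
 have "?D * ((s/2) ^ ?n * (s/2)\<^sup>2) \<le> ?D * (s ^ ?n * s\<^sup>2)"
  using s by (intro mult_left_mono[OF _ D0] mult_mono power_mono) auto
 hence sq: "sqrt (?D * (s/2) ^ ?n * (s/2)\<^sup>2) \<le> sqrt (?D * s ^ ?n * s\<^sup>2)" by (simp only: mult.assoc real_sqrt_le_iff)
 let ?X = "sqrt (?D * s ^ ?n * s\<^sup>2)"
 have "l2n ?M (\<lambda>x. h x - h' x) \<le> 2 * ?X"
 proof -
  have e: "(\<lambda>x. (h x - u x) - (h' x - u x)) = (\<lambda>x. h x - h' x)" by auto
  have "l2n ?M (\<lambda>x. (h x - u x) - (h' x - u x)) \<le> l2n ?M (\<lambda>x. (h x - u x) - 0) + l2n ?M (\<lambda>x. 0 - (h' x - u x))"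
   by (rule l2n_diff_triangle[OF r1(1) L2_zero r2(1)])
  also have "l2n ?M (\<lambda>x. 0 - (h' x - u x)) = l2n ?M (\<lambda>x. (h' x - u x) - 0)" by (rule l2n_minus_commute)
  finally show ?thesis unfolding diff_0_right e using r1(2) r2(2) h(4) h'(4) sq by linarith
 qed
 hence l: "(l2n ?M (\<lambda>x. h x - h' x))\<^sup>2 \<le> (2 * ?X)\<^sup>2" by (intro power_mono l2n_nonneg)
 have hd: "harm (ball c ?R) (\<lambda>x. h x - h' x) (\<lambda>x. H x - H' x)"
  by (rule harm_diff[OF harm_restrict[OF h(1) sub(1) BO open_ball open_ball] harm_restrict[OF h'(1) sub(2) BO2 open_ball open_ball] BR open_ball])
 have cd: "continuous_on (cball c ?R) (\<lambda>x. h x - h' x)"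
  by (intro continuous_intros continuous_on_subset[OF h(2) sub(3)] continuous_on_subset[OF h'(2) sub(4)])
 have R: "0 < ?R" "?R < 1" and cR: "c \<in> cball c (?R/2)" using s by auto
 have "?R ^ ?n * (t - t')\<^sup>2 \<le> CLB * (l2n ?M (\<lambda>x. h x - h' x))\<^sup>2"
  using harm_local_bound[OF hd BR R cd cR] h(3) h'(3) by simp
 also have "\<dots> \<le> CLB * (2 * ?X)\<^sup>2" by (rule mult_left_mono[OF l]) (use CLB_pos in simp)
 also have "(2 * ?X)\<^sup>2 = 4 * (?D * s ^ ?n * s\<^sup>2)"
 proof -
  have nn: "0 \<le> ?D * s ^ ?n * s\<^sup>2" using s by (intro mult_nonneg_nonneg D0) auto
  show ?thesis unfolding power_mult_distrib real_sqrt_pow2[OF nn] by simp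
 qed
 finally have "s ^ ?n * (t - t')\<^sup>2 \<le> s ^ ?n * ((CG \<beta>)\<^sup>2 * s\<^sup>2)"
 proof -
  assume a: "?R ^ ?n * (t - t')\<^sup>2 \<le> CLB * (4 * (?D * s ^ ?n * s\<^sup>2))"
  have CG2: "(CG \<beta>)\<^sup>2 = 4 * 8 ^ ?n * CLB * ?D" unfolding CG_def
   by (rule real_sqrt_pow2) (intro mult_nonneg_nonneg D0, use CLB_pos in auto)
  have e8: "s ^ ?n = 8 ^ ?n * ?R ^ ?n" using power_mult_distrib[of 8 ?R ?n] by simp
  have "s ^ ?n * (t - t')\<^sup>2 = 8 ^ ?n * (?R ^ ?n * (t - t')\<^sup>2)" unfolding e8 by (rule mult.assoc)
  also have "\<dots> \<le> 8 ^ ?n * (CLB * (4 * (?D * s ^ ?n * s\<^sup>2)))" by (rule mult_left_mono[OF a]) simp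
  also have "\<dots> = s ^ ?n * ((CG \<beta>)\<^sup>2 * s\<^sup>2)" unfolding CG2 by (simp only: mult_ac)
  finally show ?thesis .
 qed
 hence "(t - t')\<^sup>2 \<le> (CG \<beta> * s)\<^sup>2" using s by (simp add: power_mult_distrib)
 moreover have "CG \<beta> * s \<ge> 0" using CG_nonneg s by simp
 ultimately have "\<bar>t - t'\<bar> \<le> CG \<beta> * s" by (simp add: abs_le_square_iff[symmetric])
 thus ?thesis by linarith
qed

text \<open>The central values at radii \<open>s / 2 ^ j\<close> change by at most
  \<open>CG \<beta> * s / 2 ^ j\<close>, a geometric series with sum
  \<open>2 * CG \<beta> * s\<close>, and they tend to \<open>u c\<close> because each lies between
  the extremes of \<open>u\<close> on its ball. Harnack at the largest radius passes from the centre
  to \<open>x\<close>.\<close>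

lemma linear_growth:
 assumes B: "cball c s \<subseteq> \<Omega>" and s: "0 < s" "s < 1" and x: "x \<in> cball c (s/8)"
 shows "u x \<le> CH * (u c + 2 * CG \<beta> * s)"
proof -
 let ?s = "\<lambda>j::nat. s / 2 ^ j"
 have s': "0 < ?s j" "?s j < 1" "?s j \<le> s" for j
 proof -
  have "s / 2 ^ j \<le> s / 1" using s by (intro divide_left_mono) auto
  thus "?s j \<le> s" by simp
  thus "?s j < 1" using s by linarith
  show "0 < ?s j" using s by simp
 qed
 have Bj: "cball c (?s j) \<subseteq> \<Omega>" for j using B s'(3)[of j] by (meson order_trans subset_cball)
 have "\<exists>t. repl c (?s j) t \<and> (\<forall>x\<in>cball c (?s j/8). u x \<le> CH * t) \<and> (\<forall>m M. (\<forall>y\<in>cball c (?s j). m \<le> u y \<and> u y \<le> M) \<longrightarrow> m \<le> t \<and> t \<le> M)" for j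
  by (rule repl_exists[OF Bj s'(1,2)]) blast
 then obtain t where t: "\<And>j. repl c (?s j) (t j)" "\<And>j x. x\<in>cball c (?s j/8) \<Longrightarrow> u x \<le> CH * t j"
  "\<And>j m M. (\<forall>y\<in>cball c (?s j). m \<le> u y \<and> u y \<le> M) \<Longrightarrow> m \<le> t j \<and> t j \<le> M" by metis
 have step: "t j \<le> t (Suc j) + CG \<beta> * ?s j" for j
  using repl_step[OF Bj s'(1,2) t(1)[of j], of "t (Suc j)"] t(1)[of "Suc j"] by (simp add: mult.commute)
 have tot: "t 0 \<le> t j + CG \<beta> * s * (2 - 2 / 2 ^ j)" for j
 proof (induction j)
  case (Suc j)
  have "CG \<beta> * s * (2 - 2 / 2 ^ Suc j) = CG \<beta> * s * (2 - 2 / 2 ^ j) + CG \<beta> * ?s j" by (simp add: field_simps)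
  thus ?case using Suc step[of j] by linarith
 qed simp
 have "t 0 \<le> u c + 2 * CG \<beta> * s + e" if e: "e > 0" for e
 proof -
  have cB: "c \<in> \<Omega>" using B s by auto
  from cu[unfolded continuous_on_iff, rule_format, OF cB e] obtain d where d: "d > 0" "\<And>y. y \<in> \<Omega> \<Longrightarrow> dist y c < d \<Longrightarrow> dist (u y) (u c) < e" by blast
  obtain j where j: "(1/2::real) ^ j < d / s" using real_arch_pow_inv[of "d/s" "1/2"] d s by auto
  have js: "?s j < d" using j s by (simp add: power_divide field_simps)
  have "\<forall>y\<in>cball c (?s j). u c - e \<le> u y \<and> u y \<le> u c + e"
  proof
   fix y assume y: "y \<in> cball c (?s j)"
   hence "dist y c < d" using js by (simp add: dist_commute)
   hence "dist (u y) (u c) < e" using d(2) y Bj by blast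
   thus "u c - e \<le> u y \<and> u y \<le> u c + e" by (auto simp: dist_real_def)
  qed
  from t(3)[OF this] have tj: "t j \<le> u c + e" by simp
  have "CG \<beta> * s * (2 - 2 / 2 ^ j) \<le> CG \<beta> * s * 2" using CG_nonneg s by (intro mult_left_mono) auto
  thus ?thesis using tot[of j] tj by linarith
 qed
 hence "t 0 \<le> u c + 2 * CG \<beta> * s" by (rule field_le_epsilon)
 hence "CH * t 0 \<le> CH * (u c + 2 * CG \<beta> * s)" using CH_pos by simp
 moreover have "u x \<le> CH * t 0" using t(2)[of x 0] x by simp
 ultimately show ?thesis by linarith
qed

text \<open>Caccioppoli sees \<open>u\<close> only where the cutoff varies, so a bound on
  \<open>u\<close> is required only there. Since \<open>G\<close> vanishes where \<open>u\<close>
  does, it coincides with the gradient of the positive part.\<close>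

lemma grad_bound:
 assumes z: "test_fun \<Omega> z" "\<And>x. x \<in> V \<Longrightarrow> z x = 1" and V: "V \<subseteq> \<Omega>" "open V" and S: "S \<ge> 0" "\<And>x. x \<in> \<Omega> \<Longrightarrow> cgrad z x \<noteq> 0 \<Longrightarrow> u x \<le> S"
 shows "l2n (Leb V) G \<le> 2 * Lam / lam * (S * l2n (Leb \<Omega>) (cgrad z))"
proof -
 let ?M = "Leb \<Omega>"
 have zs: "smooth_fun z" using z(1) test_fun_smooth by blast
 have zm[measurable]: "z \<in> borel_measurable ?M" "cgrad z \<in> borel_measurable ?M" using smooth_meas[OF zs openO] by auto
 note O = openO bddO
 let ?F = "\<lambda>x. z x *\<^sub>R (if u x > 0 then G x else 0)"
 have Lz: "L2 ?M (cgrad z)" by (rule smooth_L2(2)[OF zs O])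
 have LP: "L2 ?M (\<lambda>x. if u x > 0 then G x else 0)" by (rule SH_L2(2)[OF SH_pos[OF SHu]])
 have LF: "L2 ?M ?F"
 proof -
  obtain Z where Z: "\<And>x. \<bar>z x\<bar> \<le> Z" by (rule test_fun_bounded[OF z(1)]) (rule that; assumption)
  have "\<bar>z x\<bar> \<le> \<bar>Z\<bar>" for x using Z[of x] by linarith
  thus ?thesis
   by (intro L2_bound(1)[OF _ L2_scaleR[OF LP, of Z]]) (auto intro!: mult_right_mono AE_I2)
 qed
 have LV: "L2 (Leb V) X" if "L2 ?M X" for X :: "'a \<Rightarrow> 'a"
  by (rule L2_restrict(1)[OF V(1) _ _ that]) (use openO V in auto)
 have "l2n (Leb V) G = l2n (Leb V) ?F"
 proof (rule l2n_cong_AE[OF L2_measurable[OF LV[OF LG]] L2_measurable[OF LV[OF LF]]])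
  have "AE x in Leb V. u x = 0 \<longrightarrow> G x = 0"
   using AE_lebesgue_on_subset[OF SH_grad_zero[OF SHu O] V(1)] openO V(2) by (auto elim!: eventually_mono)
  moreover have "AE x in Leb V. x \<in> V" using V(2) by (intro AE_I2) (simp add: space_restrict_space)
  ultimately show "AE x in Leb V. norm (G x) = norm (?F x)"
   by eventually_elim (use z(2) u0 V(1) in \<open>force simp: order_less_le\<close>)
 qed
 also have "\<dots> \<le> l2n ?M ?F" by (rule L2_restrict(2)[OF V(1) _ _ LF]) (use V openO in auto)
 also have "\<dots> \<le> 2 * Lam / lam * l2n ?M (\<lambda>x. max (u x) 0 *\<^sub>R cgrad z x)"
  by (rule caccioppoli[OF u_subsol z(1) order_refl openO])
 also have "\<dots> \<le> 2 * Lam / lam * (S * l2n ?M (cgrad z))"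
 proof (rule mult_left_mono)
  show "l2n ?M (\<lambda>x. max (u x) 0 *\<^sub>R cgrad z x) \<le> S * l2n ?M (cgrad z)"
  proof (rule order_trans[OF L2_bound(2)[OF _ L2_scaleR[OF Lz, of S]]])
   show "AE x in ?M. norm (max (u x) 0 *\<^sub>R cgrad z x) \<le> norm (S *\<^sub>R cgrad z x)"
   proof (rule AE_I2)
    fix x assume "x \<in> space ?M"
    hence x: "x \<in> \<Omega>" by (simp add: space_restrict_space)
    show "norm (max (u x) 0 *\<^sub>R cgrad z x) \<le> norm (S *\<^sub>R cgrad z x)"
     using S(1) S(2)[OF x] u0[OF x] by (cases "cgrad z x = 0") (auto intro!: mult_right_mono)
   qed
  qed (use S in \<open>auto simp: l2n_scaleR\<close>)
 qed (use lam in auto)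
 finally show ?thesis .
qed

definition low_energy :: "real \<Rightarrow> ('a \<Rightarrow> real) \<Rightarrow> real" where
 "low_energy \<delta> \<eta> = lam / 2 * (l2n (Leb \<Omega>) (\<lambda>x. if u x < \<delta> * \<eta> x then G x else 0))\<^sup>2
  + (\<integral>x. (if u x < \<delta> * \<eta> x then Be (u x) else 0) \<partial>Leb \<Omega>)"

text \<open>Minimality is tested in the direction \<open>- min u (\<delta> * \<eta>)\<close>, which removes the penalty where \<open>u < \<delta> * \<eta>\<close>.\<close>
lemma master_inequality:
 assumes e: "test_fun V \<eta>" "\<And>x. 0 \<le> \<eta> x" and V: "V \<subseteq> \<Omega>" "open V" and d: "\<delta> > 0"
 shows "low_energy \<delta> \<eta>
  \<le> \<delta> * Lam * (l2n (Leb V) G * l2n (Leb V) (cgrad \<eta>)) + Lam / 2 * \<delta>\<^sup>2 * (l2n (Leb V) (cgrad \<eta>))\<^sup>2"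
proof -
 let ?M = "Leb \<Omega>" let ?S = "\<lambda>x. u x < \<delta> * \<eta> x"
 note O = openO bddO
 have es: "smooth_fun \<eta>" using e(1) test_fun_smooth by blast
 have em[measurable]: "\<eta> \<in> borel_measurable ?M" "cgrad \<eta> \<in> borel_measurable ?M" using smooth_meas[OF es openO] by auto
 have Lce: "L2 ?M (\<lambda>x. \<delta> *\<^sub>R cgrad \<eta> x)" by (rule L2_scaleR[OF smooth_L2(2)[OF es O]])
 \<comment> \<open>The gradient of \<open>min u (\<delta> * \<eta>)\<close> splits into
   \<open>?P1\<close> where \<open>u\<close> is the smaller and \<open>?D\<close> elsewhere; the
   pieces have disjoint supports, so their mixed energies vanish.\<close>
 let ?P1 = "\<lambda>x. if ?S x then G x else 0" let ?D = "\<lambda>x. if ?S x then 0 else \<delta> *\<^sub>R cgrad \<eta> x"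
 have L1: "L2 ?M ?P1" by (rule L2_bound(1)[OF _ LG]) auto
 have L2: "L2 ?M ?D" by (rule L2_bound(1)[OF _ Lce]) auto
 have Hp: "H10 \<Omega> (\<lambda>x. \<delta> * \<eta> x) (\<lambda>x. \<delta> *\<^sub>R cgrad \<eta> x)"
  by (rule H10_cmult[OF H10_test[OF test_fun_mono[OF e(1) V(1)] O]])
 \<comment> \<open>The minimum is written as
   \<open>\<delta> * \<eta> - max (\<delta> * \<eta> - max u 0) 0\<close>, the form to which
   \<open>H10_pos_diff\<close> applies.\<close>
 note H1 = H10_diff[OF Hp H10_pos_diff[OF Hp SHu]]
 have sp: "AE x in ?M. x \<in> \<Omega>" by (intro AE_I2) (simp add: space_restrict_space)
 have p: "H10 \<Omega> (\<lambda>x. - min (u x) (\<delta> * \<eta> x)) (\<lambda>x. - (?P1 x + ?D x))"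
 proof (rule H10_cong_AE[OF H10_minus[OF H1]])
  show "AE x in ?M. - (\<delta> * \<eta> x - max (\<delta> * \<eta> x - max (u x) 0) 0) = - min (u x) (\<delta> * \<eta> x)"
   using sp
  proof eventually_elim
   case (elim x)
   show ?case unfolding max_absorb1[OF u0[OF elim]] by (auto simp: max_def min_def)
  qed
  show "AE x in ?M. - (\<delta> *\<^sub>R cgrad \<eta> x - (if 0 < \<delta> * \<eta> x - max (u x) 0 then \<delta> *\<^sub>R cgrad \<eta> x - (if 0 < u x then G x else 0) else 0)) = - (?P1 x + ?D x)"
   using SH_grad_zero[OF SHu O] sp
  proof eventually_elim
   case (elim x)
   have "max (u x) 0 = u x" using u0[OF elim(2)] by simp
   moreover have "G x = 0" if "\<not> 0 < u x" using elim u0[OF elim(2)] that by (auto simp: not_less)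
   ultimately show ?case by (cases "u x > 0") auto
  qed
 qed measurable
 note var = variation[OF p]
 have dis: "E \<Omega> ?P1 ?D = 0" "E \<Omega> ?D ?P1 = 0" unfolding E_def by (auto intro!: integral_eq_zero_AE AE_I2 simp: quad_zero)
 have PP: "E \<Omega> (\<lambda>x. - (?P1 x + ?D x)) (\<lambda>x. - (?P1 x + ?D x)) = E \<Omega> ?P1 ?P1 + E \<Omega> ?D ?D"
  unfolding E_minus_left[OF U\<Omega>] E_minus_right[OF U\<Omega>] using E_square[OF U\<Omega> L1 L2, of 1] dis by simp
 have GP: "E \<Omega> G (\<lambda>x. - (?P1 x + ?D x)) = - E \<Omega> G ?P1 - E \<Omega> G ?D"
  unfolding E_minus_right[OF U\<Omega>] using E_add_right[OF U\<Omega> L1 L2 LG] by simp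
 \<comment> \<open>The linear term thus contributes minus the energy of \<open>?P1\<close> and the
   quadratic one plus half of it; the remaining half ends up on the left-hand side.\<close>
 have "E \<Omega> G ?P1 = E \<Omega> ?P1 ?P1" unfolding E_def by (intro Bochner_Integration.integral_cong refl) (simp add: quad_zero)
 note GP = GP[unfolded this]
 have De: "?D = (\<lambda>x. if x \<in> V then ?D x else 0)"
 proof
  fix x show "?D x = (if x \<in> V then ?D x else 0)" using test_fun_outside[OF e(1), of x] by auto
 qed
 have LV: "L2 (Leb V) F" if "L2 ?M F" for F :: "'a \<Rightarrow> 'a"
  by (rule L2_restrict(1)[OF V(1) _ _ that]) (use openO V in auto)
 let ?g = "l2n (Leb V) G" and ?e = "l2n (Leb V) (cgrad \<eta>)"
 have lD: "l2n (Leb V) ?D \<le> \<delta> * ?e"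
  using L2_bound(2)[OF L2_measurable[OF LV[OF L2]] LV[OF Lce]] d by (simp add: l2n_scaleR)
 have "E \<Omega> G ?D = E V G ?D" by (subst De) (rule E_restrict[OF V(1) order_refl openO V(2)])
 also have "\<bar>\<dots>\<bar> \<le> Lam * (?g * l2n (Leb V) ?D)" by (rule E_bound[OF V LV[OF LG] LV[OF L2]])
 finally have g1: "- E \<Omega> G ?D \<le> Lam * (?g * l2n (Leb V) ?D)" by linarith
 have "Lam * (?g * l2n (Leb V) ?D) \<le> Lam * (?g * (\<delta> * ?e))"
  using lam lD l2n_nonneg by (intro mult_left_mono) auto
 with g1 have g2: "- E \<Omega> G ?D \<le> \<delta> * Lam * (?g * ?e)" by (simp add: mult_ac)
 have "E \<Omega> ?D ?D = E V ?D ?D" by (subst (2) De) (rule E_restrict[OF V(1) order_refl openO V(2)])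
 also have "\<dots> \<le> Lam * (l2n (Leb V) ?D * l2n (Leb V) ?D)" using E_bound[OF V LV[OF L2] LV[OF L2]] by linarith
 finally have d1: "E \<Omega> ?D ?D \<le> Lam * (l2n (Leb V) ?D * l2n (Leb V) ?D)" .
 have "Lam * (l2n (Leb V) ?D * l2n (Leb V) ?D) \<le> Lam * ((\<delta> * ?e) * (\<delta> * ?e))"
  using lam lD l2n_nonneg d by (intro mult_left_mono mult_mono) auto
 with d1 have d2: "1/2 * E \<Omega> ?D ?D \<le> Lam / 2 * \<delta>\<^sup>2 * ?e\<^sup>2" by (simp add: power2_eq_square mult_ac)
 have i1: "integrable ?M (\<lambda>x. if ?S x then Be (u x) else 0)"
  by (rule Bochner_Integration.integrable_bound[OF B_int[OF um O]]) auto
 have "(\<integral>x. Be (u x + - min (u x) (\<delta> * \<eta> x)) - Be (u x) \<partial>?M) \<le> (\<integral>x. - (if ?S x then Be (u x) else 0) \<partial>?M)"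
 proof (rule integral_mono)
  show "integrable ?M (\<lambda>x. Be (u x + - min (u x) (\<delta> * \<eta> x)) - Be (u x))"
   by (intro Bochner_Integration.integrable_diff B_int O) measurable
  show "Be (u x + - min (u x) (\<delta> * \<eta> x)) - Be (u x) \<le> - (if ?S x then Be (u x) else 0)" for x
   using d e(2)[of x] by (auto simp: Bfacts min_def intro!: Bfacts(1))
 qed (intro Bochner_Integration.integrable_minus i1)
 hence bb: "(\<integral>x. Be (u x + - min (u x) (\<delta> * \<eta> x)) - Be (u x) \<partial>?M) \<le> - (\<integral>x. (if ?S x then Be (u x) else 0) \<partial>?M)" by simp
 have "lam / 2 * (l2n ?M ?P1)\<^sup>2 \<le> 1/2 * E \<Omega> ?P1 ?P1" using E_lower[OF U\<Omega> L1] by simp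
 thus ?thesis using var bb d2 g2 unfolding PP GP low_energy_def by argo
qed

text \<open>\<open>grad_bound\<close> controls the gradient of \<open>u\<close> where
  \<open>\<eta>\<close> varies. The leading term is linear in \<open>\<delta>\<close>, from pairing
  \<open>G\<close> with \<open>\<delta>\<close> times the gradient of \<open>\<eta>\<close>.\<close>

lemma energy_decay:
 assumes z: "test_fun \<Omega> z" "\<And>x. x \<in> V \<Longrightarrow> z x = 1" and e: "test_fun V \<eta>" "\<And>x. 0 \<le> \<eta> x"
  and V: "V \<subseteq> \<Omega>" "open V" and S: "S \<ge> 0" "\<And>x. x \<in> \<Omega> \<Longrightarrow> cgrad z x \<noteq> 0 \<Longrightarrow> u x \<le> S" and d: "\<delta> > 0"
  and Z: "l2n (Leb \<Omega>) (cgrad z) \<le> Y" "l2n (Leb V) (cgrad \<eta>) \<le> Y"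
 shows "low_energy \<delta> \<eta>
  \<le> (2 * Lam\<^sup>2 / lam * S * \<delta> + Lam / 2 * \<delta>\<^sup>2) * Y\<^sup>2"
proof -
 let ?g = "l2n (Leb V) G" and ?e = "l2n (Leb V) (cgrad \<eta>)"
 have Y: "0 \<le> Y" using Z(2) l2n_nonneg order_trans by blast
 have "2 * Lam / lam * (S * l2n (Leb \<Omega>) (cgrad z)) \<le> 2 * Lam / lam * (S * Y)"
  using lam S(1) Z(1) by (intro mult_left_mono) auto
 with grad_bound[OF z V S] have g: "?g \<le> 2 * Lam / lam * (S * Y)" by linarith
 have "\<delta> * Lam * (?g * ?e) \<le> \<delta> * Lam * (2 * Lam / lam * (S * Y) * Y)"
  using lam d g Z(2) Y S(1) by (intro mult_left_mono mult_mono l2n_nonneg) auto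
 moreover have "Lam / 2 * \<delta>\<^sup>2 * ?e\<^sup>2 \<le> Lam / 2 * \<delta>\<^sup>2 * Y\<^sup>2"
  using lam Z(2) by (intro mult_left_mono power_mono l2n_nonneg) auto
 moreover have "\<delta> * Lam * (2 * Lam / lam * (S * Y) * Y) + Lam / 2 * \<delta>\<^sup>2 * Y\<^sup>2 = (2 * Lam\<^sup>2 / lam * S * \<delta> + Lam / 2 * \<delta>\<^sup>2) * Y\<^sup>2"
  by (simp add: algebra_simps power2_eq_square)
 ultimately show ?thesis using master_inequality[OF e V d] by linarith
qed

lemma Be_integrable: "integrable (Leb \<Omega>) (\<lambda>x. if u x < \<delta> * \<eta> x then Be (u x) else 0)"
 if [measurable]: "\<eta> \<in> borel_measurable (Leb \<Omega>)" for \<eta> :: "'a \<Rightarrow> real"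
 by (rule Bochner_Integration.integrable_bound[OF B_int[OF um openO bddO]]) auto

lemma Be_volume:
 assumes V: "V \<in> lmeasurable" "V \<subseteq> \<Omega>" "\<And>x. x \<in> V \<Longrightarrow> \<epsilon> \<le> u x \<and> u x < \<delta> * \<eta> x" and m[measurable]: "\<eta> \<in> borel_measurable (Leb \<Omega>)"
 shows "Mb \<beta> * measure lebesgue V \<le> low_energy \<delta> \<eta>"
proof -
 have s: "V \<in> sets (Leb \<Omega>)" using V openO by (auto simp: sets_restrict_space intro!: image_eqI[of _ _ V])
 have e: "emeasure (Leb \<Omega>) V = emeasure lebesgue V" using V openO by (intro emeasure_restrict_space) auto
 have fin: "emeasure (Leb \<Omega>) V < \<infinity>" unfolding e using V(1) by (simp only: fmeasurable_def mem_Collect_eq infinity_ennreal_def)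
 have "Mb \<beta> * measure lebesgue V = Mb \<beta> * measure (Leb \<Omega>) V" by (simp add: measure_def e)
 also have "\<dots> = (\<integral>x. Mb \<beta> * indicator V x \<partial>Leb \<Omega>)" using s fin V(2)
  by (simp add: space_restrict_space Int_absorb2)
 also have "\<dots> \<le> (\<integral>x. (if u x < \<delta> * \<eta> x then Be (u x) else 0) \<partial>Leb \<Omega>)"
 proof (rule integral_mono[OF _ Be_integrable[OF m]])
  show "integrable (Leb \<Omega>) (\<lambda>x. Mb \<beta> * indicator V x)" using s fin by (simp add: integrable_real_indicator)
  show "Mb \<beta> * indicator V x \<le> (if u x < \<delta> * \<eta> x then Be (u x) else 0)" for x
   using V(3)[of x] Bfacts by (auto split: split_indicator)
 qed
 also have "\<dots> \<le> low_energy \<delta> \<eta>" unfolding low_energy_def using lam by simp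
 finally show ?thesis .
qed

lemma gradient_le_low_energy: "lam / 2 * (l2n (Leb \<Omega>) (\<lambda>x. if u x < \<delta> * \<eta> x then G x else 0))\<^sup>2 \<le> low_energy \<delta> \<eta>"
proof -
 have "0 \<le> (\<integral>x. (if u x < \<delta> * \<eta> x then Be (u x) else 0) \<partial>Leb \<Omega>)" by (rule integral_nonneg_AE) (auto simp: Bfacts)
 thus ?thesis unfolding low_energy_def by linarith
qed

text \<open>With \<open>\<delta> = 2 * S\<close> the whole inner ball lies in
  \<open>{u < \<delta> * \<eta>}\<close>, so the volume where \<open>u \<ge> \<epsilon>\<close> is
  at most \<open>CN \<beta> * (S / \<rho>) ^ 2 * \<rho> ^ n\<close>. The mean value inequality for
  the positive part of \<open>u - \<epsilon>\<close>, which is at most \<open>S\<close> and lives on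
  that set, gives a bound quadratic in \<open>S\<close>: an improvement when \<open>S\<close> is a
  small multiple of \<open>\<rho>\<close>.\<close>

lemma nondegeneracy:
 assumes B: "ball c (4 * \<rho>) \<subseteq> \<Omega>" and \<rho>: "0 < \<rho>" "\<rho> < 1" and S: "S > 0" "\<And>x. x \<in> ball c (4 * \<rho>) \<Longrightarrow> u x \<le> S"
  and x: "x \<in> cball c (\<rho> / 16)"
 shows "u x \<le> \<epsilon> + CD \<beta> * S\<^sup>2 / \<rho>"
proof -
 let ?n = "DIM('a)"
 let ?Z = "(bumpC TYPE('a) / \<rho>)\<^sup>2 * ((4 * \<rho>) ^ ?n * w1)" let ?Y = "sqrt ?Z"
 have w: "w1 > 0" by (rule w1_pos)
 have Z0: "?Z \<ge> 0" using \<rho> w by simp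
 have B2: "ball c (2 * \<rho>) \<subseteq> ball c (4 * \<rho>)" "ball c \<rho> \<subseteq> ball c (2 * \<rho>)" using \<rho> by (auto intro!: subset_ball)
 have V: "ball c (2 * \<rho>) \<subseteq> \<Omega>" using B B2 by blast
 have r2: "2 * \<rho> > 0" using \<rho> by simp
 have e4: "2 * (2 * \<rho>) = 4 * \<rho>" by simp
 have "(l2n (Leb \<Omega>) (cgrad (bump c (2 * \<rho>))))\<^sup>2 \<le> (bumpC TYPE('a) / (2 * \<rho>))\<^sup>2 * ((4 * \<rho>) ^ ?n * w1)"
  using bump_energy[OF _ openO bddO r2, of c] B \<rho> unfolding e4 by (simp add: measure_ball_w1)
 also have "\<dots> \<le> ?Z" using \<rho> w bumpC(1)[where 'a='a] by (intro mult_right_mono power_mono divide_left_mono) auto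
 finally have z: "l2n (Leb \<Omega>) (cgrad (bump c (2 * \<rho>))) \<le> ?Y" by (rule real_le_rsqrt)
 have "(l2n (Leb (ball c (2 * \<rho>))) (cgrad (bump c \<rho>)))\<^sup>2 \<le> (bumpC TYPE('a) / \<rho>)\<^sup>2 * ((2 * \<rho>) ^ ?n * w1)"
  using bump_energy[OF order_refl open_ball bounded_ball \<rho>(1), of c] \<rho> by (simp add: measure_ball_w1)
 also have "\<dots> \<le> ?Z" using \<rho> w by (intro mult_left_mono mult_right_mono power_mono) auto
 finally have y: "l2n (Leb (ball c (2 * \<rho>))) (cgrad (bump c \<rho>)) \<le> ?Y" by (rule real_le_rsqrt)
 have tz: "test_fun \<Omega> (bump c (2 * \<rho>))" using test_fun_mono[OF bump_test[OF r2] B[folded e4]] .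
 have z1: "bump c (2 * \<rho>) x = 1" if "x \<in> ball c (2 * \<rho>)" for x
  by (rule bump_one[OF r2]) (use that in \<open>auto simp: dist_norm norm_minus_commute\<close>)
 have zS: "u x \<le> S" if "x \<in> \<Omega>" "cgrad (bump c (2 * \<rho>)) x \<noteq> 0" for x
  using S(2) that(2) test_fun_outside(2)[OF bump_test[OF r2, unfolded e4]] by blast
 have S0: "0 \<le> S" and d: "2 * S > 0" using S(1) by auto
 note I = energy_decay[OF tz z1 bump_test[OF \<rho>(1)] bump_range(1) V open_ball S0 zS d z y]
 let ?W = "{x \<in> ball c \<rho>. \<epsilon> \<le> u x}"
 have cb: "continuous_on (ball c \<rho>) u" by (rule continuous_on_subset[OF cu]) (use V B2 in blast)
 have W: "?W \<in> lmeasurable"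
 proof (rule bounded_set_imp_lmeasurable)
  have "?W = {x \<in> space (Leb (ball c \<rho>)). \<epsilon> \<le> u x}" by (auto simp: space_restrict_space)
  also have "\<dots> \<in> sets (Leb (ball c \<rho>))"
   using continuous_measurable_lebesgue_on[OF cb open_ball] by measurable
  finally show "?W \<in> sets lebesgue" unfolding sets_restrict_space using sets.Int[of "ball c \<rho>" lebesgue] by auto
 qed (auto intro: bounded_subset[OF bounded_ball])
 have Wm: "Mb \<beta> * measure lebesgue ?W \<le> low_energy (2 * S) (bump c \<rho>)"
 proof (rule Be_volume[OF W])
  show "?W \<subseteq> \<Omega>" using V B2 by blast
  fix x assume x: "x \<in> ?W"
  hence "bump c \<rho> x = 1" using \<rho> by (intro bump_one) (auto simp: dist_norm norm_minus_commute)
  moreover have "u x \<le> S" using x B2 S(2) by blast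
  ultimately show "\<epsilon> \<le> u x \<and> u x < 2 * S * bump c \<rho> x" using x S(1) by auto
 qed (rule smooth_meas(1)[OF bump_smooth openO])
 have M: "Mb \<beta> > 0" by (rule Mb_pos[OF beta])
 have "Mb \<beta> * measure lebesgue ?W \<le> (2 * Lam\<^sup>2 / lam * S * (2 * S) + Lam / 2 * (2 * S)\<^sup>2) * ?Z"
  using I Wm unfolding real_sqrt_pow2[OF Z0] by linarith
 also have "\<dots> = Mb \<beta> * (CN \<beta> * (S / \<rho>)\<^sup>2 * \<rho> ^ ?n)"
  unfolding CN_def using M lam \<rho> by (simp add: field_simps power2_eq_square power_mult_distrib)
 finally have Wle: "measure lebesgue ?W \<le> CN \<beta> * (S / \<rho>)\<^sup>2 * \<rho> ^ ?n" using M by (rule mult_left_le_imp_le)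
 have e: "4 * (\<rho>/4) = \<rho>" by simp
 have BO: "ball c (4 * (\<rho>/4)) \<subseteq> \<Omega>" unfolding e using V B2 by blast
 have "subsol (ball c (4 * (\<rho>/4))) (\<lambda>x. u x - \<epsilon>) (\<lambda>x. G x - 0)"
  by (rule subsol_minus_harm[OF subsol_restrict[OF u_subsol BO order_refl openO open_ball] harm_const[OF BO open_ball] BO open_ball])
 note sub = this[unfolded diff_0_right]
 have r4: "0 < \<rho>/4" "2 * (\<rho>/4) < 1" using \<rho> by auto
 have "(\<rho>/4) ^ ?n * (max (u x - \<epsilon>) 0)\<^sup>2 \<le> CMV * (l2n (Leb (ball c \<rho>)) (\<lambda>x. max (u x - \<epsilon>) 0))\<^sup>2"
 proof (rule mean_value[OF sub BO r4, unfolded e])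
  show "AE x in Leb (ball c \<rho>). u x - \<epsilon> \<le> S"
  proof (rule AE_I2)
   fix x assume "x \<in> space (Leb (ball c \<rho>))"
   hence "x \<in> ball c \<rho>" by (simp add: space_restrict_space)
   hence "u x \<le> S" using S(2) B2 by blast
   thus "u x - \<epsilon> \<le> S" using eps by simp
  qed
  show "continuous_on (ball c (\<rho>/4)) (\<lambda>x. u x - \<epsilon>)"
   by (intro continuous_intros continuous_on_subset[OF cb]) (use \<rho> in \<open>auto intro!: subset_ball\<close>)
  show "x \<in> cball c (\<rho>/4/4)" using x by simp
 qed
 also have "\<dots> \<le> CMV * (S\<^sup>2 * (CN \<beta> * (S / \<rho>)\<^sup>2 * \<rho> ^ ?n))"
 proof (rule mult_left_mono)
  have L: "L2 (Leb (ball c \<rho>)) (\<lambda>x. max (u x - \<epsilon>) 0)"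
   using SH_L2(1)[OF SH_pos[of "ball c (4 * (\<rho>/4))" "\<lambda>x. u x - \<epsilon>" G]] sub unfolding e subsol_def by blast
  have "(l2n (Leb (ball c \<rho>)) (\<lambda>x. max (u x - \<epsilon>) 0))\<^sup>2 \<le> S\<^sup>2 * measure lebesgue ?W"
  proof (rule l2n_upper[OF L W])
   fix x assume x: "x \<in> ?W"
   hence "u x \<le> S" using B2 S(2) by blast
   thus "norm (max (u x - \<epsilon>) 0) \<le> S" using x eps S(1) by auto
  qed auto
  also have "\<dots> \<le> S\<^sup>2 * (CN \<beta> * (S / \<rho>)\<^sup>2 * \<rho> ^ ?n)" by (rule mult_left_mono[OF Wle]) simp
  finally show "(l2n (Leb (ball c \<rho>)) (\<lambda>x. max (u x - \<epsilon>) 0))\<^sup>2 \<le> S\<^sup>2 * (CN \<beta> * (S / \<rho>)\<^sup>2 * \<rho> ^ ?n)" .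
 qed (use CMV_pos in simp)
 finally have f: "(\<rho>/4) ^ ?n * (max (u x - \<epsilon>) 0)\<^sup>2 \<le> CMV * (S\<^sup>2 * (CN \<beta> * (S / \<rho>)\<^sup>2 * \<rho> ^ ?n))" .
 have CN0: "CN \<beta> \<ge> 0" unfolding CN_def using lam M w by (intro divide_nonneg_nonneg mult_nonneg_nonneg add_nonneg_nonneg) auto
 have CD2: "(CD \<beta>)\<^sup>2 = 4 ^ ?n * CMV * CN \<beta>" unfolding CD_def using CN0 CMV_pos by simp
 have e4n: "\<rho> ^ ?n = 4 ^ ?n * (\<rho>/4) ^ ?n" using power_mult_distrib[of 4 "\<rho>/4" ?n] by simp
 have "(\<rho>/4) ^ ?n * (max (u x - \<epsilon>) 0)\<^sup>2 \<le> (\<rho>/4) ^ ?n * (CD \<beta> * S\<^sup>2 / \<rho>)\<^sup>2"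
 proof -
  have "(CD \<beta> * S\<^sup>2 / \<rho>)\<^sup>2 = (CD \<beta>)\<^sup>2 * (S\<^sup>2 * (S / \<rho>)\<^sup>2)" by (simp add: power2_eq_square)
  hence "(\<rho>/4) ^ ?n * (CD \<beta> * S\<^sup>2 / \<rho>)\<^sup>2 = CMV * (S\<^sup>2 * (CN \<beta> * (S / \<rho>)\<^sup>2 * \<rho> ^ ?n))"
   unfolding CD2 e4n by (simp only: mult_ac)
  thus ?thesis using f by linarith
 qed
 hence "(max (u x - \<epsilon>) 0)\<^sup>2 \<le> (CD \<beta> * S\<^sup>2 / \<rho>)\<^sup>2" by (rule mult_left_le_imp_le) (use \<rho> in simp)
 moreover have "0 \<le> CD \<beta> * S\<^sup>2 / \<rho>" unfolding CD_def using CN0 CMV_pos \<rho> by simp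
 ultimately have "max (u x - \<epsilon>) 0 \<le> CD \<beta> * S\<^sup>2 / \<rho>" by (rule power2_le_imp_le)
 thus ?thesis by linarith
qed

end

section \<open>Hausdorff measure: covers, null sets, dimension and sweeping along segments\<close>

lemma diam_pow_nonneg: "0 \<le> diam_pow s C" by (simp add: diam_pow_def)

text \<open>In dimension one the exponent is 0, and the convention that \<open>diam_pow 0\<close> is
  1 on nonempty sets agrees with \<open>0 ^ 0 = 1\<close>; for a positive exponent both expressions
  vanish at diameter 0.\<close>

lemma diam_pow_dim:
 assumes C: "bounded (C::'a::euclidean_space set)" shows "diam_pow (real DIM('a) - 1) C = (if C = {} then 0 else diameter C ^ (DIM('a) - 1))"
proof -
 have n: "real DIM('a) - 1 = real (DIM('a) - 1)" using DIM_positive[where 'a='a] by (simp add: of_nat_diff)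
 have "diameter C = 0 \<or> diameter C > 0" using diameter_ge_0[OF C] by linarith
 thus ?thesis unfolding diam_pow_def n using powr_realpow[of "diameter C"] by (cases "DIM('a) - 1 = 0") (auto simp del: of_nat_diff of_nat_1)
qed

lemma hausdorff_delta_le:
 assumes "A \<subseteq> (\<Union>i. C i)" "\<And>i. bounded (C i)" "\<And>i. diameter (C i) \<le> \<delta>"
 shows "hausdorff_delta s \<delta> A \<le> (\<Sum>i. ennreal (diam_pow s (C i)))"
 unfolding hausdorff_delta_def by (rule Inf_lower) (use assms in blast)

lemma hausdorff_cover:
 assumes "hausdorff_delta s \<delta> A < e"
 obtains C where "A \<subseteq> (\<Union>i. C i)" "\<And>i::nat. bounded (C i)" "\<And>i. diameter (C i) \<le> \<delta>" "(\<Sum>i. ennreal (diam_pow s (C i))) < e"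
 using assms unfolding hausdorff_delta_def Inf_less_iff by blast

lemma hausdorff_delta_antimono: "\<delta> \<le> \<delta>' \<Longrightarrow> hausdorff_delta s \<delta>' A \<le> hausdorff_delta s \<delta> A"
 unfolding hausdorff_delta_def by (rule Inf_superset_mono, rule Collect_mono, rule impI, erule ex_forward) (auto intro: order_trans)

lemma hausdorff_delta_measure: "\<delta> > 0 \<Longrightarrow> hausdorff_delta s \<delta> A \<le> hausdorff_measure s A"
 unfolding hausdorff_measure_def by (rule SUP_upper) simp

lemma hausdorff_measure_leI: "(\<And>\<delta>. \<delta> > 0 \<Longrightarrow> hausdorff_delta s \<delta> A \<le> e) \<Longrightarrow> hausdorff_measure s A \<le> e"
 unfolding hausdorff_measure_def by (rule SUP_least) simp

lemma hausdorff_measure_mono: assumes "A \<subseteq> B" shows "hausdorff_measure s A \<le> hausdorff_measure s B"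
proof (rule hausdorff_measure_leI)
 fix \<delta> :: real assume "\<delta> > 0"
 have "hausdorff_delta s \<delta> A \<le> hausdorff_delta s \<delta> B"
  unfolding hausdorff_delta_def by (rule Inf_superset_mono) (use assms in blast)
 also have "\<dots> \<le> hausdorff_measure s B" by (rule hausdorff_delta_measure[OF \<open>\<delta> > 0\<close>])
 finally show "hausdorff_delta s \<delta> A \<le> hausdorff_measure s B" .
qed

text \<open>The common core of two facts: with \<open>k = 1\<close> null sets stay null for larger
  exponents, and with \<open>k \<delta> = \<delta> powr (t - s)\<close> finite measure forces
  measure 0 for every larger exponent.\<close>

lemma hausdorff_compare:
 fixes A :: "'a::euclidean_space set"
 assumes A: "hausdorff_measure s A < \<infinity>" and le: "\<And>C \<delta>. bounded C \<Longrightarrow> diameter C \<le> \<delta> \<Longrightarrow> 0 < \<delta> \<Longrightarrow> \<delta> \<le> 1 \<Longrightarrow> diam_pow t (C::'a set) \<le> k \<delta> * diam_pow s C"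
  and \<delta>: "0 < \<delta>" "\<delta> \<le> 1" "k \<delta> \<ge> 0"
 shows "hausdorff_delta t \<delta> A \<le> ennreal (k \<delta>) * hausdorff_measure s A"
proof -
 have "hausdorff_delta t \<delta> A \<le> ennreal (k \<delta>) * (hausdorff_measure s A + ennreal e)" if e: "e > 0" for e
 proof -
  have "hausdorff_delta s \<delta> A < hausdorff_measure s A + ennreal e"
   using hausdorff_delta_measure[OF \<delta>(1), of s A] A e by (metis add.commute ennreal_add_left_cancel_less add_0 add.right_neutral ennreal_less_zero_iff infinity_ennreal_def order_le_less_trans)
  then obtain C where C: "A \<subseteq> (\<Union>i. C i)" "\<And>i::nat. bounded (C i)" "\<And>i. diameter (C i) \<le> \<delta>"
   "(\<Sum>i. ennreal (diam_pow s (C i))) < hausdorff_measure s A + ennreal e" by (rule hausdorff_cover) (rule that; assumption)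
  have "hausdorff_delta t \<delta> A \<le> (\<Sum>i. ennreal (diam_pow t (C i)))" by (rule hausdorff_delta_le[OF C(1-3)])
  also have "\<dots> \<le> (\<Sum>i. ennreal (k \<delta>) * ennreal (diam_pow s (C i)))"
   by (rule suminf_le) (use le[OF C(2,3) \<delta>(1,2)] \<delta> in \<open>auto simp: ennreal_mult[symmetric] diam_pow_nonneg intro!: ennreal_leI\<close>)
  also have "\<dots> \<le> ennreal (k \<delta>) * (hausdorff_measure s A + ennreal e)"
   unfolding ennreal_suminf_cmult by (rule mult_left_mono) (use C(4) in auto)
  finally show ?thesis .
 qed
 hence "hausdorff_delta t \<delta> A \<le> ennreal (k \<delta>) * hausdorff_measure s A + ennreal e'" if "e' > 0" for e'
 proof -
  have p: "e' / (k \<delta> + 1) > 0" using that \<delta>(3) by simp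
  have "hausdorff_delta t \<delta> A \<le> ennreal (k \<delta>) * hausdorff_measure s A + ennreal (k \<delta>) * ennreal (e' / (k \<delta> + 1))"
   using \<open>\<And>e. e > 0 \<Longrightarrow> _\<close>[OF p] by (simp add: distrib_left)
  also have "ennreal (k \<delta>) * ennreal (e' / (k \<delta> + 1)) \<le> ennreal e'"
   using that \<delta>(3) by (simp add: ennreal_mult[symmetric] divide_simps algebra_simps)
  finally show ?thesis by (simp add: add_left_mono)
 qed
 thus ?thesis by (rule ennreal_le_epsilon)
qed

lemma hausdorff_null_mono:
 assumes "0 \<le> s" "s \<le> t" "hausdorff_measure s A = 0" shows "hausdorff_measure t (A::'a::euclidean_space set) = 0"
proof -
 have le: "diam_pow t C \<le> 1 * diam_pow s C" if bC: "bounded C" and that: "diameter C \<le> \<delta>" "0 < \<delta>" "\<delta> \<le> 1" for C :: "'a set" and \<delta>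
 proof -
  have d: "0 \<le> diameter C" by (rule diameter_ge_0[OF bC])
  have "diameter C powr t \<le> diameter C powr s" if "s > 0"
   using that assms \<open>diameter C \<le> \<delta>\<close> \<open>\<delta> \<le> 1\<close> d by (cases "diameter C = 0") (auto intro!: powr_mono')
  moreover have "diameter C powr t \<le> 1" using powr_mono2[of t "diameter C" 1] assms that d by auto
  ultimately show ?thesis using assms by (auto simp: diam_pow_def)
 qed
 have "hausdorff_measure t A \<le> 0"
 proof (rule hausdorff_measure_leI)
  fix \<delta> :: real assume "\<delta> > 0"
  hence m: "0 < min \<delta> 1" "min \<delta> 1 \<le> 1" by auto
  have "hausdorff_delta t \<delta> A \<le> hausdorff_delta t (min \<delta> 1) A" by (rule hausdorff_delta_antimono) simp
  also have "\<dots> \<le> ennreal 1 * hausdorff_measure s A"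
   by (rule hausdorff_compare[where k="\<lambda>_. 1"]) (use le m assms in auto)
  finally show "hausdorff_delta t \<delta> A \<le> 0" using assms by simp
 qed
 thus ?thesis by simp
qed

lemma hausdorff_null_of_finite:
 assumes "0 \<le> s" "s < t" "hausdorff_measure s A < \<infinity>" shows "hausdorff_measure t (A::'a::euclidean_space set) = 0"
proof -
 have le: "diam_pow t C \<le> \<delta> powr (t - s) * diam_pow s C" if bC: "bounded C" and d1: "diameter C \<le> \<delta>" "0 < \<delta>" "\<delta> \<le> 1" for C :: "'a set" and \<delta>
 proof -
  have d: "0 \<le> diameter C" by (rule diameter_ge_0[OF bC])
  have p: "diameter C powr (t - s) \<le> \<delta> powr (t - s)" using d d1 assms by (intro powr_mono2) auto
  have "diameter C powr t = diameter C powr (t - s) * diameter C powr s" by (simp add: powr_add[symmetric])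
  also have "\<dots> \<le> \<delta> powr (t - s) * diameter C powr s" by (rule mult_right_mono[OF p]) simp
  finally show ?thesis using p assms by (cases "s = 0") (auto simp: diam_pow_def)
 qed
 obtain H where H: "hausdorff_measure s A = ennreal H" "H \<ge> 0" using assms(3) by (cases "hausdorff_measure s A") auto
 have "hausdorff_delta t \<delta> A \<le> 0" if "\<delta> > 0" for \<delta>
 proof (rule ennreal_le_epsilon)
  fix e :: real assume e: "e > 0"
  have "((\<lambda>d. d powr (t - s) * H) \<longlongrightarrow> 0 * H) (at_right 0)"
   by (intro tendsto_intros) (use assms in \<open>auto intro!: tendsto_eq_intros tendsto_powr' eventually_mono[OF eventually_at_right_less[of "0::real"]]\<close>)
  hence "\<forall>\<^sub>F d in at_right 0. d powr (t - s) * H < e" using e by (auto dest: order_tendstoD(2))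
  moreover have "\<forall>\<^sub>F d in at_right 0. d < min \<delta> 1" using that by (intro eventually_at_right_less order_tendstoD(2)[OF tendsto_ident_at]) auto
  moreover have "\<forall>\<^sub>F d in at_right (0::real). 0 < d" by (rule eventually_at_right_less)
  ultimately have "\<forall>\<^sub>F d in at_right (0::real). d powr (t - s) * H < e \<and> d < min \<delta> 1 \<and> 0 < d" by eventually_elim blast
  from eventually_happens'[OF trivial_limit_at_right_real this]
  obtain d where d: "d powr (t - s) * H < e" "d < min \<delta> 1" "0 < d" by (elim exE conjE) (rule that; assumption)
  have "hausdorff_delta t \<delta> A \<le> hausdorff_delta t d A" by (rule hausdorff_delta_antimono) (use d in simp)
  also have "\<dots> \<le> ennreal (d powr (t - s)) * hausdorff_measure s A"
   by (rule hausdorff_compare[where k="\<lambda>d. d powr (t - s)"]) (use le d assms in auto)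
  also have "\<dots> \<le> ennreal e" unfolding H(1) using H(2) d(1) by (auto simp: ennreal_mult[symmetric] intro!: ennreal_leI)
  finally show "hausdorff_delta t \<delta> A \<le> 0 + ennreal e" by simp
 qed
 hence "hausdorff_measure t A \<le> 0" by (rule hausdorff_measure_leI)
 thus ?thesis by simp
qed

lemma hausdorff_null_UN:
 assumes "\<And>i::nat. hausdorff_measure s (A i) = 0" shows "hausdorff_measure s (\<Union>i. A i) = 0"
proof -
 have "hausdorff_delta s \<delta> (\<Union>i. A i) \<le> 0" if "\<delta> > 0" for \<delta>
 proof (rule ennreal_le_epsilon)
  fix e :: real assume e: "e > 0"
  have "\<exists>C. A i \<subseteq> (\<Union>j. C j) \<and> (\<forall>j::nat. bounded (C j) \<and> diameter (C j) \<le> \<delta>) \<and> (\<Sum>j. ennreal (diam_pow s (C j))) < ennreal (e * (1/2) ^ Suc i)" for i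
  proof -
   have "hausdorff_delta s \<delta> (A i) < ennreal (e * (1/2) ^ Suc i)"
    using hausdorff_delta_measure[OF that, of s "A i"] assms[of i] e by (simp add: ennreal_less_zero_iff)
   thus ?thesis by (rule hausdorff_cover) blast
  qed
  then obtain C where C: "\<And>i. A i \<subseteq> (\<Union>j. C i j)" "\<And>i j. bounded (C i j)" "\<And>i j. diameter (C i j) \<le> \<delta>"
    "\<And>i. (\<Sum>j. ennreal (diam_pow s (C i j))) < ennreal (e * (1/2) ^ Suc i)" by metis
  let ?D = "\<lambda>k. C (fst (prod_decode k)) (snd (prod_decode k))"
  have "(\<Union>i. A i) \<subseteq> (\<Union>k. ?D k)"
  proof
   fix x assume "x \<in> (\<Union>i. A i)"
   then obtain i j where "x \<in> C i j" using C(1) by blast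
   hence "x \<in> ?D (prod_encode (i, j))" by simp
   thus "x \<in> (\<Union>k. ?D k)" by blast
  qed
  hence "hausdorff_delta s \<delta> (\<Union>i. A i) \<le> (\<Sum>k. ennreal (diam_pow s (?D k)))"
   by (rule hausdorff_delta_le) (use C in auto)
  also have "\<dots> = (\<Sum>i. \<Sum>j. ennreal (diam_pow s (C i j)))"
   using suminf_ennreal_2dimen[of "\<lambda>i. \<Sum>j. ennreal (diam_pow s (C i j))" "\<lambda>(i, j). ennreal (diam_pow s (C i j))"] by (simp add: case_prod_beta)
  also have "\<dots> \<le> (\<Sum>i. ennreal (e * (1/2) ^ Suc i))" by (rule suminf_le) (use C(4) less_imp_le in auto)
  also have "\<dots> = ennreal e"
  proof (rule suminf_ennreal_eq)
   show "(\<lambda>i. e * (1/2) ^ Suc i) sums e" using sums_mult[OF power_half_series, of e] by simp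
  qed (use e in simp)
  finally show "hausdorff_delta s \<delta> (\<Union>i. A i) \<le> 0 + ennreal e" by simp
 qed
 hence "hausdorff_measure s (\<Union>i. A i) \<le> 0" by (rule hausdorff_measure_leI)
 thus ?thesis by simp
qed

lemma hausdorff_finite_cover:
 fixes A :: "'a::euclidean_space set"
 assumes "\<And>\<delta>. \<delta> > 0 \<Longrightarrow> \<exists>X r. finite X \<and> 0 < r \<and> 4 * r \<le> \<delta> \<and> A \<subseteq> (\<Union>x\<in>X. cball x (2 * r)) \<and> real (card X) * r ^ (DIM('a) - 1) \<le> C"
 shows "hausdorff_measure (real DIM('a) - 1) A \<le> ennreal (4 ^ (DIM('a) - 1) * C)"
proof (rule hausdorff_measure_leI)
 fix \<delta> :: real assume "\<delta> > 0"
 from assms[OF this] obtain X r where X: "finite X" "0 < r" "4 * r \<le> \<delta>" "A \<subseteq> (\<Union>x\<in>X. cball x (2 * r))" "real (card X) * r ^ (DIM('a) - 1) \<le> C" by blast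
 obtain f where f: "bij_betw f {..<card X} X" using ex_bij_betw_nat_finite[OF X(1)] by (metis atLeast0LessThan)
 let ?C = "\<lambda>i. if i < card X then cball (f i) (2 * r) else {}"
 have "A \<subseteq> (\<Union>i. ?C i)"
 proof
  fix x assume "x \<in> A"
  then obtain y where y: "y \<in> X" "x \<in> cball y (2 * r)" using X(4) by blast
  have "y \<in> f ` {..<card X}" using f y(1) by (simp add: bij_betw_def)
  then obtain i where "i < card X" "f i = y" by (elim imageE) auto
  hence "x \<in> ?C i" using y by simp
  thus "x \<in> (\<Union>i. ?C i)" by blast
 qed
 hence "hausdorff_delta (real DIM('a) - 1) \<delta> A \<le> (\<Sum>i. ennreal (diam_pow (real DIM('a) - 1) (?C i)))"
  by (rule hausdorff_delta_le) (use X \<open>\<delta> > 0\<close> in auto)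
 also have "\<dots> = (\<Sum>i<card X. ennreal (diam_pow (real DIM('a) - 1) (?C i)))"
  by (rule suminf_finite) (auto simp: diam_pow_def)
 also have "\<dots> \<le> (\<Sum>i<card X. ennreal ((4 * r) ^ (DIM('a) - 1)))"
  by (intro sum_mono ennreal_leI) (use X in \<open>auto simp: diam_pow_dim\<close>)
 also have "\<dots> = ennreal (real (card X) * (4 * r) ^ (DIM('a) - 1))" using X(2) by (simp add: ennreal_mult ennreal_of_nat_eq_real_of_nat)
 also have "\<dots> \<le> ennreal (4 ^ (DIM('a) - 1) * C)"
 proof (rule ennreal_leI)
  have "real (card X) * (4 * r) ^ (DIM('a) - 1) = 4 ^ (DIM('a) - 1) * (real (card X) * r ^ (DIM('a) - 1))" by (simp add: power_mult_distrib)
  also have "\<dots> \<le> 4 ^ (DIM('a) - 1) * C" by (rule mult_left_mono[OF X(5)]) simp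
  finally show "real (card X) * (4 * r) ^ (DIM('a) - 1) \<le> 4 ^ (DIM('a) - 1) * C" .
 qed
 finally show "hausdorff_delta (real DIM('a) - 1) \<delta> A \<le> ennreal (4 ^ (DIM('a) - 1) * C)" .
qed

text \<open>Above the critical exponent each piece in a compact exhaustion of
  \<open>\<Omega>\<close> is null, hence so is \<open>A\<close>; below it a null set would also be
  null at the critical exponent.\<close>

lemma hausdorff_dim_eq:
 fixes A :: "'a::euclidean_space set"
 assumes fin: "\<And>C. compact C \<Longrightarrow> C \<subseteq> \<Omega> \<Longrightarrow> hausdorff_measure (real DIM('a) - 1) (A \<inter> C) < \<infinity>"
  and A: "A \<subseteq> \<Omega>" "open \<Omega>" and pos: "hausdorff_measure (real DIM('a) - 1) A \<noteq> 0"
 shows "hausdorff_dim A = real DIM('a) - 1"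
proof -
 let ?m = "real DIM('a) - 1"
 have m0: "0 \<le> ?m" using DIM_positive[where 'a='a] by (simp add: Suc_leI)
 obtain C :: "nat \<Rightarrow> 'a set" where C: "\<And>n. compact (C n)" "\<And>n. C n \<subseteq> \<Omega>" "(\<Union>n. C n) = \<Omega>"
  using open_Union_compact_subsets[OF A(2)] by metis
 have null: "hausdorff_measure t A = 0" if t: "t > ?m" for t
 proof -
  have "A = (\<Union>n. A \<inter> C n)" using C(3) A(1) by blast
  moreover have "hausdorff_measure t (A \<inter> C n) = 0" for n
   by (rule hausdorff_null_of_finite[OF m0 t fin[OF C(1,2)]])
  ultimately show ?thesis using hausdorff_null_UN by metis
 qed
 have low: "?m \<le> s" if "0 \<le> s \<and> hausdorff_measure s A = 0" for s
  using hausdorff_null_mono[of s ?m A] that pos by (metis nle_le)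
 show ?thesis unfolding hausdorff_dim_def
 proof (rule cInf_eq_non_empty)
  show "{s. 0 \<le> s \<and> hausdorff_measure s A = 0} \<noteq> {}" using null[of "?m + 1"] m0 by (auto intro!: exI[of _ "?m + 1"])
  show "?m \<le> s" if "s \<in> {s. 0 \<le> s \<and> hausdorff_measure s A = 0}" for s using low that by blast
  fix y assume y: "\<And>x. x \<in> {s. 0 \<le> s \<and> hausdorff_measure s A = 0} \<Longrightarrow> y \<le> x"
  show "y \<le> ?m"
  proof (rule field_le_epsilon)
   fix e :: real assume "e > 0"
   thus "y \<le> ?m + e" using y[of "?m + e"] null[of "?m + e"] m0 by simp
  qed
 qed
qed

text \<open>The sweep of a small set \<open>C\<close> along the segment \<open>v\<close> is covered by about \<open>|v| / diam C\<close> balls.\<close>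
lemma sweep_small:
 fixes C :: "'a::euclidean_space set" and v :: 'a
 assumes C: "bounded C" "diameter C \<le> 1" and e: "e > 0"
 obtains S where "S \<in> sets lborel" "\<And>c t. c \<in> C \<Longrightarrow> 0 \<le> t \<Longrightarrow> t \<le> 1 \<Longrightarrow> c - t *\<^sub>R v \<in> S"
  "emeasure lborel S \<le> ennreal (measure lborel (ball (0::'a) 1) * 3 ^ DIM('a) * (norm v + 6) * (diam_pow (real DIM('a) - 1) C + e))"
proof (cases "C = {}")
 case True
 show thesis by (rule that[of "{}"]) (use True in auto)
next
 case False
 let ?m = "DIM('a) - 1" let ?w = "measure lborel (ball (0::'a) 1)"
 obtain c0 where c0: "c0 \<in> C" using False by blast
 have n: "DIM('a) = Suc ?m" using DIM_positive[where 'a='a] by simp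
 have "((\<lambda>d. d ^ ?m) \<longlongrightarrow> diameter C ^ ?m) (at_right (diameter C))" by (intro tendsto_intros)
 from order_tendstoD(2)[OF this, of "diameter C ^ ?m + e"] e
 have "\<forall>\<^sub>F d in at_right (diameter C). d ^ ?m < diameter C ^ ?m + e" by simp
 then obtain b where b: "b > diameter C" "\<And>d. diameter C < d \<Longrightarrow> d < b \<Longrightarrow> d ^ ?m < diameter C ^ ?m + e"
  unfolding eventually_at_right_field by blast
 \<comment> \<open>A number strictly above the diameter, so that it is positive even for a single
   point; its excess is paid by \<open>e\<close>.\<close>
 define d where "d = (diameter C + min b 2) / 2"
 have d: "diameter C < d" "d < b" "d \<le> 2" using b(1) C(2) by (auto simp: d_def)
 have d0: "d > 0" using d(1) diameter_ge_0[OF C(1)] by linarith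
 \<comment> \<open>Enough equally spaced translates along \<open>v\<close> that neighbouring centres
   are at most \<open>d\<close> apart.\<close>
 define N where "N = nat \<lceil>norm v / d\<rceil> + 1"
 have N: "norm v / d \<le> real N" "real N \<le> norm v / d + 2" "N > 0" using d0 unfolding N_def by (auto, linarith+)
 define S where "S = (\<Union>j\<le>N. ball (c0 - (real j / real N) *\<^sub>R v) (3 * d))"
 show thesis
 proof (rule that[of S])
  show "S \<in> sets lborel" unfolding S_def by (intro sets.finite_UN) auto
  fix c t assume c: "c \<in> C" and t: "0 \<le> t" "t \<le> (1::real)"
  define j where "j = nat \<lfloor>t * real N\<rfloor>"
  have "0 \<le> t * real N" using t by simp
  hence tj: "real j \<le> t * real N" "t * real N \<le> real j + 1" unfolding j_def by linarith+
  have jN: "j \<le> N" using tj(1) t mult_right_mono[of t 1 "real N"] by linarith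
  have tN: "t - real j / real N = (t * real N - real j) / real N" using N(3) by (simp add: field_simps)
  have "\<bar>t - real j / real N\<bar> \<le> 1 / real N" unfolding tN abs_divide using tj N(3) by (intro divide_right_mono frac_le) auto
  hence "\<bar>t - real j / real N\<bar> * norm v \<le> 1 / real N * norm v" by (rule mult_right_mono) simp
  also have "\<dots> \<le> d" using N(1,3) d0 by (simp add: field_simps)
  finally have a: "norm ((t - real j / real N) *\<^sub>R v) \<le> d" by simp
  have b': "norm (c - c0) \<le> d" using diameter_bounded_bound[OF C(1) c c0] d(1) by (simp add: dist_norm)
  have "norm ((c - c0) - (t - real j / real N) *\<^sub>R v) < 3 * d" using norm_triangle_ineq4[of "c - c0" "(t - real j / real N) *\<^sub>R v"] a b' d0 by linarith
  moreover have "(c - t *\<^sub>R v) - (c0 - (real j / real N) *\<^sub>R v) = (c - c0) - (t - real j / real N) *\<^sub>R v" by (simp add: algebra_simps)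
  ultimately have "dist (c - t *\<^sub>R v) (c0 - (real j / real N) *\<^sub>R v) < 3 * d" unfolding dist_norm by (simp only:)
  hence "c - t *\<^sub>R v \<in> ball (c0 - (real j / real N) *\<^sub>R v) (3 * d)" by (simp only: mem_ball dist_commute)
  thus "c - t *\<^sub>R v \<in> S" unfolding S_def using jN by blast
 next
  have ball: "emeasure lborel (ball (x::'a) (3 * d)) = ennreal ((3 * d) ^ DIM('a) * ?w)" for x
   unfolding emeasure_ball using measure_ball_scale[of "3 * d" 1 x 0] d0 by simp
  have "emeasure lborel S \<le> (\<Sum>j\<le>N. emeasure lborel (ball (c0 - (real j / real N) *\<^sub>R v) (3 * d)))"
   unfolding S_def by (rule emeasure_subadditive_finite) auto
  also have "\<dots> = ennreal (real (Suc N) * ((3 * d) ^ DIM('a) * ?w))" unfolding ball using d0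
   by (simp add: ennreal_mult ennreal_of_nat_eq_real_of_nat)
  also have "\<dots> \<le> ennreal (?w * 3 ^ DIM('a) * (norm v + 6) * (diam_pow (real DIM('a) - 1) C + e))"
  proof (rule ennreal_leI)
   have "real (Suc N) * d \<le> (norm v / d + 3) * d" using N(2) d0 by (intro mult_right_mono) auto
   also have "\<dots> \<le> norm v + 6" using d0 d(3) by (simp add: field_simps)
   finally have 1: "real (Suc N) * d \<le> norm v + 6" .
   have 2: "d ^ ?m \<le> diam_pow (real DIM('a) - 1) C + e" using b(2)[OF d(1,2)] False C by (simp add: diam_pow_dim)
   have "real (Suc N) * ((3 * d) ^ DIM('a) * ?w) = ?w * 3 ^ DIM('a) * ((real (Suc N) * d) * d ^ ?m)"
    using power_Suc[of d ?m, folded n] by (simp add: power_mult_distrib)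
   also have "\<dots> \<le> ?w * 3 ^ DIM('a) * ((norm v + 6) * (diam_pow (real DIM('a) - 1) C + e))"
    using 1 2 d0 by (intro mult_left_mono mult_mono) auto
   finally show "real (Suc N) * ((3 * d) ^ DIM('a) * ?w) \<le> ?w * 3 ^ DIM('a) * (norm v + 6) * (diam_pow (real DIM('a) - 1) C + e)" by (simp add: mult.assoc)
  qed
  finally show "emeasure lborel S \<le> ennreal (?w * 3 ^ DIM('a) * (norm v + 6) * (diam_pow (real DIM('a) - 1) C + e))" .
 qed
qed

text \<open>A set that is null in codimension one sweeps out a Lebesgue null set when moved along a
  fixed segment; sum the volumes from \<open>sweep_small\<close> over a cover.\<close>

lemma sweep_null:
 fixes A :: "'a::euclidean_space set" and v :: 'a
 assumes A: "hausdorff_measure (real DIM('a) - 1) A = 0"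
  and Z: "\<And>x. x \<in> Z \<Longrightarrow> \<exists>t. 0 \<le> t \<and> t \<le> 1 \<and> x + t *\<^sub>R v \<in> A"
 shows "Z \<in> null_sets lebesgue"
proof -
 define k where "k = measure lborel (ball (0::'a) 1) * 3 ^ DIM('a) * (norm v + 6)"
 have k: "k > 0" unfolding k_def using measure_ball_pos[of 1 "0::'a"] by (auto intro!: mult_pos_pos add_nonneg_pos)
 have "\<exists>T. Z \<subseteq> T \<and> T \<in> lmeasurable \<and> measure lebesgue T \<le> e" if e: "e > 0" for e
 proof -
  \<comment> \<open>Half of the budget \<open>e\<close> goes to the cover itself, the other half to
    the slacks \<open>e / (2 * k) * (1/2) ^ Suc i\<close> of the individual sweeps. The scale 1
    meets the diameter condition of \<open>sweep_small\<close>.\<close>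
  have h: "hausdorff_delta (real DIM('a) - 1) 1 A < ennreal (e / (2 * k))"
   using hausdorff_delta_measure[of 1 "real DIM('a) - 1" A] A e k by (simp add: ennreal_less_zero_iff)
  obtain C where C: "A \<subseteq> (\<Union>i. C i)" "\<And>i::nat. bounded (C i)" "\<And>i. diameter (C i) \<le> 1"
   "(\<Sum>i. ennreal (diam_pow (real DIM('a) - 1) (C i))) < ennreal (e / (2 * k))"
   by (rule hausdorff_cover[OF h]) (rule that; assumption)
  have e': "e / (2 * k) * (1/2) ^ Suc i > 0" for i using e k by simp
  have "\<exists>S. S \<in> sets lborel \<and> (\<forall>c t. c \<in> C i \<longrightarrow> 0 \<le> t \<longrightarrow> t \<le> 1 \<longrightarrow> c - t *\<^sub>R v \<in> S) \<and>
   emeasure lborel S \<le> ennreal (k * (diam_pow (real DIM('a) - 1) (C i) + e / (2 * k) * (1/2) ^ Suc i))" for i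
   unfolding k_def[symmetric] by (rule sweep_small[OF C(2,3) e', of i v i]) (unfold k_def[symmetric], blast)
  then obtain S where S: "\<And>i. S i \<in> sets lborel" "\<And>i c t. c \<in> C i \<Longrightarrow> 0 \<le> t \<Longrightarrow> t \<le> 1 \<Longrightarrow> c - t *\<^sub>R v \<in> S i"
   "\<And>i. emeasure lborel (S i) \<le> ennreal (k * (diam_pow (real DIM('a) - 1) (C i) + e / (2 * k) * (1/2) ^ Suc i))" by metis
  have Sl: "S i \<in> sets lebesgue" for i using S(1) by simp
  have "Z \<subseteq> (\<Union>i. S i)"
  proof
   fix x assume "x \<in> Z"
   then obtain t where t: "0 \<le> t" "t \<le> 1" "x + t *\<^sub>R v \<in> A" using Z by blast
   then obtain i where "x + t *\<^sub>R v \<in> C i" using C(1) by blast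
   from S(2)[OF this t(1,2)] have "x \<in> S i" by simp
   thus "x \<in> (\<Union>i. S i)" by blast
  qed
  moreover have "emeasure lebesgue (\<Union>i. S i) \<le> (\<Sum>i. emeasure lebesgue (S i))"
   by (rule emeasure_subadditive_countably) (use Sl in auto)
  moreover have "(\<Sum>i. emeasure lebesgue (S i)) \<le> (\<Sum>i. ennreal k * (ennreal (diam_pow (real DIM('a) - 1) (C i)) + ennreal (e / (2 * k) * (1/2) ^ Suc i)))"
  proof (rule suminf_le)
   fix i
   have "emeasure lebesgue (S i) = emeasure lborel (S i)" using S(1) by simp
   also have "\<dots> \<le> ennreal (k * (diam_pow (real DIM('a) - 1) (C i) + e / (2 * k) * (1/2) ^ Suc i))" by (rule S(3))
   also have "\<dots> = ennreal k * (ennreal (diam_pow (real DIM('a) - 1) (C i)) + ennreal (e / (2 * k) * (1/2) ^ Suc i))"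
    using k e'[of i] diam_pow_nonneg[of "real DIM('a) - 1" "C i"] by (simp add: ennreal_mult ennreal_plus)
   finally show "emeasure lebesgue (S i) \<le> ennreal k * (ennreal (diam_pow (real DIM('a) - 1) (C i)) + ennreal (e / (2 * k) * (1/2) ^ Suc i))" .
  qed auto
  moreover have "\<dots> = ennreal k * ((\<Sum>i. ennreal (diam_pow (real DIM('a) - 1) (C i))) + (\<Sum>i. ennreal (e / (2 * k) * (1/2) ^ Suc i)))"
   unfolding ennreal_suminf_cmult by (subst suminf_add) auto
  moreover have "(\<Sum>i. ennreal (e / (2 * k) * (1/2) ^ Suc i)) = ennreal (e / (2 * k))"
  proof (rule suminf_ennreal_eq)
   show "(\<lambda>i. e / (2 * k) * (1/2) ^ Suc i) sums (e / (2 * k))" using sums_mult[OF power_half_series, of "e / (2 * k)"] by simp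
   show "0 \<le> e / (2 * k) * (1/2) ^ Suc i" for i using e'[of i] by linarith
  qed
  moreover have "ennreal k * ((\<Sum>i. ennreal (diam_pow (real DIM('a) - 1) (C i))) + ennreal (e / (2 * k))) \<le> ennreal k * (ennreal (e / (2 * k)) + ennreal (e / (2 * k)))"
   by (intro mult_left_mono add_right_mono) (use C(4) in auto)
  moreover have "ennreal k * (ennreal (e / (2 * k)) + ennreal (e / (2 * k))) = ennreal e"
   using k e by (simp add: ennreal_mult[symmetric] ennreal_plus[symmetric] del: ennreal_plus)
  ultimately have le: "Z \<subseteq> (\<Union>i. S i)" "emeasure lebesgue (\<Union>i. S i) \<le> ennreal e" by (auto intro: order_trans)
  have "(\<Union>i. S i) \<in> lmeasurable" by (rule fmeasurableI) (use Sl le(2) in \<open>auto simp: le_less_trans[OF _ ennreal_less_top]\<close>)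
  moreover have "measure lebesgue (\<Union>i. S i) \<le> e" using le(2) e by (simp add: measure_def enn2real_leI)
  ultimately show ?thesis using le(1) by blast
 qed
 thus ?thesis unfolding negligible_iff_null_sets[symmetric] negligible_outer_le by blast
qed

context minimizer
begin

text \<open>If \<open>u\<close> is almost everywhere saturated then it is close to its harmonic replacement, which obeys Harnack.\<close>
lemma gap_growth:
 assumes B: "cball c (2 * r) \<subseteq> \<Omega>" and r: "0 < r" "2 * r < 1" and \<sigma>: "0 < \<sigma>" "3 * \<sigma> < r"
  and m: "\<And>x. x \<in> ball c \<sigma> \<Longrightarrow> u x \<le> m" and x: "x \<in> cball c (r/4)"
 shows "u x \<le> CH * (CH * (m + sqrt ((KP * (2 * r))\<^sup>2 * (2 / lam) * gap c (2 * r) / measure lborel (ball c \<sigma>))))"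
proof -
 obtain h H where h: "harm (ball c (2 * r)) h H" "continuous_on (ball c r) h" "L2 (Leb (ball c (2 * r))) h"
  "\<And>m M x. (\<And>y. y \<in> cball c (2 * r) \<Longrightarrow> m \<le> u y \<and> u y \<le> M) \<Longrightarrow> x \<in> ball c r \<Longrightarrow> m \<le> h x \<and> h x \<le> M"
  "\<And>x. x \<in> ball c r \<Longrightarrow> u x \<le> h x"
  "(l2n (Leb (ball c (2 * r))) (\<lambda>x. h x - u x))\<^sup>2 \<le> (KP * (2 * r))\<^sup>2 * (2 / lam) * gap c (2 * r)"
  by (fact replacement_u[OF B r])
 let ?g = "(KP * (2 * r))\<^sup>2 * (2 / lam) * gap c (2 * r)" and ?s = "measure lborel (ball c \<sigma>)"
 have BO: "ball c (2 * r) \<subseteq> \<Omega>" using B ball_subset_cball by blast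
 have sr: "ball c r \<subseteq> ball c (2 * r)" using r by (intro subset_ball) simp
 have h0: "0 \<le> h x" if "x \<in> ball c r" for x
 proof -
  have "0 \<le> u x" using u0 that sr BO by blast
  thus ?thesis using h(5)[OF that] by linarith
 qed
 have har: "h x \<le> CH * h y" if y: "cball y \<rho> \<subseteq> ball c r" "0 < \<rho>" "\<rho> < 1" "x \<in> cball y (\<rho>/2)" for x y \<rho>
 proof -
  have s: "ball y \<rho> \<subseteq> ball c (2 * r)" using y(1) sr ball_subset_cball by blast
  show ?thesis
   by (rule harnack[OF harm_restrict[OF h(1) s BO open_ball open_ball] order_trans[OF s BO] y(2,3) continuous_on_subset[OF h(2) y(1)] h0 y(4)])
     (use y(1) in blast)
 qed
 have s0: "?s > 0" by (rule measure_ball_pos[OF \<sigma>(1)])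
 \<comment> \<open>On the small ball Harnack keeps \<open>h\<close> above \<open>h c / CH\<close>
   while \<open>u\<close> is at most \<open>m\<close>. A large \<open>h c\<close> would thus make
   the L2 distance of \<open>h\<close> and \<open>u\<close>, which the gap controls, too
   big.\<close>
 have "h c / CH - m \<le> sqrt (?g / ?s)"
 proof (cases "h c / CH - m \<ge> 0")
  case True
  have Lu: "L2 (Leb (ball c (2 * r))) u"
   by (rule L2_restrict(1)[OF BO _ _ SH_L2(1)[OF SHu]]) (use openO in auto)
  have sub: "ball c \<sigma> \<subseteq> ball c (2 * r)" using \<sigma> r by (intro subset_ball) simp
  have "(h c / CH - m)\<^sup>2 * measure lebesgue (ball c \<sigma>) \<le> (l2n (Leb (ball c (2 * r))) (\<lambda>x. h x - u x))\<^sup>2"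
  proof (rule l2n_lower[OF L2_diff[OF h(3) Lu] _ sub _ True])
   fix y assume y: "y \<in> ball c \<sigma>"
   have "h c \<le> CH * h y"
   proof (rule har)
    show "cball y (2 * \<sigma>) \<subseteq> ball c r"
    proof
     fix z assume "z \<in> cball y (2 * \<sigma>)"
     thus "z \<in> ball c r" using dist_triangle[of c z y] y \<sigma> by simp
    qed
    show "c \<in> cball y (2 * \<sigma> / 2)" using y by (simp add: dist_commute)
   qed (use \<sigma> r in auto)
   hence "h c / CH \<le> h y" using CH_pos by (simp add: field_simps)
   thus "h c / CH - m \<le> \<bar>h y - u y\<bar>" using m[OF y] by linarith
  qed auto
  hence "(h c / CH - m)\<^sup>2 * ?s \<le> ?g" using h(6) by simp
  hence "(h c / CH - m)\<^sup>2 \<le> ?g / ?s" unfolding pos_le_divide_eq[OF s0] .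
  thus ?thesis by (rule real_le_rsqrt)
 next
  case False
  have "gap c (2 * r) \<ge> 0" unfolding gap_def by (rule integral_nonneg_AE) (auto simp: Bfacts)
  hence "sqrt (?g / ?s) \<ge> 0" using lam s0 by simp
  thus ?thesis using False by linarith
 qed
 hence hc: "h c \<le> CH * (m + sqrt (?g / ?s))" using CH_pos by (simp add: field_simps)
 have xr: "x \<in> ball c r" using x r by auto
 have "h x \<le> CH * h c" by (rule har[of c "r/2"]) (use x r in auto)
 also have "\<dots> \<le> CH * (CH * (m + sqrt (?g / ?s)))" using hc CH_pos by simp
 finally show ?thesis using h(5)[OF xr] by linarith
qed

end

section \<open>The limit function: growth, nondegeneracy and density\<close>

locale minimizer_seq = elliptic \<Omega> a lam Lam K
 for \<Omega> :: "'a::euclidean_space set" and a lam Lam K +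
 fixes \<beta> :: "real \<Rightarrow> real" and \<epsilon> :: "nat \<Rightarrow> real" and u :: "nat \<Rightarrow> 'a \<Rightarrow> real" and G :: "nat \<Rightarrow> 'a \<Rightarrow> 'a" and v :: "'a \<Rightarrow> real"
 assumes mini: "minimizer \<Omega> a lam Lam K \<beta> (\<epsilon> k) (u k) (G k)" and beta: "admissible_beta \<beta>"
  and eps_lim: "\<epsilon> \<longlonglongrightarrow> 0"
  and unif: "compact C \<Longrightarrow> C \<subseteq> \<Omega> \<Longrightarrow> uniform_limit C u v sequentially"
begin

abbreviation "low k \<equiv> minimizer.low_energy \<Omega> lam \<beta> (\<epsilon> k) (u k) (G k)"

lemma mini_eps: "\<epsilon> k > 0" and mini_cont: "continuous_on \<Omega> (u k)" and mini_nonneg: "x \<in> \<Omega> \<Longrightarrow> 0 \<le> u k x"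
 using minimizer.eps[OF mini] minimizer.cu[OF mini] minimizer.u0[OF mini] by blast+

lemma v_lim: "x \<in> \<Omega> \<Longrightarrow> (\<lambda>k. u k x) \<longlonglongrightarrow> v x"
 using unif[of "{x}"] by (auto intro: tendsto_uniform_limitI)

lemma v_nonneg: "x \<in> \<Omega> \<Longrightarrow> 0 \<le> v x"
 by (rule LIMSEQ_le_const[OF v_lim]) (auto intro: mini_nonneg)

lemma v_cont: "continuous_on \<Omega> v"
proof (rule continuous_at_imp_continuous_on, rule ballI)
 fix x assume "x \<in> \<Omega>"
 then obtain r where r: "r > 0" "cball x r \<subseteq> \<Omega>" using openO open_contains_cball by blast
 have "continuous_on (cball x r) v"
  by (rule uniform_limit_theorem[OF _ unif[OF compact_cball r(2)]])
    (auto intro!: always_eventually continuous_on_subset[OF mini_cont r(2)])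
 thus "continuous (at x) v" by (rule continuous_on_interior) (use r in auto)
qed

lemma v_unif: assumes "compact C" "C \<subseteq> \<Omega>" "e > 0" shows "\<forall>\<^sub>F k in sequentially. \<forall>x\<in>C. \<bar>u k x - v x\<bar> < e"
 using uniform_limitD[OF unif[OF assms(1,2)] assms(3)] by (simp add: dist_real_def)

lemma CG_nonneg: "CG \<beta> \<ge> 0" by (rule minimizer.CG_nonneg[OF mini])

lemma v_growth:
 assumes "cball c s \<subseteq> \<Omega>" "0 < s" "s < 1" "x \<in> cball c (s/8)"
 shows "v x \<le> CH * (v c + 2 * CG \<beta> * s)"
proof (rule LIMSEQ_le)
 have c: "c \<in> \<Omega>" and x: "x \<in> \<Omega>" using assms by (auto simp: subset_iff)
 show "(\<lambda>k. u k x) \<longlonglongrightarrow> v x" by (rule v_lim[OF x])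
 show "(\<lambda>k. CH * (u k c + 2 * CG \<beta> * s)) \<longlonglongrightarrow> CH * (v c + 2 * CG \<beta> * s)" by (intro tendsto_intros v_lim[OF c])
qed (use minimizer.linear_growth[OF mini assms] in auto)

text \<open>The additive \<open>\<epsilon>\<close> of \<open>nondegeneracy\<close> disappears in the
  limit; \<open>S\<close> is relaxed by \<open>1 / (n + 1)\<close> to absorb the uniform convergence
  error and then restored.\<close>

lemma v_decay:
 assumes B: "cball c (4 * \<rho>) \<subseteq> \<Omega>" and \<rho>: "0 < \<rho>" "\<rho> < 1" and S: "S > 0" "\<And>x. x \<in> cball c (4 * \<rho>) \<Longrightarrow> v x \<le> S"
  and x: "x \<in> cball c (\<rho> / 16)"
 shows "v x \<le> CD \<beta> * S\<^sup>2 / \<rho>"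
proof (rule LIMSEQ_le_const)
 have xO: "x \<in> \<Omega>" using B x \<rho> by (auto simp: subset_iff)
 have B2: "ball c (4 * \<rho>) \<subseteq> \<Omega>" using B ball_subset_cball by blast
 show "(\<lambda>n. CD \<beta> * (S + inverse (real (Suc n)))\<^sup>2 / \<rho>) \<longlonglongrightarrow> CD \<beta> * S\<^sup>2 / \<rho>"
  using tendsto_divide[OF tendsto_mult[OF tendsto_const[of "CD \<beta>"] tendsto_power[OF tendsto_add[OF tendsto_const[of S] LIMSEQ_inverse_real_of_nat], of 2]] tendsto_const[of \<rho>]] \<rho> by simp
 show "\<exists>N. \<forall>n\<ge>N. v x \<le> CD \<beta> * (S + inverse (real (Suc n)))\<^sup>2 / \<rho>"
 proof (intro exI[of _ 0] allI impI)
  fix n :: nat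
  let ?S = "S + inverse (real (Suc n))"
  have i: "inverse (real (Suc n)) > 0" by simp
  hence S0: "?S > 0" using S(1) by linarith
  have "\<forall>\<^sub>F k in sequentially. u k x \<le> \<epsilon> k + CD \<beta> * ?S\<^sup>2 / \<rho>"
   using v_unif[OF compact_cball B i]
  proof eventually_elim
   case (elim k)
   show ?case
   proof (rule minimizer.nondegeneracy[OF mini B2 \<rho> S0 _ x])
    fix y assume "y \<in> ball c (4 * \<rho>)"
    hence y: "y \<in> cball c (4 * \<rho>)" by simp
    show "u k y \<le> ?S" using elim[rule_format, OF y] S(2)[OF y] by linarith
   qed
  qed
  moreover have "(\<lambda>k. \<epsilon> k + CD \<beta> * ?S\<^sup>2 / \<rho>) \<longlonglongrightarrow> 0 + CD \<beta> * ?S\<^sup>2 / \<rho>" by (intro tendsto_add eps_lim tendsto_const)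
  ultimately show "v x \<le> CD \<beta> * ?S\<^sup>2 / \<rho>"
   using tendsto_le[OF sequentially_bot _ v_lim[OF xO]] by fastforce
 qed
qed

text \<open>Small enough that the quadratic gain in \<open>v_decay\<close> beats the shrinking of
  the radius by 64: \<open>CD \<beta> * tau \<le> 1/64\<close>.\<close>

definition tau :: real where "tau = 1 / (64 * (\<bar>CD \<beta>\<bar> + 1))"

lemma tau_pos: "tau > 0" by (simp add: tau_def add_nonneg_pos)

text \<open>One application of \<open>v_decay\<close> passes from the ball of radius
  \<open>4 * r\<close> to that of radius \<open>r / 16 = 4 * (r / 64)\<close>, and there the bound
  \<open>tau * r\<close> becomes \<open>tau * (r / 64)\<close>. Iterating forces the value at the
  centre down to 0.\<close>

lemma v_nondegenerate:
 assumes B: "cball c (4 * \<rho>) \<subseteq> \<Omega>" and \<rho>: "0 < \<rho>" "\<rho> < 1" and v: "\<And>x. x \<in> cball c (4 * \<rho>) \<Longrightarrow> v x \<le> tau * \<rho>"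
 shows "v c \<le> 0"
proof -
 let ?r = "\<lambda>j::nat. \<rho> / 64 ^ j"
 have r: "0 < ?r j" "?r j < 1" "?r j \<le> \<rho>" for j
 proof -
  have "\<rho> / 64 ^ j \<le> \<rho> / 1" using \<rho> by (intro divide_left_mono) auto
  thus "?r j \<le> \<rho>" by simp
  thus "?r j < 1" using \<rho> by linarith
  show "0 < ?r j" using \<rho> by simp
 qed
 have ct: "CD \<beta> * tau \<le> 1/64" unfolding tau_def by (simp add: field_simps abs_if)
 have "\<forall>x\<in>cball c (4 * ?r j). v x \<le> tau * ?r j" for j
 proof (induction j)
  case (Suc j)
  show ?case
  proof
   fix x assume x: "x \<in> cball c (4 * ?r (Suc j))"
   hence x': "x \<in> cball c (?r j / 16)" by simp
   have Bj: "cball c (4 * ?r j) \<subseteq> \<Omega>" using B r(3)[of j] by (meson order_trans subset_cball mult_left_mono zero_le_numeral)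
   have "v x \<le> CD \<beta> * (tau * ?r j)\<^sup>2 / ?r j"
    by (rule v_decay[OF Bj r(1,2) _ _ x']) (use Suc mult_pos_pos[OF tau_pos r(1)[of j]] in auto)
   also have "\<dots> = (CD \<beta> * tau) * (tau * ?r j)" using r(1)[of j] by (simp add: power2_eq_square)
   also have "\<dots> \<le> 1/64 * (tau * ?r j)" by (rule mult_right_mono[OF ct less_imp_le[OF mult_pos_pos[OF tau_pos r(1)]]])
   finally show "v x \<le> tau * ?r (Suc j)" by simp
  qed
 qed (use v in simp)
 hence le: "v c \<le> tau * \<rho> * (1/64) ^ j" for j using r(1)[of j] by (auto simp: power_divide dest!: spec bspec[of _ _ c])
 have "(\<lambda>j. tau * \<rho> * (1/64) ^ j) \<longlonglongrightarrow> tau * \<rho> * 0" by (intro tendsto_intros LIMSEQ_power_zero) simp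
 thus ?thesis using LIMSEQ_le_const[of _ "tau * \<rho> * 0" "v c"] le by simp
qed

text \<open>Chosen so that linear growth from a zero over the radius \<open>kap * r\<close> stays
  below the value \<open>tau * r / 16\<close> guaranteed by nondegeneracy; adding 1 to
  \<open>CG \<beta>\<close> makes this strict and keeps the denominator positive. \<open>M1\<close>
  is the slope of linear growth from a zero.\<close>

definition kap :: real where "kap = min 1 (tau / (32 * CH * (CG \<beta> + 1)))"
definition M1 :: real where "M1 = 16 * CH * (CG \<beta> + 1)"

lemma kap: "0 < kap" "kap \<le> 1" "M1 > 0"
 unfolding kap_def M1_def using tau_pos CH_pos CG_nonneg by (auto simp: add_nonneg_pos)

text \<open>Nondegeneracy near a positive point \<open>x1\<close> close to \<open>x0\<close>
  produces \<open>y\<close> with \<open>v y > tau * r / 16\<close>; linear growth centred at a point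
  \<open>z\<close> close to \<open>y\<close> then shows \<open>v z > 0\<close>. The upper bound is
  linear growth from the zero \<open>x0\<close>.\<close>

lemma density:
 assumes x0: "v x0 = 0" "x0 \<in> closure {x\<in>\<Omega>. v x > 0}" and B: "cball x0 (8 * r) \<subseteq> \<Omega>" and r: "0 < r" "8 * r < 1"
 obtains y where "ball y (kap * r / 8) \<subseteq> {x \<in> ball x0 r. 0 < v x \<and> v x \<le> M1 * r}"
proof -
 have up: "v x \<le> M1 * r" if "x \<in> cball x0 r" for x
 proof -
  have "v x \<le> CH * (v x0 + 2 * CG \<beta> * (8 * r))" by (rule v_growth[OF B]) (use r that in auto)
  also have "\<dots> = 16 * CH * CG \<beta> * r" using x0 by simp
  also have "\<dots> \<le> M1 * r" unfolding M1_def using r CH_pos by simp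
  finally show ?thesis .
 qed
 obtain x1 where x1: "x1 \<in> \<Omega>" "v x1 > 0" "dist x1 x0 < r/4" using x0(2) r unfolding closure_approachable by (metis (no_types, lifting) mem_Collect_eq zero_less_divide_iff zero_less_numeral)
 have sub: "cball y s \<subseteq> \<Omega>" if "dist x0 y + s \<le> 8 * r" for y s
 proof
  fix z assume "z \<in> cball y s"
  hence "z \<in> cball x0 (8 * r)" using dist_triangle[of x0 z y] that by simp
  thus "z \<in> \<Omega>" using B by blast
 qed
 have "\<exists>y\<in>cball x1 (4 * (r/16)). \<not> v y \<le> tau * (r/16)"
 proof (rule ccontr)
  assume n: "\<not> ?thesis"
  have "v x1 \<le> 0"
   by (rule v_nondegenerate[of x1 "r/16"]) (use n r x1 in \<open>auto intro!: sub[THEN subsetD] simp: dist_commute\<close>)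
  thus False using x1 by simp
 qed
 then obtain y where y: "dist x1 y \<le> r/4" "v y > tau * (r/16)" by (auto simp: not_le)
 have yr: "dist x0 y < r/2" using dist_triangle[of x0 y x1] x1(3) y(1) by (simp add: dist_commute)
 show thesis
 proof (rule that[of y], rule subsetI)
  fix z assume "z \<in> ball y (kap * r / 8)"
  hence z: "dist y z < kap * r / 8" by simp
  have kr: "0 < kap * r" "kap * r \<le> r" using kap r mult_right_mono[of kap 1 r] by auto
  have zr: "dist x0 z < r" using dist_triangle[of x0 z y] yr z kr by linarith
  have "v y \<le> CH * (v z + 2 * CG \<beta> * (kap * r))"
  proof (rule v_growth[OF sub])
   show "dist x0 z + kap * r \<le> 8 * r" "0 < kap * r" "kap * r < 1" using zr kr r by linarith+
   show "y \<in> cball z (kap * r / 8)" using z by (simp add: dist_commute)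
  qed
  hence a: "tau * (r/16) < CH * v z + CH * (2 * CG \<beta> * (kap * r))" using y(2) by (simp add: algebra_simps)
  have "kap * (32 * CH * (CG \<beta> + 1)) \<le> tau"
  proof -
   have p: "32 * CH * (CG \<beta> + 1) > 0" using CH_pos CG_nonneg by simp
   have "kap \<le> tau / (32 * CH * (CG \<beta> + 1))" unfolding kap_def by (rule min.cobounded2)
   thus ?thesis using p by (simp add: pos_le_divide_eq)
  qed
  hence "r/16 * (kap * (32 * CH * (CG \<beta> + 1))) \<le> r/16 * tau" using r by (intro mult_left_mono) auto
  moreover have "r/16 * (kap * (32 * CH * (CG \<beta> + 1))) = CH * (2 * CG \<beta> * (kap * r)) + 2 * CH * (kap * r)" by (simp add: algebra_simps)
  moreover have "r/16 * tau = tau * (r/16)" by simp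
  moreover have "0 < 2 * CH * (kap * r)" using CH_pos kr by simp
  ultimately have "CH * v z > 0" using a by linarith
  hence "v z > 0" using CH_pos by (simp add: zero_less_mult_iff)
  thus "z \<in> {x \<in> ball x0 r. 0 < v x \<and> v x \<le> M1 * r}" using up[of z] zr by simp
 qed
qed

text \<open>Nested cutoffs make \<open>energy_decay\<close> uniform in \<open>k\<close>: the
  required bound on \<open>u k\<close> concerns only the compact set where the gradient of
  \<open>z\<close> lives, and there uniform convergence bounds it by \<open>S + 1\<close> from some
  index on.\<close>

lemma decay_uniform:
 assumes C: "compact C" "C \<subseteq> \<Omega>"
 obtains \<eta> A N where "smooth_fun \<eta>" "\<And>x. 0 \<le> \<eta> x" "\<And>x. x \<in> C \<Longrightarrow> \<eta> x = 1" "A \<ge> 0"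
  "\<And>k \<delta>. k \<ge> N \<Longrightarrow> 0 < \<delta> \<Longrightarrow> \<delta> \<le> 1 \<Longrightarrow> low k \<delta> \<eta> \<le> A * \<delta>"
proof -
 obtain \<eta> where \<eta>: "test_fun \<Omega> \<eta>" "\<And>x. 0 \<le> \<eta> x \<and> \<eta> x \<le> 1" "\<And>x. x \<in> C \<Longrightarrow> \<eta> x = 1"
  by (rule cutoff_exists[OF C(1) openO C(2)]) (rule that; assumption)
 obtain D where D: "compact D" "D \<subseteq> \<Omega>" "\<And>x. x \<notin> D \<Longrightarrow> \<eta> x = 0" using \<eta>(1) unfolding test_fun_def by blast
 obtain z1 where z1: "test_fun \<Omega> z1" "\<And>x. 0 \<le> z1 x \<and> z1 x \<le> 1" "\<And>x. x \<in> D \<Longrightarrow> z1 x = 1"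
  by (rule cutoff_exists[OF D(1) openO D(2)]) (rule that; assumption)
 obtain D1 where D1: "compact D1" "D1 \<subseteq> \<Omega>" "\<And>x. x \<notin> D1 \<Longrightarrow> z1 x = 0" using z1(1) unfolding test_fun_def by blast
 obtain z where z: "test_fun \<Omega> z" "\<And>x. 0 \<le> z x \<and> z x \<le> 1" "\<And>x. x \<in> D1 \<Longrightarrow> z x = 1"
  by (rule cutoff_exists[OF D1(1) openO D1(2)]) (rule that; assumption)
 obtain D2 where D2: "compact D2" "D2 \<subseteq> \<Omega>" "\<And>x. x \<notin> D2 \<Longrightarrow> cgrad z x = 0" using test_fun_support[OF z(1)] by metis
 \<comment> \<open>The intermediate cutoff \<open>z1\<close> serves only to produce an open set that
   contains the support of \<open>\<eta>\<close> and on which \<open>z = 1\<close>.\<close>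
 define V where "V = {x. z1 x > 0}"
 have V: "V \<subseteq> \<Omega>" "open V" "V \<subseteq> D1" "D \<subseteq> V"
 proof -
  show "V \<subseteq> D1" "D \<subseteq> V" unfolding V_def using D1(3) z1(3) by force+
  thus "V \<subseteq> \<Omega>" using D1(2) by blast
  have "continuous_on UNIV z1" by (rule smooth_fun_continuous[OF test_fun_smooth[OF z1(1)]])
  thus "open V" unfolding V_def by (intro open_Collect_less continuous_on_const)
 qed
 have es: "test_fun V \<eta>" unfolding test_fun_def using test_fun_smooth[OF \<eta>(1)] D V(4) by blast
 obtain S where S: "S \<ge> 0" "\<And>x. x \<in> D2 \<Longrightarrow> v x \<le> S"
 proof -
  have "bounded (v ` D2)" by (intro compact_imp_bounded compact_continuous_image continuous_on_subset[OF v_cont D2(2)] D2(1))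
  then obtain S where S: "\<And>x. x \<in> D2 \<Longrightarrow> \<bar>v x\<bar> \<le> S" unfolding bounded_iff by auto
  show thesis
  proof (rule that[of "\<bar>S\<bar>"])
   fix x assume "x \<in> D2" thus "v x \<le> \<bar>S\<bar>" using S[of x] by linarith
  qed simp
 qed
 obtain N where N: "\<And>k x. k \<ge> N \<Longrightarrow> x \<in> D2 \<Longrightarrow> \<bar>u k x - v x\<bar> < 1"
  using v_unif[OF D2(1,2), of 1] unfolding eventually_sequentially by auto
 define Y where "Y = max (l2n (Leb \<Omega>) (cgrad z)) (l2n (Leb V) (cgrad \<eta>))"
 define A where "A = (2 * Lam\<^sup>2 / lam * (S + 1) + Lam / 2) * Y\<^sup>2"
 have A0: "A \<ge> 0" unfolding A_def using lam S by (intro mult_nonneg_nonneg add_nonneg_nonneg) auto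
 show thesis
 proof (rule that[of \<eta> A N])
  show "smooth_fun \<eta>" by (rule test_fun_smooth[OF \<eta>(1)])
  fix k \<delta> assume k: "k \<ge> N" and d: "0 < \<delta>" "\<delta> \<le> (1::real)"
  have "low k \<delta> \<eta> \<le> (2 * Lam\<^sup>2 / lam * (S + 1) * \<delta> + Lam / 2 * \<delta>\<^sup>2) * Y\<^sup>2"
  proof (rule minimizer.energy_decay[OF mini z(1) _ es _ V(1,2) _ _ d(1)])
   fix x assume x: "x \<in> \<Omega>" "cgrad z x \<noteq> 0"
   hence "x \<in> D2" using D2(3) by blast
   thus "u k x \<le> S + 1" using N[OF k] S(2) by force
  qed (use V z \<eta> S in \<open>auto simp: Y_def\<close>)
  also have "\<dots> \<le> A * \<delta>"
  proof -
   have "\<delta>\<^sup>2 \<le> \<delta>" using d mult_left_mono[of \<delta> 1 \<delta>] by (simp add: power2_eq_square)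
   hence "Lam / 2 * \<delta>\<^sup>2 \<le> Lam / 2 * \<delta>" using lam by (intro mult_left_mono) auto
   hence "(2 * Lam\<^sup>2 / lam * (S + 1) * \<delta> + Lam / 2 * \<delta>\<^sup>2) * Y\<^sup>2 \<le> (2 * Lam\<^sup>2 / lam * (S + 1) * \<delta> + Lam / 2 * \<delta>) * Y\<^sup>2" by (intro mult_right_mono) auto
   also have "\<dots> = A * \<delta>" unfolding A_def by (simp add: algebra_simps)
   finally show ?thesis .
  qed
  finally show "low k \<delta> \<eta> \<le> A * \<delta>" .
 qed (use \<eta> A0 in auto)
qed

end

section \<open>Hausdorff measure and dimension of the free boundary\<close>

context minimizer_seq
begin

definition W :: "'a set" where "W = {x\<in>\<Omega>. v x > 0}"

lemma W_open: "open W"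
 unfolding W_def using continuous_open_preimage[OF v_cont openO open_greaterThan[of 0]] by (simp add: vimage_def Int_def)

lemma W_frontier: assumes "x \<in> frontier W" "x \<in> \<Omega>" shows "v x = 0" "x \<in> closure W"
proof -
 have "x \<notin> W" using assms(1) W_open by (auto simp: frontier_def interior_open)
 thus "v x = 0" using v_nonneg[OF assms(2)] assms(2) by (simp add: W_def)
 show "x \<in> closure W" using assms(1) by (simp add: frontier_def)
qed

lemma level_measurable:
 assumes "compact C" "C \<subseteq> \<Omega>" "continuous_on \<Omega> f" "S \<in> sets borel"
 shows "{x\<in>C. f x \<in> S} \<in> lmeasurable"
proof (rule bounded_set_imp_lmeasurable)
 have C: "C \<in> sets borel" by (rule borel_compact[OF assms(1)])
 have "f \<in> borel_measurable (restrict_space borel C)"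
  by (rule borel_measurable_continuous_on_restrict[OF continuous_on_subset[OF assms(3,2)]])
 hence m: "f -` S \<inter> space (restrict_space borel C) \<in> sets (restrict_space borel C)" using assms(4) by (rule measurable_sets)
 have CC: "C \<inter> space borel \<in> sets borel" using C by (simp only: space_borel Int_UNIV_right)
 have e: "f -` S \<inter> space (restrict_space borel C) = {x\<in>C. f x \<in> S}" by (auto simp: space_restrict_space)
 have "{x\<in>C. f x \<in> S} \<in> sets borel" using m unfolding sets_restrict_space_iff[OF CC] e by (rule conjunct2)
 hence "{x\<in>C. f x \<in> S} \<in> sets lborel" by (simp only: sets_lborel)
 thus "{x\<in>C. f x \<in> S} \<in> sets lebesgue" by (rule sets_completionI_sets)
 show "bounded {x\<in>C. f x \<in> S}" by (rule bounded_subset[OF compact_imp_bounded[OF assms(1)]]) (rule Collect_restrict)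
qed

lemma sublevel_volume:
 assumes A: "A \<ge> 0" "smooth_fun \<eta>" "\<And>x. x \<in> C \<Longrightarrow> \<eta> x = 1"
  and E: "low k \<delta> \<eta> \<le> A * \<delta>"
  and V: "V \<in> lmeasurable" "V \<subseteq> C" "C \<subseteq> \<Omega>" "\<And>x. x \<in> V \<Longrightarrow> \<epsilon> k \<le> u k x \<and> u k x < \<delta>"
 shows "measure lebesgue V \<le> A / Mb \<beta> * \<delta>"
proof -
 have "Mb \<beta> * measure lebesgue V \<le> low k \<delta> \<eta>"
  by (rule minimizer.Be_volume[OF mini V(1) order_trans[OF V(2,3)] _ smooth_meas(1)[OF A(2) openO]]) (use V A(3) in auto)
 with E have "Mb \<beta> * measure lebesgue V \<le> A * \<delta>" by linarith
 thus ?thesis using Mb_pos[OF beta] by (simp add: field_simps)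
qed

text \<open>A point with \<open>0 < v x \<le> d\<close> eventually satisfies
  \<open>\<epsilon> k \<le> u k x < 2 * d\<close>, because \<open>\<epsilon>\<close> tends to 0. The
  volume bound for these strips is uniform in \<open>k\<close> and passes to the set of points that
  eventually lie in them.\<close>

lemma volume:
 assumes C: "compact C" "C \<subseteq> \<Omega>"
 obtains A where "A \<ge> 0" "\<And>d. 0 < d \<Longrightarrow> d \<le> 1/2 \<Longrightarrow> measure lebesgue {x\<in>C. 0 < v x \<and> v x \<le> d} \<le> A * d"
proof -
 obtain \<eta> A N where A: "smooth_fun \<eta>" "\<And>x. 0 \<le> \<eta> x" "\<And>x. x \<in> C \<Longrightarrow> \<eta> x = 1" "A \<ge> 0"
  "\<And>k \<delta>. k \<ge> N \<Longrightarrow> 0 < \<delta> \<Longrightarrow> \<delta> \<le> 1 \<Longrightarrow> low k \<delta> \<eta> \<le> A * \<delta>"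
  by (fact decay_uniform[OF C])
 have M: "Mb \<beta> > 0" by (rule Mb_pos[OF beta])
 show thesis
 proof (rule that[of "A / Mb \<beta> * 2"])
  fix d :: real assume d: "0 < d" "d \<le> 1/2"
  define P where "P = (\<lambda>k. {x\<in>C. \<epsilon> k \<le> u k x \<and> u k x < 2 * d})"
  \<comment> \<open>Tail intersections increase with \<open>m\<close>, so continuity of the measure
    from below replaces a Fatou argument.\<close>
  define T where "T = (\<lambda>m. \<Inter>k\<in>{N+m..}. P k)"
  have P: "P k \<in> lmeasurable" for k
  proof -
   have "P k = {x\<in>C. u k x \<in> {\<epsilon> k..<2*d}}" by (auto simp: P_def)
   thus ?thesis using level_measurable[OF C mini_cont, of "{\<epsilon> k..<2*d}" k] by simp
  qed
  have Ts: "T m \<in> sets lebesgue" for m unfolding T_def by (intro sets.countable_INT'') (use P in \<open>auto simp: fmeasurable_def\<close>)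
  have TP: "T m \<subseteq> P (N + m)" for m by (auto simp: T_def)
  have Tm: "T m \<in> lmeasurable" for m by (rule fmeasurableI2[OF P TP Ts])
  have mT: "emeasure lebesgue (T m) \<le> ennreal (A / Mb \<beta> * (2 * d))" for m
  proof -
   have d2: "0 < 2 * d" "2 * d \<le> 1" using d by auto
   have "measure lebesgue (T m) \<le> A / Mb \<beta> * (2 * d)"
    by (rule sublevel_volume[OF A(4,1,3) A(5)[OF _ d2, of "N + m"] Tm _ C(2)]) (use TP[of m] in \<open>auto simp: P_def\<close>)
   thus ?thesis using Tm by (simp add: emeasure_eq_measure2 ennreal_leI)
  qed
  have "{x\<in>C. 0 < v x \<and> v x \<le> d} \<subseteq> (\<Union>m. T m)"
  proof
   fix x assume x: "x \<in> {x\<in>C. 0 < v x \<and> v x \<le> d}"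
   hence xO: "x \<in> \<Omega>" using C by blast
   have "(\<lambda>k. u k x - \<epsilon> k) \<longlonglongrightarrow> v x - 0" by (rule tendsto_diff[OF v_lim[OF xO] eps_lim])
   hence "\<forall>\<^sub>F k in sequentially. u k x - \<epsilon> k > 0" using x by (intro order_tendstoD(1)) auto
   moreover have "\<forall>\<^sub>F k in sequentially. u k x < 2 * d" by (rule order_tendstoD(2)[OF v_lim[OF xO]]) (use x d in auto)
   ultimately have "\<forall>\<^sub>F k in sequentially. x \<in> P k" by eventually_elim (use x in \<open>auto simp: P_def\<close>)
   then obtain m where "\<And>k. k \<ge> m \<Longrightarrow> x \<in> P k" unfolding eventually_sequentially by blast
   hence "x \<in> T m" unfolding T_def by auto
   thus "x \<in> (\<Union>m. T m)" by blast
  qed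
  hence "emeasure lebesgue {x\<in>C. 0 < v x \<and> v x \<le> d} \<le> emeasure lebesgue (\<Union>m. T m)" by (rule emeasure_mono) (use Ts in auto)
  also have "\<dots> = (SUP m. emeasure lebesgue (T m))"
  proof (rule SUP_emeasure_incseq[symmetric])
   show "incseq T" unfolding T_def incseq_def by (intro allI impI INT_anti_mono) auto
  qed (use Ts in auto)
  also have "\<dots> \<le> ennreal (A / Mb \<beta> * (2 * d))" by (rule SUP_least) (rule mT)
  finally show "measure lebesgue {x\<in>C. 0 < v x \<and> v x \<le> d} \<le> A / Mb \<beta> * 2 * d"
   using A(4) M d by (simp add: measure_def enn2real_leI mult.assoc)
 qed (use A(4) M in simp)
qed

text \<open>Balls of radius \<open>r\<close> about points at mutual distance at least
  \<open>2 * r\<close> are disjoint, so the volume estimate limits their number; a set of such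
  points of maximal size covers with balls of twice the radius.\<close>

lemma hausdorff_locally_finite:
 assumes C: "compact C" "C \<subseteq> \<Omega>"
 shows "hausdorff_measure (real DIM('a) - 1) (frontier W \<inter> C) < \<infinity>"
proof -
 let ?n = "DIM('a)" let ?A = "frontier W \<inter> C"
 obtain R where R: "R > 0" "(\<Union>x\<in>C. cball x R) \<subseteq> \<Omega>" using compact_subset_open_imp_cball_epsilon_subset[OF C(1) openO C(2)] by metis
 \<comment> \<open>The closed \<open>R\<close>-neighbourhood, written as a Minkowski sum so that it
   is visibly compact.\<close>
 define C' where "C' = {x + y | x y. x \<in> C \<and> y \<in> cball 0 R}"
 have C'e: "C' = (\<Union>x\<in>C. cball x R)"
 proof (intro subset_antisym subsetI)
  fix z assume "z \<in> C'"
  then obtain x y where "x \<in> C" "norm y \<le> R" "z = x + y" by (auto simp: C'_def)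
  hence "x \<in> C" "z \<in> cball x R" by (auto simp: dist_norm)
  thus "z \<in> (\<Union>x\<in>C. cball x R)" by blast
 next
  fix z assume "z \<in> (\<Union>x\<in>C. cball x R)"
  then obtain x where "x \<in> C" "dist x z \<le> R" by auto
  hence "z = x + (z - x)" "x \<in> C" "z - x \<in> cball 0 R" by (auto simp: dist_norm norm_minus_commute)
  thus "z \<in> C'" unfolding C'_def by blast
 qed
 have C': "compact C'" "C' \<subseteq> \<Omega>" using R(2) C'e compact_sums[OF C(1) compact_cball, of 0 R] unfolding C'_def[symmetric] by auto
 obtain A where A: "A \<ge> 0" "\<And>d. 0 < d \<Longrightarrow> d \<le> 1/2 \<Longrightarrow> measure lebesgue {x\<in>C'. 0 < v x \<and> v x \<le> d} \<le> A * d"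
  by (rule volume[OF C']) (rule that; assumption)
 define b where "b = (kap / 8) ^ ?n * w1"
 have b0: "b > 0" unfolding b_def using kap(1) w1_pos by simp
 have "hausdorff_measure (real DIM('a) - 1) ?A \<le> ennreal (4 ^ (?n - 1) * (A * M1 / b))"
 proof (rule hausdorff_finite_cover)
  fix \<delta> :: real assume \<delta>: "\<delta> > 0"
  \<comment> \<open>The conditions come from \<open>density\<close> (radius \<open>8 * r\<close>
    inside the domain and below 1), from the diameter bound for the cover, and from the range
    \<open>M1 * r \<le> 1/2\<close> of \<open>volume\<close>.\<close>
  define r where "r = min (min (R/8) (1/16)) (min (\<delta>/4) (1 / (2 * M1)))"
  have r: "0 < r" "8 * r \<le> R" "8 * r < 1" "4 * r \<le> \<delta>" "r \<le> 1 / (2 * M1)" unfolding r_def using R(1) \<delta> kap(3) by auto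
  have Mr: "0 < M1 * r" "M1 * r \<le> 1/2" using r(1,5) kap(3) by (auto simp: field_simps)
  define Q where "Q = (\<lambda>X. finite X \<and> X \<subseteq> ?A \<and> (\<forall>x\<in>X. \<forall>y\<in>X. x \<noteq> y \<longrightarrow> dist x y \<ge> 2 * r))"
  have rn: "r ^ ?n = r ^ (?n - 1) * r" using power_Suc2[of r "?n - 1"] DIM_positive[where 'a='a] by simp
  have card: "real (card X) * r ^ (?n - 1) \<le> A * M1 / b" if Q: "Q X" for X
  proof -
   let ?S = "{x\<in>C'. 0 < v x \<and> v x \<le> M1 * r}"
   have ey0: "\<exists>y. ball y (kap * r / 8) \<subseteq> {z \<in> ball x r. 0 < v z \<and> v z \<le> M1 * r}" if x: "x \<in> X" for x
   proof -
    have xA: "x \<in> frontier W" "x \<in> C" using x Q by (auto simp: Q_def)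
    have B: "cball x (8 * r) \<subseteq> \<Omega>" using xA(2) R(2) r(2) by (force simp: subset_iff)
    have xO: "x \<in> \<Omega>" using xA(2) C(2) by blast
    show ?thesis by (rule density[OF W_frontier(1)[OF xA(1) xO] W_frontier(2)[OF xA(1) xO, unfolded W_def] B r(1,3)]) blast
   qed
   have ey: "\<forall>x\<in>X. \<exists>y. ball y (kap * r / 8) \<subseteq> {z \<in> ball x r. 0 < v z \<and> v z \<le> M1 * r}" by (intro ballI ey0)
   from bchoice[OF ey] obtain y where y0: "\<forall>x\<in>X. ball (y x) (kap * r / 8) \<subseteq> {z \<in> ball x r. 0 < v z \<and> v z \<le> M1 * r}" by (elim exE)
   note y = bspec[OF y0]
   let ?B = "\<lambda>x. ball (y x) (kap * r / 8)"
   have kr: "kap * r / 8 \<ge> 0" using kap(1) r(1) by simp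
   have mB: "measure lebesgue (?B x) = b * r ^ ?n" for x
    using measure_ball_w1[OF kr, of "y x"] by (simp add: b_def power_mult_distrib power_divide)
   have dis: "disjoint_family_on ?B X"
   unfolding disjoint_family_on_def
   proof (intro ballI impI)
    fix x x' assume x: "x \<in> X" "x' \<in> X" "x \<noteq> x'"
    have "2 * r \<le> dist x x'" using Q x by (auto simp: Q_def)
    hence "ball x r \<inter> ball x' r = {}" by (intro disjoint_ballI) simp
    thus "?B x \<inter> ?B x' = {}" using y[OF x(1)] y[OF x(2)] by blast
   qed
   have fX: "finite X" using Q by (simp add: Q_def)
   have "real (card X) * (b * r ^ ?n) = (\<Sum>x\<in>X. measure lebesgue (?B x))" unfolding mB by simp
   also have "\<dots> = measure lebesgue (\<Union>x\<in>X. ?B x)"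
    by (rule measure_finite_Union[OF fX _ dis, symmetric]) (auto simp: fmeasurable_def emeasure_ball)
   also have "\<dots> \<le> measure lebesgue ?S"
   proof (rule measure_mono_fmeasurable)
    show "(\<Union>x\<in>X. ?B x) \<subseteq> ?S"
    proof (rule UN_least)
     fix x assume x: "x \<in> X"
     have xC: "x \<in> C" using Q x by (auto simp: Q_def)
     have "ball x r \<subseteq> cball x R" using r by auto
     hence "ball x r \<subseteq> C'" unfolding C'e using xC by blast
     thus "?B x \<subseteq> ?S" using y[OF x] by blast
    qed
    show "?S \<in> lmeasurable"
    proof -
     have "?S = {x\<in>C'. v x \<in> {0<..M1 * r}}" by auto
     thus ?thesis using level_measurable[OF C' v_cont, of "{0<..M1 * r}"] by simp
    qed
   qed (use fX in auto)
   also have "\<dots> \<le> A * (M1 * r)" by (rule A(2)[OF Mr])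
   finally have "(real (card X) * r ^ (?n - 1)) * (b * r) \<le> (A * M1 / b) * (b * r)" unfolding rn using b0 by (simp add: mult_ac)
   thus ?thesis by (rule mult_right_le_imp_le) (use b0 r(1) in simp)
  qed
  \<comment> \<open>A family of largest cardinality exists because \<open>card\<close> bounds all of
    them; a point far from all its members could be added.\<close>
  obtain X where X: "Q X" "\<And>Y. Q Y \<Longrightarrow> card Y \<le> card X"
  proof -
   have Q0: "Q {}" by (simp add: Q_def)
   have "card Y < Suc (nat \<lfloor>A * M1 / b / r ^ (?n - 1)\<rfloor>)" if "Q Y" for Y
   proof -
    have rp: "r ^ (?n - 1) > 0" using r(1) by simp
    have "real (card Y) \<le> A * M1 / b / r ^ (?n - 1)" using card[OF that] unfolding pos_le_divide_eq[OF rp] .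
    hence "card Y \<le> nat \<lfloor>A * M1 / b / r ^ (?n - 1)\<rfloor>" by (simp add: le_nat_floor)
    thus ?thesis by simp
   qed
   hence "\<exists>X. Q X \<and> (\<forall>Y. Q Y \<longrightarrow> card Y \<le> card X)"
    using ex_has_greatest_nat[of Q "{}" card "Suc (nat \<lfloor>A * M1 / b / r ^ (?n - 1)\<rfloor>)"] Q0 by blast
   thus thesis using that by blast
  qed
  have "?A \<subseteq> (\<Union>x\<in>X. cball x (2 * r))"
  proof
   fix z assume z: "z \<in> ?A"
   show "z \<in> (\<Union>x\<in>X. cball x (2 * r))"
   proof (rule ccontr)
    assume n: "z \<notin> (\<Union>x\<in>X. cball x (2 * r))"
    hence far: "\<And>x. x \<in> X \<Longrightarrow> dist x z > 2 * r" by (auto simp: not_le)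
    hence "z \<notin> X" using r(1) by force
    moreover have "Q (insert z X)" using X(1) z far unfolding Q_def by (auto simp: dist_commute intro: less_imp_le)
    moreover have "finite X" using X(1) by (simp add: Q_def)
    ultimately show False using X(2)[of "insert z X"] by simp
   qed
  qed
  thus "\<exists>X r. finite X \<and> 0 < r \<and> 4 * r \<le> \<delta> \<and> ?A \<subseteq> (\<Union>x\<in>X. cball x (2 * r)) \<and> real (card X) * r ^ (?n - 1) \<le> A * M1 / b"
   using X(1) r card[OF X(1)] by (intro exI[of _ X] exI[of _ r]) (auto simp: Q_def)
 qed
 thus ?thesis using le_less_trans ennreal_less_top by (metis infinity_ennreal_def)
qed

text \<open>If almost every point were positive, then \<open>u k > \<epsilon> k\<close> eventually
  at almost every point and the gap would tend to 0 by dominated convergence.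
  \<open>gap_growth\<close>, with an arbitrarily small bound near the zero \<open>x0\<close>, would
  make \<open>v\<close> vanish in a ball, contradicting that \<open>x0\<close> is in the closure of
  \<open>W\<close>.\<close>

lemma zero_set_not_null:
 assumes x0: "x0 \<in> frontier W" "x0 \<in> \<Omega>" and B: "cball x0 (2 * r) \<subseteq> \<Omega>" and r: "0 < r" "2 * r < 1"
 shows "{x\<in>ball x0 (2 * r). v x = 0} \<notin> null_sets lebesgue"
proof
 assume null: "{x\<in>ball x0 (2 * r). v x = 0} \<in> null_sets lebesgue"
 let ?M = "Leb (ball x0 (2 * r))"
 note v0 = W_frontier[OF x0]
 have BO: "ball x0 (2 * r) \<subseteq> \<Omega>" using B ball_subset_cball by blast
 interpret finite_measure ?M by (rule finite_measure_bounded_open) auto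
 have gap0: "(\<lambda>k. minimizer.gap \<beta> (\<epsilon> k) (u k) x0 (2 * r)) \<longlonglongrightarrow> 0"
 proof -
  have "(\<lambda>k. \<integral>x. Mb \<beta> - B_eps \<beta> (\<epsilon> k) (u k x) \<partial>?M) \<longlonglongrightarrow> (\<integral>x. 0 \<partial>?M)"
  proof (rule integral_dominated_convergence[where w="\<lambda>_. Mb \<beta>"])
   have um: "u k \<in> borel_measurable ?M" for k
    by (rule continuous_measurable_lebesgue_on[OF continuous_on_subset[OF mini_cont BO] open_ball])
   show "(\<lambda>x. Mb \<beta> - B_eps \<beta> (\<epsilon> k) (u k x)) \<in> borel_measurable ?M" for k
    by (intro borel_measurable_diff borel_measurable_const measurable_compose[OF um B_measurable[OF beta mini_eps]])
   show "AE x in ?M. norm (Mb \<beta> - B_eps \<beta> (\<epsilon> k) (u k x)) \<le> Mb \<beta>" for k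
    using B_nonneg[OF beta mini_eps, of k] B_le[OF beta mini_eps, of k] by (intro AE_I2) (auto simp: abs_le_iff)
   have "AE x in ?M. v x \<noteq> 0"
   proof (rule AE_I')
    show "{x\<in>ball x0 (2 * r). v x = 0} \<in> null_sets ?M" using null by (auto simp: null_sets_restrict_space)
   qed (auto simp: space_restrict_space)
   moreover have "AE x in ?M. x \<in> ball x0 (2 * r)" by (intro AE_I2) (simp add: space_restrict_space)
   ultimately show "AE x in ?M. (\<lambda>k. Mb \<beta> - B_eps \<beta> (\<epsilon> k) (u k x)) \<longlonglongrightarrow> 0"
   proof eventually_elim
    case (elim x)
    hence xO: "x \<in> \<Omega>" and p: "v x > 0" using BO v_nonneg[of x] by auto
    have "(\<lambda>k. u k x - \<epsilon> k) \<longlonglongrightarrow> v x - 0" by (rule tendsto_diff[OF v_lim[OF xO] eps_lim])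
    hence "\<forall>\<^sub>F k in sequentially. u k x - \<epsilon> k > 0" using p by (intro order_tendstoD(1)) auto
    hence "\<forall>\<^sub>F k in sequentially. Mb \<beta> - B_eps \<beta> (\<epsilon> k) (u k x) = 0"
     by eventually_elim (use B_full[OF beta mini_eps] in simp)
    thus ?case by (rule tendsto_eventually)
   qed
  qed auto
  thus ?thesis unfolding minimizer.gap_def[OF mini] by simp
 qed
 have le: "v x \<le> CH * (CH * m)" if x: "x \<in> cball x0 (r/4)" and m: "m > 0" for x m
 proof -
  have xO: "x \<in> \<Omega>" using x B r by (auto simp: subset_iff)
  have "isCont v x0" using v_cont openO x0(2) by (simp add: continuous_on_eq_continuous_at)
  moreover have m2: "m/2 > 0" using m by simp
  ultimately obtain \<sigma>' where s0: "\<sigma>' > 0" "\<And>y. dist y x0 < \<sigma>' \<Longrightarrow> dist (v y) (v x0) < m/2" unfolding continuous_at_eps_delta by blast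
  have s': "v y < m/2" if "dist y x0 < \<sigma>'" for y using s0(2)[OF that] v0(1) unfolding dist_real_def by linarith
  define \<sigma> where "\<sigma> = min (\<sigma>'/2) (r/4)"
  have \<sigma>: "0 < \<sigma>" "3 * \<sigma> < r" "\<sigma> < \<sigma>'" using s0(1) r by (auto simp: \<sigma>_def)
  have cs: "cball x0 \<sigma> \<subseteq> \<Omega>" using B \<sigma> r by (auto simp: subset_iff)
  let ?F = "\<lambda>k. CH * (CH * (m + sqrt ((KP * (2 * r))\<^sup>2 * (2 / lam) * minimizer.gap \<beta> (\<epsilon> k) (u k) x0 (2 * r) / measure lborel (ball x0 \<sigma>))))"
  have ev: "\<forall>\<^sub>F k in sequentially. u k x \<le> ?F k"
   using v_unif[OF compact_cball cs m2]
  proof (eventually_elim)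
   case (elim k)
   show ?case
   proof (rule minimizer.gap_growth[OF mini B r \<sigma>(1,2) _ x])
    fix y assume y: "y \<in> ball x0 \<sigma>"
    hence "v y < m/2" using s'[of y] \<sigma>(3) by (simp add: dist_commute)
    moreover have "\<bar>u k y - v y\<bar> < m/2" using elim y by simp
    ultimately show "u k y \<le> m" by linarith
   qed
  qed
  have lim: "?F \<longlonglongrightarrow> CH * (CH * (m + sqrt ((KP * (2 * r))\<^sup>2 * (2 / lam) * 0 / measure lborel (ball x0 \<sigma>))))"
   by (rule tendsto_mult[OF tendsto_const tendsto_mult[OF tendsto_const tendsto_add[OF tendsto_const tendsto_real_sqrt[OF tendsto_divide[OF tendsto_mult[OF tendsto_const gap0] tendsto_const]]]]])
     (use measure_ball_pos[OF \<sigma>(1), of x0] in simp)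
  show ?thesis using tendsto_le[OF sequentially_bot lim v_lim[OF xO] ev] by simp
 qed
 have v_le: "v x \<le> 0" if x: "x \<in> cball x0 (r/4)" for x
 proof (rule field_le_epsilon)
  fix e :: real assume e: "e > 0"
  have "v x \<le> CH * (CH * (e / (CH * CH)))" by (rule le[OF x]) (use e CH_pos in simp)
  thus "v x \<le> 0 + e" using CH_pos by simp
 qed
 have "x \<notin> W" if "x \<in> ball x0 (r/4)" for x using v_le[of x] that unfolding W_def by auto
 hence "ball x0 (r/4) \<inter> W = {}" by blast
 moreover have "x0 \<in> ball x0 (r/4)" using r by simp
 ultimately show False using v0(2) open_Int_closure_eq_empty[OF open_ball, of x0 "r/4" W] by blast
qed

text \<open>Sweeping a null free boundary would cover the zero set near \<open>x0\<close> by a null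
  set, contrary to \<open>zero_set_not_null\<close>.\<close>

lemma hausdorff_not_null:
 assumes x0: "x0 \<in> frontier W" "x0 \<in> \<Omega>"
 shows "hausdorff_measure (real DIM('a) - 1) (frontier W \<inter> \<Omega>) \<noteq> 0"
proof
 assume H: "hausdorff_measure (real DIM('a) - 1) (frontier W \<inter> \<Omega>) = 0"
 obtain r1 where r1: "r1 > 0" "cball x0 r1 \<subseteq> \<Omega>" using openO x0(2) open_contains_cball by blast
 define r where "r = min (r1/2) (1/4)"
 have r: "0 < r" "2 * r < 1" "2 * r \<le> r1" using r1 by (auto simp: r_def)
 have B: "cball x0 (2 * r) \<subseteq> \<Omega>" using r1(2) r(3) by (auto simp: subset_iff)
 hence BO: "ball x0 (2 * r) \<subseteq> \<Omega>" using ball_subset_cball by blast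
 let ?Z = "{x\<in>ball x0 (2 * r). v x = 0}"
 have "ball x0 (2 * r) \<inter> W \<noteq> {}"
 proof -
  have "x0 \<in> ball x0 (2 * r) \<inter> closure W" using W_frontier(2)[OF x0] r(1) by simp
  thus ?thesis using open_Int_closure_eq_empty[OF open_ball, of x0 "2 * r" W] by blast
 qed
 then obtain y where y: "y \<in> ball x0 (2 * r) \<inter> W" by blast
 then obtain \<rho> where \<rho>: "\<rho> > 0" "ball y \<rho> \<subseteq> ball x0 (2 * r) \<inter> W" using open_contains_ball W_open open_Int open_ball by metis
 \<comment> \<open>Cover by balls of the radius \<open>\<rho>\<close> of the positive ball: for the
   piece near \<open>q\<close> the single translation \<open>y - q\<close> carries every point into
   the ball about \<open>y\<close>, so one sweep direction per piece suffices.\<close>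
 obtain Q where Q: "finite Q" "cball x0 (2 * r) \<subseteq> (\<Union>q\<in>Q. ball q \<rho>)"
 proof -
  have cov: "cball x0 (2 * r) \<subseteq> (\<Union>q\<in>UNIV. ball q \<rho>)"
  proof
   fix z :: 'a
   have "z \<in> ball z \<rho>" using \<rho>(1) by simp
   thus "z \<in> (\<Union>q\<in>UNIV. ball q \<rho>)" by blast
  qed
  show thesis by (rule compactE_image[OF compact_cball open_ball cov]) (rule that; assumption)
 qed
 have "?Z \<inter> ball q \<rho> \<in> null_sets lebesgue" for q
 proof (rule sweep_null[OF H])
  fix x assume x: "x \<in> ?Z \<inter> ball q \<rho>"
  let ?w = "y - q"
  have end_point: "x + ?w \<in> ball y \<rho>" using x by (simp add: dist_norm algebra_simps)
  let ?S = "closed_segment x (x + ?w)"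
  have sub: "?S \<subseteq> ball x0 (2 * r)" using x end_point \<rho>(2) by (intro closed_segment_subset convex_ball) auto
  have "?S \<inter> frontier W \<noteq> {}"
  proof (rule connected_Int_frontier[OF connected_segment(1)])
   show "?S \<inter> W \<noteq> {}" using end_point \<rho>(2) ends_in_segment(2) by blast
   show "?S - W \<noteq> {}" using x ends_in_segment(1)[of x "x + ?w"] unfolding W_def by force
  qed
  then obtain z where z: "z \<in> ?S" "z \<in> frontier W" by blast
  then obtain t where t: "0 \<le> t" "t \<le> 1" "z = (1 - t) *\<^sub>R x + t *\<^sub>R (x + ?w)" unfolding closed_segment_def by blast
  have "z = x + t *\<^sub>R ?w" unfolding t(3) by (simp add: algebra_simps)
  thus "\<exists>t. 0 \<le> t \<and> t \<le> 1 \<and> x + t *\<^sub>R ?w \<in> frontier W \<inter> \<Omega>" using t(1,2) z sub BO by blast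
 qed
 hence "(\<Union>q\<in>Q. ?Z \<inter> ball q \<rho>) \<in> null_sets lebesgue" using Q(1) by (intro null_sets.finite_UN) auto
 moreover have "?Z = (\<Union>q\<in>Q. ?Z \<inter> ball q \<rho>)"
 proof -
  have "?Z \<subseteq> cball x0 (2 * r)" by auto
  hence "?Z \<subseteq> (\<Union>q\<in>Q. ball q \<rho>)" using Q(2) by (rule order_trans)
  thus ?thesis by blast
 qed
 ultimately show False using zero_set_not_null[OF x0 B r(1,2)] by argo
qed

lemma hausdorff_dim_frontier:
 assumes "frontier W \<inter> \<Omega> \<noteq> {}" shows "hausdorff_dim (frontier W \<inter> \<Omega>) = real DIM('a) - 1"
proof (rule hausdorff_dim_eq[OF _ _ openO])
 show "hausdorff_measure (real DIM('a) - 1) (frontier W \<inter> \<Omega>) \<noteq> 0" using assms hausdorff_not_null by blast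
 fix C assume C: "compact C" "C \<subseteq> \<Omega>"
 have "frontier W \<inter> \<Omega> \<inter> C \<subseteq> frontier W \<inter> C" by blast
 from hausdorff_measure_mono[OF this] hausdorff_locally_finite[OF C]
 show "hausdorff_measure (real DIM('a) - 1) (frontier W \<inter> \<Omega> \<inter> C) < \<infinity>" by (rule le_less_trans)
qed auto

end

section \<open>Finite perimeter of the positivity set\<close>

context minimizer_seq
begin

text \<open>The piecewise linear ramp from 0 at \<open>\<delta>/2\<close> to 1 at
  \<open>\<delta>\<close>, written with positive parts so that its gradient along \<open>u k\<close>
  follows from \<open>SH_pos\<close>.\<close>

definition ramp :: "real \<Rightarrow> real \<Rightarrow> real" where "ramp \<delta> t = (2/\<delta>) * (max (t - \<delta>/2) 0 - max (t - \<delta>) 0)"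

lemma ramp:
 assumes "\<delta> > 0"
 shows "0 \<le> ramp \<delta> t" "ramp \<delta> t \<le> 1" "t \<le> \<delta>/2 \<Longrightarrow> ramp \<delta> t = 0" "t \<ge> \<delta> \<Longrightarrow> ramp \<delta> t = 1"
 unfolding ramp_def using assms by (auto simp: max_def field_simps)

text \<open>The estimate holds for ramps of \<open>u k\<close> once
  \<open>\<epsilon> k \<le> \<delta>/2\<close>, so the limits are taken in this order: first in
  \<open>k\<close> with \<open>\<delta>\<close> fixed, then in \<open>\<delta>\<close>, where the
  ramps of \<open>v\<close> tend to the indicator of \<open>W\<close>.\<close>

lemma perimeter_finite:
 assumes V: "open V" "compact (closure V)" "closure V \<subseteq> \<Omega>"
 shows "perimeter W V < \<infinity>"
proof -
 let ?M = "Leb \<Omega>" let ?C = "closure V"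
 note O = openO bddO and C = V(2,3)
 obtain \<eta> A N where A: "smooth_fun \<eta>" "\<And>x. 0 \<le> \<eta> x" "\<And>x. x \<in> ?C \<Longrightarrow> \<eta> x = 1" "A \<ge> 0"
  "\<And>k \<delta>. k \<ge> N \<Longrightarrow> 0 < \<delta> \<Longrightarrow> \<delta> \<le> 1 \<Longrightarrow> low k \<delta> \<eta> \<le> A * \<delta>"
  by (fact decay_uniform[OF C])
 have \<eta>m[measurable]: "\<eta> \<in> borel_measurable ?M" by (rule smooth_meas(1)[OF A(1) openO])
 define p where "p = 4 * A / lam + A / Mb \<beta> * 2"
 have "perimeter W V \<le> ereal p" unfolding perimeter_def
 proof (rule SUP_least)
  fix F :: "'a \<Rightarrow> 'a" assume "F \<in> {F. (\<forall>b\<in>Basis. test_fun V (\<lambda>x. F x \<bullet> b)) \<and> (\<forall>x. norm (F x) \<le> 1)}"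
  hence F: "\<And>b. b \<in> Basis \<Longrightarrow> test_fun V (\<lambda>x. F x \<bullet> b)" "\<And>x. norm (F x) \<le> 1" by auto
  have VO: "V \<subseteq> \<Omega>" using V(3) closure_subset by blast
  have Ft: "test_fun \<Omega> (\<lambda>x. F x \<bullet> b)" if "b \<in> Basis" for b by (rule test_fun_mono[OF F(1)[OF that] VO])
  have Fs: "smooth_fun (\<lambda>x. F x \<bullet> b)" if "b \<in> Basis" for b by (rule test_fun_smooth[OF F(1)[OF that]])
  have F0: "F x = 0" if "x \<notin> closure V" for x
  proof (rule euclidean_eqI)
   fix b :: 'a assume b: "b \<in> Basis"
   have "x \<notin> V" using that closure_subset by blast
   thus "F x \<bullet> b = 0 \<bullet> b" using test_fun_outside(1)[OF F(1)[OF b]] by simp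
  qed
  let ?\<psi> = "\<lambda>b x. F x \<bullet> b"
  have div: "divergence F x = (\<Sum>b\<in>Basis. cgrad (?\<psi> b) x \<bullet> b)" for x
   unfolding divergence_def by (intro sum.cong refl) (simp add: cgrad_inner_Basis)
  have Lc: "L2 ?M (\<lambda>x. cgrad (?\<psi> b) x \<bullet> b)" if "b \<in> Basis" for b
   by (rule L2_inner_const[OF smooth_L2(2)[OF Fs[OF that] O]])
  have L1: "L2 ?M (\<lambda>x. 1::real)" by (rule SH_L2(1)[OF SH_const[OF O]])
  have ic: "integrable ?M (\<lambda>x. cgrad (?\<psi> b) x \<bullet> b)" if "b \<in> Basis" for b
   using L2_integrable_inner[OF Lc[OF that] L1] by simp
  have id: "integrable ?M (divergence F)" unfolding div[abs_def] by (intro Bochner_Integration.integrable_sum ic)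
  have Fm: "F \<in> borel_measurable ?M"
  proof (subst borel_measurable_euclidean_space, intro ballI)
   fix b :: 'a assume "b \<in> Basis"
   thus "(\<lambda>x. F x \<bullet> b) \<in> borel_measurable ?M" by (intro smooth_meas(1)[OF Fs openO])
  qed
  have dm: "divergence F \<in> borel_measurable ?M" by (rule borel_measurable_integrable[OF id])
  have rm: "ramp \<delta> \<in> borel_measurable borel" for \<delta> unfolding ramp_def by measurable
  have est: "(\<integral>x. ramp \<delta> (u k x) * divergence F x \<partial>?M) \<le> p" if d: "0 < \<delta>" "\<delta> \<le> 1/2" and k: "k \<ge> N" "\<epsilon> k \<le> \<delta>/2" for k \<delta>
  proof -
   note S = minimizer.SHu[OF mini[of k]]
   let ?H = "\<lambda>t x. if u k x - t > 0 then G k x - 0 else 0"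
   let ?D = "\<lambda>x. (2/\<delta>) *\<^sub>R (?H (\<delta>/2) x - ?H \<delta> x)"
   have SR: "SH \<Omega> (\<lambda>x. ramp \<delta> (u k x)) ?D"
    unfolding ramp_def by (rule SH_cmult[OF SH_diff[OF SH_pos[OF SH_diff[OF S SH_const[OF O]]] SH_pos[OF SH_diff[OF S SH_const[OF O]]]]])
   have iD: "integrable ?M (\<lambda>x. (?D x \<bullet> b) * ?\<psi> b x)" if "b \<in> Basis" for b
    using L2_integrable_inner[OF L2_inner_const[OF SH_L2(2)[OF SR]] smooth_L2(1)[OF Fs[OF that] O], of b] by simp
   have iR: "integrable ?M (\<lambda>x. ramp \<delta> (u k x) * (cgrad (?\<psi> b) x \<bullet> b))" if "b \<in> Basis" for b
    using L2_integrable_inner[OF SH_L2(1)[OF SR] Lc[OF that]] by simp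
   have "(\<integral>x. ramp \<delta> (u k x) * divergence F x \<partial>?M) = (\<Sum>b\<in>Basis. \<integral>x. ramp \<delta> (u k x) * (cgrad (?\<psi> b) x \<bullet> b) \<partial>?M)"
    unfolding div sum_distrib_left by (rule Bochner_Integration.integral_sum) (rule iR)
   also have "\<dots> = (\<Sum>b\<in>Basis. - (\<integral>x. (?D x \<bullet> b) * ?\<psi> b x \<partial>?M))"
    by (intro sum.cong refl SH_int_by_parts[OF SR Ft O])
   also have "\<dots> = - (\<integral>x. (\<Sum>b\<in>Basis. (?D x \<bullet> b) * ?\<psi> b x) \<partial>?M)"
    unfolding sum_negf by (subst Bochner_Integration.integral_sum[OF iD]) auto
   also have "\<dots> = - (\<integral>x. ?D x \<bullet> F x \<partial>?M)" by (simp only: euclidean_inner[symmetric])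
   finally have e1: "(\<integral>x. ramp \<delta> (u k x) * divergence F x \<partial>?M) = - (\<integral>x. ?D x \<bullet> F x \<partial>?M)" .
   let ?P = "\<lambda>x. if u k x < 2 * \<delta> * \<eta> x then G k x else 0"
   let ?T = "{x\<in>?C. u k x \<in> {\<delta>/2<..\<delta>}}" let ?F = "\<lambda>x. if x \<in> ?T then F x else 0"
   \<comment> \<open>On the closure of \<open>V\<close> the cutoff is 1, so the strip
     \<open>{\<delta>/2 < u k \<le> \<delta>}\<close> lies inside
     \<open>{u k < 2 * \<delta> * \<eta>}\<close>, where the low energy at level
     \<open>2 * \<delta>\<close> controls the gradient; outside that closure \<open>F\<close>
     vanishes.\<close>
   have DF: "?D x \<bullet> F x = (2/\<delta>) * (?P x \<bullet> ?F x)" for x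
    using F0[of x] A(3)[of x] d by (cases "x \<in> ?C") auto
   have e2: "(\<integral>x. ?D x \<bullet> F x \<partial>?M) = (2/\<delta>) * (\<integral>x. ?P x \<bullet> ?F x \<partial>?M)" by (simp only: DF integral_mult_right_zero)
   have T: "?T \<in> lmeasurable" by (rule level_measurable[OF C mini_cont]) simp
   have um[measurable]: "u k \<in> borel_measurable ?M" by (rule SH_meas(1)[OF S])
   have Tm: "?T \<in> sets ?M"
    using T C(2) openO by (auto simp: sets_restrict_space fmeasurable_def intro!: image_eqI[of _ _ ?T])
   have TO: "?T \<inter> space ?M = ?T" using C(2) by (auto simp: space_restrict_space)
   have LP: "L2 ?M ?P"
    by (rule L2_bound(1)[OF _ SH_L2(2)[OF S]]) (use SH_meas(2)[OF S] in auto)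
   have LF: "L2 ?M ?F"
   proof (rule L2_boundedI[OF O])
    show "?F \<in> borel_measurable ?M" by (rule measurable_If_set[OF Fm borel_measurable_const], unfold TO) (rule Tm)
    show "AE x in ?M. norm (?F x) \<le> 1" using F(2) by (intro AE_I2) auto
   qed
   have d2: "0 < 2 * \<delta>" "2 * \<delta> \<le> 1" using d by auto
   note en = A(5)[OF k(1) d2]
   have "lam / 2 * (l2n ?M ?P)\<^sup>2 \<le> A * (2 * \<delta>)" using minimizer.gradient_le_low_energy[OF mini, of k "2 * \<delta>" \<eta>] en by linarith
   hence X: "(l2n ?M ?P)\<^sup>2 \<le> 4 * A / lam * \<delta>" using lam by (simp add: field_simps)
   have "(l2n ?M ?F)\<^sup>2 \<le> 1\<^sup>2 * measure lebesgue ?T"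
    by (rule l2n_upper[OF LF T]) (use C F(2) openO in auto)
   also have "measure lebesgue ?T \<le> A / Mb \<beta> * (2 * \<delta>)"
    by (rule sublevel_volume[OF A(4,1,3) en T _ C(2)]) (use k d in auto)
   finally have Y: "(l2n ?M ?F)\<^sup>2 \<le> A / Mb \<beta> * 2 * \<delta>" by simp
   have "- (\<integral>x. ?P x \<bullet> ?F x \<partial>?M) \<le> l2n ?M ?P * l2n ?M ?F" using L2_inner_le[OF LP LF] by linarith
   \<comment> \<open>Gradient energy and strip volume are both of order \<open>\<delta>\<close>, so
     their product under the square root cancels the slope \<open>2 / \<delta>\<close> of the ramp;
     \<open>p\<close> is the sum of the two constants.\<close>
   moreover have "2 * (l2n ?M ?P * l2n ?M ?F) \<le> (l2n ?M ?P)\<^sup>2 + (l2n ?M ?F)\<^sup>2"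
    using sum_squares_bound[of "l2n ?M ?P" "l2n ?M ?F"] by (simp add: mult.assoc)
   moreover have "p * \<delta> = 4 * A / lam * \<delta> + A / Mb \<beta> * 2 * \<delta>" unfolding p_def by (rule distrib_right)
   ultimately have "2 * - (\<integral>x. ?P x \<bullet> ?F x \<partial>?M) \<le> p * \<delta>" using X Y by linarith
   hence "1/\<delta> * (2 * - (\<integral>x. ?P x \<bullet> ?F x \<partial>?M)) \<le> 1/\<delta> * (p * \<delta>)" using d by (intro mult_left_mono) auto
   thus ?thesis unfolding e1 e2 using d by simp
  qed
  have main: "(\<integral>x. ramp \<delta> (v x) * divergence F x \<partial>?M) \<le> p" if d: "0 < \<delta>" "\<delta> \<le> 1/2" for \<delta>
  proof -
  have lim: "(\<lambda>k. \<integral>x. ramp \<delta> (u k x) * divergence F x \<partial>?M) \<longlonglongrightarrow> (\<integral>x. ramp \<delta> (v x) * divergence F x \<partial>?M)"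
  proof (rule integral_dominated_convergence[where w="\<lambda>x. norm (divergence F x)"])
   show "(\<lambda>x. ramp \<delta> (v x) * divergence F x) \<in> borel_measurable ?M"
    by (intro borel_measurable_times dm measurable_compose[OF continuous_measurable_lebesgue_on[OF v_cont openO] rm])
   show "(\<lambda>x. ramp \<delta> (u k x) * divergence F x) \<in> borel_measurable ?M" for k
    by (intro borel_measurable_times dm measurable_compose[OF continuous_measurable_lebesgue_on[OF mini_cont openO] rm])
   show "integrable ?M (\<lambda>x. norm (divergence F x))" by (rule integrable_norm[OF id])
   show "AE x in ?M. norm (ramp \<delta> (u k x) * divergence F x) \<le> norm (divergence F x)" for k
    using ramp(1,2)[OF d(1)] by (intro AE_I2) (auto simp: abs_mult intro!: mult_left_le_one_le)
   show "AE x in ?M. (\<lambda>k. ramp \<delta> (u k x) * divergence F x) \<longlonglongrightarrow> ramp \<delta> (v x) * divergence F x"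
   proof (rule AE_I2)
    fix x assume "x \<in> space ?M"
    hence "x \<in> \<Omega>" by (simp add: space_restrict_space)
    from v_lim[OF this] show "(\<lambda>k. ramp \<delta> (u k x) * divergence F x) \<longlonglongrightarrow> ramp \<delta> (v x) * divergence F x"
     unfolding ramp_def by (intro tendsto_mult tendsto_const tendsto_diff tendsto_max)
   qed
  qed
  have "\<forall>\<^sub>F k in sequentially. \<epsilon> k < \<delta>/2" using order_tendstoD(2)[OF eps_lim, of "\<delta>/2"] d by simp
  hence "\<forall>\<^sub>F k in sequentially. (\<integral>x. ramp \<delta> (u k x) * divergence F x \<partial>?M) \<le> p"
   using eventually_ge_at_top[of N] by eventually_elim (auto intro: est[OF d])
  thus ?thesis by (rule tendsto_upperbound[OF lim]) simp
  qed
  \<comment> \<open>The shift by 2 keeps \<open>?d n \<le> 1/2\<close>, so that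
    \<open>2 * ?d n \<le> 1\<close> is an admissible level in \<open>decay_uniform\<close>.\<close>
  let ?d = "\<lambda>n::nat. 1 / (real n + 2)"
  have d: "0 < ?d n" "?d n \<le> 1/2" for n by (auto simp: field_simps)
  have lim1: "(\<lambda>n. \<integral>x. ramp (?d n) (v x) * divergence F x \<partial>?M) \<longlonglongrightarrow> (\<integral>x. indicator W x * divergence F x \<partial>?M)"
  proof (rule integral_dominated_convergence[where w="\<lambda>x. norm (divergence F x)"])
   show "(\<lambda>x. ramp (?d n) (v x) * divergence F x) \<in> borel_measurable ?M" for n
    by (intro borel_measurable_times dm measurable_compose[OF continuous_measurable_lebesgue_on[OF v_cont openO] rm])
   have "W \<in> sets ?M" using W_open openO by (auto simp: W_def sets_restrict_space intro!: image_eqI[of _ _ W])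
   thus "(\<lambda>x. indicator W x * divergence F x) \<in> borel_measurable ?M"
    by (intro borel_measurable_times dm borel_measurable_indicator)
   show "integrable ?M (\<lambda>x. norm (divergence F x))" by (rule integrable_norm[OF id])
   show "AE x in ?M. norm (ramp (?d n) (v x) * divergence F x) \<le> norm (divergence F x)" for n
    using ramp(1,2)[OF d(1)] by (intro AE_I2) (auto simp: abs_mult intro!: mult_left_le_one_le)
   show "AE x in ?M. (\<lambda>n. ramp (?d n) (v x) * divergence F x) \<longlonglongrightarrow> indicator W x * divergence F x"
   proof (rule AE_I2)
    fix x assume "x \<in> space ?M"
    hence x: "x \<in> \<Omega>" by (simp add: space_restrict_space)
    have "(\<lambda>n. ramp (?d n) (v x)) \<longlonglongrightarrow> indicator W x"
    proof (rule tendsto_eventually, cases "v x > 0")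
     case True
     have "?d \<longlonglongrightarrow> 0" using LIMSEQ_ignore_initial_segment[OF lim_1_over_n, of 2] by (simp add: add.commute)
     hence "\<forall>\<^sub>F n in sequentially. ?d n < v x" by (rule order_tendstoD(2)) (rule True)
     thus "\<forall>\<^sub>F n in sequentially. ramp (?d n) (v x) = indicator W x"
      by eventually_elim (use True x ramp(4)[OF d(1)] in \<open>simp add: W_def\<close>)
    next
     case False
     hence "v x = 0" using v_nonneg[OF x] by simp
     thus "\<forall>\<^sub>F n in sequentially. ramp (?d n) (v x) = indicator W x"
      using ramp(3)[OF d(1), of 0] by (intro always_eventually) (simp add: W_def)
    qed
    thus "(\<lambda>n. ramp (?d n) (v x) * divergence F x) \<longlonglongrightarrow> indicator W x * divergence F x"
     by (intro tendsto_mult tendsto_const)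
   qed
  qed
  have le: "(\<integral>x. indicator W x * divergence F x \<partial>?M) \<le> p"
   by (rule tendsto_upperbound[OF lim1 always_eventually]) (use main[OF d] in auto)
  have "set_lebesgue_integral lebesgue W (divergence F) = (\<integral>x. indicator W x * divergence F x \<partial>?M)"
  proof -
   have Os: "\<Omega> \<inter> space lebesgue \<in> sets lebesgue" using openO by simp
   show ?thesis unfolding set_lebesgue_integral_def integral_restrict_space[OF Os]
    by (intro Bochner_Integration.integral_cong refl) (auto simp: W_def split: split_indicator)
  qed
  thus "ereal (set_lebesgue_integral lebesgue W (divergence F)) \<le> ereal p" using le by simp
 qed
 thus ?thesis by (rule le_less_trans) simp
qed

end

theorem mainTheorem15:
  fixes \<Omega> :: "'a::euclidean_space set"
    and a :: "'a \<Rightarrow> 'a \<Rightarrow> 'a \<Rightarrow> real"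
    and lam Lam K :: real
    and \<phi> :: "'a \<Rightarrow> real"
    and \<beta> :: "real \<Rightarrow> real"
    and \<epsilon> :: "nat \<Rightarrow> real"
    and u :: "nat \<Rightarrow> 'a \<Rightarrow> real"
    and u0 :: "'a \<Rightarrow> real"
  assumes dom: "lipschitz_domain \<Omega>"
    and ell: "elliptic_field \<Omega> a lam Lam"
    and phi_nonneg: "\<forall>x\<in>frontier \<Omega>. 0 \<le> \<phi> x"
    and phi_L2: "L2_bdry \<Omega> \<phi>"
    and beta: "admissible_beta \<beta>"
    and Kpos: "K > 0"
    and Klip: "K_Lip \<Omega> a K"
    and eps_pos: "\<forall>k. \<epsilon> k > 0"
    and eps_lim: "\<epsilon> \<longlonglongrightarrow> 0"
    and minim: "\<forall>k. is_minimizer \<Omega> a \<beta> \<phi> (\<epsilon> k) (u k)"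
    and cont: "\<forall>k. continuous_on \<Omega> (u k)"
    and loc_unif: "\<forall>C. compact C \<and> C \<subseteq> \<Omega> \<longrightarrow> uniform_limit C u u0 sequentially"
  shows "locally_finite_perimeter {x\<in>\<Omega>. u0 x > 0} \<Omega>
     \<and> (\<forall>C. compact C \<and> C \<subseteq> \<Omega> \<longrightarrow>
            hausdorff_measure (real DIM('a) - 1) (frontier {x\<in>\<Omega>. u0 x > 0} \<inter> C) < \<infinity>)
     \<and> (frontier {x\<in>\<Omega>. u0 x > 0} \<inter> \<Omega> \<noteq> {} \<longrightarrow>
            hausdorff_dim (frontier {x\<in>\<Omega>. u0 x > 0} \<inter> \<Omega>) = real DIM('a) - 1)"
proof -
 have D: "open \<Omega>" "connected \<Omega>" "bounded \<Omega>" using dom by (auto simp: lipschitz_domain_def)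
 interpret elliptic \<Omega> a lam Lam K by unfold_locales (use D ell Kpos Klip in auto)
 have ep: "\<epsilon> k > 0" and mk: "is_minimizer \<Omega> a \<beta> \<phi> (\<epsilon> k) (u k)" and ck: "continuous_on \<Omega> (u k)" for k
  using eps_pos minim cont by auto
 show ?thesis
 \<comment> \<open>Either all late minimizers are nonnegative and the theory applies to a tail of
   the sequence, or infinitely many are negative somewhere, hence nonpositive everywhere, and the
   limit is nonpositive.\<close>
 proof (cases "\<exists>N. \<forall>k\<ge>N. \<forall>x\<in>\<Omega>. 0 \<le> u k x")
  case True
  then obtain N where N: "\<And>k x. k \<ge> N \<Longrightarrow> x \<in> \<Omega> \<Longrightarrow> 0 \<le> u k x" by blast
  have "\<exists>G. minimizer \<Omega> a lam Lam K \<beta> (\<epsilon> (k + N)) (u (k + N)) G" for k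
  proof -
   obtain G where G: "SH \<Omega> (u (k + N)) G" "\<And>p P. H10 \<Omega> p P \<Longrightarrow>
     0 \<le> E \<Omega> G P + 1/2 * E \<Omega> P P + (\<integral>x. B_eps \<beta> (\<epsilon> (k + N)) (u (k + N) x + p x) - B_eps \<beta> (\<epsilon> (k + N)) (u (k + N) x) \<partial>Leb \<Omega>)"
    by (fact minimizer_variation[OF mk beta ep])
   have "minimizer \<Omega> a lam Lam K \<beta> (\<epsilon> (k + N)) (u (k + N)) G"
    by (unfold_locales) (fact beta ep G ck N[OF le_add2])+
   thus ?thesis by (intro exI[of _ G])
  qed
  then obtain G where G: "\<And>k. minimizer \<Omega> a lam Lam K \<beta> (\<epsilon> (k + N)) (u (k + N)) (G k)" by metis
  interpret minimizer_seq \<Omega> a lam Lam K \<beta> "\<lambda>k. \<epsilon> (k + N)" "\<lambda>k. u (k + N)" G u0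
  proof (rule minimizer_seq.intro[OF elliptic_axioms], rule minimizer_seq_axioms.intro)
   show "(\<lambda>k. \<epsilon> (k + N)) \<longlonglongrightarrow> 0" by (rule LIMSEQ_ignore_initial_segment[OF eps_lim])
   fix C assume "compact C" "C \<subseteq> \<Omega>"
   hence "uniform_limit C u u0 sequentially" using loc_unif by blast
   thus "uniform_limit C (\<lambda>k. u (k + N)) u0 sequentially"
    unfolding uniform_limit_iff eventually_sequentially by (meson trans_le_add1)
  qed (fact G beta)+
  have W: "{x\<in>\<Omega>. u0 x > 0} = W" by (simp add: W_def)
  show ?thesis unfolding W locally_finite_perimeter_def
   using perimeter_finite hausdorff_locally_finite hausdorff_dim_frontier by blast
 next
  case False
  have nonpos: "u0 x \<le> 0" if x: "x \<in> \<Omega>" for x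
  proof (rule ccontr)
   assume "\<not> u0 x \<le> 0"
   hence p: "0 < u0 x" by simp
   have "(\<lambda>k. u k x) \<longlonglongrightarrow> u0 x" using spec[OF loc_unif, of "{x}"] x by simp
   hence "\<forall>\<^sub>F k in sequentially. 0 < u k x" using p by (rule order_tendstoD(1))
   then obtain N where N: "\<And>k. k \<ge> N \<Longrightarrow> 0 < u k x" unfolding eventually_sequentially by blast
   obtain k where k: "k \<ge> N" "\<not> (\<forall>y\<in>\<Omega>. 0 \<le> u k y)" using False by blast
   hence "u k x \<le> 0" using minimizer_nonneg_or_nonpos[OF mk beta ep phi_L2 phi_nonneg D(2) ck, of k] x by blast
   thus False using N[OF k(1)] by simp
  qed
  have W: "{x\<in>\<Omega>. u0 x > 0} = {}" using nonpos by force
  have "perimeter {} V \<le> 0" for V :: "'a set"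
   unfolding perimeter_def by (rule SUP_least) (simp add: set_lebesgue_integral_def)
  hence "perimeter {} V < \<infinity>" for V :: "'a set" by (rule le_less_trans) simp
  moreover have "hausdorff_measure s ({} :: 'a set) \<le> ennreal 0" for s
   by (rule hausdorff_measure_leI, rule order_trans[OF hausdorff_delta_le[where C="\<lambda>_. {}"]]) (auto simp: diam_pow_def)
  hence "hausdorff_measure s ({} :: 'a set) < \<infinity>" for s by (rule le_less_trans) simp
  ultimately show ?thesis unfolding W locally_finite_perimeter_def by simp
 qed
qed

end
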